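(* Let $H$ be a finite-dimensional Hopf algebra with dual $\widehat H$, $X$ an algebra, $\alpha:X\to X\otimes H$ a right coaction of $H$ and $\beta:X\to\widehat H\otimes X$ a left coaction of $\widehat H$. Write $\alpha(x)=x_{[0]}\otimes x_{[1]}$, $\beta(x)=x^{[-1]}\otimes x^{[0]}$, and define $$\Sigma\beta^{\mathrm{co}}:X^{\mathrm{op}}\to X^{\mathrm{op}}\otimes\widehat H,\quad x^{\mathrm{op}}\mapsto (x^{[0]})^{\mathrm{op}}\otimes\widehat S(x^{[-1]}),\qquad(\Sigma\alpha)^{\mathrm{co}}:X^{\mathrm{op}}\to H\otimes X^{\mathrm{op}},\quad x^{\mathrm{op}}\mapsto S^{-1}(x_{[1]})\otimes (x_{[0]})^{\mathrm{op}},$$ which are a right coaction of $\widehat H$ and a left coaction of $H$ on $X^{\mathrm{op}}$. Then $(X,\alpha,\beta)$ is a right-left $(H,\widehat H)$-Yetter--Drinfeld algebra if and only if $(X^{\mathrm{op}},\Sigma\beta^{\mathrm{co}},(\Sigma\alpha)^{\mathrm{co}})$ is a right-left $(\widehat H,H)$-Yetter--Drinfeld algebra. Moreover, $(X,\alpha,\beta)$ is braided commutative if and only if $(X^{\mathrm{op}},\Sigma\beta^{\mathrm{co}},(\Sigma\alpha)^{\mathrm{co}})$ is braided commutative.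
   Context: $\Bbbk$ is a field, algebras are unital $\Bbbk$-algebras; $X^{\mathrm{op}}$ is the opposite algebra, with elements $x^{\mathrm{op}}$. For a finite-dimensional Hopf algebra $K$ with structure maps $\Delta,\varepsilon,S$ (antipode bijective), $\widehat K$ is the dual Hopf algebra (antipode $\widehat S$), $\mathbf p(k,\theta)=\theta(k)$, with $\mathbf p(k,\theta\theta')=\mathbf p(k_{(1)},\theta)\mathbf p(k_{(2)},\theta')$, $\mathbf p(kk',\theta)=\mathbf p(k,\theta_{(1)})\mathbf p(k',\theta_{(2)})$. The bidual of $H$ is identified with $H$. $U_K=\sum_ik_i\otimes\widehat k_i\in K\otimes\widehat K$ (dual bases), which is invertible; $\Sigma$ is the flip, and $\Sigma(U_K)^{-1}_{13}$ is $\Sigma(U_K)^{-1}\in\widehat K\otimes K$ placed in legs 1 and 3. $\mathrm{Ad}(W)(z)=WzW^{-1}$. A left coaction of a Hopf algebra $K$ on an algebra $Y$ is an algebra homomorphism $\beta:Y\to K\otimes Y$ with $(\mathrm{id}\otimes\beta)\beta=(\Delta_K\otimes\mathrm{id})\beta$, $(\varepsilon_K\otimes\mathrm{id})\beta=\mathrm{id}$; right coactions are defined similarly. A right-left $(K,\widehat K)$-Yetter--Drinfeld algebra is a triple $(Y,\alpha,\beta)$ with $\alpha:Y\to Y\otimes K$ a right coaction of $K$, $\beta:Y\to\widehat K\otimes Y$ a left coaction of $\widehat K$, and $(\mathrm{id}_{\widehat K}\otimes\alpha)\beta=\mathrm{Ad}(\Sigma(U_K)^{-1}_{13})(\beta\otimes\mathrm{id}_K)\alpha$.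 (Used for $K=H$ and $K=\widehat H$.) The Heisenberg algebra $\mathcal H(\widehat K)=\widehat K\#K$ is $\widehat K\otimes K$ with product $(\theta\#k)(\theta'\#k')=\theta\,\theta'_{(1)}\,\mathbf p(k_{(1)},\theta'_{(2)})\#k_{(2)}k'$. A right-left $(K,\widehat K)$-Yetter--Drinfeld algebra $(Y,\alpha,\beta)$ is braided commutative if for all $x,y\in Y$, in the tensor product algebra $Y\otimes\mathcal H(\widehat K)$, $$(x_{[0]}\otimes1\#x_{[1]})(y^{[0]}\otimes y^{[-1]}\#1)=(y^{[0]}\otimes y^{[-1]}\#1)(x_{[0]}\otimes1\#x_{[1]}),$$ where $\alpha(x)=x_{[0]}\otimes x_{[1]}$, $\beta(y)=y^{[-1]}\otimes y^{[0]}$ (summations understood). *)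

theory Defs
  imports "Jordan_Normal_Form.Missing_VectorSpace" "HOL-Algebra.AbelCoset"
begin

section \<open>Algebras over a field\<close>

locale unital_algebra = vectorspace k A + ring A
  for k :: "('k, 'm) ring_scheme" and A :: "('k, 'a, 'n) module_scheme" +
  assumes smult_mult_left:
      "\<lbrakk>c \<in> carrier k; x \<in> carrier A; y \<in> carrier A\<rbrakk>
        \<Longrightarrow> (c \<odot>\<^bsub>A\<^esub> x) \<otimes>\<^bsub>A\<^esub> y = c \<odot>\<^bsub>A\<^esub> (x \<otimes>\<^bsub>A\<^esub> y)"
    and smult_mult_right:
      "\<lbrakk>c \<in> carrier k; x \<in> carrier A; y \<in> carrier A\<rbrakk>
        \<Longrightarrow> x \<otimes>\<^bsub>A\<^esub> (c \<odot>\<^bsub>A\<^esub> y) = c \<odot>\<^bsub>A\<^esub> (x \<otimes>\<^bsub>A\<^esub> y)"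

definition algebra_hom ::
  "('k, 'm) ring_scheme \<Rightarrow> ('k, 'a, 'n) module_scheme \<Rightarrow> ('k, 'b, 'p) module_scheme
    \<Rightarrow> ('a \<Rightarrow> 'b) set" where
  "algebra_hom k A B = ring_hom A B \<inter> module_hom k A B"

text \<open>The base field, regarded as an algebra over itself.\<close>

definition scalars :: "('k, 'm) ring_scheme \<Rightarrow> ('k, 'k) module" where
  "scalars k = \<lparr>carrier = carrier k, mult = mult k, one = one k, zero = zero k, add = add k,
     smult = mult k\<rparr>"

text \<open>The opposite algebra lives on the same carrier, so the element written
  \<open>x\<^sup>o\<^sup>p\<close> on paper is represented by \<open>x\<close> itself.\<close>

definition opposite :: "('k, 'a, 'n) module_scheme \<Rightarrow> ('k, 'a, 'n) module_scheme" where
  "opposite A = A\<lparr>mult := \<lambda>x y. y \<otimes>\<^bsub>A\<^esub> x\<rparr>"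


section \<open>Tensor products\<close>

text \<open>The tensor product of two spaces is the quotient of the space of finitely supported
  functions on the product of the carriers by the span of the bilinearity relations; its elements
  are the cosets. In records that only serve as vector spaces, the multiplicative fields are
  \<open>undefined\<close>.\<close>

type_synonym ('k, 'a, 'b) tens = "('a \<times> 'b \<Rightarrow> 'k) set"

definition free_space :: "('k, 'm) ring_scheme \<Rightarrow> 's set \<Rightarrow> ('k, 's \<Rightarrow> 'k) module" where
  "free_space k S =
     \<lparr>carrier = {f. (\<forall>p. f p \<in> carrier k) \<and> {p. f p \<noteq> \<zero>\<^bsub>k\<^esub>} \<subseteq> S \<and> finite {p. f p \<noteq> \<zero>\<^bsub>k\<^esub>}},
      mult = undefined, one = undefined,
      zero = (\<lambda>p. \<zero>\<^bsub>k\<^esub>), add = (\<lambda>f g p. f p \<oplus>\<^bsub>k\<^esub> g p),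
      smult = (\<lambda>c f p. c \<otimes>\<^bsub>k\<^esub> f p)\<rparr>"

definition free_gen :: "('k, 'm) ring_scheme \<Rightarrow> 's \<Rightarrow> 's \<Rightarrow> 'k" where
  "free_gen k p = (\<lambda>q. if q = p then \<one>\<^bsub>k\<^esub> else \<zero>\<^bsub>k\<^esub>)"

abbreviation tensor_free ::
  "('k, 'm) ring_scheme \<Rightarrow> ('k, 'a, 'n) module_scheme \<Rightarrow> ('k, 'b, 'p) module_scheme
    \<Rightarrow> ('k, 'a \<times> 'b \<Rightarrow> 'k) module" where
  "tensor_free k A B \<equiv> free_space k (carrier A \<times> carrier B)"

inductive_set tensor_rels ::
  "('k, 'm) ring_scheme \<Rightarrow> ('k, 'a, 'n) module_scheme \<Rightarrow> ('k, 'b, 'p) module_scheme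
    \<Rightarrow> ('a \<times> 'b \<Rightarrow> 'k) set"
  for k and A and B where
  add_left: "\<lbrakk>a \<in> carrier A; a' \<in> carrier A; b \<in> carrier B\<rbrakk> \<Longrightarrow>
    free_gen k (a \<oplus>\<^bsub>A\<^esub> a', b)
      \<ominus>\<^bsub>tensor_free k A B\<^esub> (free_gen k (a, b) \<oplus>\<^bsub>tensor_free k A B\<^esub> free_gen k (a', b))
    \<in> tensor_rels k A B"
| add_right: "\<lbrakk>a \<in> carrier A; b \<in> carrier B; b' \<in> carrier B\<rbrakk> \<Longrightarrow>
    free_gen k (a, b \<oplus>\<^bsub>B\<^esub> b')
      \<ominus>\<^bsub>tensor_free k A B\<^esub> (free_gen k (a, b) \<oplus>\<^bsub>tensor_free k A B\<^esub> free_gen k (a, b'))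
    \<in> tensor_rels k A B"
| smult_left: "\<lbrakk>c \<in> carrier k; a \<in> carrier A; b \<in> carrier B\<rbrakk> \<Longrightarrow>
    free_gen k (c \<odot>\<^bsub>A\<^esub> a, b)
      \<ominus>\<^bsub>tensor_free k A B\<^esub> (c \<odot>\<^bsub>tensor_free k A B\<^esub> free_gen k (a, b))
    \<in> tensor_rels k A B"
| smult_right: "\<lbrakk>c \<in> carrier k; a \<in> carrier A; b \<in> carrier B\<rbrakk> \<Longrightarrow>
    free_gen k (a, c \<odot>\<^bsub>B\<^esub> b)
      \<ominus>\<^bsub>tensor_free k A B\<^esub> (c \<odot>\<^bsub>tensor_free k A B\<^esub> free_gen k (a, b))
    \<in> tensor_rels k A B"

definition tensor_null ::
  "('k, 'm) ring_scheme \<Rightarrow> ('k, 'a, 'n) module_scheme \<Rightarrow> ('k, 'b, 'p) module_scheme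
    \<Rightarrow> ('a \<times> 'b \<Rightarrow> 'k) set" where
  "tensor_null k A B = LinearCombinations.module.span k (tensor_free k A B) (tensor_rels k A B)"

text \<open>The pure tensor \<open>a \<otimes> b\<close>.\<close>

definition pure_tensor ::
  "('k, 'm) ring_scheme \<Rightarrow> ('k, 'a, 'n) module_scheme \<Rightarrow> ('k, 'b, 'p) module_scheme
    \<Rightarrow> 'a \<Rightarrow> 'b \<Rightarrow> ('k, 'a, 'b) tens" where
  "pure_tensor k A B a b = tensor_null k A B +>\<^bsub>tensor_free k A B\<^esub> free_gen k (a, b)"

definition tensor_space ::
  "('k, 'm) ring_scheme \<Rightarrow> ('k, 'a, 'n) module_scheme \<Rightarrow> ('k, 'b, 'p) module_scheme
    \<Rightarrow> ('k, ('k, 'a, 'b) tens) module" where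
  "tensor_space k A B =
     \<lparr>carrier = a_rcosets\<^bsub>tensor_free k A B\<^esub> (tensor_null k A B),
      mult = undefined, one = undefined,
      zero = tensor_null k A B, add = set_add (tensor_free k A B),
      smult = (\<lambda>c t. \<Union>f\<in>t. tensor_null k A B +>\<^bsub>tensor_free k A B\<^esub> (c \<odot>\<^bsub>tensor_free k A B\<^esub> f))\<rparr>"

text \<open>The linear map into \<open>W\<close> induced by a bilinear map \<open>\<phi>\<close>, that is,
  \<open>\<Sum> a\<^sub>i \<otimes> b\<^sub>i \<mapsto> \<Sum> \<phi> a\<^sub>i b\<^sub>i\<close>. For bilinear \<open>\<phi>\<close> the value does not depend on the
  representative \<open>f\<close> of the coset. Sweedler notation is rendered by this operation: an
  expression in \<open>W\<close> that is bilinear in the two components of \<open>\<Delta>(h)\<close> becomes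
  \<open>tensor_lift k W (\<lambda>h1 h2. \<dots>) (comult H h)\<close>.\<close>

definition tensor_lift ::
  "('k, 'm) ring_scheme \<Rightarrow> ('k, 'w, 'q) module_scheme \<Rightarrow> ('a \<Rightarrow> 'b \<Rightarrow> 'w)
    \<Rightarrow> ('k, 'a, 'b) tens \<Rightarrow> 'w" where
  "tensor_lift k W \<phi> t =
     the_elem ((\<lambda>f. \<Oplus>\<^bsub>W\<^esub>p\<in>{p. f p \<noteq> \<zero>\<^bsub>k\<^esub>}. f p \<odot>\<^bsub>W\<^esub> \<phi> (fst p) (snd p)) ` t)"

text \<open>The tensor product algebra, with
  \<open>(a \<otimes> b)(a' \<otimes> b') = aa' \<otimes> bb'\<close>.\<close>

definition tensor ::
  "('k, 'm) ring_scheme \<Rightarrow> ('k, 'a, 'n) module_scheme \<Rightarrow> ('k, 'b, 'p) module_scheme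
    \<Rightarrow> ('k, ('k, 'a, 'b) tens) module" where
  "tensor k A B = (tensor_space k A B)
     \<lparr>mult := \<lambda>s t.
        tensor_lift k (tensor_space k A B) (\<lambda>a b.
          tensor_lift k (tensor_space k A B) (\<lambda>a' b'.
            pure_tensor k A B (a \<otimes>\<^bsub>A\<^esub> a') (b \<otimes>\<^bsub>B\<^esub> b')) t) s,
      one := pure_tensor k A B \<one>\<^bsub>A\<^esub> \<one>\<^bsub>B\<^esub>\<rparr>"

text \<open>For \<open>f\<close> from \<open>A\<close> to \<open>C\<close> and \<open>g\<close> from \<open>B\<close> to \<open>D\<close>,
  \<open>tensor_map k C D f g\<close> is \<open>f \<otimes> g\<close>.\<close>

definition tensor_map ::
  "('k, 'm) ring_scheme \<Rightarrow> ('k, 'c, 'n) module_scheme \<Rightarrow> ('k, 'd, 'p) module_scheme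
    \<Rightarrow> ('a \<Rightarrow> 'c) \<Rightarrow> ('b \<Rightarrow> 'd) \<Rightarrow> ('k, 'a, 'b) tens \<Rightarrow> ('k, 'c, 'd) tens" where
  "tensor_map k C D f g =
     tensor_lift k (tensor k C D) (\<lambda>a b. pure_tensor k C D (f a) (g b))"

definition tensor_flip ::
  "('k, 'm) ring_scheme \<Rightarrow> ('k, 'a, 'n) module_scheme \<Rightarrow> ('k, 'b, 'p) module_scheme
    \<Rightarrow> ('k, 'a, 'b) tens \<Rightarrow> ('k, 'b, 'a) tens" where
  "tensor_flip k A B = tensor_lift k (tensor k B A) (\<lambda>a b. pure_tensor k B A b a)"

text \<open>Threefold tensor products are bracketed to the left. The canonical isomorphism
  \<open>A \<otimes> (B \<otimes> C) \<cong> (A \<otimes> B) \<otimes> C\<close>, suppressed on paper, is explicit here.\<close>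

definition tensor_assoc ::
  "('k, 'm) ring_scheme \<Rightarrow> ('k, 'a, 'n) module_scheme \<Rightarrow> ('k, 'b, 'p) module_scheme
    \<Rightarrow> ('k, 'c, 'q) module_scheme
    \<Rightarrow> ('k, 'a, ('k, 'b, 'c) tens) tens \<Rightarrow> ('k, ('k, 'a, 'b) tens, 'c) tens" where
  "tensor_assoc k A B C =
     tensor_lift k (tensor k (tensor k A B) C) (\<lambda>a.
       tensor_lift k (tensor k (tensor k A B) C) (\<lambda>b c.
         pure_tensor k (tensor k A B) C (pure_tensor k A B a b) c))"

text \<open>\<open>tensor_leg13 k A B C z\<close> is \<open>z\<^sub>1\<^sub>3\<close> for \<open>z\<close> in \<open>A \<otimes> C\<close>, with
  \<open>\<one>\<close> of \<open>B\<close> in the middle leg.\<close>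

definition tensor_leg13 ::
  "('k, 'm) ring_scheme \<Rightarrow> ('k, 'a, 'n) module_scheme \<Rightarrow> ('k, 'b, 'p) module_scheme
    \<Rightarrow> ('k, 'c, 'q) module_scheme
    \<Rightarrow> ('k, 'a, 'c) tens \<Rightarrow> ('k, ('k, 'a, 'b) tens, 'c) tens" where
  "tensor_leg13 k A B C =
     tensor_lift k (tensor k (tensor k A B) C) (\<lambda>a c.
       pure_tensor k (tensor k A B) C (pure_tensor k A B a \<one>\<^bsub>B\<^esub>) c)"


section \<open>Hopf algebras and their duals\<close>

record ('k, 'h) hopf = "('k, 'h) module" +
  comult :: "'h \<Rightarrow> ('k, 'h, 'h) tens"
  counit :: "'h \<Rightarrow> 'k"
  antipode :: "'h \<Rightarrow> 'h"

locale hopf_algebra = unital_algebra k H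
  for k :: "('k, 'm) ring_scheme" and H :: "('k, 'h, 'n) hopf_scheme" +
  assumes comult_hom: "comult H \<in> algebra_hom k H (tensor k H H)"
    and counit_hom: "counit H \<in> algebra_hom k H (scalars k)"
    and antipode_linear: "antipode H \<in> module_hom k H H"
    and coassoc: "h \<in> carrier H \<Longrightarrow>
      tensor_assoc k H H H (tensor_map k H (tensor k H H) (\<lambda>x. x) (comult H) (comult H h))
        = tensor_map k (tensor k H H) H (comult H) (\<lambda>x. x) (comult H h)"
    and counit_left: "h \<in> carrier H \<Longrightarrow>
      tensor_lift k H (\<lambda>h1 h2. counit H h1 \<odot>\<^bsub>H\<^esub> h2) (comult H h) = h"
    and counit_right: "h \<in> carrier H \<Longrightarrow>
      tensor_lift k H (\<lambda>h1 h2. counit H h2 \<odot>\<^bsub>H\<^esub> h1) (comult H h) = h"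
    and antipode_left: "h \<in> carrier H \<Longrightarrow>
      tensor_lift k H (\<lambda>h1 h2. antipode H h1 \<otimes>\<^bsub>H\<^esub> h2) (comult H h)
        = counit H h \<odot>\<^bsub>H\<^esub> \<one>\<^bsub>H\<^esub>"
    and antipode_right: "h \<in> carrier H \<Longrightarrow>
      tensor_lift k H (\<lambda>h1 h2. h1 \<otimes>\<^bsub>H\<^esub> antipode H h2) (comult H h)
        = counit H h \<odot>\<^bsub>H\<^esub> \<one>\<^bsub>H\<^esub>"

text \<open>The dual consists of the linear forms, made extensional so that equal forms are equal
  functions. Its algebra structure is determined by
  \<open>(\<theta>\<theta>')(h) = \<theta>(h\<^sub>1) \<theta>'(h\<^sub>2)\<close> and its coproduct by
  \<open>\<theta>(ab) = \<theta>\<^sub>1(a) \<theta>\<^sub>2(b)\<close>; the latter defines an element of the tensor square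
  because \<open>H\<close> is finite-dimensional.\<close>

definition dual_algebra ::
  "('k, 'm) ring_scheme \<Rightarrow> ('k, 'h, 'n) hopf_scheme \<Rightarrow> ('k, 'h \<Rightarrow> 'k) module" where
  "dual_algebra k H =
     \<lparr>carrier = module_hom k H (scalars k) \<inter> extensional (carrier H),
      mult = (\<lambda>\<theta> \<theta>'. \<lambda>h\<in>carrier H.
        tensor_lift k (scalars k) (\<lambda>h1 h2. \<theta> h1 \<otimes>\<^bsub>k\<^esub> \<theta>' h2) (comult H h)),
      one = (\<lambda>h\<in>carrier H. counit H h),
      zero = (\<lambda>h\<in>carrier H. \<zero>\<^bsub>k\<^esub>),
      add = (\<lambda>\<theta> \<theta>'. \<lambda>h\<in>carrier H. \<theta> h \<oplus>\<^bsub>k\<^esub> \<theta>' h),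
      smult = (\<lambda>c \<theta>. \<lambda>h\<in>carrier H. c \<otimes>\<^bsub>k\<^esub> \<theta> h)\<rparr>"

definition dual_comult ::
  "('k, 'm) ring_scheme \<Rightarrow> ('k, 'h, 'n) hopf_scheme
    \<Rightarrow> ('h \<Rightarrow> 'k) \<Rightarrow> ('k, 'h \<Rightarrow> 'k, 'h \<Rightarrow> 'k) tens" where
  "dual_comult k H \<theta> =
     (THE t. t \<in> carrier (tensor k (dual_algebra k H) (dual_algebra k H)) \<and>
        (\<forall>a\<in>carrier H. \<forall>b\<in>carrier H.
           tensor_lift k (scalars k) (\<lambda>\<theta>1 \<theta>2. \<theta>1 a \<otimes>\<^bsub>k\<^esub> \<theta>2 b) t = \<theta> (a \<otimes>\<^bsub>H\<^esub> b)))"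

definition dual_hopf ::
  "('k, 'm) ring_scheme \<Rightarrow> ('k, 'h, 'n) hopf_scheme \<Rightarrow> ('k, 'h \<Rightarrow> 'k) hopf" where
  "dual_hopf k H = module.extend (dual_algebra k H)
     (hopf.fields (dual_comult k H) (\<lambda>\<theta>. \<theta> \<one>\<^bsub>H\<^esub>) (\<lambda>\<theta>. \<lambda>h\<in>carrier H. \<theta> (antipode H h)))"


section \<open>Coactions\<close>

definition right_coaction ::
  "('k, 'm) ring_scheme \<Rightarrow> ('k, 'h, 'n) hopf_scheme \<Rightarrow> ('k, 'y, 'p) module_scheme
    \<Rightarrow> ('y \<Rightarrow> ('k, 'y, 'h) tens) \<Rightarrow> bool" where
  "right_coaction k K Y \<alpha> \<longleftrightarrow>
     \<alpha> \<in> algebra_hom k Y (tensor k Y K) \<and>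
     (\<forall>y\<in>carrier Y.
        tensor_map k (tensor k Y K) K \<alpha> (\<lambda>x. x) (\<alpha> y)
          = tensor_assoc k Y K K (tensor_map k Y (tensor k K K) (\<lambda>x. x) (comult K) (\<alpha> y))) \<and>
     (\<forall>y\<in>carrier Y. tensor_lift k Y (\<lambda>y0 h. counit K h \<odot>\<^bsub>Y\<^esub> y0) (\<alpha> y) = y)"

definition left_coaction ::
  "('k, 'm) ring_scheme \<Rightarrow> ('k, 'h, 'n) hopf_scheme \<Rightarrow> ('k, 'y, 'p) module_scheme
    \<Rightarrow> ('y \<Rightarrow> ('k, 'h, 'y) tens) \<Rightarrow> bool" where
  "left_coaction k K Y \<beta> \<longleftrightarrow>
     \<beta> \<in> algebra_hom k Y (tensor k K Y) \<and>
     (\<forall>y\<in>carrier Y.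
        tensor_assoc k K K Y (tensor_map k K (tensor k K Y) (\<lambda>x. x) \<beta> (\<beta> y))
          = tensor_map k (tensor k K K) Y (comult K) (\<lambda>x. x) (\<beta> y)) \<and>
     (\<forall>y\<in>carrier Y. tensor_lift k Y (\<lambda>h y0. counit K h \<odot>\<^bsub>Y\<^esub> y0) (\<beta> y) = y)"


section \<open>Yetter--Drinfeld algebras and braided commutativity\<close>

text \<open>The notions below refer to a Hopf algebra \<open>K\<close>, its dual \<open>L\<close>, and the pairing
  \<open>p\<close> of \<open>K\<close> with \<open>L\<close>. They are used for \<open>K = H\<close>, \<open>L = dual_hopf k H\<close> with
  \<open>p h \<theta> = \<theta> h\<close>, and, identifying the bidual of \<open>H\<close> with \<open>H\<close>, for
  \<open>K = dual_hopf k H\<close>, \<open>L = H\<close> with \<open>p \<theta> h = \<theta> h\<close>.\<close>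

text \<open>\<open>U\<^sub>K = \<Sum> b \<otimes> d b\<close> for any basis \<open>b\<close> of \<open>K\<close> with dual basis \<open>d b\<close>;
  the element does not depend on the choice of the basis.\<close>

definition canonical_element ::
  "('k, 'm) ring_scheme \<Rightarrow> ('k, 'h, 'n) hopf_scheme \<Rightarrow> ('k, 'l, 'q) hopf_scheme
    \<Rightarrow> ('h \<Rightarrow> 'l \<Rightarrow> 'k) \<Rightarrow> ('k, 'h, 'l) tens" where
  "canonical_element k K L p =
     (THE u. \<exists>B d. finite B \<and> vectorspace.basis k K B \<and> d \<in> B \<rightarrow> carrier L \<and>
        (\<forall>b\<in>B. \<forall>b'\<in>B. p b (d b') = (if b = b' then \<one>\<^bsub>k\<^esub> else \<zero>\<^bsub>k\<^esub>)) \<and>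
        u = (\<Oplus>\<^bsub>tensor k K L\<^esub>b\<in>B. pure_tensor k K L b (d b)))"

definition Ad :: "('a, 'm) monoid_scheme \<Rightarrow> 'a \<Rightarrow> 'a \<Rightarrow> 'a" where
  "Ad G w z = w \<otimes>\<^bsub>G\<^esub> z \<otimes>\<^bsub>G\<^esub> inv\<^bsub>G\<^esub> w"

definition yetter_drinfeld_algebra ::
  "('k, 'm) ring_scheme \<Rightarrow> ('k, 'h, 'n) hopf_scheme \<Rightarrow> ('k, 'l, 'q) hopf_scheme
    \<Rightarrow> ('h \<Rightarrow> 'l \<Rightarrow> 'k) \<Rightarrow> ('k, 'y, 'p) module_scheme
    \<Rightarrow> ('y \<Rightarrow> ('k, 'y, 'h) tens) \<Rightarrow> ('y \<Rightarrow> ('k, 'l, 'y) tens) \<Rightarrow> bool" where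
  "yetter_drinfeld_algebra k K L p Y \<alpha> \<beta> \<longleftrightarrow>
     right_coaction k K Y \<alpha> \<and> left_coaction k L Y \<beta> \<and>
     (\<forall>y\<in>carrier Y.
        tensor_assoc k L Y K (tensor_map k L (tensor k Y K) (\<lambda>x. x) \<alpha> (\<beta> y))
          = Ad (tensor k (tensor k L Y) K)
              (tensor_leg13 k L Y K
                (inv\<^bsub>tensor k L K\<^esub> (tensor_flip k K L (canonical_element k K L p))))
              (tensor_map k (tensor k L Y) K \<beta> (\<lambda>x. x) (\<alpha> y)))"

text \<open>The Heisenberg algebra \<open>L # K\<close>: the space \<open>L \<otimes> K\<close> with
  \<open>(\<theta> # h)(\<theta>' # h') = \<theta> \<theta>'\<^sub>1 p(h\<^sub>1, \<theta>'\<^sub>2) # h\<^sub>2 h'\<close>.\<close>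

definition heisenberg ::
  "('k, 'm) ring_scheme \<Rightarrow> ('k, 'h, 'n) hopf_scheme \<Rightarrow> ('k, 'l, 'q) hopf_scheme
    \<Rightarrow> ('h \<Rightarrow> 'l \<Rightarrow> 'k) \<Rightarrow> ('k, ('k, 'l, 'h) tens) module" where
  "heisenberg k K L p = (tensor k L K)
     \<lparr>mult := \<lambda>s t.
        tensor_lift k (tensor k L K) (\<lambda>\<theta> h.
          tensor_lift k (tensor k L K) (\<lambda>\<theta>' h'.
            tensor_lift k (tensor k L K) (\<lambda>\<theta>'1 \<theta>'2.
              tensor_lift k (tensor k L K) (\<lambda>h1 h2.
                p h1 \<theta>'2 \<odot>\<^bsub>tensor k L K\<^esub>
                  pure_tensor k L K (\<theta> \<otimes>\<^bsub>L\<^esub> \<theta>'1) (h2 \<otimes>\<^bsub>K\<^esub> h'))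
              (comult K h)) (comult L \<theta>')) t) s\<rparr>"

definition braided_commutative ::
  "('k, 'm) ring_scheme \<Rightarrow> ('k, 'h, 'n) hopf_scheme \<Rightarrow> ('k, 'l, 'q) hopf_scheme
    \<Rightarrow> ('h \<Rightarrow> 'l \<Rightarrow> 'k) \<Rightarrow> ('k, 'y, 'p) module_scheme
    \<Rightarrow> ('y \<Rightarrow> ('k, 'y, 'h) tens) \<Rightarrow> ('y \<Rightarrow> ('k, 'l, 'y) tens) \<Rightarrow> bool" where
  "braided_commutative k K L p Y \<alpha> \<beta> \<longleftrightarrow>
     yetter_drinfeld_algebra k K L p Y \<alpha> \<beta> \<and>
     (let \<H> = heisenberg k K L p;
          YH = tensor k Y \<H>;
          i = \<lambda>x. tensor_map k Y \<H> (\<lambda>y. y) (\<lambda>h. pure_tensor k L K \<one>\<^bsub>L\<^esub> h) (\<alpha> x);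
          j = \<lambda>y. tensor_lift k YH
                (\<lambda>\<theta> y0. pure_tensor k Y \<H> y0 (pure_tensor k L K \<theta> \<one>\<^bsub>K\<^esub>)) (\<beta> y)
      in \<forall>x\<in>carrier Y. \<forall>y\<in>carrier Y. i x \<otimes>\<^bsub>YH\<^esub> j y = j y \<otimes>\<^bsub>YH\<^esub> i x)"


section \<open>The coactions on the opposite algebra\<close>

text \<open>The map \<open>x\<^sup>o\<^sup>p \<mapsto> (x\<^sup>[\<^sup>0\<^sup>])\<^sup>o\<^sup>p \<otimes> S(x\<^sup>[\<^sup>-\<^sup>1\<^sup>])\<close>
  for \<open>\<beta>\<close> with values in \<open>K \<otimes> X\<close>.\<close>

definition flip_co_left ::
  "('k, 'm) ring_scheme \<Rightarrow> ('k, 'h, 'n) hopf_scheme \<Rightarrow> ('k, 'x, 'p) module_scheme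
    \<Rightarrow> ('x \<Rightarrow> ('k, 'h, 'x) tens) \<Rightarrow> 'x \<Rightarrow> ('k, 'x, 'h) tens" where
  "flip_co_left k K X \<beta> x =
     tensor_lift k (tensor k (opposite X) K)
       (\<lambda>\<theta> x0. pure_tensor k (opposite X) K x0 (antipode K \<theta>)) (\<beta> x)"

text \<open>The map \<open>x\<^sup>o\<^sup>p \<mapsto> S\<^sup>-\<^sup>1(x\<^sub>[\<^sub>1\<^sub>]) \<otimes> (x\<^sub>[\<^sub>0\<^sub>])\<^sup>o\<^sup>p\<close>
  for \<open>\<alpha>\<close> with values in \<open>X \<otimes> K\<close>.\<close>

definition flip_co_right ::
  "('k, 'm) ring_scheme \<Rightarrow> ('k, 'h, 'n) hopf_scheme \<Rightarrow> ('k, 'x, 'p) module_scheme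
    \<Rightarrow> ('x \<Rightarrow> ('k, 'x, 'h) tens) \<Rightarrow> 'x \<Rightarrow> ('k, 'h, 'x) tens" where
  "flip_co_right k K X \<alpha> x =
     tensor_lift k (tensor k K (opposite X))
       (\<lambda>x0 h. pure_tensor k K (opposite X) (inv_into (carrier K) (antipode K) h) x0) (\<alpha> x)"

end

theory Submission
  imports Defs
begin

text \<open>Let \<open>K\<close> and \<open>L\<close> be finite-dimensional Hopf algebras that are dual to each other by a pairing
  \<open>p\<close>. Evaluating the leg of a tensor that lies in \<open>K\<close> against an element of \<open>L\<close>, or the
  leg in \<open>L\<close> against an element of \<open>K\<close>, loses no information, because dual bases exist. A
  right coaction \<open>\<alpha>\<close> of \<open>K\<close> on \<open>Y\<close> thereby becomes a left action
  \<open>l \<rhd> y = y\<^sub>0 p(y\<^sub>1, l)\<close>, and a left coaction \<open>\<beta>\<close> of \<open>L\<close> becomes a right action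
  \<open>y \<lhd> x = p(x, y\<^sup>-\<^sup>1) y\<^sup>0\<close>. In these terms all the notions of the theorem are identities
  without tensors:

  \<^item> \<open>\<alpha>\<close> is a coaction iff \<open>Y\<close> is a left \<open>L\<close>-module algebra, \<open>\<beta>\<close> is a coaction iff
    \<open>Y\<close> is a right \<open>K\<close>-module algebra (\<open>right_coaction_iff\<close>, \<open>left_coaction_iff\<close>);
  \<^item> the Yetter--Drinfeld condition says
    \<open>p(x\<^sub>1, l\<^sub>1) l\<^sub>2 \<rhd> (y \<lhd> x\<^sub>2) = p(x\<^sub>2, l\<^sub>2) (l\<^sub>1 \<rhd> y) \<lhd> x\<^sub>1\<close>
    (\<open>yetter_drinfeld_iff\<close>), because the flipped canonical element represents the form \<open>p\<close>
    itself and can be moved to the other side of the equation;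
  \<^item> for a Yetter--Drinfeld algebra, braided commutativity says \<open>a\<^sub>0 (b \<lhd> a\<^sub>1) = b a\<close>
    (\<open>braided_commutative_iff\<close>).

  The two coactions on the opposite algebra correspond to the actions \<open>y \<lhd> S(x)\<close> and
  \<open>S\<^sup>-\<^sup>1(l) \<rhd> y\<close>, where \<open>S\<^sup>-\<^sup>1\<close> is the inverse antipode of \<open>L\<close>. Antipodes reverse products
  and coproducts (\<open>antipode_mult\<close>, \<open>comult_antipode\<close>), so they exchange left and right
  module algebras when the product of \<open>Y\<close> is reversed as well; this gives the two coactions.
  Substituting \<open>S(x)\<close> and \<open>S\<^sup>-\<^sup>1(l)\<close> into the Yetter--Drinfeld identity of \<open>Y\<close> exchanges
  its two sides and yields the identity of the opposite algebra, since the pairing is invariant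
  under \<open>S\<close> on \<open>K\<close> together with \<open>S\<^sup>-\<^sup>1\<close> on \<open>L\<close>; as both maps are bijective, the two
  identities are equivalent. Finally \<open>a\<^sub>0 (b \<lhd> a\<^sub>1) = p(a\<^sub>1, b\<^sup>-\<^sup>1) a\<^sub>0 b\<^sup>0\<close>, and
  forming \<open>a\<^sub>0 (b \<lhd> a\<^sub>1)\<close> in the opposite algebra gives the same expression with \<open>a\<close> and
  \<open>b\<close> exchanged.

  The pair \<open>(K, L)\<close> is \<open>(H, dual_hopf k H)\<close> for the original algebra and
  \<open>(dual_hopf k H, H)\<close> for the opposite one. The locale \<open>dual_pair\<close> collects symmetric
  conditions on \<open>(K, L, p)\<close>, so that each characterization applies to both situations
  (\<open>dual_pair\<close>, \<open>swap\<close>).\<close>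

section \<open>Linear and bilinear maps\<close>

definition bilinear ::
  "('k, 'm) ring_scheme \<Rightarrow> ('k, 'a, 'n) module_scheme \<Rightarrow> ('k, 'b, 'p) module_scheme
    \<Rightarrow> ('k, 'w, 'q) module_scheme \<Rightarrow> ('a \<Rightarrow> 'b \<Rightarrow> 'w) \<Rightarrow> bool" where
  "bilinear k A B W \<phi> \<longleftrightarrow>
     (\<forall>a\<in>carrier A. \<phi> a \<in> module_hom k B W) \<and>
     (\<forall>b\<in>carrier B. (\<lambda>a. \<phi> a b) \<in> module_hom k A W)"

lemma bilinearI:
  "\<lbrakk>\<And>a. a \<in> carrier A \<Longrightarrow> (\<lambda>b. \<phi> a b) \<in> module_hom k B W;
    \<And>b. b \<in> carrier B \<Longrightarrow> (\<lambda>a. \<phi> a b) \<in> module_hom k A W\<rbrakk> \<Longrightarrow> bilinear k A B W \<phi>"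
  by (simp add: bilinear_def)

lemma bilinear_right: "\<lbrakk>bilinear k A B W \<phi>; a \<in> carrier A\<rbrakk> \<Longrightarrow> \<phi> a \<in> module_hom k B W"
  by (simp add: bilinear_def)

lemma bilinear_left: "\<lbrakk>bilinear k A B W \<phi>; b \<in> carrier B\<rbrakk> \<Longrightarrow> (\<lambda>a. \<phi> a b) \<in> module_hom k A W"
  by (simp add: bilinear_def)

lemma linI:
  "\<lbrakk>\<And>x. x \<in> carrier A \<Longrightarrow> f x \<in> carrier B;
    \<And>x y. \<lbrakk>x \<in> carrier A; y \<in> carrier A\<rbrakk> \<Longrightarrow> f (x \<oplus>\<^bsub>A\<^esub> y) = f x \<oplus>\<^bsub>B\<^esub> f y;
    \<And>c x. \<lbrakk>c \<in> carrier k; x \<in> carrier A\<rbrakk> \<Longrightarrow> f (c \<odot>\<^bsub>A\<^esub> x) = c \<odot>\<^bsub>B\<^esub> f x\<rbrakk>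
   \<Longrightarrow> f \<in> module_hom k A B"
  by (auto simp: module_hom_def)

lemma lin_closed: "\<lbrakk>f \<in> module_hom k A B; x \<in> carrier A\<rbrakk> \<Longrightarrow> f x \<in> carrier B"
  by (auto simp: module_hom_def)

lemmas lin_add = module_hom_add
lemmas lin_smult = module_hom_smult

lemma bilinear_closed:
  "\<lbrakk>bilinear k A B W \<phi>; a \<in> carrier A; b \<in> carrier B\<rbrakk> \<Longrightarrow> \<phi> a b \<in> carrier W"
  by (metis bilinear_right lin_closed)

lemma lin_cong:
  assumes "module k A" "f \<in> module_hom k A B" "\<And>x. x \<in> carrier A \<Longrightarrow> f x = g x"
  shows "g \<in> module_hom k A B"
proof -
  interpret module k A by fact
  show ?thesis
    using assms(2) by (intro linI) (auto simp: assms(3)[symmetric] lin_closed lin_add lin_smult)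
qed

text \<open>Finite sums are folds, and the graph of the fold evaluates the summand only on the index set.
  So the congruence holds for summands with values outside the carrier, and for infinite index
  sets.\<close>

lemma finsum_cong_weak:
  fixes G :: "('a, 'b) ring_scheme"
  assumes "\<And>x. x \<in> S \<Longrightarrow> f x = g x"
  shows "finsum G f S = finsum G g S"
proof -
  have *: "(S', z) \<in> foldSetD D h2 e"
    if "(S', z) \<in> foldSetD D h1 e" "\<And>x y. x \<in> S' \<Longrightarrow> h1 x y = h2 x y" for S' z D h1 h2 e
    using that by (induction rule: foldSetD.induct) (auto intro: foldSetD.intros)
  let ?f = "(\<otimes>\<^bsub>add_monoid G\<^esub>) \<circ> f" and ?g = "(\<otimes>\<^bsub>add_monoid G\<^esub>) \<circ> g"
  have "(S, z) \<in> foldSetD D ?f e \<longleftrightarrow> (S, z) \<in> foldSetD D ?g e" for D z e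
    using *[of S z D ?f e ?g] *[of S z D ?g e ?f] assms by auto
  then show ?thesis
    by (simp add: finsum_def finprod_def foldD_def)
qed

locale ground =
  fixes k :: "('k, 'm) ring_scheme" (structure)
  assumes field_k: "field k"
begin

abbreviation lin where "lin A B f \<equiv> f \<in> module_hom k A B"
abbreviation bil where "bil \<equiv> bilinear k"
abbreviation vs where "vs A \<equiv> vectorspace k A"
abbreviation lift where "lift \<equiv> tensor_lift k"
abbreviation pt where "pt \<equiv> pure_tensor k"
abbreviation T where "T \<equiv> tensor k"

sublocale field k by (rule field_k)

lemma vsI: "module k A \<Longrightarrow> vs A"
  by (simp add: vectorspace_def field_k)

lemma vs_module: "vs A \<Longrightarrow> module k A"
  by (simp add: vectorspace_def)

lemma vs_group: "vs A \<Longrightarrow> abelian_group A"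
  by (simp add: vectorspace_def module_def)

lemma lin_id: "lin A A (\<lambda>x. x)"
  by (auto intro: linI)

lemma lin_compose: "\<lbrakk>lin B C g; lin A B f\<rbrakk> \<Longrightarrow> lin A C (\<lambda>x. g (f x))"
  by (auto simp: module_hom_def Pi_def)

lemma lin_zero:
  assumes "vs A" "vs B" "lin A B f" shows "f \<zero>\<^bsub>A\<^esub> = \<zero>\<^bsub>B\<^esub>"
proof -
  interpret mod_hom k A B f
    using assms by (simp add: mod_hom_def vs_module mod_hom_axioms_def)
  show ?thesis by simp
qed

lemma lin_finsum:
  assumes A: "vs A" and B: "vs B" and f: "lin A B f" and "finite I" "g \<in> I \<rightarrow> carrier A"
  shows "f (\<Oplus>\<^bsub>A\<^esub>i\<in>I. g i) = (\<Oplus>\<^bsub>B\<^esub>i\<in>I. f (g i))"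
proof -
  interpret A: abelian_group A using A by (rule vs_group)
  interpret B: abelian_group B using B by (rule vs_group)
  show ?thesis using assms(4,5)
  proof (induction I rule: finite_induct)
    case empty show ?case by (simp add: lin_zero[OF A B f])
  next
    case (insert i I)
    then have "g \<in> I \<rightarrow> carrier A" "g i \<in> carrier A" by auto
    moreover from this have "(\<lambda>i. f (g i)) \<in> I \<rightarrow> carrier B" "f (g i) \<in> carrier B"
      using f by (auto simp: lin_closed Pi_iff)
    ultimately show ?case using insert f
      by (simp add: lin_add)
  qed
qed

lemma scalars_simps [simp]:
  "carrier (scalars k) = carrier k" "mult (scalars k) = mult k" "one (scalars k) = one k"
  "zero (scalars k) = zero k" "add (scalars k) = add k" "smult (scalars k) = mult k"
  by (simp_all add: scalars_def)

section \<open>The free space\<close>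

lemma free_simps [simp]:
  "\<zero>\<^bsub>free_space k S\<^esub> = (\<lambda>p. \<zero>)"
  "f \<oplus>\<^bsub>free_space k S\<^esub> g = (\<lambda>p. f p \<oplus> g p)"
  "c \<odot>\<^bsub>free_space k S\<^esub> f = (\<lambda>p. c \<otimes> f p)"
  by (simp_all add: free_space_def)

lemma free_carrier:
  "f \<in> carrier (free_space k S) \<longleftrightarrow>
     (\<forall>p. f p \<in> carrier k) \<and> {p. f p \<noteq> \<zero>} \<subseteq> S \<and> finite {p. f p \<noteq> \<zero>}"
  by (simp add: free_space_def)

lemma free_value: "f \<in> carrier (free_space k S) \<Longrightarrow> f p \<in> carrier k"
  by (simp add: free_carrier)

lemma free_add_closed:
  assumes "f \<in> carrier (free_space k S)" "g \<in> carrier (free_space k S)"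
  shows "(\<lambda>p. f p \<oplus> g p) \<in> carrier (free_space k S)"
proof -
  have *: "{p. f p \<oplus> g p \<noteq> \<zero>} \<subseteq> {p. f p \<noteq> \<zero>} \<union> {p. g p \<noteq> \<zero>}"
    by auto
  then have "finite {p. f p \<oplus> g p \<noteq> \<zero>}"
    by (rule finite_subset) (use assms in \<open>auto simp: free_carrier\<close>)
  with * show ?thesis using assms by (auto simp: free_carrier)
qed

lemma free_smult_closed:
  assumes "c \<in> carrier k" "f \<in> carrier (free_space k S)"
  shows "(\<lambda>p. c \<otimes> f p) \<in> carrier (free_space k S)"
proof -
  have *: "{p. c \<otimes> f p \<noteq> \<zero>} \<subseteq> {p. f p \<noteq> \<zero>}"
    using assms by auto
  then have "finite {p. c \<otimes> f p \<noteq> \<zero>}"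
    by (rule finite_subset) (use assms in \<open>auto simp: free_carrier\<close>)
  with * show ?thesis using assms by (auto simp: free_carrier)
qed

lemma free_vs: "vs (free_space k S)"
proof (rule vsI, rule moduleI)
  show "cring k" by (rule is_cring)
  show "abelian_group (free_space k S)"
  proof (rule abelian_groupI)
    fix f assume f: "f \<in> carrier (free_space k S)"
    have "(\<lambda>p. \<ominus> \<one> \<otimes> f p) \<in> carrier (free_space k S)"
      using free_smult_closed[OF _ f, of "\<ominus> \<one>"] by simp
    then show "\<exists>g\<in>carrier (free_space k S). g \<oplus>\<^bsub>free_space k S\<^esub> f = \<zero>\<^bsub>free_space k S\<^esub>"
      using f by (intro bexI[of _ "\<lambda>p. \<ominus> \<one> \<otimes> f p"]) (auto simp: free_value l_minus l_neg)
  next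
    show "\<zero>\<^bsub>free_space k S\<^esub> \<in> carrier (free_space k S)" by (simp add: free_carrier)
  next
    fix f g assume f: "f \<in> carrier (free_space k S)" "g \<in> carrier (free_space k S)"
    show "f \<oplus>\<^bsub>free_space k S\<^esub> g \<in> carrier (free_space k S)"
      using free_add_closed[OF f] by simp
    show "f \<oplus>\<^bsub>free_space k S\<^esub> g = g \<oplus>\<^bsub>free_space k S\<^esub> f"
      using f by (auto simp: free_value a_comm)
  qed (auto simp: free_value a_assoc)
next
  fix c f assume c: "c \<in> carrier k" "f \<in> carrier (free_space k S)"
  show "c \<odot>\<^bsub>free_space k S\<^esub> f \<in> carrier (free_space k S)"
    using free_smult_closed[OF c] by simp
qed (auto simp: free_value l_distr r_distr m_assoc)

lemma free_gen_closed [simp]: "p \<in> S \<Longrightarrow> free_gen k p \<in> carrier (free_space k S)"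
  by (auto simp: free_gen_def free_carrier)

text \<open>The linear extension of a map from the basis.\<close>

definition free_lift :: "('k, 'w, 'q) module_scheme \<Rightarrow> ('s \<Rightarrow> 'w) \<Rightarrow> ('s \<Rightarrow> 'k) \<Rightarrow> 'w" where
  "free_lift W \<psi> f = (\<Oplus>\<^bsub>W\<^esub>p\<in>{p. f p \<noteq> \<zero>}. f p \<odot>\<^bsub>W\<^esub> \<psi> p)"

lemma free_lift_superset:
  assumes W: "vs W" and \<psi>: "\<psi> \<in> S \<rightarrow> carrier W" and f: "f \<in> carrier (free_space k S)"
    and "finite I" "{p. f p \<noteq> \<zero>} \<subseteq> I" "I \<subseteq> S"
  shows "free_lift W \<psi> f = (\<Oplus>\<^bsub>W\<^esub>p\<in>I. f p \<odot>\<^bsub>W\<^esub> \<psi> p)"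
proof -
  interpret W: module k W using W by (rule vs_module)
  show ?thesis unfolding free_lift_def
  proof (rule W.add.finprod_mono_neutral_cong_left[folded finsum_def])
    have "\<psi> p \<in> carrier W" if "p \<in> I" for p
      using that \<psi> \<open>I \<subseteq> S\<close> by (simp add: Pi_iff subset_iff)
    then show "(\<lambda>p. f p \<odot>\<^bsub>W\<^esub> \<psi> p) \<in> I \<rightarrow> carrier W"
      using free_value[OF f] by simp
    show "f p \<odot>\<^bsub>W\<^esub> \<psi> p = \<zero>\<^bsub>W\<^esub>" if "p \<in> I - {p. f p \<noteq> \<zero>}" for p
      using that \<psi> \<open>I \<subseteq> S\<close> by (auto simp: Pi_iff)
  qed (use assms in simp_all)
qed

lemma free_lift_lin:
  assumes W: "vs W" and \<psi>: "\<psi> \<in> S \<rightarrow> carrier W"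
  shows "lin (free_space k S) W (free_lift W \<psi>)"
proof (rule linI)
  interpret W: module k W using W by (rule vs_module)
  let ?F = "free_space k S"
  have closed: "c \<odot>\<^bsub>W\<^esub> \<psi> p \<in> carrier W" if "c \<in> carrier k" "p \<in> S" for c p
    using that \<psi> by (simp add: Pi_iff)
  fix f assume f: "f \<in> carrier ?F"
  let ?I = "{p. f p \<noteq> \<zero>}"
  have I: "finite ?I" "?I \<subseteq> S" using f by (simp_all add: free_carrier)
  have fI: "(\<lambda>p. f p \<odot>\<^bsub>W\<^esub> \<psi> p) \<in> ?I \<rightarrow> carrier W"
    using closed[OF free_value[OF f]] I(2) by (meson Pi_I subset_eq)
  then show "free_lift W \<psi> f \<in> carrier W"
    unfolding free_lift_def by (rule W.finsum_closed)
  show "free_lift W \<psi> (c \<odot>\<^bsub>?F\<^esub> f) = c \<odot>\<^bsub>W\<^esub> free_lift W \<psi> f" if c: "c \<in> carrier k" for c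
  proof -
    have cf: "(\<lambda>p. c \<otimes> f p) \<in> carrier ?F" by (rule free_smult_closed[OF c f])
    have "free_lift W \<psi> (\<lambda>p. c \<otimes> f p) = (\<Oplus>\<^bsub>W\<^esub>p\<in>?I. (c \<otimes> f p) \<odot>\<^bsub>W\<^esub> \<psi> p)"
      by (rule free_lift_superset[OF W \<psi> cf I(1) _ I(2)]) (use c in auto)
    also have "\<dots> = (\<Oplus>\<^bsub>W\<^esub>p\<in>?I. c \<odot>\<^bsub>W\<^esub> (f p \<odot>\<^bsub>W\<^esub> \<psi> p))"
    proof (rule finsum_cong_weak)
      fix p assume "p \<in> ?I"
      then have "\<psi> p \<in> carrier W" using I \<psi> by blast
      then show "(c \<otimes> f p) \<odot>\<^bsub>W\<^esub> \<psi> p = c \<odot>\<^bsub>W\<^esub> (f p \<odot>\<^bsub>W\<^esub> \<psi> p)"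
        using free_value[OF f] c by (simp add: W.smult_assoc1)
    qed
    also have "\<dots> = c \<odot>\<^bsub>W\<^esub> (\<Oplus>\<^bsub>W\<^esub>p\<in>?I. f p \<odot>\<^bsub>W\<^esub> \<psi> p)"
      by (rule W.finsum_smult_ldistr[symmetric, OF I(1) c fI])
    finally show ?thesis
      by (simp only: free_simps free_lift_def[of W \<psi> f])
  qed
  fix g assume g: "g \<in> carrier ?F"
  let ?J = "{p. f p \<noteq> \<zero>} \<union> {p. g p \<noteq> \<zero>}"
  have J: "finite ?J" "?J \<subseteq> S" using f g by (simp_all add: free_carrier)
  have fJ: "(\<lambda>p. f p \<odot>\<^bsub>W\<^esub> \<psi> p) \<in> ?J \<rightarrow> carrier W"
    using closed[OF free_value[OF f]] J(2) by (meson Pi_I subset_eq)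
  have gJ: "(\<lambda>p. g p \<odot>\<^bsub>W\<^esub> \<psi> p) \<in> ?J \<rightarrow> carrier W"
    using closed[OF free_value[OF g]] J(2) by (meson Pi_I subset_eq)
  have 1: "free_lift W \<psi> f = (\<Oplus>\<^bsub>W\<^esub>p\<in>?J. f p \<odot>\<^bsub>W\<^esub> \<psi> p)"
    by (rule free_lift_superset[OF W \<psi> f J(1) _ J(2)]) blast
  have 2: "free_lift W \<psi> g = (\<Oplus>\<^bsub>W\<^esub>p\<in>?J. g p \<odot>\<^bsub>W\<^esub> \<psi> p)"
    by (rule free_lift_superset[OF W \<psi> g J(1) _ J(2)]) blast
  have "free_lift W \<psi> (\<lambda>p. f p \<oplus> g p) = (\<Oplus>\<^bsub>W\<^esub>p\<in>?J. (f p \<oplus> g p) \<odot>\<^bsub>W\<^esub> \<psi> p)"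
    by (rule free_lift_superset[OF W \<psi> free_add_closed[OF f g] J(1) _ J(2)]) auto
  also have "\<dots> = (\<Oplus>\<^bsub>W\<^esub>p\<in>?J. f p \<odot>\<^bsub>W\<^esub> \<psi> p \<oplus>\<^bsub>W\<^esub> g p \<odot>\<^bsub>W\<^esub> \<psi> p)"
  proof (rule finsum_cong_weak)
    fix p assume "p \<in> ?J"
    then have "\<psi> p \<in> carrier W" using J \<psi> by blast
    then show "(f p \<oplus> g p) \<odot>\<^bsub>W\<^esub> \<psi> p = f p \<odot>\<^bsub>W\<^esub> \<psi> p \<oplus>\<^bsub>W\<^esub> g p \<odot>\<^bsub>W\<^esub> \<psi> p"
      using free_value[OF f] free_value[OF g] by (simp add: W.smult_l_distr)
  qed
  also have "\<dots> = (\<Oplus>\<^bsub>W\<^esub>p\<in>?J. f p \<odot>\<^bsub>W\<^esub> \<psi> p) \<oplus>\<^bsub>W\<^esub> (\<Oplus>\<^bsub>W\<^esub>p\<in>?J. g p \<odot>\<^bsub>W\<^esub> \<psi> p)"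
    using fJ gJ by (rule W.finsum_addf)
  finally show "free_lift W \<psi> (f \<oplus>\<^bsub>?F\<^esub> g) = free_lift W \<psi> f \<oplus>\<^bsub>W\<^esub> free_lift W \<psi> g"
    by (simp only: free_simps 1 2)
qed

lemma free_lift_gen:
  assumes "vs W" "\<psi> p \<in> carrier W"
  shows "free_lift W \<psi> (free_gen k p) = \<psi> p"
proof -
  interpret W: module k W using assms(1) by (rule vs_module)
  have "{q. free_gen k p q \<noteq> \<zero>} = {p}"
    by (simp add: free_gen_def)
  then have "free_lift W \<psi> (free_gen k p) = (\<Oplus>\<^bsub>W\<^esub>q\<in>{p}. free_gen k p q \<odot>\<^bsub>W\<^esub> \<psi> q)"
    by (simp only: free_lift_def)
  also have "\<dots> = free_gen k p p \<odot>\<^bsub>W\<^esub> \<psi> p"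
    using assms(2) by (subst W.finsum_insert) (auto simp: free_gen_def)
  also have "\<dots> = \<psi> p"
    using assms(2) by (simp add: free_gen_def)
  finally show ?thesis .
qed

text \<open>Induction over the finite support.\<close>

lemma free_induct [consumes 1, case_names gen zero add]:
  assumes f: "f \<in> carrier (free_space k S)"
    and gen: "\<And>c p. \<lbrakk>c \<in> carrier k; p \<in> S\<rbrakk> \<Longrightarrow> P (\<lambda>q. c \<otimes> free_gen k p q)"
    and zero: "P (\<lambda>q. \<zero>)"
    and add: "\<And>f g. \<lbrakk>f \<in> carrier (free_space k S); g \<in> carrier (free_space k S); P f; P g\<rbrakk>
        \<Longrightarrow> P (\<lambda>p. f p \<oplus> g p)"
  shows "P f"
proof -
  have *: "P f" if "finite I" "f \<in> carrier (free_space k S)" "{p. f p \<noteq> \<zero>} = I" for I f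
    using that
  proof (induction I arbitrary: f rule: finite_induct)
    case empty
    then have "f = (\<lambda>q. \<zero>)" by (simp add: fun_eq_iff)
    then show ?case using zero by simp
  next
    case (insert p I)
    let ?g = "\<lambda>q. if q = p then \<zero> else f q" and ?h = "\<lambda>q. f p \<otimes> free_gen k p q"
    have f: "\<And>q. f q \<in> carrier k" "{p. f p \<noteq> \<zero>} \<subseteq> S"
      using insert.prems(1) by (simp_all add: free_carrier)
    have pS: "p \<in> S" using f(2) insert.prems(2) by blast
    have gI: "{q. ?g q \<noteq> \<zero>} = I" using insert.hyps(2) insert.prems(2) by (auto simp: set_eq_iff)
    have g: "?g \<in> carrier (free_space k S)"
      unfolding free_carrier gI using f insert.prems(2) insert.hyps(1) by auto
    have "P ?g" using g gI by (rule insert.IH)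
    moreover have "?h \<in> carrier (free_space k S)"
      using f(1) pS by (intro free_smult_closed free_gen_closed)
    moreover have "P ?h" using f(1) pS by (rule gen)
    ultimately have "P (\<lambda>q. ?g q \<oplus> ?h q)" using g by (intro add)
    also have "(\<lambda>q. ?g q \<oplus> ?h q) = f" using f(1) by (simp add: free_gen_def fun_eq_iff)
    finally show ?case .
  qed
  have "finite {p. f p \<noteq> \<zero>}" using f by (simp add: free_carrier)
  then show ?thesis using f refl by (rule *)
qed

end

section \<open>The tensor product and its universal property\<close>

context ground
begin

lemma vs_transfer:
  assumes V: "vs V" and "carrier W = carrier V" "zero W = zero V" "add W = add V" "smult W = smult V"
  shows "vs W"
proof -
  interpret V: module k V using V by (rule vs_module)
  show ?thesis
    using V.l_neg by (intro vsI moduleI abelian_groupI is_cring)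
      (auto simp: assms V.a_ac V.smult_l_distr V.smult_r_distr V.smult_assoc1)
qed

context
  fixes A :: "('k, 'a, 'n) module_scheme" and B :: "('k, 'b, 'p) module_scheme"
  assumes A: "vs A" and B: "vs B"
begin

private abbreviation "F \<equiv> tensor_free k A B"
private abbreviation "N \<equiv> tensor_null k A B"

interpretation A: module k A using A by (rule vs_module)
interpretation B: module k B using B by (rule vs_module)
interpretation F: module k F by (rule vs_module[OF free_vs])

lemma tensor_rels_subset: "tensor_rels k A B \<subseteq> carrier F"
proof
  fix r assume "r \<in> tensor_rels k A B"
  then show "r \<in> carrier F"
    by induction
      (auto simp del: free_simps intro!: F.minus_closed F.a_closed F.smult_closed free_gen_closed)
qed

lemma null_submodule: "submodule k N F"
  unfolding tensor_null_def by (rule F.span_is_submodule[OF tensor_rels_subset])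

lemma rels_in_null: "r \<in> tensor_rels k A B \<Longrightarrow> r \<in> N"
  unfolding tensor_null_def using F.in_own_span[OF tensor_rels_subset] by blast

lemma null_abelian_subgroup: "abelian_subgroup N F"
proof (rule abelian_subgroupI3)
  interpret N: submodule k N F by (rule null_submodule)
  show "additive_subgroup N F"
  proof (rule additive_subgroupI, rule F.add.subgroupI, goal_cases)
    case 1 show ?case by (rule N.subset)
  next
    case 2 show ?case using N.zero_closed by blast
  next
    case (3 f)
    then have "f \<in> carrier F" using N.subset by blast
    then have "\<ominus>\<^bsub>F\<^esub> f = (\<ominus> \<one>) \<odot>\<^bsub>F\<^esub> f"
      by (simp add: F.smult_l_minus del: free_simps)
    then show ?case using 3 N.smult_closed[of "\<ominus> \<one>" f] by (simp del: free_simps)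
  next
    case (4 f g) then show ?case by (rule N.m_closed)
  qed
qed (rule F.abelian_group_axioms)

interpretation N: abelian_subgroup N F by (rule null_abelian_subgroup)

private abbreviation "cls f \<equiv> N +>\<^bsub>F\<^esub> f"

lemma tensor_space_carrier: "carrier (tensor_space k A B) = cls ` carrier F"
  by (auto simp: tensor_space_def A_RCOSETS_def')

lemma tensor_space_add:
  "\<lbrakk>f \<in> carrier F; g \<in> carrier F\<rbrakk> \<Longrightarrow> cls f \<oplus>\<^bsub>tensor_space k A B\<^esub> cls g = cls (f \<oplus>\<^bsub>F\<^esub> g)"
  by (simp add: tensor_space_def N.a_rcos_sum del: free_simps)

lemma cls_zero: "cls \<zero>\<^bsub>F\<^esub> = N"
  using N.a_rcos_const[OF N.zero_closed] .

lemma cls_eqI: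
  assumes "f \<in> carrier F" "g \<in> carrier F" "f \<ominus>\<^bsub>F\<^esub> g \<in> N" shows "cls f = cls g"
  using N.a_repr_independence'[of f g] N.a_rcos_module[of g f] assms
  by (simp add: a_minus_def del: free_simps)

lemma tensor_space_smult:
  assumes c: "c \<in> carrier k" and f: "f \<in> carrier F"
  shows "c \<odot>\<^bsub>tensor_space k A B\<^esub> cls f = cls (c \<odot>\<^bsub>F\<^esub> f)"
proof -
  interpret S: submodule k N F by (rule null_submodule)
  have "cls (c \<odot>\<^bsub>F\<^esub> g) = cls (c \<odot>\<^bsub>F\<^esub> f)" if g: "g \<in> cls f" for g
  proof (rule cls_eqI)
    have gF: "g \<in> carrier F" using N.a_elemrcos_carrier[OF f g] .
    then show "c \<odot>\<^bsub>F\<^esub> g \<in> carrier F" "c \<odot>\<^bsub>F\<^esub> f \<in> carrier F"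
      using c f by (auto simp del: free_simps)
    have "g \<ominus>\<^bsub>F\<^esub> f \<in> N"
      using N.a_rcos_module_imp[OF f g] by (simp add: a_minus_def del: free_simps)
    then have "c \<odot>\<^bsub>F\<^esub> (g \<ominus>\<^bsub>F\<^esub> f) \<in> N" using c by (rule S.smult_closed[rotated])
    moreover have "c \<odot>\<^bsub>F\<^esub> (g \<ominus>\<^bsub>F\<^esub> f) = c \<odot>\<^bsub>F\<^esub> g \<ominus>\<^bsub>F\<^esub> c \<odot>\<^bsub>F\<^esub> f"
      using c f gF by (simp add: a_minus_def F.smult_r_distr F.smult_r_minus del: free_simps)
    ultimately show "c \<odot>\<^bsub>F\<^esub> g \<ominus>\<^bsub>F\<^esub> c \<odot>\<^bsub>F\<^esub> f \<in> N" by simp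
  qed
  then have "(\<Union>g\<in>cls f. cls (c \<odot>\<^bsub>F\<^esub> g)) = (\<Union>g\<in>cls f. cls (c \<odot>\<^bsub>F\<^esub> f))"
    by (rule SUP_cong[OF refl])
  also have "\<dots> = cls (c \<odot>\<^bsub>F\<^esub> f)"
    using N.a_rcos_self[OF f] by blast
  finally show ?thesis by (simp add: tensor_space_def del: free_simps)
qed

lemma tensor_space_vs: "vs (tensor_space k A B)"
proof (rule vsI, rule moduleI)
  let ?T = "tensor_space k A B"
  have zero: "\<zero>\<^bsub>?T\<^esub> = cls \<zero>\<^bsub>F\<^esub>" by (simp add: tensor_space_def cls_zero del: free_simps)
  note simps = tensor_space_carrier tensor_space_add tensor_space_smult zero
  show "cring k" by (rule is_cring)
  show "abelian_group ?T"
  proof (rule abelian_groupI)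
    fix t assume "t \<in> carrier ?T"
    then obtain f where f: "f \<in> carrier F" "t = cls f" by (auto simp: tensor_space_carrier)
    then have "cls (\<ominus>\<^bsub>F\<^esub> f) \<oplus>\<^bsub>?T\<^esub> t = \<zero>\<^bsub>?T\<^esub>"
      by (simp add: simps F.l_neg del: free_simps)
    moreover have "cls (\<ominus>\<^bsub>F\<^esub> f) \<in> carrier ?T"
      using f by (simp add: tensor_space_carrier del: free_simps)
    ultimately show "\<exists>s\<in>carrier ?T. s \<oplus>\<^bsub>?T\<^esub> t = \<zero>\<^bsub>?T\<^esub>" by blast
  next
    show "\<zero>\<^bsub>?T\<^esub> \<in> carrier ?T"
      unfolding zero tensor_space_carrier by (rule imageI) (rule F.zero_closed)
  next
    fix t assume "t \<in> carrier ?T"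
    then obtain f where f: "f \<in> carrier F" "t = cls f" by (auto simp: tensor_space_carrier)
    show "\<zero>\<^bsub>?T\<^esub> \<oplus>\<^bsub>?T\<^esub> t = t"
      unfolding zero f(2) tensor_space_add[OF F.zero_closed f(1)] by (simp add: f(1) del: free_simps)
  qed (auto simp: tensor_space_carrier tensor_space_add F.a_ac simp del: free_simps)
qed (auto simp: tensor_space_carrier tensor_space_add tensor_space_smult F.smult_l_distr
       F.smult_r_distr F.smult_assoc1 simp del: free_simps)

lemma tensor_simps:
  "carrier (T A B) = carrier (tensor_space k A B)" "zero (T A B) = zero (tensor_space k A B)"
  "add (T A B) = add (tensor_space k A B)" "smult (T A B) = smult (tensor_space k A B)"
  "one (T A B) = pt A B \<one>\<^bsub>A\<^esub> \<one>\<^bsub>B\<^esub>"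
  by (simp_all add: tensor_def)

lemma tensor_vs: "vs (T A B)"
  by (rule vs_transfer[OF tensor_space_vs]) (simp_all add: tensor_simps)

lemma pt_closed: "\<lbrakk>a \<in> carrier A; b \<in> carrier B\<rbrakk> \<Longrightarrow> pt A B a b \<in> carrier (T A B)"
  by (simp add: tensor_simps tensor_space_carrier pure_tensor_def)

lemma pt_bilinear: "bil A B (T A B) (pt A B)"
proof (intro bilinearI linI)
  note [simp del] = free_simps
  fix a assume a: "a \<in> carrier A"
  fix b assume b: "b \<in> carrier B"
  then show "pt A B a b \<in> carrier (T A B)" by (rule pt_closed[OF a])
  show "pt A B a (c \<odot>\<^bsub>B\<^esub> b) = c \<odot>\<^bsub>T A B\<^esub> pt A B a b" if c: "c \<in> carrier k" for c
    using rels_in_null[OF tensor_rels.smult_right[OF c a b]] a b c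
    by (simp add: tensor_simps pure_tensor_def tensor_space_smult cls_eqI)
  fix b' assume b': "b' \<in> carrier B"
  show "pt A B a (b \<oplus>\<^bsub>B\<^esub> b') = pt A B a b \<oplus>\<^bsub>T A B\<^esub> pt A B a b'"
    using rels_in_null[OF tensor_rels.add_right[OF a b b']] a b b'
    by (simp add: tensor_simps pure_tensor_def tensor_space_add cls_eqI)
next
  note [simp del] = free_simps
  fix b assume b: "b \<in> carrier B"
  fix a assume a: "a \<in> carrier A"
  then show "pt A B a b \<in> carrier (T A B)" using b by (rule pt_closed)
  show "pt A B (c \<odot>\<^bsub>A\<^esub> a) b = c \<odot>\<^bsub>T A B\<^esub> pt A B a b" if c: "c \<in> carrier k" for c
    using rels_in_null[OF tensor_rels.smult_left[OF c a b]] a b c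
    by (simp add: tensor_simps pure_tensor_def tensor_space_smult cls_eqI)
  fix a' assume a': "a' \<in> carrier A"
  show "pt A B (a \<oplus>\<^bsub>A\<^esub> a') b = pt A B a b \<oplus>\<^bsub>T A B\<^esub> pt A B a' b"
    using rels_in_null[OF tensor_rels.add_left[OF a a' b]] a b a'
    by (simp add: tensor_simps pure_tensor_def tensor_space_add cls_eqI)
qed

lemma tensor_induct [consumes 1, case_names pure add]:
  assumes t: "t \<in> carrier (T A B)"
    and pure: "\<And>a b. \<lbrakk>a \<in> carrier A; b \<in> carrier B\<rbrakk> \<Longrightarrow> P (pt A B a b)"
    and add: "\<And>s t. \<lbrakk>s \<in> carrier (T A B); t \<in> carrier (T A B); P s; P t\<rbrakk>
        \<Longrightarrow> P (s \<oplus>\<^bsub>T A B\<^esub> t)"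
  shows "P t"
proof -
  interpret T: module k "T A B" by (rule vs_module[OF tensor_vs])
  have eq: "cls (\<lambda>q. c \<otimes> free_gen k p q) = pt A B (c \<odot>\<^bsub>A\<^esub> fst p) (snd p)"
    if "c \<in> carrier k" "p \<in> carrier A \<times> carrier B" for c p
  proof -
    have p: "fst p \<in> carrier A" "snd p \<in> carrier B" using that(2) by auto
    have "pt A B (c \<odot>\<^bsub>A\<^esub> fst p) (snd p) = c \<odot>\<^bsub>T A B\<^esub> pt A B (fst p) (snd p)"
      using lin_smult[OF bilinear_left[OF pt_bilinear p(2)] that(1) p(1)] .
    also have "\<dots> = cls (c \<odot>\<^bsub>F\<^esub> free_gen k p)"
      unfolding tensor_simps pure_tensor_def prod.collapse
      by (rule tensor_space_smult[OF that(1) free_gen_closed[OF that(2)]])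
    finally show ?thesis by (simp only: free_simps)
  qed
  have "P (cls f)" if f: "f \<in> carrier F" for f
    using f
  proof (induction rule: free_induct)
    case (gen c p)
    then have "c \<odot>\<^bsub>A\<^esub> fst p \<in> carrier A" "snd p \<in> carrier B" by (auto intro: A.smult_closed)
    then show ?case unfolding eq[OF gen] by (rule pure)
  next
    case zero
    have "(\<lambda>q. \<zero> \<otimes> free_gen k (\<zero>\<^bsub>A\<^esub>, \<zero>\<^bsub>B\<^esub>) q) = (\<lambda>q. \<zero>)"
      by (auto simp: free_gen_def)
    moreover have "P (cls (\<lambda>q. \<zero> \<otimes> free_gen k (\<zero>\<^bsub>A\<^esub>, \<zero>\<^bsub>B\<^esub>) q))"
      by (subst eq) (auto intro: pure)
    ultimately show ?case by (simp only:)
  next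
    case (add f g)
    have "cls f \<in> carrier (T A B)" "cls g \<in> carrier (T A B)"
      using add(1,2) by (simp_all only: tensor_simps tensor_space_carrier imageI)
    then have "P (cls f \<oplus>\<^bsub>T A B\<^esub> cls g)" using add(3,4) by (rule assms(3))
    then show ?case
      by (simp only: tensor_simps tensor_space_add[OF add(1,2)] free_simps)
  qed
  moreover obtain f where "f \<in> carrier F" "t = cls f"
    using t unfolding tensor_simps tensor_space_carrier by blast
  ultimately show ?thesis by blast
qed

lemma tensor_ext:
  assumes "lin (T A B) W f" "lin (T A B) W g"
    and "\<And>a b. \<lbrakk>a \<in> carrier A; b \<in> carrier B\<rbrakk> \<Longrightarrow> f (pt A B a b) = g (pt A B a b)"
    and t: "t \<in> carrier (T A B)"
  shows "f t = g t"
  using t by (induction rule: tensor_induct) (simp_all add: assms(3) lin_add[OF assms(1)] lin_add[OF assms(2)])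

context
  fixes W :: "('k, 'w, 'q) module_scheme" and \<phi>
  assumes W: "vs W" and \<phi>: "bil A B W \<phi>"
begin

private abbreviation "\<psi> \<equiv> \<lambda>p. \<phi> (fst p) (snd p)"

interpretation W: module k W using W by (rule vs_module)

text \<open>The linear extension of a bilinear map vanishes on the bilinearity relations, hence on their
  span; so it is constant on cosets.\<close>

lemma null_killed: "f \<in> N \<Longrightarrow> free_lift W \<psi> f = \<zero>\<^bsub>W\<^esub>"
proof -
  have \<psi>: "\<psi> \<in> carrier A \<times> carrier B \<rightarrow> carrier W"
    using bilinear_closed[OF \<phi>] by auto
  interpret h: mod_hom k F W "free_lift W \<psi>"
    by (simp add: mod_hom_def mod_hom_axioms_def F.module_axioms W.module_axioms
        free_lift_lin[OF W \<psi>])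
  have gen: "free_lift W \<psi> (free_gen k (a, b)) = \<phi> a b" if "a \<in> carrier A" "b \<in> carrier B" for a b
    using free_lift_gen[OF W, of \<psi> "(a, b)"] bilinear_closed[OF \<phi> that] by simp
  note lin = lin_add[OF bilinear_left[OF \<phi>]] lin_add[OF bilinear_right[OF \<phi>]]
    lin_smult[OF bilinear_left[OF \<phi>]] lin_smult[OF bilinear_right[OF \<phi>]]
  have rel: "free_lift W \<psi> r = \<zero>\<^bsub>W\<^esub>" if "r \<in> tensor_rels k A B" for r
    using that
    by induction (simp_all add: gen lin bilinear_closed[OF \<phi>] h.f_minus W.r_neg a_minus_def
        del: free_simps)
  have "tensor_rels k A B \<subseteq> h.ker"
    using tensor_rels_subset rel by (auto simp: h.ker_def)
  then have "N \<subseteq> h.ker"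
    unfolding tensor_null_def using h.ker_is_submodule by (rule F.span_is_subset)
  then show "f \<in> N \<Longrightarrow> free_lift W \<psi> f = \<zero>\<^bsub>W\<^esub>" by (auto simp: h.ker_def)
qed

lemma lift_cls:
  assumes f: "f \<in> carrier F" shows "lift W \<phi> (cls f) = free_lift W \<psi> f"
proof -
  have \<psi>: "\<psi> \<in> carrier A \<times> carrier B \<rightarrow> carrier W"
    using bilinear_closed[OF \<phi>] by auto
  note l = free_lift_lin[OF W \<psi>]
  have "free_lift W \<psi> g = free_lift W \<psi> f" if g: "g \<in> cls f" for g
  proof -
    obtain n where n: "n \<in> N" "g = n \<oplus>\<^bsub>F\<^esub> f" using g by (auto simp: a_r_coset_def')
    then show ?thesis
      using lin_add[OF l, of n f] f null_killed[OF n(1)] lin_closed[OF l f]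
      by (simp del: free_simps)
  qed
  moreover have "f \<in> cls f" using f by (rule N.a_rcos_self)
  ultimately have "free_lift W \<psi> ` cls f = {free_lift W \<psi> f}" by blast
  then show ?thesis by (simp add: tensor_lift_def free_lift_def[abs_def])
qed

lemma lift_lin: "lin (T A B) W (lift W \<phi>)"
proof -
  have \<psi>: "\<psi> \<in> carrier A \<times> carrier B \<rightarrow> carrier W"
    using bilinear_closed[OF \<phi>] by auto
  note l = free_lift_lin[OF W \<psi>]
  show ?thesis
    by (intro linI) (auto simp: tensor_simps tensor_space_carrier tensor_space_add
       tensor_space_smult lift_cls lin_closed[OF l] lin_add[OF l] lin_smult[OF l] simp del: free_simps)
qed

lemma lift_pt: "\<lbrakk>a \<in> carrier A; b \<in> carrier B\<rbrakk> \<Longrightarrow> lift W \<phi> (pt A B a b) = \<phi> a b"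
  using free_lift_gen[OF W, of \<psi> "(a, b)"] bilinear_closed[OF \<phi>]
  by (simp add: pure_tensor_def lift_cls)

end

text \<open>Every representative of the coset \<open>t\<close> is supported on \<open>carrier A \<times> carrier B\<close>, so both
  sides fold the same summands.\<close>

lemma lift_cong:
  assumes "t \<in> carrier (T A B)"
    and "\<And>a b. \<lbrakk>a \<in> carrier A; b \<in> carrier B\<rbrakk> \<Longrightarrow> \<phi> a b = \<phi>' a b"
  shows "lift W \<phi> t = lift W \<phi>' t"
proof -
  obtain f where f: "f \<in> carrier F" "t = cls f"
    using assms(1) by (auto simp: tensor_simps tensor_space_carrier)
  have "(\<Oplus>\<^bsub>W\<^esub>p\<in>{p. g p \<noteq> \<zero>}. g p \<odot>\<^bsub>W\<^esub> \<phi> (fst p) (snd p))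
      = (\<Oplus>\<^bsub>W\<^esub>p\<in>{p. g p \<noteq> \<zero>}. g p \<odot>\<^bsub>W\<^esub> \<phi>' (fst p) (snd p))" if "g \<in> t" for g
  proof (rule finsum_cong_weak)
    have "g \<in> carrier F" using N.a_elemrcos_carrier[OF f(1)] that f(2) by simp
    then have "{p. g p \<noteq> \<zero>} \<subseteq> carrier A \<times> carrier B" by (simp add: free_carrier)
    then show "g p \<odot>\<^bsub>W\<^esub> \<phi> (fst p) (snd p) = g p \<odot>\<^bsub>W\<^esub> \<phi>' (fst p) (snd p)" if "p \<in> {p. g p \<noteq> \<zero>}" for p
      using that assms(2)[of "fst p" "snd p"] by (auto simp: mem_Times_iff)
  qed
  then have "(\<lambda>g. \<Oplus>\<^bsub>W\<^esub>p\<in>{p. g p \<noteq> \<zero>}. g p \<odot>\<^bsub>W\<^esub> \<phi> (fst p) (snd p)) ` t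
      = (\<lambda>g. \<Oplus>\<^bsub>W\<^esub>p\<in>{p. g p \<noteq> \<zero>}. g p \<odot>\<^bsub>W\<^esub> \<phi>' (fst p) (snd p)) ` t"
    by (rule image_cong[OF refl])
  then show ?thesis unfolding tensor_lift_def by (rule arg_cong)
qed

end

end

section \<open>Calculus of induced maps\<close>

text \<open>Goals of the form "this expression is linear in \<open>x\<close>", "bilinear in \<open>x\<close> and \<open>y\<close>" or "lies in
  this carrier" are decided by the shape of the expression. The collection \<open>multilin\<close> holds one rule
  for each way of building expressions, and resolving with it repeatedly solves such goals.\<close>

named_theorems multilin

context ground
begin

definition trilinear where
  "trilinear A B C W \<psi> \<longleftrightarrow> (\<forall>a\<in>carrier A. bil B C W (\<psi> a)) \<and>
     (\<forall>b\<in>carrier B. \<forall>c\<in>carrier C. lin A W (\<lambda>a. \<psi> a b c))"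

text \<open>A product that need be neither associative nor unital. The Heisenberg product is treated on
  this level: only its bilinearity and its values on pure tensors enter.\<close>

definition bilinear_product where
  "bilinear_product A \<longleftrightarrow> vs A \<and> bil A A A (mult A)"

declare bilinearI [multilin] lin_id [multilin] tensor_vs [multilin] pt_closed [multilin]

lemma trilinearI [multilin]:
  "\<lbrakk>\<And>a. a \<in> carrier A \<Longrightarrow> bil B C W (\<lambda>b c. \<psi> a b c);
    \<And>b c. \<lbrakk>b \<in> carrier B; c \<in> carrier C\<rbrakk> \<Longrightarrow> lin A W (\<lambda>a. \<psi> a b c)\<rbrakk> \<Longrightarrow> trilinear A B C W \<psi>"
  by (simp add: trilinear_def)

lemma trilinearD:
  assumes "trilinear A B C W \<psi>"
  shows "a \<in> carrier A \<Longrightarrow> bil B C W (\<psi> a)"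
    "\<lbrakk>b \<in> carrier B; c \<in> carrier C\<rbrakk> \<Longrightarrow> lin A W (\<lambda>a. \<psi> a b c)"
    "c \<in> carrier C \<Longrightarrow> bil A B W (\<lambda>a b. \<psi> a b c)"
    "\<lbrakk>a \<in> carrier A; b \<in> carrier B\<rbrakk> \<Longrightarrow> lin C W (\<psi> a b)"
    "\<lbrakk>a \<in> carrier A; c \<in> carrier C\<rbrakk> \<Longrightarrow> lin B W (\<lambda>b. \<psi> a b c)"
  using assms by (auto simp: trilinear_def bilinear_def)

lemma scalars_vs [multilin]: "vs (scalars k)"
proof (rule vsI, rule moduleI)
  show "abelian_group (scalars k)"
    by (rule abelian_groupI) (auto simp: a_ac intro: l_neg bexI[of _ "\<ominus> x" for x])
qed (auto simp: is_cring l_distr r_distr m_assoc)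

lemma unital_algebra_vs [multilin]: "unital_algebra k A \<Longrightarrow> vs A"
  by (simp add: unital_algebra_def)

lemma mult_bilinear: "bilinear_product A \<Longrightarrow> bil A A A (mult A)"
  by (simp add: bilinear_product_def)

lemma bilinear_product_vs [multilin]: "bilinear_product A \<Longrightarrow> vs A"
  by (simp add: bilinear_product_def)

lemma unital_algebra_product [multilin]:
  assumes "unital_algebra k A" shows "bilinear_product A"
proof -
  interpret A: unital_algebra k A by fact
  show ?thesis unfolding bilinear_product_def
    by (auto intro!: bilinearI linI simp: A.vectorspace_axioms A.l_distr A.r_distr
        A.smult_mult_left A.smult_mult_right)
qed

lemma mult_closed [multilin]:
  "\<lbrakk>bilinear_product A; a \<in> carrier A; b \<in> carrier A\<rbrakk> \<Longrightarrow> a \<otimes>\<^bsub>A\<^esub> b \<in> carrier A"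
  by (rule bilinear_closed[OF mult_bilinear])

lemma smult_closed [multilin]:
  "\<lbrakk>vs W; c \<in> carrier k; w \<in> carrier W\<rbrakk> \<Longrightarrow> c \<odot>\<^bsub>W\<^esub> w \<in> carrier W"
  by (meson module.smult_closed vs_module)

lemma scalars_closed [multilin]: "c \<in> carrier k \<Longrightarrow> c \<in> carrier (scalars k)"
  by simp

lemma one_closed_algebra [multilin]: "unital_algebra k A \<Longrightarrow> \<one>\<^bsub>A\<^esub> \<in> carrier A"
  by (meson ring.ring_simprules(6) unital_algebra_def)

declare m_closed [multilin]

lemma smult_bilinear: "vs W \<Longrightarrow> bil (scalars k) W W (smult W)"
proof -
  assume "vs W" then interpret W: module k W by (rule vs_module)
  show ?thesis
    by (auto intro!: bilinearI linI simp: W.smult_l_distr W.smult_r_distr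
        W.smult_assoc1[symmetric] m_comm)
qed

lemma lin_bilinear_left: "\<lbrakk>bil A B W \<phi>; lin X A f; b \<in> carrier B\<rbrakk> \<Longrightarrow> lin X W (\<lambda>x. \<phi> (f x) b)"
  by (rule lin_compose[OF bilinear_left])

lemma lin_bilinear_right: "\<lbrakk>bil A B W \<phi>; lin X B f; a \<in> carrier A\<rbrakk> \<Longrightarrow> lin X W (\<lambda>x. \<phi> a (f x))"
  by (rule lin_compose[OF bilinear_right])

lemma lin_smult_left [multilin]:
  "\<lbrakk>lin X (scalars k) f; vs W; w \<in> carrier W\<rbrakk> \<Longrightarrow> lin X W (\<lambda>x. f x \<odot>\<^bsub>W\<^esub> w)"
  by (rule lin_bilinear_left[OF smult_bilinear])

lemma lin_smult_right [multilin]: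
  "\<lbrakk>lin X W f; vs W; c \<in> carrier k\<rbrakk> \<Longrightarrow> lin X W (\<lambda>x. c \<odot>\<^bsub>W\<^esub> f x)"
  using lin_bilinear_right[OF smult_bilinear] by fastforce

lemma lin_scalar_left [multilin]:
  "\<lbrakk>lin X (scalars k) f; c \<in> carrier k\<rbrakk> \<Longrightarrow> lin X (scalars k) (\<lambda>x. f x \<otimes> c)"
  using lin_smult_left[OF _ scalars_vs, of f X c] by simp

lemma lin_scalar_right [multilin]:
  "\<lbrakk>lin X (scalars k) f; c \<in> carrier k\<rbrakk> \<Longrightarrow> lin X (scalars k) (\<lambda>x. c \<otimes> f x)"
  using lin_smult_right[OF _ scalars_vs, of f X c] by simp

lemma lin_mult_left [multilin]:
  "\<lbrakk>lin X A f; bilinear_product A; c \<in> carrier A\<rbrakk> \<Longrightarrow> lin X A (\<lambda>x. f x \<otimes>\<^bsub>A\<^esub> c)"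
  by (rule lin_bilinear_left[OF mult_bilinear])

lemma lin_mult_right [multilin]:
  "\<lbrakk>lin X A f; bilinear_product A; c \<in> carrier A\<rbrakk> \<Longrightarrow> lin X A (\<lambda>x. c \<otimes>\<^bsub>A\<^esub> f x)"
  by (rule lin_bilinear_right[OF mult_bilinear])

lemma lin_pt_left [multilin]:
  "\<lbrakk>lin X A f; vs A; vs B; b \<in> carrier B\<rbrakk> \<Longrightarrow> lin X (T A B) (\<lambda>x. pt A B (f x) b)"
  by (rule lin_bilinear_left[OF pt_bilinear])

lemma lin_pt_right [multilin]:
  "\<lbrakk>lin X B f; vs A; vs B; a \<in> carrier A\<rbrakk> \<Longrightarrow> lin X (T A B) (\<lambda>x. pt A B a (f x))"
  by (rule lin_bilinear_right[OF pt_bilinear])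

lemma lift_closed [multilin]:
  "\<lbrakk>t \<in> carrier (T A B); vs A; vs B; vs W; bil A B W \<phi>\<rbrakk> \<Longrightarrow> lift W \<phi> t \<in> carrier W"
  by (rule lin_closed[OF lift_lin])

lemma lift_scalars_closed [multilin]:
  "\<lbrakk>t \<in> carrier (T A B); vs A; vs B; bil A B (scalars k) \<phi>\<rbrakk> \<Longrightarrow> lift (scalars k) \<phi> t \<in> carrier k"
  using lift_closed[OF _ _ _ scalars_vs] by simp

lemma lin_lift_arg [multilin]:
  "\<lbrakk>lin X (T A B) f; vs A; vs B; vs W; bil A B W \<phi>\<rbrakk> \<Longrightarrow> lin X W (\<lambda>x. lift W \<phi> (f x))"
  by (rule lin_compose[OF lift_lin])

lemma lin_plus:
  assumes "vs W" "lin X W f" "lin X W g"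
  shows "lin X W (\<lambda>x. f x \<oplus>\<^bsub>W\<^esub> g x)"
proof -
  interpret W: module k W using assms(1) by (rule vs_module)
  show ?thesis
    using assms(2,3) by (intro linI) (simp_all add: lin_closed lin_add lin_smult W.smult_r_distr W.a_ac)
qed

text \<open>Linear dependence on a parameter of \<open>\<phi>\<close> passes to the induced map: it holds on pure tensors and
  is preserved by sums of tensors.\<close>

lemma lin_lift_param [multilin]:
  assumes t: "t \<in> carrier (T A B)"
    and vs: "vs A" "vs B" "vs W" "vs X"
    and \<phi>: "\<And>x. x \<in> carrier X \<Longrightarrow> bil A B W (\<lambda>a b. \<phi> x a b)"
    and lin: "\<And>a b. \<lbrakk>a \<in> carrier A; b \<in> carrier B\<rbrakk> \<Longrightarrow> lin X W (\<lambda>x. \<phi> x a b)"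
  shows "lin X W (\<lambda>x. lift W (\<phi> x) t)"
proof (rule tensor_induct[OF vs(1,2) t])
  fix a b assume pure: "a \<in> carrier A" "b \<in> carrier B"
  show "lin X W (\<lambda>x. lift W (\<phi> x) (pt A B a b))"
    by (rule lin_cong[OF vs_module[OF vs(4)] lin[OF pure]]) (simp add: lift_pt vs \<phi> pure)
next
  fix s t assume add: "s \<in> carrier (T A B)" "t \<in> carrier (T A B)"
    "lin X W (\<lambda>x. lift W (\<phi> x) s)" "lin X W (\<lambda>x. lift W (\<phi> x) t)"
  show "lin X W (\<lambda>x. lift W (\<phi> x) (s \<oplus>\<^bsub>T A B\<^esub> t))"
    by (rule lin_cong[OF vs_module[OF vs(4)] lin_plus[OF vs(3) add(3,4)]])
      (simp add: lin_add[OF lift_lin] vs \<phi> add)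
qed

lemma lift_hom:
  assumes "lin W V f" and t: "t \<in> carrier (T A B)" and vs: "vs A" "vs B" "vs W" "vs V"
    and \<phi>: "bil A B W \<phi>"
  shows "f (lift W \<phi> t) = lift V (\<lambda>a b. f (\<phi> a b)) t"
proof -
  have f\<phi>: "bil A B V (\<lambda>a b. f (\<phi> a b))"
    by (intro bilinearI lin_compose[OF assms(1)] bilinear_right[OF \<phi>] bilinear_left[OF \<phi>])
  show ?thesis
    by (rule tensor_ext[OF vs(1,2) _ _ _ t, where W=V])
      (simp_all add: lift_pt vs \<phi> f\<phi> lin_compose[OF assms(1)] lift_lin)
qed

text \<open>The Fubini theorem for Sweedler sums.\<close>

lemma lift_swap:
  assumes s: "s \<in> carrier (T A B)" and t: "t \<in> carrier (T C D)"
    and vs: "vs A" "vs B" "vs C" "vs D" "vs W"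
    and 1: "\<And>a b. \<lbrakk>a \<in> carrier A; b \<in> carrier B\<rbrakk> \<Longrightarrow> bil C D W (\<lambda>c d. \<phi> a b c d)"
    and 2: "\<And>c d. \<lbrakk>c \<in> carrier C; d \<in> carrier D\<rbrakk> \<Longrightarrow> bil A B W (\<lambda>a b. \<phi> a b c d)"
  shows "lift W (\<lambda>a b. lift W (\<lambda>c d. \<phi> a b c d) t) s = lift W (\<lambda>c d. lift W (\<lambda>a b. \<phi> a b c d) s) t"
proof -
  have A: "bil A B W (\<lambda>a b. lift W (\<lambda>c d. \<phi> a b c d) t)"
    by (rule bilinearI lin_lift_param[OF t] vs 1 bilinear_right[OF 2] bilinear_left[OF 2] | assumption)+
  have C: "bil C D W (\<lambda>c d. lift W (\<lambda>a b. \<phi> a b c d) s)" if "s \<in> carrier (T A B)" for s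
    by (rule bilinearI lin_lift_param[OF that] vs 2 bilinear_right[OF 1] bilinear_left[OF 1] | assumption)+
  have L: "lin (T A B) W (\<lambda>s. lift W (\<lambda>c d. lift W (\<lambda>a b. \<phi> a b c d) s) t)"
    by (rule lin_lift_param[OF t] vs C tensor_vs lift_lin 2 | assumption)+
  show ?thesis
  proof (rule tensor_ext[OF vs(1,2) lift_lin[OF vs(1,2,5) A] L _ s])
    fix a b assume ab: "a \<in> carrier A" "b \<in> carrier B"
    show "lift W (\<lambda>a b. lift W (\<lambda>c d. \<phi> a b c d) t) (pt A B a b)
      = lift W (\<lambda>c d. lift W (\<lambda>a b. \<phi> a b c d) (pt A B a b)) t"
      unfolding lift_pt[OF vs(1,2,5) A ab]
      by (rule lift_cong[OF vs(3,4) t]) (simp add: lift_pt vs 2 ab)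
  qed
qed

text \<open>The two records have the same underlying space, and an induced map sees only that.\<close>

lemma tensor_space_eq:
  "finsum (tensor_space k A B) = finsum (T A B)" "smult (tensor_space k A B) = smult (T A B)"
  by (simp_all add: tensor_def finsum_def fun_eq_iff)

lemma lift_tensor_space: "lift (tensor_space k A B) = lift (T A B)"
  by (simp add: tensor_lift_def tensor_space_eq fun_eq_iff)

subsection \<open>Maps between tensor products\<close>

lemma pt_compose_bilinear:
  assumes vs: "vs C" "vs D" and f: "lin A C f" and g: "lin B D g"
  shows "bil A B (T C D) (\<lambda>a b. pt C D (f a) (g b))"
  by (intro bilinearI lin_pt_left lin_pt_right lin_closed[OF f] lin_closed[OF g] vs f g)

lemma map_lin [multilin]:
  "\<lbrakk>vs A; vs B; vs C; vs D; lin A C f; lin B D g\<rbrakk>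
    \<Longrightarrow> lin (T A B) (T C D) (tensor_map k C D f g)"
  unfolding tensor_map_def
  by (intro lift_lin tensor_vs pt_compose_bilinear)

lemma map_closed [multilin]:
  "\<lbrakk>t \<in> carrier (T A B); vs A; vs B; vs C; vs D; lin A C f; lin B D g\<rbrakk>
    \<Longrightarrow> tensor_map k C D f g t \<in> carrier (T C D)"
  by (rule lin_closed[OF map_lin])

lemma map_pt:
  "\<lbrakk>vs A; vs B; vs C; vs D; lin A C f; lin B D g; a \<in> carrier A; b \<in> carrier B\<rbrakk>
    \<Longrightarrow> tensor_map k C D f g (pt A B a b) = pt C D (f a) (g b)"
  unfolding tensor_map_def
  by (simp add: lift_pt tensor_vs pt_compose_bilinear)

lemma lift_map:
  assumes t: "t \<in> carrier (T A B)" and vs: "vs A" "vs B" "vs C" "vs D" "vs W"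
    and f: "lin A C f" and g: "lin B D g" and \<phi>: "bil C D W \<phi>"
  shows "lift W \<phi> (tensor_map k C D f g t) = lift W (\<lambda>a b. \<phi> (f a) (g b)) t"
proof -
  have "lift W \<phi> (tensor_map k C D f g t) = lift W (\<lambda>a b. lift W \<phi> (pt C D (f a) (g b))) t"
    unfolding tensor_map_def
    by (rule lift_hom[OF lift_lin[OF vs(3,4,5) \<phi>] t vs(1,2) tensor_vs[OF vs(3,4)] vs(5)])
      (rule pt_compose_bilinear[OF vs(3,4) f g])
  also have "\<dots> = lift W (\<lambda>a b. \<phi> (f a) (g b)) t"
    by (rule lift_cong[OF vs(1,2) t])
      (rule lift_pt[OF vs(3,4,5) \<phi> lin_closed[OF f] lin_closed[OF g]])
  finally show ?thesis .
qed

lemma assoc_bilinear: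
  assumes "vs A" "vs B" "vs C"
  shows "trilinear A B C (T (T A B) C) (\<lambda>a b c. pt (T A B) C (pt A B a b) c)"
  by (rule multilin assms | assumption)+

lemma trilinear_lift_bilinear:
  assumes \<psi>: "trilinear A B C W \<psi>" and vs: "vs A" "vs B" "vs C" "vs W"
  shows "bil A (T B C) W (\<lambda>a. lift W (\<psi> a))" "bil (T A B) C W (\<lambda>s c. lift W (\<lambda>a b. \<psi> a b c) s)"
  by (rule bilinearI lift_lin lin_lift_param tensor_vs vs trilinearD[OF \<psi>] | assumption)+

lemma assoc_pt:
  assumes "vs A" "vs B" "vs C" and abc: "a \<in> carrier A" "b \<in> carrier B" "c \<in> carrier C"
  shows "tensor_assoc k A B C (pt A (T B C) a (pt B C b c)) = pt (T A B) C (pt A B a b) c"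
  unfolding tensor_assoc_def
  using trilinear_lift_bilinear(1)[OF assoc_bilinear[OF assms(1-3)]]
    trilinearD(1)[OF assoc_bilinear[OF assms(1-3)] abc(1)] assms
  by (simp add: lift_pt tensor_vs pt_closed)

lemma assoc_lin [multilin]:
  assumes "vs A" "vs B" "vs C"
  shows "lin (T A (T B C)) (T (T A B) C) (tensor_assoc k A B C)"
  unfolding tensor_assoc_def
  using trilinear_lift_bilinear(1)[OF assoc_bilinear[OF assms(1-3)]] assms
  by (simp add: lift_lin tensor_vs)

lemma tensor_ext3_right:
  assumes vs: "vs A" "vs B" "vs C" and f: "lin (T A (T B C)) W f" and g: "lin (T A (T B C)) W g"
    and eq: "\<And>a b c. \<lbrakk>a \<in> carrier A; b \<in> carrier B; c \<in> carrier C\<rbrakk> \<Longrightarrow>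
      f (pt A (T B C) a (pt B C b c)) = g (pt A (T B C) a (pt B C b c))"
    and t: "t \<in> carrier (T A (T B C))"
  shows "f t = g t"
proof (rule tensor_ext[OF vs(1) tensor_vs[OF vs(2,3)] f g _ t])
  fix a u assume a: "a \<in> carrier A" and u: "u \<in> carrier (T B C)"
  note l = lin_compose[OF _ bilinear_right[OF pt_bilinear[OF vs(1) tensor_vs[OF vs(2,3)]] a]]
  show "f (pt A (T B C) a u) = g (pt A (T B C) a u)"
    by (rule tensor_ext[OF vs(2,3) l[OF f] l[OF g] eq[OF a] u])
qed

text \<open>The associator is invisible in Sweedler notation: an iterated sum does not depend on the
  bracketing.\<close>

lemma lift_assoc:
  assumes t: "t \<in> carrier (T A (T B C))" and vs: "vs A" "vs B" "vs C" "vs W"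
    and \<psi>: "trilinear A B C W \<psi>"
  shows "lift W (\<lambda>s c. lift W (\<lambda>a b. \<psi> a b c) s) (tensor_assoc k A B C t)
       = lift W (\<lambda>a u. lift W (\<lambda>b c. \<psi> a b c) u) t"
proof (rule tensor_ext3_right[OF vs(1-3) _ _ _ t])
  note b = trilinear_lift_bilinear[OF \<psi> vs]
  show "lin (T A (T B C)) W (\<lambda>t. lift W (\<lambda>s c. lift W (\<lambda>a b. \<psi> a b c) s) (tensor_assoc k A B C t))"
    by (rule lin_compose[OF lift_lin assoc_lin] b vs tensor_vs)+
  show "lin (T A (T B C)) W (lift W (\<lambda>a u. lift W (\<lambda>b c. \<psi> a b c) u))"
    by (rule lift_lin b vs tensor_vs)+
  fix a b c assume abc: "a \<in> carrier A" "b \<in> carrier B" "c \<in> carrier C"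
  then show "lift W (\<lambda>s c. lift W (\<lambda>a b. \<psi> a b c) s) (tensor_assoc k A B C (pt A (T B C) a (pt B C b c)))
      = lift W (\<lambda>a u. lift W (\<lambda>b c. \<psi> a b c) u) (pt A (T B C) a (pt B C b c))"
    using b trilinearD[OF \<psi>] vs by (simp add: assoc_pt lift_pt tensor_vs pt_closed)
qed

subsection \<open>Tensor products of algebras\<close>

context
  fixes A :: "('k, 'a, 'n) module_scheme" and B :: "('k, 'b, 'p) module_scheme"
  assumes A: "bilinear_product A" and B: "bilinear_product B"
begin

private lemma mult_def:
  "s \<otimes>\<^bsub>T A B\<^esub> t = lift (T A B) (\<lambda>a b. lift (T A B) (\<lambda>a' b'. pt A B (a \<otimes>\<^bsub>A\<^esub> a') (b \<otimes>\<^bsub>B\<^esub> b')) t) s"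
  unfolding lift_tensor_space[symmetric] by (simp add: tensor_def)

lemma tensor_product_bilinear [multilin]: "bilinear_product (T A B)"
  unfolding bilinear_product_def
proof (intro conjI)
  show "vs (T A B)" by (rule multilin A B)+
  show "bil (T A B) (T A B) (T A B) (mult (T A B))"
    unfolding mult_def[abs_def]
    by (rule multilin A B | assumption)+
qed

lemma tensor_mult_pt:
  assumes "a \<in> carrier A" "b \<in> carrier B" "a' \<in> carrier A" "b' \<in> carrier B"
  shows "pt A B a b \<otimes>\<^bsub>T A B\<^esub> pt A B a' b' = pt A B (a \<otimes>\<^bsub>A\<^esub> a') (b \<otimes>\<^bsub>B\<^esub> b')"
proof -
  have "bil A B (T A B) (\<lambda>a b. lift (T A B) (\<lambda>a' b'. pt A B (a \<otimes>\<^bsub>A\<^esub> a') (b \<otimes>\<^bsub>B\<^esub> b')) (pt A B a' b'))"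
    by (rule multilin A B assms | assumption)+
  moreover have "bil A B (T A B) (\<lambda>a' b'. pt A B (a \<otimes>\<^bsub>A\<^esub> a') (b \<otimes>\<^bsub>B\<^esub> b'))"
    by (rule multilin A B assms | assumption)+
  moreover have "vs A" "vs B" "vs (T A B)" by (rule multilin A B)+
  ultimately show ?thesis unfolding mult_def using assms by (simp add: lift_pt)
qed

lemma lift_mult:
  assumes s: "s \<in> carrier (T A B)" and t: "t \<in> carrier (T A B)" and W: "vs W" and \<phi>: "bil A B W \<phi>"
  shows "lift W \<phi> (s \<otimes>\<^bsub>T A B\<^esub> t) =
    lift W (\<lambda>a b. lift W (\<lambda>a' b'. \<phi> (a \<otimes>\<^bsub>A\<^esub> a') (b \<otimes>\<^bsub>B\<^esub> b')) t) s"
proof -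
  have vs: "vs A" "vs B" "vs (T A B)" by (rule multilin A B)+
  have 1: "bil A B (T A B) (\<lambda>a b. lift (T A B) (\<lambda>a' b'. pt A B (a \<otimes>\<^bsub>A\<^esub> a') (b \<otimes>\<^bsub>B\<^esub> b')) t)"
    by (rule multilin A B t | assumption)+
  have 2: "bil A B (T A B) (\<lambda>a' b'. pt A B (a \<otimes>\<^bsub>A\<^esub> a') (b \<otimes>\<^bsub>B\<^esub> b'))"
    if "a \<in> carrier A" "b \<in> carrier B" for a b
    by (rule multilin A B that | assumption)+
  show ?thesis
    unfolding mult_def lift_hom[OF lift_lin[OF vs(1,2) W \<phi>] s vs W 1]
  proof (rule lift_cong[OF vs(1,2) s])
    fix a b assume ab: "a \<in> carrier A" "b \<in> carrier B"
    show "lift W \<phi> (lift (T A B) (\<lambda>a' b'. pt A B (a \<otimes>\<^bsub>A\<^esub> a') (b \<otimes>\<^bsub>B\<^esub> b')) t)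
        = lift W (\<lambda>a' b'. \<phi> (a \<otimes>\<^bsub>A\<^esub> a') (b \<otimes>\<^bsub>B\<^esub> b')) t"
      unfolding lift_hom[OF lift_lin[OF vs(1,2) W \<phi>] t vs W 2[OF ab]]
      by (rule lift_cong[OF vs(1,2) t]) (simp add: lift_pt vs W \<phi> ab mult_closed A B)
  qed
qed

end

lemma unital_algebraI:
  assumes A: "bilinear_product A" and one: "\<one>\<^bsub>A\<^esub> \<in> carrier A"
    and "\<And>x. x \<in> carrier A \<Longrightarrow> \<one>\<^bsub>A\<^esub> \<otimes>\<^bsub>A\<^esub> x = x" "\<And>x. x \<in> carrier A \<Longrightarrow> x \<otimes>\<^bsub>A\<^esub> \<one>\<^bsub>A\<^esub> = x"
    and "\<And>x y z. \<lbrakk>x \<in> carrier A; y \<in> carrier A; z \<in> carrier A\<rbrakk>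
      \<Longrightarrow> x \<otimes>\<^bsub>A\<^esub> y \<otimes>\<^bsub>A\<^esub> z = x \<otimes>\<^bsub>A\<^esub> (y \<otimes>\<^bsub>A\<^esub> z)"
  shows "unital_algebra k A"
proof -
  interpret A: vectorspace k A using A by (rule bilinear_product_vs)
  note b = mult_bilinear[OF A]
  show ?thesis
    by (intro unital_algebra.intro A.vectorspace_axioms ringI A.abelian_group_axioms monoidI
        unital_algebra_axioms.intro)
      (simp_all add: assms(3-) one bilinear_closed[OF b] lin_add[OF bilinear_left[OF b]]
        lin_add[OF bilinear_right[OF b]] lin_smult[OF bilinear_left[OF b]] lin_smult[OF bilinear_right[OF b]])
qed

lemma unital_algebra_monoid: "unital_algebra k A \<Longrightarrow> monoid A"
  by (simp add: unital_algebra_def ring_def)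

lemma tensor_unital_algebra [multilin]:
  assumes A: "unital_algebra k A" and B: "unital_algebra k B"
  shows "unital_algebra k (T A B)"
proof -
  interpret A: unital_algebra k A by fact
  interpret B: unital_algebra k B by fact
  note vs = A.vectorspace_axioms B.vectorspace_axioms
  note p = unital_algebra_product[OF A] unital_algebra_product[OF B]
  let ?T = "T A B"
  have one: "\<one>\<^bsub>?T\<^esub> = pt A B \<one>\<^bsub>A\<^esub> \<one>\<^bsub>B\<^esub>" by (rule tensor_simps[OF vs])
  have one_closed: "\<one>\<^bsub>?T\<^esub> \<in> carrier ?T" unfolding one by (simp add: pt_closed vs)
  show ?thesis
  proof (rule unital_algebraI)
    show prod: "bilinear_product ?T" by (rule multilin A B)+
    note tp = lin_id lin_mult_left[OF _ prod] lin_mult_right[OF _ prod] lin_compose one_closed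
    show "\<one>\<^bsub>?T\<^esub> \<in> carrier ?T" by fact
    show "\<one>\<^bsub>?T\<^esub> \<otimes>\<^bsub>?T\<^esub> x = x" if "x \<in> carrier ?T" for x
      by (rule tensor_ext[OF vs _ _ _ that, where W="?T"])
        (auto intro!: tp(1-3) one_closed simp: one tensor_mult_pt[OF p] pt_closed vs)
    show "x \<otimes>\<^bsub>?T\<^esub> \<one>\<^bsub>?T\<^esub> = x" if "x \<in> carrier ?T" for x
      by (rule tensor_ext[OF vs _ _ _ that, where W="?T"])
        (auto intro!: tp(1-3) one_closed simp: one tensor_mult_pt[OF p] pt_closed vs)
    fix x y z assume xyz: "x \<in> carrier ?T" "y \<in> carrier ?T" "z \<in> carrier ?T"
    note m = mult_closed[OF prod]
    have 1: "pt A B a b \<otimes>\<^bsub>?T\<^esub> pt A B a' b' \<otimes>\<^bsub>?T\<^esub> z = pt A B a b \<otimes>\<^bsub>?T\<^esub> (pt A B a' b' \<otimes>\<^bsub>?T\<^esub> z)"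
      if "a \<in> carrier A" "b \<in> carrier B" "a' \<in> carrier A" "b' \<in> carrier B" for a b a' b'
      by (rule tensor_ext[OF vs _ _ _ xyz(3), where W="?T"])
        (use that in \<open>auto intro!: tp(1-3) m pt_closed vs simp: tensor_mult_pt[OF p] A.m_assoc B.m_assoc\<close>)
    have 2: "pt A B a b \<otimes>\<^bsub>?T\<^esub> y \<otimes>\<^bsub>?T\<^esub> z = pt A B a b \<otimes>\<^bsub>?T\<^esub> (y \<otimes>\<^bsub>?T\<^esub> z)"
      if "a \<in> carrier A" "b \<in> carrier B" for a b
      by (rule tensor_ext[OF vs _ _ _ xyz(2), where W="?T"])
        (use that xyz in \<open>auto intro!: tp(1-3) m pt_closed vs simp: 1\<close>)
    show "x \<otimes>\<^bsub>?T\<^esub> y \<otimes>\<^bsub>?T\<^esub> z = x \<otimes>\<^bsub>?T\<^esub> (y \<otimes>\<^bsub>?T\<^esub> z)"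
      by (rule tensor_ext[OF vs _ _ _ xyz(1), where W="?T"])
        (use xyz in \<open>auto intro!: tp(1-3) m pt_closed vs simp: 2\<close>)
  qed
qed

end

section \<open>Convolution algebras\<close>

text \<open>The linear maps from a coalgebra to an algebra, with the convolution product
  \<open>(fg)(h) = f(h\<^sub>1) g(h\<^sub>2)\<close>. They are extensional, so that maps with equal values are equal. For
  \<open>A = scalars k\<close> this is the dual algebra.\<close>

definition conv_algebra ::
  "('k, 'm) ring_scheme \<Rightarrow> ('k, 'h, 'n) hopf_scheme \<Rightarrow> ('k, 'a, 'p) module_scheme
    \<Rightarrow> ('k, 'h \<Rightarrow> 'a) module" where
  "conv_algebra k H A =
     \<lparr>carrier = module_hom k H A \<inter> extensional (carrier H),
      mult = (\<lambda>f g. \<lambda>h\<in>carrier H.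
        tensor_lift k A (\<lambda>h1 h2. f h1 \<otimes>\<^bsub>A\<^esub> g h2) (comult H h)),
      one = (\<lambda>h\<in>carrier H. counit H h \<odot>\<^bsub>A\<^esub> \<one>\<^bsub>A\<^esub>),
      zero = (\<lambda>h\<in>carrier H. \<zero>\<^bsub>A\<^esub>),
      add = (\<lambda>f g. \<lambda>h\<in>carrier H. f h \<oplus>\<^bsub>A\<^esub> g h),
      smult = (\<lambda>c f. \<lambda>h\<in>carrier H. c \<odot>\<^bsub>A\<^esub> f h)\<rparr>"

lemma conv_simps [simp]:
  "carrier (conv_algebra k H A) = module_hom k H A \<inter> extensional (carrier H)"
  "\<zero>\<^bsub>conv_algebra k H A\<^esub> = (\<lambda>h\<in>carrier H. \<zero>\<^bsub>A\<^esub>)"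
  "f \<oplus>\<^bsub>conv_algebra k H A\<^esub> g = (\<lambda>h\<in>carrier H. f h \<oplus>\<^bsub>A\<^esub> g h)"
  "c \<odot>\<^bsub>conv_algebra k H A\<^esub> f = (\<lambda>h\<in>carrier H. c \<odot>\<^bsub>A\<^esub> f h)"
  "\<one>\<^bsub>conv_algebra k H A\<^esub> = (\<lambda>h\<in>carrier H. counit H h \<odot>\<^bsub>A\<^esub> \<one>\<^bsub>A\<^esub>)"
  "f \<otimes>\<^bsub>conv_algebra k H A\<^esub> g = (\<lambda>h\<in>carrier H.
        tensor_lift k A (\<lambda>h1 h2. f h1 \<otimes>\<^bsub>A\<^esub> g h2) (comult H h))"
  by (simp_all add: conv_algebra_def)

context ground
begin

lemma lin_restrict:
  assumes "vs A" shows "lin A B (restrict f (carrier A)) \<longleftrightarrow> lin A B f"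
proof -
  interpret A: module k A using assms by (rule vs_module)
  have "lin A B (restrict f (carrier A))" if "lin A B f"
    by (rule lin_cong[OF A.module_axioms that]) simp
  moreover have "lin A B f" if "lin A B (restrict f (carrier A))"
    by (rule lin_cong[OF A.module_axioms that]) simp
  ultimately show ?thesis by blast
qed

lemma hopf_algebra_alg [multilin]: "hopf_algebra k H \<Longrightarrow> unital_algebra k H"
  by (simp add: hopf_algebra_def)

lemma hopf_vs [multilin]: "hopf_algebra k H \<Longrightarrow> vs H"
  by (simp add: hopf_algebra_def unital_algebra_def)

context
  fixes H :: "('k, 'h, 'n) hopf_scheme" and A :: "('k, 'a, 'p) module_scheme"
  assumes H: "vs H" and A: "vs A"
begin

interpretation H: module k H using H by (rule vs_module)
interpretation A: module k A using A by (rule vs_module)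

private abbreviation "C \<equiv> conv_algebra k H A"

private lemma conv_ext:
  "f \<in> carrier C \<Longrightarrow> g \<in> carrier C \<Longrightarrow> (\<And>h. h \<in> carrier H \<Longrightarrow> f h = g h) \<Longrightarrow> f = g"
  by (auto intro: extensionalityI)

private lemma conv_value: "\<lbrakk>f \<in> carrier C; h \<in> carrier H\<rbrakk> \<Longrightarrow> f h \<in> carrier A"
  by (auto intro: lin_closed)

lemma conv_vs: "vs C"
proof (rule vsI, rule moduleI)
  have add: "f \<oplus>\<^bsub>C\<^esub> g \<in> carrier C" if "f \<in> carrier C" "g \<in> carrier C" for f g
    using that lin_plus[OF A, of f H g] by (simp add: lin_restrict[OF H])
  have smult: "c \<odot>\<^bsub>C\<^esub> f \<in> carrier C" if "c \<in> carrier k" "f \<in> carrier C" for c f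
    using that lin_smult_right[OF _ A, of f H c] by (simp add: lin_restrict[OF H])
  have zero: "\<zero>\<^bsub>C\<^esub> \<in> carrier C"
    by (simp add: lin_restrict[OF H]) (auto intro: linI)
  show "cring k" by (rule is_cring)
  show "abelian_group C"
  proof (rule abelian_groupI)
    fix f assume f: "f \<in> carrier C"
    have "(\<ominus> \<one>) \<odot>\<^bsub>C\<^esub> f \<oplus>\<^bsub>C\<^esub> f = \<zero>\<^bsub>C\<^esub>"
      by (rule conv_ext[OF add[OF smult[OF _ f] f] zero])
        (use conv_value[OF f] in \<open>simp_all add: A.smult_l_minus A.l_neg\<close>)
    then show "\<exists>g\<in>carrier C. g \<oplus>\<^bsub>C\<^esub> f = \<zero>\<^bsub>C\<^esub>" using smult[OF _ f, of "\<ominus> \<one>"] by blast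
  next
    fix f g h assume fgh: "f \<in> carrier C" "g \<in> carrier C" "h \<in> carrier C"
    note val = conv_value[OF fgh(1)] conv_value[OF fgh(2)] conv_value[OF fgh(3)]
    show "f \<oplus>\<^bsub>C\<^esub> g \<in> carrier C" using fgh by (intro add)
    show "f \<oplus>\<^bsub>C\<^esub> g \<oplus>\<^bsub>C\<^esub> h = f \<oplus>\<^bsub>C\<^esub> (g \<oplus>\<^bsub>C\<^esub> h)"
      by (rule conv_ext[OF add[OF add[OF fgh(1,2)] fgh(3)] add[OF fgh(1) add[OF fgh(2,3)]]])
        (simp add: val A.a_assoc)
    show "f \<oplus>\<^bsub>C\<^esub> g = g \<oplus>\<^bsub>C\<^esub> f"
      by (rule conv_ext[OF add[OF fgh(1,2)] add[OF fgh(2,1)]]) (simp add: val A.a_comm)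
    show "\<zero>\<^bsub>C\<^esub> \<oplus>\<^bsub>C\<^esub> f = f"
      by (rule conv_ext[OF add[OF zero fgh(1)] fgh(1)]) (simp add: val)
  qed (rule zero)
  fix c d f g assume c: "c \<in> carrier k" "d \<in> carrier k" and f: "f \<in> carrier C" and g: "g \<in> carrier C"
  note val = conv_value[OF f] conv_value[OF g]
  show "c \<odot>\<^bsub>C\<^esub> f \<in> carrier C" using c f by (intro smult)
  show "(c \<oplus> d) \<odot>\<^bsub>C\<^esub> f = c \<odot>\<^bsub>C\<^esub> f \<oplus>\<^bsub>C\<^esub> d \<odot>\<^bsub>C\<^esub> f"
    by (rule conv_ext[OF smult[OF _ f] add[OF smult[OF _ f] smult[OF _ f]]])
      (simp_all add: c val A.smult_l_distr)
  show "c \<odot>\<^bsub>C\<^esub> (f \<oplus>\<^bsub>C\<^esub> g) = c \<odot>\<^bsub>C\<^esub> f \<oplus>\<^bsub>C\<^esub> c \<odot>\<^bsub>C\<^esub> g"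
    by (rule conv_ext[OF smult[OF _ add[OF f g]] add[OF smult[OF _ f] smult[OF _ g]]])
      (simp_all add: c val A.smult_r_distr)
  show "(c \<otimes> d) \<odot>\<^bsub>C\<^esub> f = c \<odot>\<^bsub>C\<^esub> (d \<odot>\<^bsub>C\<^esub> f)"
    by (rule conv_ext[OF smult[OF _ f] smult[OF _ smult[OF _ f]]])
      (simp_all add: c val A.smult_assoc1)
next
  fix f assume f: "f \<in> carrier C"
  have "\<one> \<odot>\<^bsub>C\<^esub> f \<in> carrier C"
    using f lin_smult_right[OF _ A, of f H \<one>] by (simp add: lin_restrict[OF H])
  then show "\<one> \<odot>\<^bsub>C\<^esub> f = f"
    by (rule conv_ext[OF _ f]) (use conv_value[OF f] in simp_all)
qed

lemma conv_eval_lin: "h \<in> carrier H \<Longrightarrow> lin C A (\<lambda>f. f h)"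
  by (intro linI) (auto intro: lin_closed)

end

declare conv_vs [multilin]

context
  fixes H :: "('k, 'h, 'n) hopf_scheme"
  assumes H: "hopf_algebra k H"
begin

lemma comult_lin: "lin H (T H H) (comult H)"
  using hopf_algebra.comult_hom[OF H] by (simp add: algebra_hom_def)

lemma counit_lin: "lin H (scalars k) (counit H)"
  using hopf_algebra.counit_hom[OF H] by (simp add: algebra_hom_def)

lemma antipode_lin: "lin H H (antipode H)"
  by (rule hopf_algebra.antipode_linear[OF H])

lemma comult_lin' [multilin]: "lin X H f \<Longrightarrow> lin X (T H H) (\<lambda>x. comult H (f x))"
  by (rule lin_compose[OF comult_lin])
lemma counit_lin' [multilin]: "lin X H f \<Longrightarrow> lin X (scalars k) (\<lambda>x. counit H (f x))"
  by (rule lin_compose[OF counit_lin])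
lemma antipode_lin' [multilin]: "lin X H f \<Longrightarrow> lin X H (\<lambda>x. antipode H (f x))"
  by (rule lin_compose[OF antipode_lin])
lemma comult_closed [multilin]: "h \<in> carrier H \<Longrightarrow> comult H h \<in> carrier (T H H)"
  by (rule lin_closed[OF comult_lin])
lemma counit_closed [multilin]: "h \<in> carrier H \<Longrightarrow> counit H h \<in> carrier k"
  using lin_closed[OF counit_lin] by simp
lemma antipode_closed [multilin]: "h \<in> carrier H \<Longrightarrow> antipode H h \<in> carrier H"
  by (rule lin_closed[OF antipode_lin])

lemma hopf_hom_simps:
  "comult H \<one>\<^bsub>H\<^esub> = pt H H \<one>\<^bsub>H\<^esub> \<one>\<^bsub>H\<^esub>" "counit H \<one>\<^bsub>H\<^esub> = \<one>"
  "\<lbrakk>a \<in> carrier H; b \<in> carrier H\<rbrakk> \<Longrightarrow> comult H (a \<otimes>\<^bsub>H\<^esub> b) = comult H a \<otimes>\<^bsub>T H H\<^esub> comult H b"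
  "\<lbrakk>a \<in> carrier H; b \<in> carrier H\<rbrakk> \<Longrightarrow> counit H (a \<otimes>\<^bsub>H\<^esub> b) = counit H a \<otimes> counit H b"
  using hopf_algebra.comult_hom[OF H] hopf_algebra.counit_hom[OF H]
    tensor_simps(5)[OF hopf_vs[OF H] hopf_vs[OF H]]
  by (simp_all add: algebra_hom_def ring_hom_def)

text \<open>Coassociativity as it is used in Sweedler calculations.\<close>

lemma coassoc_lift:
  assumes h: "h \<in> carrier H" and W: "vs W" and \<psi>: "trilinear H H H W \<psi>"
  shows "lift W (\<lambda>g c. lift W (\<lambda>a b. \<psi> a b c) (comult H g)) (comult H h)
       = lift W (\<lambda>a g. lift W (\<lambda>b c. \<psi> a b c) (comult H g)) (comult H h)"
proof -
  note vs = hopf_vs[OF H]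
  note bil = trilinear_lift_bilinear[OF \<psi> vs vs vs W]
  let ?\<Phi> = "lift W (\<lambda>s c. lift W (\<lambda>a b. \<psi> a b c) s)"
  have "lift W (\<lambda>g c. lift W (\<lambda>a b. \<psi> a b c) (comult H g)) (comult H h)
      = ?\<Phi> (tensor_map k (T H H) H (comult H) (\<lambda>x. x) (comult H h))"
    by (rule lift_map[symmetric]) (rule multilin h W bil vs | assumption)+
  also have "\<dots> = ?\<Phi> (tensor_assoc k H H H (tensor_map k H (T H H) (\<lambda>x. x) (comult H) (comult H h)))"
    by (simp only: hopf_algebra.coassoc[OF H h])
  also have "\<dots> = lift W (\<lambda>a u. lift W (\<lambda>b c. \<psi> a b c) u)
      (tensor_map k H (T H H) (\<lambda>x. x) (comult H) (comult H h))"
    by (rule lift_assoc) (rule multilin h W \<psi> vs | assumption)+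
  also have "\<dots> = lift W (\<lambda>a g. lift W (\<lambda>b c. \<psi> a b c) (comult H g)) (comult H h)"
    by (rule lift_map) (rule multilin h W bil vs | assumption)+
  finally show ?thesis .
qed

lemma counit_left_lift:
  assumes h: "h \<in> carrier H" and W: "vs W" and f: "lin H W f"
  shows "lift W (\<lambda>a b. counit H a \<odot>\<^bsub>W\<^esub> f b) (comult H h) = f h"
proof -
  note vs = hopf_vs[OF H]
  have "f (lift H (\<lambda>a b. counit H a \<odot>\<^bsub>H\<^esub> b) (comult H h))
      = lift W (\<lambda>a b. f (counit H a \<odot>\<^bsub>H\<^esub> b)) (comult H h)"
    by (rule lift_hom[OF f]) (rule multilin h W vs | assumption)+
  also have "\<dots> = lift W (\<lambda>a b. counit H a \<odot>\<^bsub>W\<^esub> f b) (comult H h)"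
    by (rule lift_cong[OF vs vs comult_closed[OF h]]) (simp add: lin_smult[OF f] counit_closed)
  finally show ?thesis by (simp add: hopf_algebra.counit_left[OF H h])
qed

lemma counit_right_lift:
  assumes h: "h \<in> carrier H" and W: "vs W" and f: "lin H W f"
  shows "lift W (\<lambda>a b. counit H b \<odot>\<^bsub>W\<^esub> f a) (comult H h) = f h"
proof -
  note vs = hopf_vs[OF H]
  have "f (lift H (\<lambda>a b. counit H b \<odot>\<^bsub>H\<^esub> a) (comult H h))
      = lift W (\<lambda>a b. f (counit H b \<odot>\<^bsub>H\<^esub> a)) (comult H h)"
    by (rule lift_hom[OF f]) (rule multilin h W vs | assumption)+
  also have "\<dots> = lift W (\<lambda>a b. counit H b \<odot>\<^bsub>W\<^esub> f a) (comult H h)"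
    by (rule lift_cong[OF vs vs comult_closed[OF h]]) (simp add: lin_smult[OF f] counit_closed)
  finally show ?thesis by (simp add: hopf_algebra.counit_right[OF H h])
qed

context
  fixes A :: "('k, 'a, 'p) module_scheme"
  assumes A: "unital_algebra k A"
begin

private abbreviation "D \<equiv> conv_algebra k H A"

interpretation A: unital_algebra k A by (rule A)

lemma conv_mult_bilinear:
  assumes "f \<in> carrier D" "g \<in> carrier D"
  shows "bil H H A (\<lambda>a b. f a \<otimes>\<^bsub>A\<^esub> g b)"
proof -
  have f: "lin H A f" and g: "lin H A g" using assms by simp_all
  show ?thesis
    by (intro bilinearI lin_mult_left lin_mult_right unital_algebra_product[OF A]
        lin_closed[OF f] lin_closed[OF g] f g)
qed

lemma conv_unital_algebra: "unital_algebra k D"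
proof (rule unital_algebraI)
  note vs = hopf_vs[OF H] A.vectorspace_axioms
  note bl = conv_mult_bilinear
  have val: "f h \<in> carrier A" if "f \<in> carrier D" "h \<in> carrier H" for f h
    using that by (auto intro: lin_closed)
  have mult: "f \<otimes>\<^bsub>D\<^esub> g \<in> carrier D" if "f \<in> carrier D" "g \<in> carrier D" for f g
    unfolding conv_simps Int_iff lin_restrict[OF vs(1)]
    by (intro conjI restrict_extensional lin_lift_arg[OF comult_lin] vs bl that)
  have fl: "lin D A (\<lambda>f. f h)" if "h \<in> carrier H" for h by (rule conv_eval_lin[OF vs that])
  show "bilinear_product D" unfolding bilinear_product_def
  proof (intro conjI bilinearI)
    have ext: "f = g" if "f \<in> carrier D" "g \<in> carrier D" "\<And>h. h \<in> carrier H \<Longrightarrow> f h = g h" for f g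
      using that by (auto intro: extensionalityI)
    have cl: "f \<oplus>\<^bsub>D\<^esub> g \<in> carrier D" "c \<in> carrier k \<Longrightarrow> c \<odot>\<^bsub>D\<^esub> f \<in> carrier D"
      if "f \<in> carrier D" "g \<in> carrier D" for f g c
      using that abelian_group.axioms(1)[OF vs_group[OF conv_vs[OF vs]], THEN abelian_monoid.a_closed]
        smult_closed[OF conv_vs[OF vs]] by blast+
    show "vs D" by (rule conv_vs[OF vs])
    fix f assume f: "f \<in> carrier D"
    have L: "lin D A (\<lambda>g. lift A (\<lambda>a b. f a \<otimes>\<^bsub>A\<^esub> g b) (comult H h))" if "h \<in> carrier H" for h
      by (rule lin_lift_param[OF comult_closed[OF that] vs(1,1,2) conv_vs[OF vs]])
        (rule bl[OF f] lin_mult_right fl unital_algebra_product[OF A] val[OF f] | assumption)+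
    show "lin D D (\<lambda>g. f \<otimes>\<^bsub>D\<^esub> g)"
    proof (rule linI)
      fix g g' assume g: "g \<in> carrier D" and g': "g' \<in> carrier D"
      show "f \<otimes>\<^bsub>D\<^esub> g \<in> carrier D" by (rule mult[OF f g])
      show "f \<otimes>\<^bsub>D\<^esub> (g \<oplus>\<^bsub>D\<^esub> g') = f \<otimes>\<^bsub>D\<^esub> g \<oplus>\<^bsub>D\<^esub> f \<otimes>\<^bsub>D\<^esub> g'"
        by (rule ext[OF mult[OF f cl(1)[OF g g']] cl(1)[OF mult[OF f g] mult[OF f g']]])
          (use lin_add[OF L g g'] in simp)
    next
      fix c g assume c: "c \<in> carrier k" and g: "g \<in> carrier D"
      show "f \<otimes>\<^bsub>D\<^esub> (c \<odot>\<^bsub>D\<^esub> g) = c \<odot>\<^bsub>D\<^esub> (f \<otimes>\<^bsub>D\<^esub> g)"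
        by (rule ext[OF mult[OF f cl(2)[OF g g c]] cl(2)[OF mult[OF f g] mult[OF f g] c]])
          (use lin_smult[OF L c g] in simp)
    qed
    have R: "lin D A (\<lambda>g. lift A (\<lambda>a b. g a \<otimes>\<^bsub>A\<^esub> f b) (comult H h))" if "h \<in> carrier H" for h
      by (rule lin_lift_param[OF comult_closed[OF that] vs(1,1,2) conv_vs[OF vs]])
        (rule bl[OF _ f] lin_mult_left fl unital_algebra_product[OF A] val[OF f] | assumption)+
    show "lin D D (\<lambda>g. g \<otimes>\<^bsub>D\<^esub> f)"
    proof (rule linI)
      fix g g' assume g: "g \<in> carrier D" and g': "g' \<in> carrier D"
      show "g \<otimes>\<^bsub>D\<^esub> f \<in> carrier D" by (rule mult[OF g f])
      show "(g \<oplus>\<^bsub>D\<^esub> g') \<otimes>\<^bsub>D\<^esub> f = g \<otimes>\<^bsub>D\<^esub> f \<oplus>\<^bsub>D\<^esub> g' \<otimes>\<^bsub>D\<^esub> f"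
        by (rule ext[OF mult[OF cl(1)[OF g g'] f] cl(1)[OF mult[OF g f] mult[OF g' f]]])
          (use lin_add[OF R g g'] in simp)
    next
      fix c g assume c: "c \<in> carrier k" and g: "g \<in> carrier D"
      show "(c \<odot>\<^bsub>D\<^esub> g) \<otimes>\<^bsub>D\<^esub> f = c \<odot>\<^bsub>D\<^esub> (g \<otimes>\<^bsub>D\<^esub> f)"
        by (rule ext[OF mult[OF cl(2)[OF g g c] f] cl(2)[OF mult[OF g f] mult[OF g f] c]])
          (use lin_smult[OF R c g] in simp)
    qed
  qed
  show one: "\<one>\<^bsub>D\<^esub> \<in> carrier D"
    unfolding conv_simps Int_iff lin_restrict[OF vs(1)]
    by (intro conjI restrict_extensional lin_smult_left counit_lin vs A.one_closed)
  show "\<one>\<^bsub>D\<^esub> \<otimes>\<^bsub>D\<^esub> f = f" if f: "f \<in> carrier D" for f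
  proof (rule extensionalityI[of _ "carrier H"])
    fix h assume h: "h \<in> carrier H"
    have "(\<one>\<^bsub>D\<^esub> \<otimes>\<^bsub>D\<^esub> f) h = lift A (\<lambda>a b. \<one>\<^bsub>D\<^esub> a \<otimes>\<^bsub>A\<^esub> f b) (comult H h)"
      using h by (simp del: conv_simps add: conv_simps(6))
    also have "\<dots> = lift A (\<lambda>a b. counit H a \<odot>\<^bsub>A\<^esub> f b) (comult H h)"
      by (rule lift_cong[OF vs(1,1) comult_closed[OF h]])
        (simp add: A.smult_mult_left val[OF f] counit_closed)
    finally show "(\<one>\<^bsub>D\<^esub> \<otimes>\<^bsub>D\<^esub> f) h = f h"
      using f by (simp add: counit_left_lift[OF h vs(2)])
  qed (use f in simp_all)
  show "f \<otimes>\<^bsub>D\<^esub> \<one>\<^bsub>D\<^esub> = f" if f: "f \<in> carrier D" for f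
  proof (rule extensionalityI[of _ "carrier H"])
    fix h assume h: "h \<in> carrier H"
    have "(f \<otimes>\<^bsub>D\<^esub> \<one>\<^bsub>D\<^esub>) h = lift A (\<lambda>a b. f a \<otimes>\<^bsub>A\<^esub> \<one>\<^bsub>D\<^esub> b) (comult H h)"
      using h by (simp del: conv_simps add: conv_simps(6))
    also have "\<dots> = lift A (\<lambda>a b. counit H b \<odot>\<^bsub>A\<^esub> f a) (comult H h)"
      by (rule lift_cong[OF vs(1,1) comult_closed[OF h]])
        (simp add: A.smult_mult_right val[OF f] counit_closed)
    finally show "(f \<otimes>\<^bsub>D\<^esub> \<one>\<^bsub>D\<^esub>) h = f h"
      using f by (simp add: counit_right_lift[OF h vs(2)])
  qed (use f in simp_all)
  fix f f' f'' assume f: "f \<in> carrier D" and f': "f' \<in> carrier D" and f'': "f'' \<in> carrier D"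
  show "f \<otimes>\<^bsub>D\<^esub> f' \<otimes>\<^bsub>D\<^esub> f'' = f \<otimes>\<^bsub>D\<^esub> (f' \<otimes>\<^bsub>D\<^esub> f'')"
  proof (rule extensionalityI[of _ "carrier H"])
    fix h assume h: "h \<in> carrier H"
    note val = val[OF f] val[OF f'] val[OF f'']
    have mr: "lin A A (\<lambda>x. c \<otimes>\<^bsub>A\<^esub> x)" and ml: "lin A A (\<lambda>x. x \<otimes>\<^bsub>A\<^esub> c)" if "c \<in> carrier A" for c
      by (rule multilin A that)+
    have tri: "trilinear H H H A (\<lambda>a b c. f a \<otimes>\<^bsub>A\<^esub> f' b \<otimes>\<^bsub>A\<^esub> f'' c)"
      using f f' f''
      by (intro trilinearI bilinearI lin_mult_left lin_mult_right unital_algebra_product[OF A]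
          A.m_closed val) auto
    have "(f \<otimes>\<^bsub>D\<^esub> f' \<otimes>\<^bsub>D\<^esub> f'') h
        = lift A (\<lambda>g c. (f \<otimes>\<^bsub>D\<^esub> f') g \<otimes>\<^bsub>A\<^esub> f'' c) (comult H h)"
      using h by (simp del: conv_simps add: conv_simps(6))
    also have "\<dots> = lift A (\<lambda>g c. lift A (\<lambda>a b. f a \<otimes>\<^bsub>A\<^esub> f' b \<otimes>\<^bsub>A\<^esub> f'' c) (comult H g)) (comult H h)"
      by (rule lift_cong[OF vs(1,1) comult_closed[OF h]])
        (simp add: lift_hom[OF ml[OF val(3)] comult_closed vs(1,1,2,2) bl[OF f f']]
          del: conv_simps add: conv_simps(6))
    also have "\<dots> = lift A (\<lambda>a g. lift A (\<lambda>b c. f a \<otimes>\<^bsub>A\<^esub> f' b \<otimes>\<^bsub>A\<^esub> f'' c) (comult H g)) (comult H h)"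
      by (rule coassoc_lift[OF h vs(2) tri])
    also have "\<dots> = lift A (\<lambda>a g. lift A (\<lambda>b c. f a \<otimes>\<^bsub>A\<^esub> (f' b \<otimes>\<^bsub>A\<^esub> f'' c)) (comult H g)) (comult H h)"
      by (intro lift_cong[OF vs(1,1)] comult_closed h A.m_assoc val)
    also have "\<dots> = lift A (\<lambda>a g. f a \<otimes>\<^bsub>A\<^esub> (f' \<otimes>\<^bsub>D\<^esub> f'') g) (comult H h)"
      by (rule lift_cong[OF vs(1,1) comult_closed[OF h]])
        (simp add: lift_hom[OF mr[OF val(1)] comult_closed vs(1,1,2,2) bl[OF f' f'']]
          del: conv_simps add: conv_simps(6))
    also have "\<dots> = (f \<otimes>\<^bsub>D\<^esub> (f' \<otimes>\<^bsub>D\<^esub> f'')) h"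
      using h by (simp del: conv_simps add: conv_simps(6))
    finally show "(f \<otimes>\<^bsub>D\<^esub> f' \<otimes>\<^bsub>D\<^esub> f'') h = (f \<otimes>\<^bsub>D\<^esub> (f' \<otimes>\<^bsub>D\<^esub> f'')) h" .
  qed (simp_all del: conv_simps add: conv_simps(6))
qed

end

end

end

section \<open>Antipodes reverse products and coproducts\<close>

text \<open>Both facts follow from the uniqueness of inverses in
  a convolution algebra: the two sides of the identity are a left and a right inverse of the same
  element.\<close>

context ground
begin

context
  fixes H :: "('k, 'h, 'n) hopf_scheme"
  assumes H: "hopf_algebra k H"
begin

interpretation HA: hopf_algebra k H by (rule H)

private abbreviation "S \<equiv> antipode H"
private abbreviation "\<Delta> \<equiv> comult H"
private abbreviation "\<epsilon> \<equiv> counit H"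

lemma antipode_one: "S \<one>\<^bsub>H\<^esub> = \<one>\<^bsub>H\<^esub>"
proof -
  have b: "bil H H H (\<lambda>a b. S a \<otimes>\<^bsub>H\<^esub> b)" by (rule multilin H | assumption)+
  have "lift H (\<lambda>a b. S a \<otimes>\<^bsub>H\<^esub> b) (\<Delta> \<one>\<^bsub>H\<^esub>) = S \<one>\<^bsub>H\<^esub> \<otimes>\<^bsub>H\<^esub> \<one>\<^bsub>H\<^esub>"
    unfolding hopf_hom_simps(1)[OF H] by (rule lift_pt[OF _ _ _ b]) (rule multilin H)+
  then show ?thesis
    using HA.antipode_left[of "\<one>\<^bsub>H\<^esub>"] by (simp add: hopf_hom_simps(2)[OF H] antipode_closed[OF H])
qed

lemma counit_antipode:
  assumes h: "h \<in> carrier H" shows "\<epsilon> (S h) = \<epsilon> h"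
proof -
  note vs = hopf_vs[OF H] scalars_vs
  have b: "bil H H H (\<lambda>a b. S a \<otimes>\<^bsub>H\<^esub> b)" by (rule multilin H | assumption)+
  have "\<epsilon> (S h) = lift (scalars k) (\<lambda>a b. \<epsilon> b \<otimes> \<epsilon> (S a)) (\<Delta> h)"
    using counit_right_lift[OF H h vs(2), of "\<lambda>a. \<epsilon> (S a)"] multilin(1)
    by (simp add: counit_lin'[OF H antipode_lin[OF H]])
  also have "\<dots> = lift (scalars k) (\<lambda>a b. \<epsilon> (S a \<otimes>\<^bsub>H\<^esub> b)) (\<Delta> h)"
    by (rule lift_cong[OF vs(1,1) comult_closed[OF H h]])
      (simp add: hopf_hom_simps(4)[OF H] antipode_closed[OF H] counit_closed[OF H] m_comm)
  also have "\<dots> = \<epsilon> (lift H (\<lambda>a b. S a \<otimes>\<^bsub>H\<^esub> b) (\<Delta> h))"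
    by (rule lift_hom[OF counit_lin[OF H] comult_closed[OF H h] vs(1,1,1,2) b, symmetric])
  also have "\<dots> = \<epsilon> h"
    unfolding HA.antipode_left[OF h]
    using lin_smult[OF counit_lin[OF H], of "\<epsilon> h" "\<one>\<^bsub>H\<^esub>"]
    by (simp add: hopf_hom_simps(2)[OF H] counit_closed[OF H h])
  finally show ?thesis .
qed

text \<open>Convolution of bilinear maps on \<open>H\<close>. Currying turns them into elements of the iterated
  convolution algebra \<open>Hom(H, Hom(H, A))\<close>, so that no coalgebra structure on \<open>H \<otimes> H\<close> has to be
  set up.\<close>

context
  fixes A :: "('k, 'a, 'p) module_scheme"
  assumes A: "unital_algebra k A"
begin

private abbreviation "E \<equiv> conv_algebra k H A"
private abbreviation "EE \<equiv> conv_algebra k H E"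

definition curried :: "('h \<Rightarrow> 'h \<Rightarrow> 'a) \<Rightarrow> 'h \<Rightarrow> 'h \<Rightarrow> 'a" where
  "curried \<phi> = (\<lambda>a\<in>carrier H. \<lambda>b\<in>carrier H. \<phi> a b)"

lemma curried_closed:
  assumes "bil H H A \<phi>" shows "curried \<phi> \<in> carrier EE"
proof -
  note vs = hopf_vs[OF H] unital_algebra_vs[OF A]
  interpret Hm: module k H by (rule vs_module[OF vs(1)])
  have E: "(\<lambda>b\<in>carrier H. \<phi> a b) \<in> carrier E" if "a \<in> carrier H" for a
    using bilinear_right[OF assms that] by (simp add: lin_restrict[OF vs(1)])
  have "lin H E (\<lambda>a. \<lambda>b\<in>carrier H. \<phi> a b)"
  proof (rule linI)
    show "(\<lambda>b\<in>carrier H. \<phi> a b) \<in> carrier E" if "a \<in> carrier H" for a by (rule E[OF that])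
  qed (auto simp: lin_add[OF bilinear_left[OF assms]] lin_smult[OF bilinear_left[OF assms]]
      intro!: restrict_ext)
  then show ?thesis by (simp add: curried_def lin_restrict[OF vs(1)])
qed

lemma curried_mult:
  assumes \<phi>: "bil H H A \<phi>" and \<phi>': "bil H H A \<phi>'" and a: "a \<in> carrier H" and b: "b \<in> carrier H"
  shows "(curried \<phi> \<otimes>\<^bsub>EE\<^esub> curried \<phi>') a b
    = lift A (\<lambda>a1 a2. lift A (\<lambda>b1 b2. \<phi> a1 b1 \<otimes>\<^bsub>A\<^esub> \<phi>' a2 b2) (\<Delta> b)) (\<Delta> a)"
proof -
  note vs = hopf_vs[OF H] unital_algebra_vs[OF A]
  have E: "unital_algebra k E" by (rule conv_unital_algebra[OF H A])
  note vE = unital_algebra_vs[OF E]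
  have "(curried \<phi> \<otimes>\<^bsub>EE\<^esub> curried \<phi>') a b
      = (lift E (\<lambda>a1 a2. curried \<phi> a1 \<otimes>\<^bsub>E\<^esub> curried \<phi>' a2) (\<Delta> a)) b"
    using a by (simp del: conv_simps add: conv_simps(6))
  also have "\<dots> = lift A (\<lambda>a1 a2. (curried \<phi> a1 \<otimes>\<^bsub>E\<^esub> curried \<phi>' a2) b) (\<Delta> a)"
    by (rule lift_hom[OF conv_eval_lin[OF vs b] comult_closed[OF H a] vs(1,1) vE vs(2)])
      (rule conv_mult_bilinear[OF H E curried_closed[OF \<phi>] curried_closed[OF \<phi>']])
  also have "\<dots> = lift A (\<lambda>a1 a2. lift A (\<lambda>b1 b2. \<phi> a1 b1 \<otimes>\<^bsub>A\<^esub> \<phi>' a2 b2) (\<Delta> b)) (\<Delta> a)"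
  proof (rule lift_cong[OF vs(1,1) comult_closed[OF H a]])
    fix a1 a2 assume "a1 \<in> carrier H" "a2 \<in> carrier H"
    then show "(curried \<phi> a1 \<otimes>\<^bsub>E\<^esub> curried \<phi>' a2) b
        = lift A (\<lambda>b1 b2. \<phi> a1 b1 \<otimes>\<^bsub>A\<^esub> \<phi>' a2 b2) (\<Delta> b)"
      using b by (simp add: curried_def) (rule lift_cong[OF vs(1,1) comult_closed[OF H b]], simp)
  qed
  finally show ?thesis .
qed

lemma curried_one: "\<lbrakk>a \<in> carrier H; b \<in> carrier H\<rbrakk> \<Longrightarrow> \<one>\<^bsub>EE\<^esub> a b = \<epsilon> a \<odot>\<^bsub>A\<^esub> (\<epsilon> b \<odot>\<^bsub>A\<^esub> \<one>\<^bsub>A\<^esub>)"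
  by simp

lemma bilinear_conv_inverse_unique:
  assumes F: "bil H H A F" and M: "bil H H A M" and G: "bil H H A G"
    and FM: "\<And>a b. \<lbrakk>a \<in> carrier H; b \<in> carrier H\<rbrakk> \<Longrightarrow>
      lift A (\<lambda>a1 a2. lift A (\<lambda>b1 b2. F a1 b1 \<otimes>\<^bsub>A\<^esub> M a2 b2) (\<Delta> b)) (\<Delta> a)
        = \<epsilon> a \<odot>\<^bsub>A\<^esub> (\<epsilon> b \<odot>\<^bsub>A\<^esub> \<one>\<^bsub>A\<^esub>)"
    and MG: "\<And>a b. \<lbrakk>a \<in> carrier H; b \<in> carrier H\<rbrakk> \<Longrightarrow>
      lift A (\<lambda>a1 a2. lift A (\<lambda>b1 b2. M a1 b1 \<otimes>\<^bsub>A\<^esub> G a2 b2) (\<Delta> b)) (\<Delta> a)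
        = \<epsilon> a \<odot>\<^bsub>A\<^esub> (\<epsilon> b \<odot>\<^bsub>A\<^esub> \<one>\<^bsub>A\<^esub>)"
    and ab: "a \<in> carrier H" "b \<in> carrier H"
  shows "F a b = G a b"
proof -
  have EE: "unital_algebra k EE"
    by (rule conv_unital_algebra[OF H conv_unital_algebra[OF H A]])
  interpret EE: monoid EE by (rule unital_algebra_monoid[OF EE])
  have E: "unital_algebra k E" by (rule conv_unital_algebra[OF H A])
  have EE_ext: "f = g" if f: "f \<in> carrier EE" and g: "g \<in> carrier EE"
    and eq: "\<And>a b. \<lbrakk>a \<in> carrier H; b \<in> carrier H\<rbrakk> \<Longrightarrow> f a b = g a b" for f g
  proof (rule extensionalityI[of _ "carrier H"])
    fix a assume a: "a \<in> carrier H"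
    have "f a \<in> carrier E" "g a \<in> carrier E"
      using f g a lin_closed[of _ k H E a] by auto
    then show "f a = g a"
      using eq[OF a] by (intro extensionalityI[of _ "carrier H"]) auto
  qed (use f g in auto)
  have 1: "curried F \<otimes>\<^bsub>EE\<^esub> curried M = \<one>\<^bsub>EE\<^esub>"
    by (rule EE_ext) (simp_all only: EE.m_closed EE.one_closed curried_closed F M curried_mult curried_one FM)
  have 2: "curried M \<otimes>\<^bsub>EE\<^esub> curried G = \<one>\<^bsub>EE\<^esub>"
    by (rule EE_ext) (simp_all only: EE.m_closed EE.one_closed curried_closed G M curried_mult curried_one MG)
  have "curried F = curried G"
    by (rule EE.inv_unique[OF 1 2 curried_closed[OF M] curried_closed[OF F] curried_closed[OF G]])
  then have "curried F a b = curried G a b" by simp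
  then show ?thesis using ab by (simp add: curried_def)
qed

end

text \<open>Both \<open>S(ab)\<close> and \<open>S(b)S(a)\<close> are convolution inverse to the product \<open>ab\<close>, the first from
  the left and the second from the right.\<close>

lemma antipode_mult:
  assumes ab: "a \<in> carrier H" "b \<in> carrier H"
  shows "S (a \<otimes>\<^bsub>H\<^esub> b) = S b \<otimes>\<^bsub>H\<^esub> S a"
proof (rule bilinear_conv_inverse_unique[OF HA.unital_algebra_axioms _ _ _ _ _ ab])
  note vs = hopf_vs[OF H]
  note prod = unital_algebra_product[OF HA.unital_algebra_axioms]
  note cl = comult_closed[OF H] counit_closed[OF H] antipode_closed[OF H]
  show "bil H H H (\<lambda>a b. S (a \<otimes>\<^bsub>H\<^esub> b))" "bil H H H (\<lambda>a b. a \<otimes>\<^bsub>H\<^esub> b)"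
      "bil H H H (\<lambda>a b. S b \<otimes>\<^bsub>H\<^esub> S a)"
    by (rule multilin H | assumption)+
  fix a b assume a: "a \<in> carrier H" and b: "b \<in> carrier H"
  have bS: "bil H H H (\<lambda>x y. S x \<otimes>\<^bsub>H\<^esub> y)" by (rule multilin H | assumption)+
  have "lift H (\<lambda>a1 a2. lift H (\<lambda>b1 b2. S (a1 \<otimes>\<^bsub>H\<^esub> b1) \<otimes>\<^bsub>H\<^esub> (a2 \<otimes>\<^bsub>H\<^esub> b2)) (\<Delta> b)) (\<Delta> a)
      = lift H (\<lambda>x y. S x \<otimes>\<^bsub>H\<^esub> y) (\<Delta> a \<otimes>\<^bsub>T H H\<^esub> \<Delta> b)"
    by (rule lift_mult[OF prod prod cl(1)[OF a] cl(1)[OF b] vs bS, symmetric])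
  also have "\<dots> = \<epsilon> (a \<otimes>\<^bsub>H\<^esub> b) \<odot>\<^bsub>H\<^esub> \<one>\<^bsub>H\<^esub>"
    unfolding hopf_hom_simps(3)[OF H a b, symmetric] using a b by (intro HA.antipode_left) simp
  also have "\<dots> = \<epsilon> a \<odot>\<^bsub>H\<^esub> (\<epsilon> b \<odot>\<^bsub>H\<^esub> \<one>\<^bsub>H\<^esub>)"
    using a b by (simp add: hopf_hom_simps(4)[OF H] HA.smult_assoc1 cl)
  finally show "lift H (\<lambda>a1 a2. lift H (\<lambda>b1 b2. S (a1 \<otimes>\<^bsub>H\<^esub> b1) \<otimes>\<^bsub>H\<^esub> (a2 \<otimes>\<^bsub>H\<^esub> b2)) (\<Delta> b)) (\<Delta> a)
      = \<epsilon> a \<odot>\<^bsub>H\<^esub> (\<epsilon> b \<odot>\<^bsub>H\<^esub> \<one>\<^bsub>H\<^esub>)" .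
  have inner: "lift H (\<lambda>b1 b2. (a1 \<otimes>\<^bsub>H\<^esub> b1) \<otimes>\<^bsub>H\<^esub> (S b2 \<otimes>\<^bsub>H\<^esub> S a2)) (\<Delta> b)
      = \<epsilon> b \<odot>\<^bsub>H\<^esub> (a1 \<otimes>\<^bsub>H\<^esub> S a2)" if "a1 \<in> carrier H" "a2 \<in> carrier H" for a1 a2
  proof -
    have f: "lin H H (\<lambda>x. a1 \<otimes>\<^bsub>H\<^esub> x \<otimes>\<^bsub>H\<^esub> S a2)"
      by (rule multilin H that | assumption)+
    have bS': "bil H H H (\<lambda>x y. x \<otimes>\<^bsub>H\<^esub> S y)" by (rule multilin H | assumption)+
    have "lift H (\<lambda>b1 b2. (a1 \<otimes>\<^bsub>H\<^esub> b1) \<otimes>\<^bsub>H\<^esub> (S b2 \<otimes>\<^bsub>H\<^esub> S a2)) (\<Delta> b)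
        = lift H (\<lambda>b1 b2. a1 \<otimes>\<^bsub>H\<^esub> (b1 \<otimes>\<^bsub>H\<^esub> S b2) \<otimes>\<^bsub>H\<^esub> S a2) (\<Delta> b)"
      by (rule lift_cong[OF vs vs cl(1)[OF b]]) (simp add: HA.m_assoc that cl)
    also have "\<dots> = a1 \<otimes>\<^bsub>H\<^esub> lift H (\<lambda>b1 b2. b1 \<otimes>\<^bsub>H\<^esub> S b2) (\<Delta> b) \<otimes>\<^bsub>H\<^esub> S a2"
      by (rule lift_hom[OF f cl(1)[OF b] vs vs vs vs bS', symmetric])
    finally show ?thesis
      by (simp add: HA.antipode_right b that cl HA.smult_mult_left HA.smult_mult_right)
  qed
  have sm: "lin H H (\<lambda>x. \<epsilon> b \<odot>\<^bsub>H\<^esub> x)" by (rule multilin H b)+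
  have bS'': "bil H H H (\<lambda>a1 a2. a1 \<otimes>\<^bsub>H\<^esub> S a2)" by (rule multilin H | assumption)+
  have "lift H (\<lambda>a1 a2. lift H (\<lambda>b1 b2. (a1 \<otimes>\<^bsub>H\<^esub> b1) \<otimes>\<^bsub>H\<^esub> (S b2 \<otimes>\<^bsub>H\<^esub> S a2)) (\<Delta> b)) (\<Delta> a)
      = lift H (\<lambda>a1 a2. \<epsilon> b \<odot>\<^bsub>H\<^esub> (a1 \<otimes>\<^bsub>H\<^esub> S a2)) (\<Delta> a)"
    by (rule lift_cong[OF vs vs cl(1)[OF a] inner])
  also have "\<dots> = \<epsilon> b \<odot>\<^bsub>H\<^esub> lift H (\<lambda>a1 a2. a1 \<otimes>\<^bsub>H\<^esub> S a2) (\<Delta> a)"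
    by (rule lift_hom[OF sm cl(1)[OF a] vs vs vs vs bS'', symmetric])
  finally show "lift H (\<lambda>a1 a2. lift H (\<lambda>b1 b2. (a1 \<otimes>\<^bsub>H\<^esub> b1) \<otimes>\<^bsub>H\<^esub> (S b2 \<otimes>\<^bsub>H\<^esub> S a2)) (\<Delta> b)) (\<Delta> a)
      = \<epsilon> a \<odot>\<^bsub>H\<^esub> (\<epsilon> b \<odot>\<^bsub>H\<^esub> \<one>\<^bsub>H\<^esub>)"
    by (simp add: HA.antipode_right a b cl HA.smult_assoc1[symmetric] m_comm)
qed

text \<open>In \<open>Hom(H, H \<otimes> H)\<close>, the map \<open>\<Delta>(S(h))\<close> is a left inverse of \<open>\<Delta>\<close> and
  \<open>S(h\<^sub>2) \<otimes> S(h\<^sub>1)\<close> is a right inverse.\<close>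

lemma comult_antipode:
  assumes h: "h \<in> carrier H"
  shows "\<Delta> (S h) = lift (T H H) (\<lambda>h1 h2. pt H H (S h2) (S h1)) (\<Delta> h)"
proof -
  let ?HH = "T H H" and ?G = "\<lambda>h. lift (T H H) (\<lambda>h1 h2. pt H H (S h2) (S h1)) (\<Delta> h)"
  let ?C = "conv_algebra k H ?HH"
  note alg = HA.unital_algebra_axioms tensor_unital_algebra[OF HA.unital_algebra_axioms HA.unital_algebra_axioms]
  note vs = hopf_vs[OF H] tensor_vs[OF hopf_vs[OF H] hopf_vs[OF H]]
  note prod = unital_algebra_product[OF alg(1)] unital_algebra_product[OF alg(2)]
  note cl = comult_closed[OF H] counit_closed[OF H] antipode_closed[OF H]
  interpret HH: unital_algebra k ?HH by (rule alg(2))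
  interpret C: monoid ?C by (rule unital_algebra_monoid[OF conv_unital_algebra[OF H alg(2)]])
  have res: "restrict f (carrier H) \<in> carrier ?C" if "lin H ?HH f" for f
    using that by (simp add: lin_restrict[OF vs(1)])
  have mult: "(restrict f (carrier H) \<otimes>\<^bsub>?C\<^esub> restrict g (carrier H)) x
      = lift ?HH (\<lambda>a b. f a \<otimes>\<^bsub>?HH\<^esub> g b) (\<Delta> x)" if "x \<in> carrier H" for f g x
    unfolding conv_simps(6) restrict_apply'[OF that]
    by (rule lift_cong[OF vs(1,1) cl(1)[OF that]]) simp
  have D: "lin H ?HH \<Delta>" by (rule comult_lin[OF H])
  have DS: "lin H ?HH (\<lambda>x. \<Delta> (S x))" by (rule multilin H)+
  have G: "lin H ?HH ?G" by (rule multilin H | assumption)+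
  have ext: "f \<otimes>\<^bsub>?C\<^esub> g = \<one>\<^bsub>?C\<^esub>" if "f \<in> carrier ?C" "g \<in> carrier ?C"
    "\<And>x. x \<in> carrier H \<Longrightarrow> (f \<otimes>\<^bsub>?C\<^esub> g) x = \<epsilon> x \<odot>\<^bsub>?HH\<^esub> \<one>\<^bsub>?HH\<^esub>" for f g
    by (rule extensionalityI[of _ "carrier H"]) (use C.m_closed[OF that(1,2)] that(3) in auto)
  have 1: "restrict (\<lambda>x. \<Delta> (S x)) (carrier H) \<otimes>\<^bsub>?C\<^esub> restrict \<Delta> (carrier H) = \<one>\<^bsub>?C\<^esub>"
  proof (rule ext[OF res[OF DS] res[OF D]])
    fix x assume x: "x \<in> carrier H"
    have b: "bil H H H (\<lambda>a b. S a \<otimes>\<^bsub>H\<^esub> b)" by (rule multilin H | assumption)+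
    have "lift ?HH (\<lambda>a b. \<Delta> (S a) \<otimes>\<^bsub>?HH\<^esub> \<Delta> b) (\<Delta> x) = lift ?HH (\<lambda>a b. \<Delta> (S a \<otimes>\<^bsub>H\<^esub> b)) (\<Delta> x)"
      by (rule lift_cong[OF vs(1,1) cl(1)[OF x]]) (simp add: hopf_hom_simps(3)[OF H] cl)
    also have "\<dots> = \<Delta> (lift H (\<lambda>a b. S a \<otimes>\<^bsub>H\<^esub> b) (\<Delta> x))"
      by (rule lift_hom[OF D cl(1)[OF x] vs(1,1,1,2) b, symmetric])
    also have "\<dots> = \<epsilon> x \<odot>\<^bsub>?HH\<^esub> \<one>\<^bsub>?HH\<^esub>"
      unfolding HA.antipode_left[OF x]
      by (simp add: lin_smult[OF D] cl x hopf_hom_simps(1)[OF H] tensor_simps(5)[OF vs(1,1)])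
    finally show "(restrict (\<lambda>x. \<Delta> (S x)) (carrier H) \<otimes>\<^bsub>?C\<^esub> restrict \<Delta> (carrier H)) x
        = \<epsilon> x \<odot>\<^bsub>?HH\<^esub> \<one>\<^bsub>?HH\<^esub>" unfolding mult[OF x] .
  qed
  have 2: "restrict \<Delta> (carrier H) \<otimes>\<^bsub>?C\<^esub> restrict ?G (carrier H) = \<one>\<^bsub>?C\<^esub>"
  proof (rule ext[OF res[OF D] res[OF G]])
    fix x assume x: "x \<in> carrier H"
    let ?g = "\<lambda>a b g. lift ?HH (\<lambda>c d. pt H H (a \<otimes>\<^bsub>H\<^esub> S d) (b \<otimes>\<^bsub>H\<^esub> S c)) (\<Delta> g)"
    have DG: "\<Delta> y \<otimes>\<^bsub>?HH\<^esub> ?G g = lift ?HH (\<lambda>a b. ?g a b g) (\<Delta> y)"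
      if y: "y \<in> carrier H" and g: "g \<in> carrier H" for y g
    proof -
      have G': "?G g \<in> carrier ?HH" by (rule lin_closed[OF G g])
      have b1: "bil H H ?HH (\<lambda>a b. pt H H a b)" by (rule pt_bilinear[OF vs(1,1)])
      have id: "t = lift ?HH (\<lambda>a b. pt H H a b) t" if "t \<in> carrier ?HH" for t
        by (rule tensor_ext[OF vs(1,1) lin_id lift_lin[OF vs(1,1,2) b1] _ that])
          (simp add: lift_pt[OF vs(1,1,2) b1])
      have "\<Delta> y \<otimes>\<^bsub>?HH\<^esub> ?G g
          = lift ?HH (\<lambda>a b. pt H H a b) (\<Delta> y \<otimes>\<^bsub>?HH\<^esub> ?G g)"
        by (rule id) (rule HH.m_closed[OF cl(1)[OF y] G'])
      also have "\<dots> = lift ?HH (\<lambda>a b. lift ?HH (\<lambda>a' b'. pt H H (a \<otimes>\<^bsub>H\<^esub> a') (b \<otimes>\<^bsub>H\<^esub> b')) (?G g)) (\<Delta> y)"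
        by (rule lift_mult[OF prod(1,1) cl(1)[OF y] G' vs(2) b1])
      also have "\<dots> = lift ?HH (\<lambda>a b. ?g a b g) (\<Delta> y)"
      proof (rule lift_cong[OF vs(1,1) cl(1)[OF y]])
        fix a b assume ab: "a \<in> carrier H" "b \<in> carrier H"
        have b2: "bil H H ?HH (\<lambda>a' b'. pt H H (a \<otimes>\<^bsub>H\<^esub> a') (b \<otimes>\<^bsub>H\<^esub> b'))"
          by (rule multilin H ab | assumption)+
        have b3: "bil H H ?HH (\<lambda>c d. pt H H (S d) (S c))"
          by (rule multilin H | assumption)+
        have "lift ?HH (\<lambda>a' b'. pt H H (a \<otimes>\<^bsub>H\<^esub> a') (b \<otimes>\<^bsub>H\<^esub> b')) (?G g)
            = lift ?HH (\<lambda>c d. lift ?HH (\<lambda>a' b'. pt H H (a \<otimes>\<^bsub>H\<^esub> a') (b \<otimes>\<^bsub>H\<^esub> b')) (pt H H (S d) (S c))) (\<Delta> g)"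
          by (rule lift_hom[OF lift_lin[OF vs(1,1,2) b2] cl(1)[OF g] vs(1,1,2,2) b3])
        also have "\<dots> = ?g a b g"
          by (rule lift_cong[OF vs(1,1) cl(1)[OF g]]) (simp add: lift_pt[OF vs(1,1,2) b2] cl)
        finally show "lift ?HH (\<lambda>a' b'. pt H H (a \<otimes>\<^bsub>H\<^esub> a') (b \<otimes>\<^bsub>H\<^esub> b')) (?G g) = ?g a b g" .
      qed
      finally show ?thesis .
    qed
    have tri: "trilinear H H H ?HH (\<lambda>a b g. ?g a b g)" by (rule multilin H | assumption)+
    have tri2: "trilinear H H H ?HH (\<lambda>b c d. pt H H (a \<otimes>\<^bsub>H\<^esub> S d) (b \<otimes>\<^bsub>H\<^esub> S c))"
      if "a \<in> carrier H" for a
      by (rule multilin H that | assumption)+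
    \<comment> \<open>The inner factors \<open>x\<^sub>2 S(x\<^sub>3)\<close> of \<open>x\<^sub>1 S(x\<^sub>4) \<otimes> x\<^sub>2 S(x\<^sub>3)\<close> cancel first, then the outer ones.\<close>
    have collapse: "lift ?HH (\<lambda>b g. ?g a b g) (\<Delta> y) = pt H H (a \<otimes>\<^bsub>H\<^esub> S y) \<one>\<^bsub>H\<^esub>"
      if a: "a \<in> carrier H" and y: "y \<in> carrier H" for a y
    proof -
      have "lift ?HH (\<lambda>b g. ?g a b g) (\<Delta> y)
          = lift ?HH (\<lambda>f d. lift ?HH (\<lambda>b c. pt H H (a \<otimes>\<^bsub>H\<^esub> S d) (b \<otimes>\<^bsub>H\<^esub> S c)) (\<Delta> f)) (\<Delta> y)"
        by (rule coassoc_lift[OF H y vs(2) tri2[OF a], symmetric])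
      also have "\<dots> = lift ?HH (\<lambda>f d. \<epsilon> f \<odot>\<^bsub>?HH\<^esub> pt H H (a \<otimes>\<^bsub>H\<^esub> S d) \<one>\<^bsub>H\<^esub>) (\<Delta> y)"
      proof (rule lift_cong[OF vs(1,1) cl(1)[OF y]])
        fix f d assume f: "f \<in> carrier H" and d: "d \<in> carrier H"
        have aSd: "a \<otimes>\<^bsub>H\<^esub> S d \<in> carrier H" using a d cl by simp
        have p: "lin H ?HH (\<lambda>x. pt H H (a \<otimes>\<^bsub>H\<^esub> S d) x)" by (rule multilin H a d | assumption)+
        have b: "bil H H H (\<lambda>b c. b \<otimes>\<^bsub>H\<^esub> S c)" by (rule multilin H | assumption)+
        have "lift ?HH (\<lambda>b c. pt H H (a \<otimes>\<^bsub>H\<^esub> S d) (b \<otimes>\<^bsub>H\<^esub> S c)) (\<Delta> f)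
            = pt H H (a \<otimes>\<^bsub>H\<^esub> S d) (lift H (\<lambda>b c. b \<otimes>\<^bsub>H\<^esub> S c) (\<Delta> f))"
          by (rule lift_hom[OF p cl(1)[OF f] vs(1,1,1,2) b, symmetric])
        then show "lift ?HH (\<lambda>b c. pt H H (a \<otimes>\<^bsub>H\<^esub> S d) (b \<otimes>\<^bsub>H\<^esub> S c)) (\<Delta> f)
            = \<epsilon> f \<odot>\<^bsub>?HH\<^esub> pt H H (a \<otimes>\<^bsub>H\<^esub> S d) \<one>\<^bsub>H\<^esub>"
          using lin_smult[OF p] by (simp add: HA.antipode_right f cl)
      qed
      also have "\<dots> = pt H H (a \<otimes>\<^bsub>H\<^esub> S y) \<one>\<^bsub>H\<^esub>"
        by (rule counit_left_lift[OF H y vs(2)]) (rule multilin H a)+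
      finally show ?thesis .
    qed
    have "lift ?HH (\<lambda>y g. \<Delta> y \<otimes>\<^bsub>?HH\<^esub> ?G g) (\<Delta> x) = lift ?HH (\<lambda>y g. lift ?HH (\<lambda>a b. ?g a b g) (\<Delta> y)) (\<Delta> x)"
      by (rule lift_cong[OF vs(1,1) cl(1)[OF x] DG])
    also have "\<dots> = lift ?HH (\<lambda>a y. lift ?HH (\<lambda>b g. ?g a b g) (\<Delta> y)) (\<Delta> x)"
      by (rule coassoc_lift[OF H x vs(2) tri])
    also have "\<dots> = lift ?HH (\<lambda>a y. pt H H (a \<otimes>\<^bsub>H\<^esub> S y) \<one>\<^bsub>H\<^esub>) (\<Delta> x)"
      by (rule lift_cong[OF vs(1,1) cl(1)[OF x] collapse])
    also have "\<dots> = pt H H (lift H (\<lambda>a y. a \<otimes>\<^bsub>H\<^esub> S y) (\<Delta> x)) \<one>\<^bsub>H\<^esub>"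
      by (rule lift_hom[OF bilinear_left[OF pt_bilinear[OF vs(1,1)] HA.one_closed] cl(1)[OF x] vs(1,1,1,2), symmetric])
        (rule multilin H | assumption)+
    also have "\<dots> = \<epsilon> x \<odot>\<^bsub>?HH\<^esub> \<one>\<^bsub>?HH\<^esub>"
      using lin_smult[OF bilinear_left[OF pt_bilinear[OF vs(1,1)] HA.one_closed], of "\<epsilon> x" "\<one>\<^bsub>H\<^esub>"]
      by (simp add: HA.antipode_right x cl tensor_simps(5)[OF vs(1,1)])
    finally show "(restrict \<Delta> (carrier H) \<otimes>\<^bsub>?C\<^esub> restrict ?G (carrier H)) x
        = \<epsilon> x \<odot>\<^bsub>?HH\<^esub> \<one>\<^bsub>?HH\<^esub>" unfolding mult[OF x] .
  qed
  have "restrict (\<lambda>x. \<Delta> (S x)) (carrier H) = restrict ?G (carrier H)"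
    by (rule C.inv_unique[OF 1 2 res[OF D] res[OF DS] res[OF G]])
  from fun_cong[OF this, of h] show ?thesis using h by simp
qed

lemma lift_comult_antipode:
  assumes h: "h \<in> carrier H" and W: "vs W" and \<phi>: "bil H H W \<phi>"
  shows "lift W \<phi> (\<Delta> (S h)) = lift W (\<lambda>h1 h2. \<phi> (S h2) (S h1)) (\<Delta> h)"
proof -
  note vs = hopf_vs[OF H] tensor_vs[OF hopf_vs[OF H] hopf_vs[OF H]]
  have "lift W \<phi> (\<Delta> (S h)) = lift W (\<lambda>h1 h2. lift W \<phi> (pt H H (S h2) (S h1))) (\<Delta> h)"
    unfolding comult_antipode[OF h]
    by (rule lift_hom[OF lift_lin[OF vs(1,1) W \<phi>] comult_closed[OF H h] vs(1,1,2) W])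
      (rule multilin H | assumption)+
  also have "\<dots> = lift W (\<lambda>h1 h2. \<phi> (S h2) (S h1)) (\<Delta> h)"
    by (rule lift_cong[OF vs(1,1) comult_closed[OF H h]])
      (simp add: lift_pt[OF vs(1,1) W \<phi>] antipode_closed[OF H])
  finally show ?thesis .
qed

end

end

context ground
begin

section \<open>Dual systems\<close>

lemma lin_finsum_fun:
  assumes W: "vs W" and I: "finite I" and f: "\<And>i. i \<in> I \<Longrightarrow> lin X W (f i)"
  shows "lin X W (\<lambda>x. \<Oplus>\<^bsub>W\<^esub>i\<in>I. f i x)"
proof -
  interpret W: module k W using W by (rule vs_module)
  have cl: "(\<lambda>i. f i x) \<in> I \<rightarrow> carrier W" if "x \<in> carrier X" for x
    using lin_closed[OF f that] by blast
  show ?thesis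
  proof (rule linI)
    fix x assume x: "x \<in> carrier X"
    show "(\<Oplus>\<^bsub>W\<^esub>i\<in>I. f i x) \<in> carrier W" by (rule W.finsum_closed[OF cl[OF x]])
    show "(\<Oplus>\<^bsub>W\<^esub>i\<in>I. f i (c \<odot>\<^bsub>X\<^esub> x)) = c \<odot>\<^bsub>W\<^esub> (\<Oplus>\<^bsub>W\<^esub>i\<in>I. f i x)" if c: "c \<in> carrier k" for c
      unfolding W.finsum_smult_ldistr[OF I c cl[OF x]]
      by (rule finsum_cong_weak) (rule lin_smult[OF f c x])
    fix y assume y: "y \<in> carrier X"
    show "(\<Oplus>\<^bsub>W\<^esub>i\<in>I. f i (x \<oplus>\<^bsub>X\<^esub> y)) = (\<Oplus>\<^bsub>W\<^esub>i\<in>I. f i x) \<oplus>\<^bsub>W\<^esub> (\<Oplus>\<^bsub>W\<^esub>i\<in>I. f i y)"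
      unfolding W.finsum_addf[OF cl[OF x] cl[OF y], symmetric]
      by (rule finsum_cong_weak) (rule lin_add[OF f x y])
  qed
qed

text \<open>A finite family \<open>e\<close> with linear forms \<open>f\<close> that reconstruct every vector. This much of a pair
  of dual bases suffices to expand tensors, and it passes to tensor products.\<close>

definition dual_system where
  "dual_system V I e f \<longleftrightarrow> finite I \<and> e \<in> I \<rightarrow> carrier V \<and> (\<forall>i\<in>I. lin V (scalars k) (f i)) \<and>
     (\<forall>v\<in>carrier V. (\<Oplus>\<^bsub>V\<^esub>i\<in>I. f i v \<odot>\<^bsub>V\<^esub> e i) = v)"

context
  fixes V :: "('k, 'v, 'n) module_scheme" and Y :: "('k, 'y, 'p) module_scheme" and I e f
  assumes V: "vs V" and Y: "vs Y" and sys: "dual_system V I e f"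
begin

private lemma sys':
  "finite I" "\<And>i. i \<in> I \<Longrightarrow> e i \<in> carrier V" "\<And>i. i \<in> I \<Longrightarrow> lin V (scalars k) (f i)"
  "\<And>v. v \<in> carrier V \<Longrightarrow> (\<Oplus>\<^bsub>V\<^esub>i\<in>I. f i v \<odot>\<^bsub>V\<^esub> e i) = v"
  "\<And>i v. \<lbrakk>i \<in> I; v \<in> carrier V\<rbrakk> \<Longrightarrow> f i v \<in> carrier k"
  using sys lin_closed[of _ k V "scalars k"] by (auto simp: dual_system_def)

private lemma summands: "v \<in> carrier V \<Longrightarrow> (\<lambda>i. f i v \<odot>\<^bsub>V\<^esub> e i) \<in> I \<rightarrow> carrier V"
  using sys' smult_closed[OF V] by blast

lemma slice_right_bilinear: "i \<in> I \<Longrightarrow> bil Y V Y (\<lambda>y v. f i v \<odot>\<^bsub>Y\<^esub> y)"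
  by (intro bilinearI lin_smult_left lin_smult_right lin_id Y sys')

lemma slice_left_bilinear: "i \<in> I \<Longrightarrow> bil V Y Y (\<lambda>v y. f i v \<odot>\<^bsub>Y\<^esub> y)"
  by (intro bilinearI lin_smult_left lin_smult_right lin_id Y sys')

text \<open>A tensor is determined by the evaluations of one leg on the forms of a dual system.\<close>

lemma expand_right:
  assumes t: "t \<in> carrier (T Y V)"
  shows "(\<Oplus>\<^bsub>T Y V\<^esub>i\<in>I. pt Y V (lift Y (\<lambda>y v. f i v \<odot>\<^bsub>Y\<^esub> y) t) (e i)) = t"
proof (rule tensor_ext[OF Y V _ lin_id _ t])
  show "lin (T Y V) (T Y V) (\<lambda>t. \<Oplus>\<^bsub>T Y V\<^esub>i\<in>I. pt Y V (lift Y (\<lambda>y v. f i v \<odot>\<^bsub>Y\<^esub> y) t) (e i))"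
    by (intro lin_finsum_fun tensor_vs Y V sys' lin_pt_left lift_lin slice_right_bilinear)
  fix y v assume y: "y \<in> carrier Y" and v: "v \<in> carrier V"
  have "(\<Oplus>\<^bsub>T Y V\<^esub>i\<in>I. pt Y V (lift Y (\<lambda>y v. f i v \<odot>\<^bsub>Y\<^esub> y) (pt Y V y v)) (e i))
      = (\<Oplus>\<^bsub>T Y V\<^esub>i\<in>I. pt Y V y (f i v \<odot>\<^bsub>V\<^esub> e i))"
  proof (rule finsum_cong_weak)
    fix i assume i: "i \<in> I"
    note c = sys'(5)[OF i v] and e = sys'(2)[OF i]
    show "pt Y V (lift Y (\<lambda>y v. f i v \<odot>\<^bsub>Y\<^esub> y) (pt Y V y v)) (e i) = pt Y V y (f i v \<odot>\<^bsub>V\<^esub> e i)"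
      unfolding lift_pt[OF Y V Y slice_right_bilinear[OF i] y v]
        lin_smult[OF bilinear_left[OF pt_bilinear[OF Y V] e] c y]
        lin_smult[OF bilinear_right[OF pt_bilinear[OF Y V] y] c e] ..
  qed
  also have "\<dots> = pt Y V y (\<Oplus>\<^bsub>V\<^esub>i\<in>I. f i v \<odot>\<^bsub>V\<^esub> e i)"
    by (rule lin_finsum[OF V tensor_vs[OF Y V] bilinear_right[OF pt_bilinear[OF Y V] y] sys'(1) summands[OF v], symmetric])
  finally show "(\<Oplus>\<^bsub>T Y V\<^esub>i\<in>I. pt Y V (lift Y (\<lambda>y v. f i v \<odot>\<^bsub>Y\<^esub> y) (pt Y V y v)) (e i)) = pt Y V y v"
    by (simp only: sys'(4)[OF v])
qed

lemma expand_left: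
  assumes t: "t \<in> carrier (T V Y)"
  shows "(\<Oplus>\<^bsub>T V Y\<^esub>i\<in>I. pt V Y (e i) (lift Y (\<lambda>v y. f i v \<odot>\<^bsub>Y\<^esub> y) t)) = t"
proof (rule tensor_ext[OF V Y _ lin_id _ t])
  show "lin (T V Y) (T V Y) (\<lambda>t. \<Oplus>\<^bsub>T V Y\<^esub>i\<in>I. pt V Y (e i) (lift Y (\<lambda>v y. f i v \<odot>\<^bsub>Y\<^esub> y) t))"
    by (intro lin_finsum_fun tensor_vs Y V sys' lin_pt_right lift_lin slice_left_bilinear)
  fix v y assume y: "y \<in> carrier Y" and v: "v \<in> carrier V"
  have "(\<Oplus>\<^bsub>T V Y\<^esub>i\<in>I. pt V Y (e i) (lift Y (\<lambda>v y. f i v \<odot>\<^bsub>Y\<^esub> y) (pt V Y v y)))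
      = (\<Oplus>\<^bsub>T V Y\<^esub>i\<in>I. pt V Y (f i v \<odot>\<^bsub>V\<^esub> e i) y)"
  proof (rule finsum_cong_weak)
    fix i assume i: "i \<in> I"
    note c = sys'(5)[OF i v] and e = sys'(2)[OF i]
    show "pt V Y (e i) (lift Y (\<lambda>v y. f i v \<odot>\<^bsub>Y\<^esub> y) (pt V Y v y)) = pt V Y (f i v \<odot>\<^bsub>V\<^esub> e i) y"
      unfolding lift_pt[OF V Y Y slice_left_bilinear[OF i] v y]
        lin_smult[OF bilinear_left[OF pt_bilinear[OF V Y] y] c e]
        lin_smult[OF bilinear_right[OF pt_bilinear[OF V Y] e] c y] ..
  qed
  also have "\<dots> = pt V Y (\<Oplus>\<^bsub>V\<^esub>i\<in>I. f i v \<odot>\<^bsub>V\<^esub> e i) y"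
    by (rule lin_finsum[OF V tensor_vs[OF V Y] bilinear_left[OF pt_bilinear[OF V Y] y] sys'(1) summands[OF v], symmetric])
  finally show "(\<Oplus>\<^bsub>T V Y\<^esub>i\<in>I. pt V Y (e i) (lift Y (\<lambda>v y. f i v \<odot>\<^bsub>Y\<^esub> y) (pt V Y v y))) = pt V Y v y"
    by (simp only: sys'(4)[OF v])
qed

lemma separate_right:
  assumes "t \<in> carrier (T Y V)" "t' \<in> carrier (T Y V)"
    and "\<And>i. i \<in> I \<Longrightarrow> lift Y (\<lambda>y v. f i v \<odot>\<^bsub>Y\<^esub> y) t = lift Y (\<lambda>y v. f i v \<odot>\<^bsub>Y\<^esub> y) t'"
  shows "t = t'"
proof -
  have "(\<Oplus>\<^bsub>T Y V\<^esub>i\<in>I. pt Y V (lift Y (\<lambda>y v. f i v \<odot>\<^bsub>Y\<^esub> y) t) (e i))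
      = (\<Oplus>\<^bsub>T Y V\<^esub>i\<in>I. pt Y V (lift Y (\<lambda>y v. f i v \<odot>\<^bsub>Y\<^esub> y) t') (e i))"
    by (rule finsum_cong_weak) (simp only: assms(3))
  then show ?thesis by (simp only: expand_right assms)
qed

lemma separate_left:
  assumes "t \<in> carrier (T V Y)" "t' \<in> carrier (T V Y)"
    and "\<And>i. i \<in> I \<Longrightarrow> lift Y (\<lambda>v y. f i v \<odot>\<^bsub>Y\<^esub> y) t = lift Y (\<lambda>v y. f i v \<odot>\<^bsub>Y\<^esub> y) t'"
  shows "t = t'"
proof -
  have "(\<Oplus>\<^bsub>T V Y\<^esub>i\<in>I. pt V Y (e i) (lift Y (\<lambda>v y. f i v \<odot>\<^bsub>Y\<^esub> y) t))
      = (\<Oplus>\<^bsub>T V Y\<^esub>i\<in>I. pt V Y (e i) (lift Y (\<lambda>v y. f i v \<odot>\<^bsub>Y\<^esub> y) t'))"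
    by (rule finsum_cong_weak) (simp only: assms(3))
  then show ?thesis by (simp only: expand_left assms)
qed

end

lemma finsum_Times:
  assumes "vs W" "finite I" "finite J" "\<And>i j. \<lbrakk>i \<in> I; j \<in> J\<rbrakk> \<Longrightarrow> g i j \<in> carrier W"
  shows "(\<Oplus>\<^bsub>W\<^esub>i\<in>I. \<Oplus>\<^bsub>W\<^esub>j\<in>J. g i j) = (\<Oplus>\<^bsub>W\<^esub>ij\<in>I \<times> J. g (fst ij) (snd ij))"
proof -
  interpret W: abelian_group W using assms(1) by (rule vs_group)
  show ?thesis using assms(2,4)
  proof (induction I rule: finite_induct)
    case empty show ?case by simp
  next
    case (insert i I)
    have "(\<Oplus>\<^bsub>W\<^esub>ij\<in>insert i I \<times> J. g (fst ij) (snd ij))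
        = (\<Oplus>\<^bsub>W\<^esub>ij\<in>(Pair i ` J) \<union> (I \<times> J). g (fst ij) (snd ij))"
      by (rule arg_cong[of _ _ "finsum W _"]) auto
    also have "\<dots> = (\<Oplus>\<^bsub>W\<^esub>ij\<in>Pair i ` J. g (fst ij) (snd ij)) \<oplus>\<^bsub>W\<^esub> (\<Oplus>\<^bsub>W\<^esub>ij\<in>I \<times> J. g (fst ij) (snd ij))"
      using insert.hyps assms(3) insert.prems by (intro W.finsum_Un_disjoint) auto
    also have "(\<Oplus>\<^bsub>W\<^esub>ij\<in>Pair i ` J. g (fst ij) (snd ij)) = (\<Oplus>\<^bsub>W\<^esub>j\<in>J. g i j)"
      using insert.prems by (subst W.finsum_reindex) (auto simp: inj_on_def)
    also have "(\<Oplus>\<^bsub>W\<^esub>ij\<in>I \<times> J. g (fst ij) (snd ij)) = (\<Oplus>\<^bsub>W\<^esub>i\<in>I. \<Oplus>\<^bsub>W\<^esub>j\<in>J. g i j)"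
      by (rule insert.IH[symmetric]) (simp add: insert.prems)
    also have "(\<Oplus>\<^bsub>W\<^esub>j\<in>J. g i j) \<oplus>\<^bsub>W\<^esub> (\<Oplus>\<^bsub>W\<^esub>i\<in>I. \<Oplus>\<^bsub>W\<^esub>j\<in>J. g i j)
        = (\<Oplus>\<^bsub>W\<^esub>i\<in>insert i I. \<Oplus>\<^bsub>W\<^esub>j\<in>J. g i j)"
      using insert.hyps insert.prems
      by (intro W.finsum_insert[symmetric]) (auto intro!: W.finsum_closed)
    finally show ?case by simp
  qed
qed

lemma dual_system_tensor:
  assumes V: "vs V" and W: "vs W" and sV: "dual_system V I e f" and sW: "dual_system W J e' f'"
  shows "dual_system (T V W) (I \<times> J) (\<lambda>ij. pt V W (e (fst ij)) (e' (snd ij)))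
    (\<lambda>ij. lift (scalars k) (\<lambda>v w. f (fst ij) v \<otimes> f' (snd ij) w))"
proof -
  have IJ: "finite I" "finite J" "e \<in> I \<rightarrow> carrier V" "e' \<in> J \<rightarrow> carrier W"
    and f: "\<And>i. i \<in> I \<Longrightarrow> lin V (scalars k) (f i)" and f': "\<And>j. j \<in> J \<Longrightarrow> lin W (scalars k) (f' j)"
    and ex: "\<And>v. v \<in> carrier V \<Longrightarrow> (\<Oplus>\<^bsub>V\<^esub>i\<in>I. f i v \<odot>\<^bsub>V\<^esub> e i) = v"
    and ex': "\<And>w. w \<in> carrier W \<Longrightarrow> (\<Oplus>\<^bsub>W\<^esub>j\<in>J. f' j w \<odot>\<^bsub>W\<^esub> e' j) = w"
    using sV sW by (auto simp: dual_system_def)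
  have cl: "\<And>i v. \<lbrakk>i \<in> I; v \<in> carrier V\<rbrakk> \<Longrightarrow> f i v \<in> carrier k"
    "\<And>j w. \<lbrakk>j \<in> J; w \<in> carrier W\<rbrakk> \<Longrightarrow> f' j w \<in> carrier k"
    "\<And>i. i \<in> I \<Longrightarrow> e i \<in> carrier V" "\<And>j. j \<in> J \<Longrightarrow> e' j \<in> carrier W"
    using lin_closed[OF f] lin_closed[OF f'] IJ by auto
  have b: "bil V W (scalars k) (\<lambda>v w. f i v \<otimes> f' j w)" if "i \<in> I" "j \<in> J" for i j
    using that by (intro bilinearI lin_scalar_left lin_scalar_right f f' cl)
  note p = pt_bilinear[OF V W] and vT = tensor_vs[OF V W]
  have L: "lin (T V W) (scalars k) (lift (scalars k) (\<lambda>v w. f i v \<otimes> f' j w))" if "i \<in> I" "j \<in> J" for i j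
    by (rule lift_lin[OF V W scalars_vs b[OF that]])
  interpret TT: module k "T V W" by (rule vs_module[OF vT])
  have "(\<Oplus>\<^bsub>T V W\<^esub>ij\<in>I \<times> J. lift (scalars k) (\<lambda>v w. f (fst ij) v \<otimes> f' (snd ij) w) t
      \<odot>\<^bsub>T V W\<^esub> pt V W (e (fst ij)) (e' (snd ij))) = t" if t: "t \<in> carrier (T V W)" for t
  proof (rule tensor_ext[OF V W _ lin_id _ t])
    show "lin (T V W) (T V W) (\<lambda>t. \<Oplus>\<^bsub>T V W\<^esub>ij\<in>I \<times> J.
        lift (scalars k) (\<lambda>v w. f (fst ij) v \<otimes> f' (snd ij) w) t \<odot>\<^bsub>T V W\<^esub> pt V W (e (fst ij)) (e' (snd ij)))"
      using IJ by (intro lin_finsum_fun vT lin_smult_left L pt_closed[OF V W] cl) auto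
    fix v w assume v: "v \<in> carrier V" and w: "w \<in> carrier W"
    have summand: "lift (scalars k) (\<lambda>v w. f i v \<otimes> f' j w) (pt V W v w) \<odot>\<^bsub>T V W\<^esub> pt V W (e i) (e' j)
        = pt V W (f i v \<odot>\<^bsub>V\<^esub> e i) (f' j w \<odot>\<^bsub>W\<^esub> e' j)" if i: "i \<in> I" and j: "j \<in> J" for i j
    proof -
      note s = lin_smult[OF bilinear_left[OF p]] lin_smult[OF bilinear_right[OF p]]
      show ?thesis
        by (simp add: lift_pt[OF V W scalars_vs b[OF i j] v w] s cl i j v w smult_closed[OF W]
            TT.smult_assoc1 pt_closed[OF V W])
    qed
    have "(\<Oplus>\<^bsub>T V W\<^esub>ij\<in>I \<times> J. lift (scalars k) (\<lambda>v w. f (fst ij) v \<otimes> f' (snd ij) w) (pt V W v w)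
        \<odot>\<^bsub>T V W\<^esub> pt V W (e (fst ij)) (e' (snd ij)))
      = (\<Oplus>\<^bsub>T V W\<^esub>ij\<in>I \<times> J. pt V W (f (fst ij) v \<odot>\<^bsub>V\<^esub> e (fst ij)) (f' (snd ij) w \<odot>\<^bsub>W\<^esub> e' (snd ij)))"
      by (rule finsum_cong_weak) (auto intro!: summand)
    also have "\<dots> = (\<Oplus>\<^bsub>T V W\<^esub>i\<in>I. \<Oplus>\<^bsub>T V W\<^esub>j\<in>J. pt V W (f i v \<odot>\<^bsub>V\<^esub> e i) (f' j w \<odot>\<^bsub>W\<^esub> e' j))"
      using IJ(1,2) cl v w
      by (intro finsum_Times[OF vT, symmetric] pt_closed[OF V W] smult_closed[OF V] smult_closed[OF W]) auto
    also have "\<dots> = (\<Oplus>\<^bsub>T V W\<^esub>i\<in>I. pt V W (f i v \<odot>\<^bsub>V\<^esub> e i) w)"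
    proof (rule finsum_cong_weak)
      fix i assume i: "i \<in> I"
      then have "f i v \<odot>\<^bsub>V\<^esub> e i \<in> carrier V" using cl v smult_closed[OF V] by blast
      from lin_finsum[OF W vT bilinear_right[OF p this] IJ(2), of "\<lambda>j. f' j w \<odot>\<^bsub>W\<^esub> e' j"]
      show "(\<Oplus>\<^bsub>T V W\<^esub>j\<in>J. pt V W (f i v \<odot>\<^bsub>V\<^esub> e i) (f' j w \<odot>\<^bsub>W\<^esub> e' j)) = pt V W (f i v \<odot>\<^bsub>V\<^esub> e i) w"
        using cl w smult_closed[OF W] by (simp add: ex'[OF w] Pi_iff)
    qed
    also have "\<dots> = pt V W (\<Oplus>\<^bsub>V\<^esub>i\<in>I. f i v \<odot>\<^bsub>V\<^esub> e i) w"
      by (rule lin_finsum[OF V vT bilinear_left[OF p w] IJ(1), symmetric]) (use cl v smult_closed[OF V] in blast)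
    finally show "(\<Oplus>\<^bsub>T V W\<^esub>ij\<in>I \<times> J. lift (scalars k) (\<lambda>v w. f (fst ij) v \<otimes> f' (snd ij) w) (pt V W v w)
        \<odot>\<^bsub>T V W\<^esub> pt V W (e (fst ij)) (e' (snd ij))) = pt V W v w"
      by (simp only: ex[OF v])
  qed
  then show ?thesis using IJ L cl pt_closed[OF V W] by (auto simp: dual_system_def)
qed

end

section \<open>Dual pairs of Hopf algebras\<close>

text \<open>The conditions on \<open>(K, L, p)\<close> that the characterizations below use. They are invariant under
  exchanging \<open>K\<close> and \<open>L\<close>. The form \<open>q\<close> is the inverse of \<open>p\<close> for the convolution of bilinear
  forms on \<open>K \<times> L\<close>; for a Hopf algebra and its dual it is \<open>p(S(x), l)\<close>. It enters because it
  represents the inverse of the canonical element.\<close>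

locale dual_pair = ground k
  for k :: "('k, 'm) ring_scheme" (structure) +
  fixes K :: "('k, 'h, 'n) hopf_scheme" and L :: "('k, 'l, 'q) hopf_scheme"
    and p q :: "'h \<Rightarrow> 'l \<Rightarrow> 'k"
  assumes K [multilin]: "unital_algebra k K" and L [multilin]: "unital_algebra k L"
    and comult_K: "lin K (T K K) (comult K)" and comult_L: "lin L (T L L) (comult L)"
    and p_bilinear: "bil K L (scalars k) p" and q_bilinear: "bil K L (scalars k) q"
    and dual_bases: "\<exists>B d. finite B \<and> vectorspace.basis k K B \<and> d \<in> B \<rightarrow> carrier L \<and>
      (\<forall>b\<in>B. \<forall>b'\<in>B. p b (d b') = (if b = b' then \<one> else \<zero>)) \<and>
      dual_system K B (\<lambda>b. b) (\<lambda>b x. p x (d b)) \<and> dual_system L B d p"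
    and pair_mult_L: "\<lbrakk>x \<in> carrier K; l \<in> carrier L; l' \<in> carrier L\<rbrakk> \<Longrightarrow>
      p x (l \<otimes>\<^bsub>L\<^esub> l') = lift (scalars k) (\<lambda>x1 x2. p x1 l \<otimes> p x2 l') (comult K x)"
    and pair_mult_K: "\<lbrakk>x \<in> carrier K; x' \<in> carrier K; l \<in> carrier L\<rbrakk> \<Longrightarrow>
      p (x \<otimes>\<^bsub>K\<^esub> x') l = lift (scalars k) (\<lambda>l1 l2. p x l1 \<otimes> p x' l2) (comult L l)"
    and counit_K: "x \<in> carrier K \<Longrightarrow> counit K x = p x \<one>\<^bsub>L\<^esub>"
    and counit_L: "l \<in> carrier L \<Longrightarrow> counit L l = p \<one>\<^bsub>K\<^esub> l"
    and comult_K_one: "comult K \<one>\<^bsub>K\<^esub> = pt K K \<one>\<^bsub>K\<^esub> \<one>\<^bsub>K\<^esub>"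
    and comult_L_one: "comult L \<one>\<^bsub>L\<^esub> = pt L L \<one>\<^bsub>L\<^esub> \<one>\<^bsub>L\<^esub>"
    and pair_one: "p \<one>\<^bsub>K\<^esub> \<one>\<^bsub>L\<^esub> = \<one>"
    and p_q: "\<lbrakk>x \<in> carrier K; l \<in> carrier L\<rbrakk> \<Longrightarrow>
      lift (scalars k) (\<lambda>x1 x2. lift (scalars k) (\<lambda>l1 l2. p x1 l1 \<otimes> q x2 l2) (comult L l)) (comult K x)
        = p x \<one>\<^bsub>L\<^esub> \<otimes> p \<one>\<^bsub>K\<^esub> l"
    and q_p: "\<lbrakk>x \<in> carrier K; l \<in> carrier L\<rbrakk> \<Longrightarrow>
      lift (scalars k) (\<lambda>x1 x2. lift (scalars k) (\<lambda>l1 l2. q x1 l1 \<otimes> p x2 l2) (comult L l)) (comult K x)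
        = p x \<one>\<^bsub>L\<^esub> \<otimes> p \<one>\<^bsub>K\<^esub> l"
begin

lemmas K_vs [multilin] = unital_algebra_vs[OF K]
lemmas L_vs [multilin] = unital_algebra_vs[OF L]

lemma comult_K_lin [multilin]: "lin X K f \<Longrightarrow> lin X (T K K) (\<lambda>x. comult K (f x))"
  by (rule lin_compose[OF comult_K])
lemma comult_L_lin [multilin]: "lin X L f \<Longrightarrow> lin X (T L L) (\<lambda>x. comult L (f x))"
  by (rule lin_compose[OF comult_L])
lemma comult_K_closed [multilin]: "x \<in> carrier K \<Longrightarrow> comult K x \<in> carrier (T K K)"
  by (rule lin_closed[OF comult_K])
lemma comult_L_closed [multilin]: "l \<in> carrier L \<Longrightarrow> comult L l \<in> carrier (T L L)"
  by (rule lin_closed[OF comult_L])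
lemma p_closed [multilin]: "\<lbrakk>x \<in> carrier K; l \<in> carrier L\<rbrakk> \<Longrightarrow> p x l \<in> carrier k"
  using bilinear_closed[OF p_bilinear] by simp
lemma p_left [multilin]: "\<lbrakk>lin X K f; l \<in> carrier L\<rbrakk> \<Longrightarrow> lin X (scalars k) (\<lambda>x. p (f x) l)"
  by (rule lin_bilinear_left[OF p_bilinear])
lemma p_right [multilin]: "\<lbrakk>lin X L f; x \<in> carrier K\<rbrakk> \<Longrightarrow> lin X (scalars k) (\<lambda>l. p x (f l))"
  by (rule lin_bilinear_right[OF p_bilinear])
lemma q_closed [multilin]: "\<lbrakk>x \<in> carrier K; l \<in> carrier L\<rbrakk> \<Longrightarrow> q x l \<in> carrier k"
  using bilinear_closed[OF q_bilinear] by simp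
lemma q_left [multilin]: "\<lbrakk>lin X K f; l \<in> carrier L\<rbrakk> \<Longrightarrow> lin X (scalars k) (\<lambda>x. q (f x) l)"
  by (rule lin_bilinear_left[OF q_bilinear])
lemma q_right [multilin]: "\<lbrakk>lin X L f; x \<in> carrier K\<rbrakk> \<Longrightarrow> lin X (scalars k) (\<lambda>l. q x (f l))"
  by (rule lin_bilinear_right[OF q_bilinear])

text \<open>Evaluation of one leg by the pairing: of the leg in \<open>K\<close> at \<open>l\<close>, and of the leg in \<open>L\<close> at
  \<open>x\<close>. Applied to the values of a coaction these are the actions \<open>l \<rhd> y\<close> and \<open>y \<lhd> x\<close>.\<close>

definition slice_K where "slice_K Y l t = lift Y (\<lambda>y x. p x l \<odot>\<^bsub>Y\<^esub> y) t"
definition slice_L where "slice_L Y x t = lift Y (\<lambda>l y. p x l \<odot>\<^bsub>Y\<^esub> y) t"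

lemma slice_K_bil: "\<lbrakk>vs Y; l \<in> carrier L\<rbrakk> \<Longrightarrow> bil Y K Y (\<lambda>y x. p x l \<odot>\<^bsub>Y\<^esub> y)"
  by (assumption | rule multilin)+
lemma slice_L_bil: "\<lbrakk>vs Y; x \<in> carrier K\<rbrakk> \<Longrightarrow> bil L Y Y (\<lambda>l y. p x l \<odot>\<^bsub>Y\<^esub> y)"
  by (assumption | rule multilin)+

lemma slice_K_lin [multilin]:
  "\<lbrakk>lin X (T Y K) f; vs Y; l \<in> carrier L\<rbrakk> \<Longrightarrow> lin X Y (\<lambda>x. slice_K Y l (f x))"
  unfolding slice_K_def by (rule lin_lift_arg[OF _ _ K_vs _ slice_K_bil])
lemma slice_L_lin [multilin]:
  "\<lbrakk>lin X (T L Y) f; vs Y; x \<in> carrier K\<rbrakk> \<Longrightarrow> lin X Y (\<lambda>z. slice_L Y x (f z))"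
  unfolding slice_L_def by (rule lin_lift_arg[OF _ L_vs _ _ slice_L_bil])
lemma slice_K_closed [multilin]:
  "\<lbrakk>t \<in> carrier (T Y K); vs Y; l \<in> carrier L\<rbrakk> \<Longrightarrow> slice_K Y l t \<in> carrier Y"
  by (rule lin_closed[OF slice_K_lin[OF lin_id]])
lemma slice_L_closed [multilin]:
  "\<lbrakk>t \<in> carrier (T L Y); vs Y; x \<in> carrier K\<rbrakk> \<Longrightarrow> slice_L Y x t \<in> carrier Y"
  by (rule lin_closed[OF slice_L_lin[OF lin_id]])
lemma slice_K_param [multilin]:
  "\<lbrakk>lin X L f; t \<in> carrier (T Y K); vs Y\<rbrakk> \<Longrightarrow> lin X Y (\<lambda>l. slice_K Y (f l) t)"
proof -
  assume f: "lin X L f" and t: "t \<in> carrier (T Y K)" and Y: "vs Y"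
  have "lin L Y (\<lambda>l. slice_K Y l t)"
    unfolding slice_K_def by (assumption | rule multilin t Y)+
  then show ?thesis by (rule lin_compose[OF _ f])
qed
lemma slice_L_param [multilin]:
  "\<lbrakk>lin X K f; t \<in> carrier (T L Y); vs Y\<rbrakk> \<Longrightarrow> lin X Y (\<lambda>x. slice_L Y (f x) t)"
proof -
  assume f: "lin X K f" and t: "t \<in> carrier (T L Y)" and Y: "vs Y"
  have "lin K Y (\<lambda>x. slice_L Y x t)"
    unfolding slice_L_def by (assumption | rule multilin t Y)+
  then show ?thesis by (rule lin_compose[OF _ f])
qed

lemma slice_K_pt: "\<lbrakk>vs Y; y \<in> carrier Y; x \<in> carrier K; l \<in> carrier L\<rbrakk> \<Longrightarrow> slice_K Y l (pt Y K y x) = p x l \<odot>\<^bsub>Y\<^esub> y"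
  unfolding slice_K_def by (rule lift_pt[OF _ K_vs _ slice_K_bil])
lemma slice_L_pt: "\<lbrakk>vs Y; y \<in> carrier Y; x \<in> carrier K; l \<in> carrier L\<rbrakk> \<Longrightarrow> slice_L Y x (pt L Y l y) = p x l \<odot>\<^bsub>Y\<^esub> y"
  unfolding slice_L_def by (rule lift_pt[OF L_vs _ _ slice_L_bil])

lemma slice_K_inj:
  assumes Y: "vs Y" and t: "t \<in> carrier (T Y K)" "t' \<in> carrier (T Y K)"
    and eq: "\<And>l. l \<in> carrier L \<Longrightarrow> slice_K Y l t = slice_K Y l t'"
  shows "t = t'"
proof -
  obtain B d where B: "d \<in> B \<rightarrow> carrier L" "dual_system K B (\<lambda>b. b) (\<lambda>b x. p x (d b))"
    using dual_bases by blast
  then show ?thesis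
    using eq by (intro separate_right[OF K_vs Y B(2) t]) (auto simp: slice_K_def)
qed

lemma slice_L_inj:
  assumes Y: "vs Y" and t: "t \<in> carrier (T L Y)" "t' \<in> carrier (T L Y)"
    and eq: "\<And>x. x \<in> carrier K \<Longrightarrow> slice_L Y x t = slice_L Y x t'"
  shows "t = t'"
proof -
  interpret Kv: vectorspace k K by (rule K_vs)
  obtain B d where B: "vectorspace.basis k K B" "dual_system L B d p"
    using dual_bases by blast
  then have "B \<subseteq> carrier K" by (simp add: Kv.basis_def)
  then show ?thesis
    using eq by (intro separate_left[OF L_vs Y B(2) t]) (auto simp: slice_L_def)
qed

end

section \<open>Coactions as module algebras over the dual\<close>

context ground
begin

definition left_module_algebra where
  "left_module_algebra L Y act \<longleftrightarrow>
     (\<forall>l\<in>carrier L. \<forall>l'\<in>carrier L. \<forall>y\<in>carrier Y. act (l \<otimes>\<^bsub>L\<^esub> l') y = act l (act l' y)) \<and>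
     (\<forall>y\<in>carrier Y. act \<one>\<^bsub>L\<^esub> y = y) \<and>
     (\<forall>l\<in>carrier L. \<forall>y\<in>carrier Y. \<forall>z\<in>carrier Y. act l (y \<otimes>\<^bsub>Y\<^esub> z) =
        lift Y (\<lambda>l1 l2. act l1 y \<otimes>\<^bsub>Y\<^esub> act l2 z) (comult L l)) \<and>
     (\<forall>l\<in>carrier L. act l \<one>\<^bsub>Y\<^esub> = counit L l \<odot>\<^bsub>Y\<^esub> \<one>\<^bsub>Y\<^esub>)"

definition right_module_algebra where
  "right_module_algebra K Y act \<longleftrightarrow>
     (\<forall>x\<in>carrier K. \<forall>x'\<in>carrier K. \<forall>y\<in>carrier Y. act y (x \<otimes>\<^bsub>K\<^esub> x') = act (act y x) x') \<and>
     (\<forall>y\<in>carrier Y. act y \<one>\<^bsub>K\<^esub> = y) \<and>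
     (\<forall>x\<in>carrier K. \<forall>y\<in>carrier Y. \<forall>z\<in>carrier Y. act (y \<otimes>\<^bsub>Y\<^esub> z) x =
        lift Y (\<lambda>x1 x2. act y x1 \<otimes>\<^bsub>Y\<^esub> act z x2) (comult K x)) \<and>
     (\<forall>x\<in>carrier K. act \<one>\<^bsub>Y\<^esub> x = counit K x \<odot>\<^bsub>Y\<^esub> \<one>\<^bsub>Y\<^esub>)"

lemma algebra_hom_iff:
  "f \<in> algebra_hom k A B \<longleftrightarrow> lin A B f \<and>
     (\<forall>x\<in>carrier A. \<forall>y\<in>carrier A. f (x \<otimes>\<^bsub>A\<^esub> y) = f x \<otimes>\<^bsub>B\<^esub> f y) \<and> f \<one>\<^bsub>A\<^esub> = \<one>\<^bsub>B\<^esub>"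
  by (auto simp: algebra_hom_def ring_hom_def intro: lin_closed lin_add)

lemma lift_smult_const:
  assumes "t \<in> carrier (T A B)" "vs A" "vs B" "vs W" "bil A B (scalars k) \<phi>" "w \<in> carrier W"
  shows "lift W (\<lambda>a b. \<phi> a b \<odot>\<^bsub>W\<^esub> w) t = lift (scalars k) \<phi> t \<odot>\<^bsub>W\<^esub> w"
  by (rule lift_hom[OF _ assms(1,2,3) scalars_vs assms(4,5), symmetric]) (rule multilin assms)+

end

context dual_pair
begin

context
  fixes Y :: "('k, 'y, 'r) module_scheme"
  assumes Y [multilin]: "unital_algebra k Y"
begin

interpretation Y: unital_algebra k Y by (rule Y)

private lemmas vY = unital_algebra_vs[OF Y]
private lemmas prod = unital_algebra_product[OF Y] unital_algebra_product[OF K] unital_algebra_product[OF L]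
private lemmas vYK = tensor_vs[OF vY K_vs] and vLY = tensor_vs[OF L_vs vY]

lemma pair_scalars_K:
  assumes "x \<in> carrier K" "x' \<in> carrier K" "l \<in> carrier L" "w \<in> carrier Y"
  shows "lift Y (\<lambda>l1 l2. (p x l1 \<otimes> p x' l2) \<odot>\<^bsub>Y\<^esub> w) (comult L l) = p (x \<otimes>\<^bsub>K\<^esub> x') l \<odot>\<^bsub>Y\<^esub> w"
  unfolding pair_mult_K[OF assms(1-3)]
  by (rule lift_smult_const) (assumption | rule multilin assms)+

lemma pair_scalars_L:
  assumes "x \<in> carrier K" "l \<in> carrier L" "l' \<in> carrier L" "w \<in> carrier Y"
  shows "lift Y (\<lambda>x1 x2. (p x1 l \<otimes> p x2 l') \<odot>\<^bsub>Y\<^esub> w) (comult K x) = p x (l \<otimes>\<^bsub>L\<^esub> l') \<odot>\<^bsub>Y\<^esub> w"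
  unfolding pair_mult_L[OF assms(1-3)]
  by (rule lift_smult_const) (assumption | rule multilin assms)+

lemma scale_product:
  assumes "c \<in> carrier k" "c' \<in> carrier k" "y \<in> carrier Y" "z \<in> carrier Y"
  shows "(c \<odot>\<^bsub>Y\<^esub> y) \<otimes>\<^bsub>Y\<^esub> (c' \<odot>\<^bsub>Y\<^esub> z) = (c \<otimes> c') \<odot>\<^bsub>Y\<^esub> (y \<otimes>\<^bsub>Y\<^esub> z)"
  using assms by (simp add: Y.smult_mult_left Y.smult_mult_right Y.smult_assoc1[symmetric] m_comm)

text \<open>The pairing turns the product of \<open>K\<close> into the coproduct of \<open>L\<close>, and conversely.\<close>

lemma slice_K_mult:
  assumes s: "s \<in> carrier (T Y K)" and t: "t \<in> carrier (T Y K)" and l: "l \<in> carrier L"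
  shows "slice_K Y l (s \<otimes>\<^bsub>T Y K\<^esub> t)
    = lift Y (\<lambda>l1 l2. slice_K Y l1 s \<otimes>\<^bsub>Y\<^esub> slice_K Y l2 t) (comult L l)"
proof -
  have 1: "slice_K Y l (pt Y K y x \<otimes>\<^bsub>T Y K\<^esub> pt Y K y' x')
      = lift Y (\<lambda>l1 l2. slice_K Y l1 (pt Y K y x) \<otimes>\<^bsub>Y\<^esub> slice_K Y l2 (pt Y K y' x')) (comult L l)"
    if y: "y \<in> carrier Y" "y' \<in> carrier Y" and x: "x \<in> carrier K" "x' \<in> carrier K" for y x y' x'
  proof -
    have "lift Y (\<lambda>l1 l2. slice_K Y l1 (pt Y K y x) \<otimes>\<^bsub>Y\<^esub> slice_K Y l2 (pt Y K y' x')) (comult L l)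
        = lift Y (\<lambda>l1 l2. (p x l1 \<otimes> p x' l2) \<odot>\<^bsub>Y\<^esub> (y \<otimes>\<^bsub>Y\<^esub> y')) (comult L l)"
      by (rule lift_cong[OF L_vs L_vs comult_L_closed[OF l]])
        (simp add: slice_K_pt[OF vY] x y scale_product p_closed)
    then show ?thesis
      using x y l by (simp add: pair_scalars_K tensor_mult_pt[OF prod(1,2)] slice_K_pt[OF vY]
          mult_closed[OF prod(2)])
  qed
  have 2: "slice_K Y l (pt Y K y x \<otimes>\<^bsub>T Y K\<^esub> t)
      = lift Y (\<lambda>l1 l2. slice_K Y l1 (pt Y K y x) \<otimes>\<^bsub>Y\<^esub> slice_K Y l2 t) (comult L l)"
    if y: "y \<in> carrier Y" and x: "x \<in> carrier K" for y x
    by (rule tensor_ext[OF vY K_vs _ _ _ t]) (assumption | rule multilin 1 x y l)+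
  show ?thesis
    by (rule tensor_ext[OF vY K_vs _ _ _ s]) (assumption | rule multilin 2 l t)+
qed

lemma slice_L_mult:
  assumes s: "s \<in> carrier (T L Y)" and t: "t \<in> carrier (T L Y)" and x: "x \<in> carrier K"
  shows "slice_L Y x (s \<otimes>\<^bsub>T L Y\<^esub> t)
    = lift Y (\<lambda>x1 x2. slice_L Y x1 s \<otimes>\<^bsub>Y\<^esub> slice_L Y x2 t) (comult K x)"
proof -
  have 1: "slice_L Y x (pt L Y l y \<otimes>\<^bsub>T L Y\<^esub> pt L Y l' y')
      = lift Y (\<lambda>x1 x2. slice_L Y x1 (pt L Y l y) \<otimes>\<^bsub>Y\<^esub> slice_L Y x2 (pt L Y l' y')) (comult K x)"
    if y: "y \<in> carrier Y" "y' \<in> carrier Y" and l: "l \<in> carrier L" "l' \<in> carrier L" for y l y' l'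
  proof -
    have "lift Y (\<lambda>x1 x2. slice_L Y x1 (pt L Y l y) \<otimes>\<^bsub>Y\<^esub> slice_L Y x2 (pt L Y l' y')) (comult K x)
        = lift Y (\<lambda>x1 x2. (p x1 l \<otimes> p x2 l') \<odot>\<^bsub>Y\<^esub> (y \<otimes>\<^bsub>Y\<^esub> y')) (comult K x)"
      by (rule lift_cong[OF K_vs K_vs comult_K_closed[OF x]])
        (simp add: slice_L_pt[OF vY] l y scale_product p_closed)
    then show ?thesis
      using x y l by (simp add: pair_scalars_L tensor_mult_pt[OF prod(3,1)] slice_L_pt[OF vY]
          mult_closed[OF prod(3)])
  qed
  have 2: "slice_L Y x (pt L Y l y \<otimes>\<^bsub>T L Y\<^esub> t)
      = lift Y (\<lambda>x1 x2. slice_L Y x1 (pt L Y l y) \<otimes>\<^bsub>Y\<^esub> slice_L Y x2 t) (comult K x)"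
    if y: "y \<in> carrier Y" and l: "l \<in> carrier L" for y l
    by (rule tensor_ext[OF L_vs vY _ _ _ t]) (assumption | rule multilin 1 x y l)+
  show ?thesis
    by (rule tensor_ext[OF L_vs vY _ _ _ s]) (assumption | rule multilin 2 x t)+
qed

lemma slice_K_one: "l \<in> carrier L \<Longrightarrow> slice_K Y l \<one>\<^bsub>T Y K\<^esub> = counit L l \<odot>\<^bsub>Y\<^esub> \<one>\<^bsub>Y\<^esub>"
  unfolding tensor_simps(5)[OF vY K_vs]
  by (simp add: slice_K_pt[OF vY] counit_L one_closed_algebra[OF K])

lemma slice_L_one: "x \<in> carrier K \<Longrightarrow> slice_L Y x \<one>\<^bsub>T L Y\<^esub> = counit K x \<odot>\<^bsub>Y\<^esub> \<one>\<^bsub>Y\<^esub>"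
  unfolding tensor_simps(5)[OF L_vs vY]
  by (simp add: slice_L_pt[OF vY] counit_K one_closed_algebra[OF L])

lemma slice_K_map:
  assumes \<alpha>: "lin Y Z \<alpha>" and Z: "vs Z" and t: "t \<in> carrier (T Y K)" and l: "l \<in> carrier L"
  shows "slice_K Z l (tensor_map k Z K \<alpha> (\<lambda>x. x) t) = \<alpha> (slice_K Y l t)"
  by (rule tensor_ext[OF vY K_vs _ _ _ t, where W=Z])
    (rule multilin lin_compose[OF \<alpha>] \<alpha> Z vY l
      | simp add: map_pt[OF vY K_vs Z K_vs \<alpha> lin_id] slice_K_pt vY Z l lin_closed[OF \<alpha>] lin_smult[OF \<alpha>] p_closed)+

lemma slice_L_map:
  assumes \<beta>: "lin Y Z \<beta>" and Z: "vs Z" and t: "t \<in> carrier (T L Y)" and x: "x \<in> carrier K"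
  shows "slice_L Z x (tensor_map k L Z (\<lambda>x. x) \<beta> t) = \<beta> (slice_L Y x t)"
  by (rule tensor_ext[OF L_vs vY _ _ _ t, where W=Z])
    (rule multilin lin_compose[OF \<beta>] \<beta> Z vY x
      | simp add: map_pt[OF L_vs vY L_vs Z lin_id \<beta>] slice_L_pt vY Z x lin_closed[OF \<beta>] lin_smult[OF \<beta>] p_closed)+

text \<open>The right-hand side of coassociativity becomes the action of a product, because the pairing turns
  the coproduct of \<open>K\<close> into the product of \<open>L\<close>.\<close>

lemma slice_K_comult:
  assumes t: "t \<in> carrier (T Y K)" and l: "l \<in> carrier L" and l': "l' \<in> carrier L"
  shows "slice_K Y l (slice_K (T Y K) l' (tensor_assoc k Y K K (tensor_map k Y (T K K) (\<lambda>x. x) (comult K) t)))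
    = slice_K Y (l \<otimes>\<^bsub>L\<^esub> l') t"
proof -
  have b: "bil K K (scalars k) (\<lambda>x x'. p x l \<otimes> p x' l')" by (assumption | rule multilin l l')+
  have bT: "bil Y (T K K) Y (\<lambda>y w. lift (scalars k) (\<lambda>x x'. p x l \<otimes> p x' l') w \<odot>\<^bsub>Y\<^esub> y)"
    by (assumption | rule multilin l l')+
  have *: "slice_K Y l (slice_K (T Y K) l' (tensor_assoc k Y K K u))
      = lift Y (\<lambda>y w. lift (scalars k) (\<lambda>x x'. p x l \<otimes> p x' l') w \<odot>\<^bsub>Y\<^esub> y) u"
    if u: "u \<in> carrier (T Y (T K K))" for u
  proof (rule tensor_ext3_right[OF vY K_vs K_vs _ _ _ u])
    show "lin (T Y (T K K)) Y (\<lambda>u. slice_K Y l (slice_K (T Y K) l' (tensor_assoc k Y K K u)))"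
      by (rule slice_K_lin[OF slice_K_lin[OF assoc_lin[OF vY K_vs K_vs] vYK l'] vY l])
    show "lin (T Y (T K K)) Y (lift Y (\<lambda>y w. lift (scalars k) (\<lambda>x x'. p x l \<otimes> p x' l') w \<odot>\<^bsub>Y\<^esub> y))"
      by (rule lift_lin[OF vY tensor_vs[OF K_vs K_vs] vY bT])
    fix y x x' assume y: "y \<in> carrier Y" and x: "x \<in> carrier K" "x' \<in> carrier K"
    have w: "pt K K x x' \<in> carrier (T K K)" by (rule pt_closed[OF K_vs K_vs x])
    have yx: "pt Y K y x \<in> carrier (T Y K)" by (rule pt_closed[OF vY K_vs y x(1)])
    have "slice_K Y l (slice_K (T Y K) l' (pt (T Y K) K (pt Y K y x) x')) = p x' l' \<odot>\<^bsub>Y\<^esub> (p x l \<odot>\<^bsub>Y\<^esub> y)"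
      using lin_smult[OF slice_K_lin[OF lin_id vY l] p_closed[OF x(2) l'] yx]
      by (simp add: slice_K_pt[OF vYK] slice_K_pt[OF vY] yx x y l l')
    then show "slice_K Y l (slice_K (T Y K) l' (tensor_assoc k Y K K (pt Y (T K K) y (pt K K x x'))))
        = lift Y (\<lambda>y w. lift (scalars k) (\<lambda>x x'. p x l \<otimes> p x' l') w \<odot>\<^bsub>Y\<^esub> y) (pt Y (T K K) y (pt K K x x'))"
      unfolding assoc_pt[OF vY K_vs K_vs y x] lift_pt[OF vY tensor_vs[OF K_vs K_vs] vY bT y w]
        lift_pt[OF K_vs K_vs scalars_vs b x]
      by (simp add: Y.smult_assoc1[symmetric] p_closed x y l l' m_comm)
  qed
  have m: "tensor_map k Y (T K K) (\<lambda>x. x) (comult K) t \<in> carrier (T Y (T K K))"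
    by (assumption | rule multilin t)+
  show ?thesis
    unfolding *[OF m] lift_map[OF t vY K_vs vY tensor_vs[OF K_vs K_vs] vY lin_id comult_K bT]
      slice_K_def[of Y "l \<otimes>\<^bsub>L\<^esub> l'"]
    by (rule lift_cong[OF vY K_vs t]) (simp add: pair_mult_L l l')
qed

text \<open>Evaluation of the two left legs of \<open>(L \<otimes> L) \<otimes> Y\<close>. With this bracketing, in which
  coassociativity of a left coaction is stated, the two legs in \<open>L\<close> cannot be evaluated by two slices in
  succession.\<close>

definition slice_LL where
  "slice_LL x x' u = lift Y (\<lambda>w y. lift (scalars k) (\<lambda>l l'. p x l \<otimes> p x' l') w \<odot>\<^bsub>Y\<^esub> y) u"

lemma slice_LL_bil:
  assumes "x \<in> carrier K" "x' \<in> carrier K"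
  shows "bil (T L L) Y Y (\<lambda>w y. lift (scalars k) (\<lambda>l l'. p x l \<otimes> p x' l') w \<odot>\<^bsub>Y\<^esub> y)"
  by (assumption | rule multilin assms)+

lemma slice_LL_inj:
  assumes u: "u \<in> carrier (T (T L L) Y)" "u' \<in> carrier (T (T L L) Y)"
    and eq: "\<And>x x'. \<lbrakk>x \<in> carrier K; x' \<in> carrier K\<rbrakk> \<Longrightarrow> slice_LL x x' u = slice_LL x x' u'"
  shows "u = u'"
proof -
  interpret Kv: vectorspace k K by (rule K_vs)
  obtain B d where B: "vectorspace.basis k K B" "dual_system L B d p"
    using dual_bases by blast
  show ?thesis
  proof (rule separate_left[OF tensor_vs[OF L_vs L_vs] vY dual_system_tensor[OF L_vs L_vs B(2) B(2)] u])
    fix ij assume "ij \<in> B \<times> B"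
    then have "fst ij \<in> carrier K" "snd ij \<in> carrier K"
      using B(1) by (auto simp: Kv.basis_def)
    from eq[OF this] show "lift Y (\<lambda>w y. lift (scalars k) (\<lambda>v w. p (fst ij) v \<otimes> p (snd ij) w) w \<odot>\<^bsub>Y\<^esub> y) u
        = lift Y (\<lambda>w y. lift (scalars k) (\<lambda>v w. p (fst ij) v \<otimes> p (snd ij) w) w \<odot>\<^bsub>Y\<^esub> y) u'"
      unfolding slice_LL_def .
  qed
qed

lemma slice_LL_assoc:
  assumes x: "x \<in> carrier K" and x': "x' \<in> carrier K" and v: "v \<in> carrier (T L (T L Y))"
  shows "slice_LL x x' (tensor_assoc k L L Y v) = slice_L Y x' (slice_L (T L Y) x v)"
proof (rule tensor_ext3_right[OF L_vs L_vs vY _ _ _ v])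
  note vLL = tensor_vs[OF L_vs L_vs]
  note b = slice_LL_bil[OF x x']
  show "lin (T L (T L Y)) Y (\<lambda>v. slice_LL x x' (tensor_assoc k L L Y v))"
    unfolding slice_LL_def
    by (rule lin_lift_arg[OF assoc_lin[OF L_vs L_vs vY] vLL vY vY b])
  show "lin (T L (T L Y)) Y (\<lambda>v. slice_L Y x' (slice_L (T L Y) x v))"
    by (rule slice_L_lin[OF slice_L_lin[OF lin_id vLY x] vY x'])
  have bs: "bil L L (scalars k) (\<lambda>l l'. p x l \<otimes> p x' l')" by (assumption | rule multilin x x')+
  fix l l' y assume l: "l \<in> carrier L" "l' \<in> carrier L" and y: "y \<in> carrier Y"
  have w: "pt L L l l' \<in> carrier (T L L)" by (rule pt_closed[OF L_vs L_vs l])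
  have ly: "pt L Y l' y \<in> carrier (T L Y)" by (rule pt_closed[OF L_vs vY l(2) y])
  have "slice_L Y x' (slice_L (T L Y) x (pt L (T L Y) l (pt L Y l' y))) = p x l \<odot>\<^bsub>Y\<^esub> (p x' l' \<odot>\<^bsub>Y\<^esub> y)"
    using lin_smult[OF slice_L_lin[OF lin_id vY x'] p_closed[OF x l(1)] ly]
    by (simp add: slice_L_pt[OF vLY] slice_L_pt[OF vY] ly x x' y l)
  then show "slice_LL x x' (tensor_assoc k L L Y (pt L (T L Y) l (pt L Y l' y)))
      = slice_L Y x' (slice_L (T L Y) x (pt L (T L Y) l (pt L Y l' y)))"
    unfolding slice_LL_def assoc_pt[OF L_vs L_vs vY l y] lift_pt[OF vLL vY vY b w y]
      lift_pt[OF L_vs L_vs scalars_vs bs l]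
    by (simp add: Y.smult_assoc1 p_closed x x' y l)
qed

lemma slice_LL_comult:
  assumes x: "x \<in> carrier K" and x': "x' \<in> carrier K" and t: "t \<in> carrier (T L Y)"
  shows "slice_LL x x' (tensor_map k (T L L) Y (comult L) (\<lambda>x. x) t) = slice_L Y (x \<otimes>\<^bsub>K\<^esub> x') t"
  unfolding slice_LL_def slice_L_def
    lift_map[OF t L_vs vY tensor_vs[OF L_vs L_vs] vY vY comult_L lin_id slice_LL_bil[OF x x']]
  by (rule lift_cong[OF L_vs vY t]) (simp add: pair_mult_K x x')

text \<open>Slices separate tensors. Slicing multiplicativity, unitality and coassociativity of \<open>\<alpha>\<close>, together
  with the counit axiom, gives one condition each on the action.\<close>

theorem right_coaction_iff:
  assumes \<alpha>: "lin Y (T Y K) \<alpha>"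
  shows "right_coaction k K Y \<alpha> \<longleftrightarrow> left_module_algebra L Y (\<lambda>l y. slice_K Y l (\<alpha> y))"
proof -
  let ?act = "\<lambda>l y. slice_K Y l (\<alpha> y)"
  note a = lin_closed[OF \<alpha>]
  have TK: "unital_algebra k (T Y K)" by (rule tensor_unital_algebra[OF Y K])
  interpret TK: unital_algebra k "T Y K" by (rule TK)
  have 1: "\<alpha> (y \<otimes>\<^bsub>Y\<^esub> z) = \<alpha> y \<otimes>\<^bsub>T Y K\<^esub> \<alpha> z \<longleftrightarrow>
      (\<forall>l\<in>carrier L. ?act l (y \<otimes>\<^bsub>Y\<^esub> z) = lift Y (\<lambda>l1 l2. ?act l1 y \<otimes>\<^bsub>Y\<^esub> ?act l2 z) (comult L l))"
    if y: "y \<in> carrier Y" and z: "z \<in> carrier Y" for y z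
    unfolding slice_K_mult[OF a[OF y] a[OF z], symmetric]
    using slice_K_inj[OF vY a[OF Y.m_closed[OF y z]] TK.m_closed[OF a[OF y] a[OF z]]]
    by (auto simp: slice_K_mult[OF a[OF y] a[OF z], symmetric])
  have 2: "\<alpha> \<one>\<^bsub>Y\<^esub> = \<one>\<^bsub>T Y K\<^esub> \<longleftrightarrow> (\<forall>l\<in>carrier L. ?act l \<one>\<^bsub>Y\<^esub> = counit L l \<odot>\<^bsub>Y\<^esub> \<one>\<^bsub>Y\<^esub>)"
    using slice_K_inj[OF vY a[OF Y.one_closed] TK.one_closed] by (auto simp: slice_K_one)
  have 3: "tensor_map k (T Y K) K \<alpha> (\<lambda>x. x) (\<alpha> y)
        = tensor_assoc k Y K K (tensor_map k Y (T K K) (\<lambda>x. x) (comult K) (\<alpha> y)) \<longleftrightarrow>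
      (\<forall>l\<in>carrier L. \<forall>l'\<in>carrier L. ?act (l \<otimes>\<^bsub>L\<^esub> l') y = ?act l (?act l' y))" (is "?l = ?r \<longleftrightarrow> ?R")
    if y: "y \<in> carrier Y" for y
  proof -
    note ay = a[OF y]
    have cl: "?l \<in> carrier (T (T Y K) K)" "?r \<in> carrier (T (T Y K) K)"
      by (rule map_closed[OF ay vY K_vs vYK K_vs \<alpha> lin_id])
        (rule lin_closed[OF assoc_lin[OF vY K_vs K_vs]]
          map_closed[OF ay vY K_vs vY tensor_vs[OF K_vs K_vs] lin_id comult_K])+
    have l: "slice_K Y l (slice_K (T Y K) l' ?l) = ?act l (?act l' y)" if "l' \<in> carrier L" for l l'
      by (simp only: slice_K_map[OF \<alpha> vYK ay that])
    have r: "slice_K Y l (slice_K (T Y K) l' ?r) = ?act (l \<otimes>\<^bsub>L\<^esub> l') y"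
      if "l \<in> carrier L" "l' \<in> carrier L" for l l'
      by (rule slice_K_comult[OF ay that])
    have "?l = ?r" if R: ?R
    proof (rule slice_K_inj[OF vYK cl], rule slice_K_inj[OF vY])
      show "slice_K (T Y K) l ?l \<in> carrier (T Y K)" "slice_K (T Y K) l ?r \<in> carrier (T Y K)"
        if "l \<in> carrier L" for l by (rule slice_K_closed[OF cl(1) vYK that] slice_K_closed[OF cl(2) vYK that])+
      show "slice_K Y l (slice_K (T Y K) l' ?l) = slice_K Y l (slice_K (T Y K) l' ?r)"
        if "l' \<in> carrier L" "l \<in> carrier L" for l l'
        unfolding l[OF that(1)] r[OF that(2,1)] using R that by simp
    qed
    moreover have ?R if "?l = ?r"
      using l r that by metis
    ultimately show ?thesis by blast
  qed
  have 4: "lift Y (\<lambda>y0 h. counit K h \<odot>\<^bsub>Y\<^esub> y0) (\<alpha> y) = ?act \<one>\<^bsub>L\<^esub> y" if "y \<in> carrier Y" for y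
    unfolding slice_K_def by (rule lift_cong[OF vY K_vs a[OF that]]) (simp add: counit_K)
  show ?thesis
    unfolding right_coaction_def left_module_algebra_def algebra_hom_iff
    using \<alpha> 1 2 3 4 by auto
qed

theorem left_coaction_iff:
  assumes \<beta>: "lin Y (T L Y) \<beta>"
  shows "left_coaction k L Y \<beta> \<longleftrightarrow> right_module_algebra K Y (\<lambda>y x. slice_L Y x (\<beta> y))"
proof -
  let ?act = "\<lambda>y x. slice_L Y x (\<beta> y)"
  note a = lin_closed[OF \<beta>]
  have TK: "unital_algebra k (T L Y)" by (rule tensor_unital_algebra[OF L Y])
  interpret TK: unital_algebra k "T L Y" by (rule TK)
  have 1: "\<beta> (y \<otimes>\<^bsub>Y\<^esub> z) = \<beta> y \<otimes>\<^bsub>T L Y\<^esub> \<beta> z \<longleftrightarrow>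
      (\<forall>x\<in>carrier K. ?act (y \<otimes>\<^bsub>Y\<^esub> z) x = lift Y (\<lambda>x1 x2. ?act y x1 \<otimes>\<^bsub>Y\<^esub> ?act z x2) (comult K x))"
    if y: "y \<in> carrier Y" and z: "z \<in> carrier Y" for y z
    using slice_L_inj[OF vY a[OF Y.m_closed[OF y z]] TK.m_closed[OF a[OF y] a[OF z]]]
    by (auto simp: slice_L_mult[OF a[OF y] a[OF z], symmetric])
  have 2: "\<beta> \<one>\<^bsub>Y\<^esub> = \<one>\<^bsub>T L Y\<^esub> \<longleftrightarrow> (\<forall>x\<in>carrier K. ?act \<one>\<^bsub>Y\<^esub> x = counit K x \<odot>\<^bsub>Y\<^esub> \<one>\<^bsub>Y\<^esub>)"
    using slice_L_inj[OF vY a[OF Y.one_closed] TK.one_closed] by (auto simp: slice_L_one)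
  have 3: "tensor_assoc k L L Y (tensor_map k L (T L Y) (\<lambda>x. x) \<beta> (\<beta> y))
        = tensor_map k (T L L) Y (comult L) (\<lambda>x. x) (\<beta> y) \<longleftrightarrow>
      (\<forall>x\<in>carrier K. \<forall>x'\<in>carrier K. ?act y (x \<otimes>\<^bsub>K\<^esub> x') = ?act (?act y x) x')" (is "?l = ?r \<longleftrightarrow> ?R")
    if y: "y \<in> carrier Y" for y
  proof -
    note ay = a[OF y]
    have m: "tensor_map k L (T L Y) (\<lambda>x. x) \<beta> (\<beta> y) \<in> carrier (T L (T L Y))"
      by (rule map_closed[OF ay L_vs vY L_vs vLY lin_id \<beta>])
    have cl: "?l \<in> carrier (T (T L L) Y)" "?r \<in> carrier (T (T L L) Y)"
      by (rule lin_closed[OF assoc_lin[OF L_vs L_vs vY] m])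
        (rule map_closed[OF ay L_vs vY tensor_vs[OF L_vs L_vs] vY comult_L lin_id])
    have l: "slice_LL x x' ?l = ?act (?act y x) x'" if "x \<in> carrier K" "x' \<in> carrier K" for x x'
      by (simp only: slice_LL_assoc[OF that m] slice_L_map[OF \<beta> vLY ay that(1)])
    have r: "slice_LL x x' ?r = ?act y (x \<otimes>\<^bsub>K\<^esub> x')" if "x \<in> carrier K" "x' \<in> carrier K" for x x'
      by (rule slice_LL_comult[OF that ay])
    have "?l = ?r" if R: ?R
      by (rule slice_LL_inj[OF cl]) (use R in \<open>simp add: l r\<close>)
    moreover have ?R if "?l = ?r"
      using l r that by metis
    ultimately show ?thesis by blast
  qed
  have 4: "lift Y (\<lambda>h y0. counit L h \<odot>\<^bsub>Y\<^esub> y0) (\<beta> y) = ?act y \<one>\<^bsub>K\<^esub>" if "y \<in> carrier Y" for y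
    unfolding slice_L_def by (rule lift_cong[OF L_vs vY a[OF that]]) (simp add: counit_L)
  show ?thesis
    unfolding left_coaction_def right_module_algebra_def algebra_hom_iff
    using \<beta> 1 2 3 4 by auto
qed

end

end

section \<open>The canonical element and the Yetter--Drinfeld condition\<close>

context ground
begin

lemma flip_lin [multilin]: "\<lbrakk>vs A; vs B\<rbrakk> \<Longrightarrow> lin (T A B) (T B A) (tensor_flip k A B)"
  unfolding tensor_flip_def by (rule lift_lin) (assumption | rule multilin)+

lemma flip_pt: "\<lbrakk>vs A; vs B; a \<in> carrier A; b \<in> carrier B\<rbrakk> \<Longrightarrow> tensor_flip k A B (pt A B a b) = pt B A b a"
  unfolding tensor_flip_def by (rule lift_pt) (assumption | rule multilin)+

lemma flip_flip:
  assumes A: "vs A" and B: "vs B" and t: "t \<in> carrier (T A B)"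
  shows "tensor_flip k B A (tensor_flip k A B t) = t"
  by (rule tensor_ext[OF A B lin_compose[OF flip_lin[OF B A] flip_lin[OF A B]] lin_id _ t])
    (simp add: flip_pt A B)

context
  fixes A :: "('k, 'a, 'n) module_scheme" and B :: "('k, 'b, 'p) module_scheme"
    and C :: "('k, 'c, 'q) module_scheme"
  assumes A: "unital_algebra k A" and B: "unital_algebra k B" and C: "unital_algebra k C"
begin

private lemmas vs = unital_algebra_vs[OF A] unital_algebra_vs[OF B] unital_algebra_vs[OF C]
private lemmas vAB = tensor_vs[OF vs(1,2)]

interpretation B: unital_algebra k B by (rule B)

lemma leg13_bilinear: "bil A C (T (T A B) C) (\<lambda>a c. pt (T A B) C (pt A B a \<one>\<^bsub>B\<^esub>) c)"
  by (assumption | rule multilin A B C vs)+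

lemma leg13_lin: "lin (T A C) (T (T A B) C) (tensor_leg13 k A B C)"
  unfolding tensor_leg13_def by (rule lift_lin[OF vs(1,3) tensor_vs[OF vAB vs(3)] leg13_bilinear])

lemma leg13_pt:
  "\<lbrakk>a \<in> carrier A; c \<in> carrier C\<rbrakk> \<Longrightarrow> tensor_leg13 k A B C (pt A C a c) = pt (T A B) C (pt A B a \<one>\<^bsub>B\<^esub>) c"
  unfolding tensor_leg13_def by (rule lift_pt[OF vs(1,3) tensor_vs[OF vAB vs(3)] leg13_bilinear])

lemma leg13_one: "tensor_leg13 k A B C \<one>\<^bsub>T A C\<^esub> = \<one>\<^bsub>T (T A B) C\<^esub>"
  by (simp add: tensor_simps(5)[OF vs(1,3)] tensor_simps(5)[OF vs(1,2)] tensor_simps(5)[OF vAB vs(3)]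
      leg13_pt one_closed_algebra[OF A] one_closed_algebra[OF C])

lemma leg13_mult:
  assumes s: "s \<in> carrier (T A C)" and t: "t \<in> carrier (T A C)"
  shows "tensor_leg13 k A B C (s \<otimes>\<^bsub>T A C\<^esub> t) = tensor_leg13 k A B C s \<otimes>\<^bsub>T (T A B) C\<^esub> tensor_leg13 k A B C t"
proof -
  note pr = unital_algebra_product[OF A] unital_algebra_product[OF B] unital_algebra_product[OF C]
  note pAB = tensor_product_bilinear[OF pr(1,2)]
  note pAC = tensor_product_bilinear[OF pr(1,3)]
  note pABC = tensor_product_bilinear[OF pAB pr(3)]
  have lg: "lin X (T (T A B) C) (\<lambda>x. tensor_leg13 k A B C (f x))" if "lin X (T A C) f" for f X
    by (rule lin_compose[OF leg13_lin that])
  have lc: "tensor_leg13 k A B C u \<in> carrier (T (T A B) C)" if "u \<in> carrier (T A C)" for u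
    by (rule lin_closed[OF leg13_lin that])
  have 1: "tensor_leg13 k A B C (pt A C a c \<otimes>\<^bsub>T A C\<^esub> pt A C a' c')
      = tensor_leg13 k A B C (pt A C a c) \<otimes>\<^bsub>T (T A B) C\<^esub> tensor_leg13 k A B C (pt A C a' c')"
    if "a \<in> carrier A" "c \<in> carrier C" "a' \<in> carrier A" "c' \<in> carrier C" for a c a' c'
    using that
    by (simp add: tensor_mult_pt[OF pr(1,3)] tensor_mult_pt[OF pr(1,2)] tensor_mult_pt[OF pAB pr(3)] leg13_pt
        mult_closed[OF pr(1)] mult_closed[OF pr(3)] pt_closed[OF vs(1,2)])
  have 2: "tensor_leg13 k A B C (pt A C a c \<otimes>\<^bsub>T A C\<^esub> t)
      = tensor_leg13 k A B C (pt A C a c) \<otimes>\<^bsub>T (T A B) C\<^esub> tensor_leg13 k A B C t"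
    if "a \<in> carrier A" "c \<in> carrier C" for a c
    by (rule tensor_ext[OF vs(1,3) _ _ _ t])
      (assumption | rule 1 lg lin_id lin_mult_right pAC pABC lc pt_closed[OF vs(1,3)] that)+
  show ?thesis
    by (rule tensor_ext[OF vs(1,3) _ _ _ s])
      (assumption | rule 2 lg lin_id lin_mult_left pAC pABC lc t)+
qed

end

lemma basis_dual_system:
  assumes V: "vs V" and fin: "finite B" and basis: "vectorspace.basis k V B"
    and f: "\<And>b. b \<in> B \<Longrightarrow> lin V (scalars k) (f b)"
    and delta: "\<And>b b'. \<lbrakk>b \<in> B; b' \<in> B\<rbrakk> \<Longrightarrow> f b' b = (if b = b' then \<one> else \<zero>)"
  shows "dual_system V B (\<lambda>b. b) f"
proof -
  interpret V: vectorspace k V by (rule V)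
  have BV: "B \<subseteq> carrier V" and gen: "V.span B = carrier V"
    using basis by (auto simp: V.basis_def)
  have "(\<Oplus>\<^bsub>V\<^esub>b\<in>B. f b v \<odot>\<^bsub>V\<^esub> b) = v" if v: "v \<in> carrier V" for v
  proof -
    have "v \<in> {V.lincomb a B |a. a \<in> B \<rightarrow> carrier k}"
      unfolding V.finite_span[OF fin BV, symmetric] gen by (rule v)
    then obtain a where a: "a \<in> B \<rightarrow> carrier k" and v_eq: "V.lincomb a B = v" by blast
    have ab: "(\<lambda>b. a b \<odot>\<^bsub>V\<^esub> b) \<in> B \<rightarrow> carrier V" using a BV by auto
    have "f b' v = a b'" if b': "b' \<in> B" for b'
    proof -
      have "f b' v = (\<Oplus>\<^bsub>scalars k\<^esub>b\<in>B. f b' (a b \<odot>\<^bsub>V\<^esub> b))"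
        unfolding v_eq[symmetric] V.lincomb_def
        by (rule lin_finsum[OF V scalars_vs f[OF b'] fin ab])
      also have "\<dots> = (\<Oplus>\<^bsub>scalars k\<^esub>b\<in>B. if b' = b then a b else \<zero>)"
      proof (rule finsum_cong_weak)
        fix b assume b: "b \<in> B"
        then have "a b \<in> carrier k" "b \<in> carrier V" using a BV by auto
        then show "f b' (a b \<odot>\<^bsub>V\<^esub> b) = (if b' = b then a b else \<zero>)"
          using lin_smult[OF f[OF b']] delta[OF b b'] by auto
      qed
      also have "\<dots> = (\<Oplus>b\<in>B. if b' = b then a b else \<zero>)"
        by (simp add: finsum_def finprod_def)
      also have "\<dots> = a b'"
        using a by (intro finsum_singleton[OF b' fin]) auto
      finally show ?thesis .
    qed
    then have "(\<Oplus>\<^bsub>V\<^esub>b\<in>B. f b v \<odot>\<^bsub>V\<^esub> b) = (\<Oplus>\<^bsub>V\<^esub>b\<in>B. a b \<odot>\<^bsub>V\<^esub> b)"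
      by (intro finsum_cong_weak) simp
    also have "\<dots> = v" unfolding v_eq[symmetric] V.lincomb_def ..
    finally show ?thesis .
  qed
  then show ?thesis using fin BV f by (auto simp: dual_system_def)
qed

end

context dual_pair
begin

text \<open>The bilinear form on \<open>K \<times> L\<close> given by an element of \<open>L \<otimes> K\<close>: the tensor \<open>l' \<otimes> x'\<close> is
  sent to \<open>p(x, l') p(x', l)\<close>.\<close>

definition eval_LK where "eval_LK x l s = p (slice_L K x s) l"

lemma eval_LK_lin [multilin]:
  "\<lbrakk>lin X (T L K) f; x \<in> carrier K; l \<in> carrier L\<rbrakk> \<Longrightarrow> lin X (scalars k) (\<lambda>z. eval_LK x l (f z))"
  unfolding eval_LK_def by (assumption | rule multilin)+

lemma eval_LK_closed [multilin]:
  "\<lbrakk>s \<in> carrier (T L K); x \<in> carrier K; l \<in> carrier L\<rbrakk> \<Longrightarrow> eval_LK x l s \<in> carrier k"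
  unfolding eval_LK_def by (assumption | rule multilin)+

lemma eval_LK_left [multilin]:
  "\<lbrakk>lin X K f; s \<in> carrier (T L K); l \<in> carrier L\<rbrakk> \<Longrightarrow> lin X (scalars k) (\<lambda>x. eval_LK (f x) l s)"
  unfolding eval_LK_def by (assumption | rule multilin)+

lemma eval_LK_right [multilin]:
  "\<lbrakk>lin X L f; s \<in> carrier (T L K); x \<in> carrier K\<rbrakk> \<Longrightarrow> lin X (scalars k) (\<lambda>l. eval_LK x (f l) s)"
  unfolding eval_LK_def by (assumption | rule multilin)+

lemma eval_LK_pt:
  "\<lbrakk>x \<in> carrier K; l \<in> carrier L; x' \<in> carrier K; l' \<in> carrier L\<rbrakk> \<Longrightarrow>
    eval_LK x l (pt L K l' x') = p x l' \<otimes> p x' l"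
  using lin_smult[OF p_left[OF lin_id]] by (simp add: eval_LK_def slice_L_pt[OF K_vs] p_closed)

lemma pair_inj_K:
  assumes "x \<in> carrier K" "x' \<in> carrier K" "\<And>l. l \<in> carrier L \<Longrightarrow> p x l = p x' l"
  shows "x = x'"
proof -
  obtain B d where B: "d \<in> B \<rightarrow> carrier L" "dual_system K B (\<lambda>b. b) (\<lambda>b x. p x (d b))"
    using dual_bases by blast
  have "(\<Oplus>\<^bsub>K\<^esub>b\<in>B. p x (d b) \<odot>\<^bsub>K\<^esub> b) = (\<Oplus>\<^bsub>K\<^esub>b\<in>B. p x' (d b) \<odot>\<^bsub>K\<^esub> b)"
  proof (rule finsum_cong_weak)
    fix b assume "b \<in> B"
    then have "p x (d b) = p x' (d b)" using B(1) by (intro assms(3)) blast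
    then show "p x (d b) \<odot>\<^bsub>K\<^esub> b = p x' (d b) \<odot>\<^bsub>K\<^esub> b" by (simp only:)
  qed
  then show ?thesis using B(2) assms(1,2) by (simp add: dual_system_def)
qed

lemma eval_LK_inj:
  assumes s: "s \<in> carrier (T L K)" "s' \<in> carrier (T L K)"
    and eq: "\<And>x l. \<lbrakk>x \<in> carrier K; l \<in> carrier L\<rbrakk> \<Longrightarrow> eval_LK x l s = eval_LK x l s'"
  shows "s = s'"
  by (rule slice_L_inj[OF K_vs s], rule pair_inj_K)
    (use eq s in \<open>auto simp: eval_LK_def intro!: slice_L_closed K_vs\<close>)

text \<open>Products in \<open>L \<otimes> K\<close> become convolutions of bilinear forms.\<close>

lemma eval_LK_mult:
  assumes s: "s \<in> carrier (T L K)" and t: "t \<in> carrier (T L K)" and x: "x \<in> carrier K" and l: "l \<in> carrier L"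
  shows "eval_LK x l (s \<otimes>\<^bsub>T L K\<^esub> t) = lift (scalars k) (\<lambda>x1 x2. lift (scalars k)
    (\<lambda>l1 l2. eval_LK x1 l1 s \<otimes> eval_LK x2 l2 t) (comult L l)) (comult K x)"
proof -
  have b: "bil K K K (\<lambda>x1 x2. slice_L K x1 s \<otimes>\<^bsub>K\<^esub> slice_L K x2 t)"
    by (assumption | rule multilin s t)+
  have "eval_LK x l (s \<otimes>\<^bsub>T L K\<^esub> t)
      = p (lift K (\<lambda>x1 x2. slice_L K x1 s \<otimes>\<^bsub>K\<^esub> slice_L K x2 t) (comult K x)) l"
    unfolding eval_LK_def slice_L_mult[OF K s t x] ..
  also have "\<dots> = lift (scalars k) (\<lambda>x1 x2. p (slice_L K x1 s \<otimes>\<^bsub>K\<^esub> slice_L K x2 t) l) (comult K x)"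
    by (rule lift_hom[OF p_left[OF lin_id l] comult_K_closed[OF x] K_vs K_vs K_vs scalars_vs b])
  also have "\<dots> = lift (scalars k) (\<lambda>x1 x2. lift (scalars k)
    (\<lambda>l1 l2. eval_LK x1 l1 s \<otimes> eval_LK x2 l2 t) (comult L l)) (comult K x)"
    unfolding eval_LK_def
    by (rule lift_cong[OF K_vs K_vs comult_K_closed[OF x] pair_mult_K[OF slice_L_closed[OF s K_vs] slice_L_closed[OF t K_vs] l]])
  finally show ?thesis .
qed

lemma eval_LK_one: "\<lbrakk>x \<in> carrier K; l \<in> carrier L\<rbrakk> \<Longrightarrow> eval_LK x l \<one>\<^bsub>T L K\<^esub> = p x \<one>\<^bsub>L\<^esub> \<otimes> p \<one>\<^bsub>K\<^esub> l"
  unfolding tensor_simps(5)[OF L_vs K_vs]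
  by (rule eval_LK_pt) (assumption | rule multilin)+

text \<open>For dual bases \<open>b\<close>, \<open>d\<close> the form \<open>\<phi>\<close> is represented by \<open>\<Sum> d(b) \<otimes> Q(b)\<close>, where
  \<open>Q(b) \<in> K\<close> represents \<open>\<phi>(b, -)\<close>.\<close>

lemma bilinear_form_representable:
  assumes \<phi>: "bil K L (scalars k) \<phi>"
  obtains s where "s \<in> carrier (T L K)" "\<And>x l. \<lbrakk>x \<in> carrier K; l \<in> carrier L\<rbrakk> \<Longrightarrow> eval_LK x l s = \<phi> x l"
proof -
  interpret Kv: vectorspace k K by (rule K_vs)
  interpret TLK: vectorspace k "T L K" by (rule tensor_vs[OF L_vs K_vs])
  obtain B d where B: "finite B" "vectorspace.basis k K B" "d \<in> B \<rightarrow> carrier L"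
    "dual_system K B (\<lambda>b. b) (\<lambda>b x. p x (d b))" "dual_system L B d p"
    using dual_bases by blast
  have BK: "b \<in> carrier K" if "b \<in> B" for b using that B(2) by (auto simp: Kv.basis_def)
  have dL: "d b \<in> carrier L" if "b \<in> B" for b using that B(3) by auto
  have \<phi>_closed: "\<phi> x l \<in> carrier k" if "x \<in> carrier K" "l \<in> carrier L" for x l
    using bilinear_closed[OF \<phi> that] by simp
  define Q where "Q b = (\<Oplus>\<^bsub>K\<^esub>c\<in>B. \<phi> b (d c) \<odot>\<^bsub>K\<^esub> c)" for b
  have cK: "(\<lambda>c. \<phi> b (d c) \<odot>\<^bsub>K\<^esub> c) \<in> B \<rightarrow> carrier K" if "b \<in> carrier K" for b
    using \<phi>_closed[OF that dL] BK by auto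
  have Q_closed: "Q b \<in> carrier K" if "b \<in> carrier K" for b
    unfolding Q_def by (rule Kv.finsum_closed[OF cK[OF that]])
  have pQ: "p (Q b) l = \<phi> b l" if b: "b \<in> carrier K" and l: "l \<in> carrier L" for b l
  proof -
    have "p (Q b) l = (\<Oplus>\<^bsub>scalars k\<^esub>c\<in>B. p (\<phi> b (d c) \<odot>\<^bsub>K\<^esub> c) l)"
      unfolding Q_def by (rule lin_finsum[OF K_vs scalars_vs p_left[OF lin_id l] B(1) cK[OF b]])
    also have "\<dots> = (\<Oplus>\<^bsub>scalars k\<^esub>c\<in>B. \<phi> b (p c l \<odot>\<^bsub>L\<^esub> d c))"
      by (rule finsum_cong_weak)
        (simp add: lin_smult[OF p_left[OF lin_id l]] lin_smult[OF bilinear_right[OF \<phi> b]] \<phi>_closed[OF b] BK dL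
          p_closed l m_comm)
    also have "\<dots> = \<phi> b (\<Oplus>\<^bsub>L\<^esub>c\<in>B. p c l \<odot>\<^bsub>L\<^esub> d c)"
      by (rule lin_finsum[OF L_vs scalars_vs bilinear_right[OF \<phi> b] B(1), symmetric])
        (intro Pi_I smult_closed[OF L_vs p_closed[OF BK l] dL])
    finally show ?thesis using B(5) l by (simp add: dual_system_def)
  qed
  define s where "s = (\<Oplus>\<^bsub>T L K\<^esub>b\<in>B. pt L K (d b) (Q b))"
  have sB: "(\<lambda>b. pt L K (d b) (Q b)) \<in> B \<rightarrow> carrier (T L K)"
    by (intro Pi_I pt_closed[OF L_vs K_vs] dL Q_closed[OF BK])
  have "s \<in> carrier (T L K)" unfolding s_def by (rule TLK.finsum_closed[OF sB])
  moreover have "eval_LK x l s = \<phi> x l" if x: "x \<in> carrier K" and l: "l \<in> carrier L" for x l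
  proof -
    have "eval_LK x l s = (\<Oplus>\<^bsub>scalars k\<^esub>b\<in>B. eval_LK x l (pt L K (d b) (Q b)))"
      unfolding s_def
      by (rule lin_finsum[OF tensor_vs[OF L_vs K_vs] scalars_vs eval_LK_lin[OF lin_id x l] B(1) sB])
    also have "\<dots> = (\<Oplus>\<^bsub>scalars k\<^esub>b\<in>B. \<phi> (p x (d b) \<odot>\<^bsub>K\<^esub> b) l)"
      by (rule finsum_cong_weak)
        (simp add: eval_LK_pt x l dL Q_closed BK pQ lin_smult[OF bilinear_left[OF \<phi> l]] p_closed)
    also have "\<dots> = \<phi> (\<Oplus>\<^bsub>K\<^esub>b\<in>B. p x (d b) \<odot>\<^bsub>K\<^esub> b) l"
      by (rule lin_finsum[OF K_vs scalars_vs bilinear_left[OF \<phi> l] B(1), symmetric])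
        (intro Pi_I smult_closed[OF K_vs p_closed[OF x dL] BK])
    finally show ?thesis using B(4) x by (simp add: dual_system_def)
  qed
  ultimately show ?thesis by (rule that)
qed

text \<open>The flipped canonical element represents the form \<open>p\<close>. Since representing elements are unique,
  this also shows that the element does not depend on the basis, so that its definite description
  denotes it.\<close>

lemma canonical_element_flip:
  shows "tensor_flip k K L (canonical_element k K L p) \<in> carrier (T L K)"
    and "\<lbrakk>x \<in> carrier K; l \<in> carrier L\<rbrakk> \<Longrightarrow>
      eval_LK x l (tensor_flip k K L (canonical_element k K L p)) = p x l"
proof -
  interpret Kv: vectorspace k K by (rule K_vs)
  interpret TKL: vectorspace k "T K L" by (rule tensor_vs[OF K_vs L_vs])
  note flip_closed = lin_closed[OF flip_lin[OF K_vs L_vs]]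
  define P where "P u \<longleftrightarrow> (\<exists>B d. finite B \<and> vectorspace.basis k K B \<and> d \<in> B \<rightarrow> carrier L \<and>
        (\<forall>b\<in>B. \<forall>b'\<in>B. p b (d b') = (if b = b' then \<one> else \<zero>)) \<and>
        u = (\<Oplus>\<^bsub>T K L\<^esub>b\<in>B. pt K L b (d b)))" for u
  have repr: "u \<in> carrier (T K L)"
    "\<And>x l. \<lbrakk>x \<in> carrier K; l \<in> carrier L\<rbrakk> \<Longrightarrow> eval_LK x l (tensor_flip k K L u) = p x l" if Pu: "P u" for u
  proof -
    obtain B d where X: "finite B \<and> vectorspace.basis k K B \<and> d \<in> B \<rightarrow> carrier L \<and>
        (\<forall>b\<in>B. \<forall>b'\<in>B. p b (d b') = (if b = b' then \<one> else \<zero>)) \<and>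
        u = (\<Oplus>\<^bsub>T K L\<^esub>b\<in>B. pt K L b (d b))"
      using Pu[unfolded P_def] by (elim exE) (rule that)
    note B = X[THEN conjunct1] X[THEN conjunct2, THEN conjunct1] X[THEN conjunct2, THEN conjunct2, THEN conjunct1]
      X[THEN conjunct2, THEN conjunct2, THEN conjunct2, THEN conjunct1]
    note u = X[THEN conjunct2, THEN conjunct2, THEN conjunct2, THEN conjunct2]
    have BK: "b \<in> carrier K" if "b \<in> B" for b using that B(2) by (auto simp: Kv.basis_def)
    have dL: "d b \<in> carrier L" if "b \<in> B" for b using that B(3) by auto
    have sys: "dual_system K B (\<lambda>b. b) (\<lambda>b x. p x (d b))"
      by (rule basis_dual_system[OF K_vs B(1,2) p_left[OF lin_id dL]]) (assumption | rule B(4)[rule_format])+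
    have cl: "(\<lambda>b. pt K L b (d b)) \<in> B \<rightarrow> carrier (T K L)"
      by (intro Pi_I pt_closed[OF K_vs L_vs] BK dL)
    then show "u \<in> carrier (T K L)" unfolding u by (rule TKL.finsum_closed)
    fix x l assume x: "x \<in> carrier K" and l: "l \<in> carrier L"
    have "eval_LK x l (tensor_flip k K L u) = (\<Oplus>\<^bsub>scalars k\<^esub>b\<in>B. eval_LK x l (tensor_flip k K L (pt K L b (d b))))"
      unfolding u
      by (rule lin_finsum[OF tensor_vs[OF K_vs L_vs] scalars_vs eval_LK_lin[OF flip_lin[OF K_vs L_vs] x l] B(1) cl])
    also have "\<dots> = (\<Oplus>\<^bsub>scalars k\<^esub>b\<in>B. p (p x (d b) \<odot>\<^bsub>K\<^esub> b) l)"
      by (rule finsum_cong_weak)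
        (simp add: flip_pt[OF K_vs L_vs] eval_LK_pt x l dL BK lin_smult[OF p_left[OF lin_id l]] p_closed)
    also have "\<dots> = p (\<Oplus>\<^bsub>K\<^esub>b\<in>B. p x (d b) \<odot>\<^bsub>K\<^esub> b) l"
      by (rule lin_finsum[OF K_vs scalars_vs p_left[OF lin_id l] B(1), symmetric])
        (intro Pi_I smult_closed[OF K_vs p_closed[OF x dL] BK])
    finally show "eval_LK x l (tensor_flip k K L u) = p x l"
      using sys x by (simp add: dual_system_def)
  qed
  obtain B d where "finite B" "vectorspace.basis k K B" "d \<in> B \<rightarrow> carrier L"
      "\<forall>b\<in>B. \<forall>b'\<in>B. p b (d b') = (if b = b' then \<one> else \<zero>)"
    using dual_bases by blast
  then have ex: "P (\<Oplus>\<^bsub>T K L\<^esub>b\<in>B. pt K L b (d b))"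
    unfolding P_def by (intro exI[of _ B] exI[of _ d]) simp
  have unique: "u = u'" if "P u" "P u'" for u u'
  proof -
    have "tensor_flip k K L u = tensor_flip k K L u'"
      by (rule eval_LK_inj[OF flip_closed[OF repr(1)[OF that(1)]] flip_closed[OF repr(1)[OF that(2)]]])
        (simp add: repr(2) that)
    then have "tensor_flip k L K (tensor_flip k K L u) = tensor_flip k L K (tensor_flip k K L u')"
      by (rule arg_cong)
    then show ?thesis
      unfolding flip_flip[OF K_vs L_vs repr(1)[OF that(1)]] flip_flip[OF K_vs L_vs repr(1)[OF that(2)]] .
  qed
  have can: "canonical_element k K L p = The P"
    unfolding canonical_element_def P_def[abs_def] ..
  have P: "P (canonical_element k K L p)"
    unfolding can by (rule theI[of P, OF ex unique[OF _ ex]])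
  show "tensor_flip k K L (canonical_element k K L p) \<in> carrier (T L K)"
    by (rule flip_closed[OF repr(1)[OF P]])
  show "\<lbrakk>x \<in> carrier K; l \<in> carrier L\<rbrakk> \<Longrightarrow> eval_LK x l (tensor_flip k K L (canonical_element k K L p)) = p x l"
    by (rule repr(2)[OF P])
qed

text \<open>The inverse is the element that represents \<open>q\<close>.\<close>

lemma canonical_element_inverse:
  obtains v where "v \<in> carrier (T L K)"
    "tensor_flip k K L (canonical_element k K L p) \<otimes>\<^bsub>T L K\<^esub> v = \<one>\<^bsub>T L K\<^esub>"
    "v \<otimes>\<^bsub>T L K\<^esub> tensor_flip k K L (canonical_element k K L p) = \<one>\<^bsub>T L K\<^esub>"
    "inv\<^bsub>T L K\<^esub> (tensor_flip k K L (canonical_element k K L p)) = v"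
proof -
  let ?u = "tensor_flip k K L (canonical_element k K L p)"
  interpret LK: unital_algebra k "T L K" by (rule tensor_unital_algebra[OF L K])
  note u = canonical_element_flip
  obtain v where v: "v \<in> carrier (T L K)" "\<And>x l. \<lbrakk>x \<in> carrier K; l \<in> carrier L\<rbrakk> \<Longrightarrow> eval_LK x l v = q x l"
    using bilinear_form_representable[OF q_bilinear] by blast
  have 1: "?u \<otimes>\<^bsub>T L K\<^esub> v = \<one>\<^bsub>T L K\<^esub>"
  proof (rule eval_LK_inj[OF LK.m_closed[OF u(1) v(1)] LK.one_closed])
    fix x l assume x: "x \<in> carrier K" and l: "l \<in> carrier L"
    have "eval_LK x l (?u \<otimes>\<^bsub>T L K\<^esub> v) = lift (scalars k) (\<lambda>x1 x2. lift (scalars k)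
        (\<lambda>l1 l2. p x1 l1 \<otimes> q x2 l2) (comult L l)) (comult K x)"
      unfolding eval_LK_mult[OF u(1) v(1) x l]
      by (intro lift_cong[OF K_vs K_vs comult_K_closed[OF x]] lift_cong[OF L_vs L_vs comult_L_closed[OF l]])
        (simp add: u(2) v(2))
    then show "eval_LK x l (?u \<otimes>\<^bsub>T L K\<^esub> v) = eval_LK x l \<one>\<^bsub>T L K\<^esub>"
      by (simp add: p_q eval_LK_one x l)
  qed
  have 2: "v \<otimes>\<^bsub>T L K\<^esub> ?u = \<one>\<^bsub>T L K\<^esub>"
  proof (rule eval_LK_inj[OF LK.m_closed[OF v(1) u(1)] LK.one_closed])
    fix x l assume x: "x \<in> carrier K" and l: "l \<in> carrier L"
    have "eval_LK x l (v \<otimes>\<^bsub>T L K\<^esub> ?u) = lift (scalars k) (\<lambda>x1 x2. lift (scalars k)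
        (\<lambda>l1 l2. q x1 l1 \<otimes> p x2 l2) (comult L l)) (comult K x)"
      unfolding eval_LK_mult[OF v(1) u(1) x l]
      by (intro lift_cong[OF K_vs K_vs comult_K_closed[OF x]] lift_cong[OF L_vs L_vs comult_L_closed[OF l]])
        (simp add: u(2) v(2))
    then show "eval_LK x l (v \<otimes>\<^bsub>T L K\<^esub> ?u) = eval_LK x l \<one>\<^bsub>T L K\<^esub>"
      by (simp add: q_p eval_LK_one x l)
  qed
  have "inv\<^bsub>T L K\<^esub> ?u = v"
    by (rule LK.inv_char[OF u(1) v(1) 1 2])
  with v(1) 1 2 show ?thesis by (rule that)
qed

context
  fixes Y :: "('k, 'y, 'r) module_scheme"
  assumes Y [multilin]: "unital_algebra k Y"
begin

interpretation Y: unital_algebra k Y by (rule Y)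

private lemmas Y_vs' = unital_algebra_vs[OF Y]
private lemmas LY = tensor_unital_algebra[OF L Y]
private lemmas LY_vs = unital_algebra_vs[OF LY]
private lemmas LYK = tensor_unital_algebra[OF LY K]

text \<open>Evaluation of the two outer legs of \<open>(L \<otimes> Y) \<otimes> K\<close>.\<close>

definition slice_LK where "slice_LK x l z = slice_L Y x (slice_K (T L Y) l z)"

lemma slice_LK_lin: "\<lbrakk>lin X (T (T L Y) K) f; x \<in> carrier K; l \<in> carrier L\<rbrakk> \<Longrightarrow> lin X Y (\<lambda>z. slice_LK x l (f z))"
  unfolding slice_LK_def by (intro slice_L_lin slice_K_lin LY_vs Y_vs')

lemma slice_LK_closed:
  "\<lbrakk>z \<in> carrier (T (T L Y) K); x \<in> carrier K; l \<in> carrier L\<rbrakk> \<Longrightarrow> slice_LK x l z \<in> carrier Y"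
  by (rule lin_closed[OF slice_LK_lin[OF lin_id]])

lemma slice_LK_inj:
  assumes z: "z \<in> carrier (T (T L Y) K)" "z' \<in> carrier (T (T L Y) K)"
    and eq: "\<And>x l. \<lbrakk>x \<in> carrier K; l \<in> carrier L\<rbrakk> \<Longrightarrow> slice_LK x l z = slice_LK x l z'"
  shows "z = z'"
  by (rule slice_K_inj[OF LY_vs z], rule slice_L_inj[OF Y_vs'])
    (use eq z in \<open>auto simp: slice_LK_def intro!: slice_K_closed LY_vs\<close>)

lemma slice_LK_mult:
  assumes z: "z \<in> carrier (T (T L Y) K)" and w: "w \<in> carrier (T (T L Y) K)"
    and x: "x \<in> carrier K" and l: "l \<in> carrier L"
  shows "slice_LK x l (z \<otimes>\<^bsub>T (T L Y) K\<^esub> w) = lift Y (\<lambda>l1 l2. lift Y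
    (\<lambda>x1 x2. slice_LK x1 l1 z \<otimes>\<^bsub>Y\<^esub> slice_LK x2 l2 w) (comult K x)) (comult L l)"
proof -
  have b: "bil L L (T L Y) (\<lambda>l1 l2. slice_K (T L Y) l1 z \<otimes>\<^bsub>T L Y\<^esub> slice_K (T L Y) l2 w)"
    by (assumption | rule multilin z w LY)+
  have "slice_LK x l (z \<otimes>\<^bsub>T (T L Y) K\<^esub> w)
      = lift Y (\<lambda>l1 l2. slice_L Y x (slice_K (T L Y) l1 z \<otimes>\<^bsub>T L Y\<^esub> slice_K (T L Y) l2 w)) (comult L l)"
    unfolding slice_LK_def slice_K_mult[OF LY z w l]
    by (rule lift_hom[OF slice_L_lin[OF lin_id Y_vs' x] comult_L_closed[OF l] L_vs L_vs LY_vs Y_vs' b])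
  also have "\<dots> = lift Y (\<lambda>l1 l2. lift Y
    (\<lambda>x1 x2. slice_LK x1 l1 z \<otimes>\<^bsub>Y\<^esub> slice_LK x2 l2 w) (comult K x)) (comult L l)"
    unfolding slice_LK_def
    by (rule lift_cong[OF L_vs L_vs comult_L_closed[OF l]])
      (rule slice_L_mult[OF Y slice_K_closed[OF z LY_vs] slice_K_closed[OF w LY_vs] x])
  finally show ?thesis .
qed

lemma slice_LK_pt:
  assumes "l' \<in> carrier L" "y \<in> carrier Y" "x' \<in> carrier K" "x \<in> carrier K" "l \<in> carrier L"
  shows "slice_LK x l (pt (T L Y) K (pt L Y l' y) x') = (p x l' \<otimes> p x' l) \<odot>\<^bsub>Y\<^esub> y"
proof -
  have ly: "pt L Y l' y \<in> carrier (T L Y)" by (rule pt_closed[OF L_vs Y_vs' assms(1,2)])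
  show ?thesis
    using lin_smult[OF slice_L_lin[OF lin_id Y_vs' assms(4)] p_closed[OF assms(3,5)] ly] assms
    by (simp add: slice_LK_def slice_K_pt[OF LY_vs ly] slice_L_pt[OF Y_vs'] Y.smult_assoc1[symmetric] p_closed m_comm)
qed

lemma slice_LK_leg13:
  assumes s: "s \<in> carrier (T L K)" and x: "x \<in> carrier K" and l: "l \<in> carrier L"
  shows "slice_LK x l (tensor_leg13 k L Y K s) = eval_LK x l s \<odot>\<^bsub>Y\<^esub> \<one>\<^bsub>Y\<^esub>"
proof (rule tensor_ext[OF L_vs K_vs _ _ _ s, where W=Y])
  show "lin (T L K) Y (\<lambda>s. slice_LK x l (tensor_leg13 k L Y K s))"
    by (rule slice_LK_lin[OF leg13_lin[OF L Y K] x l])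
  show "lin (T L K) Y (\<lambda>s. eval_LK x l s \<odot>\<^bsub>Y\<^esub> \<one>\<^bsub>Y\<^esub>)"
    by (assumption | rule multilin x l)+
  show "slice_LK x l (tensor_leg13 k L Y K (pt L K l' x')) = eval_LK x l (pt L K l' x') \<odot>\<^bsub>Y\<^esub> \<one>\<^bsub>Y\<^esub>"
    if "l' \<in> carrier L" "x' \<in> carrier K" for l' x'
    using that x l by (simp add: leg13_pt[OF L Y K] slice_LK_pt eval_LK_pt)
qed

lemma slice_LK_assoc:
  assumes v: "v \<in> carrier (T L (T Y K))" and x: "x \<in> carrier K" and l: "l \<in> carrier L"
  shows "slice_LK x l (tensor_assoc k L Y K v) = slice_K Y l (slice_L (T Y K) x v)"
proof (rule tensor_ext3_right[OF L_vs Y_vs' K_vs _ _ _ v, where W=Y])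
  note vYK = tensor_vs[OF Y_vs' K_vs]
  show "lin (T L (T Y K)) Y (\<lambda>v. slice_LK x l (tensor_assoc k L Y K v))"
    by (rule slice_LK_lin[OF assoc_lin[OF L_vs Y_vs' K_vs] x l])
  show "lin (T L (T Y K)) Y (\<lambda>v. slice_K Y l (slice_L (T Y K) x v))"
    by (rule slice_K_lin[OF slice_L_lin[OF lin_id vYK x] Y_vs' l])
  fix l' y x' assume l': "l' \<in> carrier L" and y: "y \<in> carrier Y" and x': "x' \<in> carrier K"
  have yx: "pt Y K y x' \<in> carrier (T Y K)" by (rule pt_closed[OF Y_vs' K_vs y x'])
  show "slice_LK x l (tensor_assoc k L Y K (pt L (T Y K) l' (pt Y K y x')))
      = slice_K Y l (slice_L (T Y K) x (pt L (T Y K) l' (pt Y K y x')))"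
    using lin_smult[OF slice_K_lin[OF lin_id Y_vs' l] p_closed[OF x l'] yx] x l y x' l'
    by (simp add: assoc_pt[OF L_vs Y_vs' K_vs] slice_LK_pt slice_L_pt[OF vYK yx] slice_K_pt[OF Y_vs']
        Y.smult_assoc1 p_closed)
qed

text \<open>With \<open>u\<close> the flipped canonical element in legs 1 and 3, the condition \<open>z = Ad(u\<^sup>-\<^sup>1)(w)\<close> is
  equivalent to \<open>uz = wu\<close>. Evaluating the outer legs turns \<open>u\<close> into the pairing, and \<open>z\<close>, \<open>w\<close>
  into the two orders of applying the actions.\<close>

theorem yetter_drinfeld_iff:
  assumes \<alpha>: "lin Y (T Y K) \<alpha>" and \<beta>: "lin Y (T L Y) \<beta>"
  shows "yetter_drinfeld_algebra k K L p Y \<alpha> \<beta> \<longleftrightarrow>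
    right_coaction k K Y \<alpha> \<and> left_coaction k L Y \<beta> \<and>
    (\<forall>y\<in>carrier Y. \<forall>x\<in>carrier K. \<forall>l\<in>carrier L.
      lift Y (\<lambda>l1 l2. lift Y (\<lambda>x1 x2. p x1 l1 \<odot>\<^bsub>Y\<^esub> slice_K Y l2 (\<alpha> (slice_L Y x2 (\<beta> y))))
        (comult K x)) (comult L l)
      = lift Y (\<lambda>l1 l2. lift Y (\<lambda>x1 x2. p x2 l2 \<odot>\<^bsub>Y\<^esub> slice_L Y x1 (\<beta> (slice_K Y l1 (\<alpha> y))))
        (comult K x)) (comult L l))"
proof -
  let ?u = "tensor_flip k K L (canonical_element k K L p)" and ?M = "T (T L Y) K"
  let ?leg = "tensor_leg13 k L Y K"
  interpret M: unital_algebra k ?M by (rule LYK)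
  note vYK = tensor_vs[OF Y_vs' K_vs]
  note u = canonical_element_flip
  obtain v where v: "v \<in> carrier (T L K)" "?u \<otimes>\<^bsub>T L K\<^esub> v = \<one>\<^bsub>T L K\<^esub>" "v \<otimes>\<^bsub>T L K\<^esub> ?u = \<one>\<^bsub>T L K\<^esub>"
      "inv\<^bsub>T L K\<^esub> ?u = v"
    by (rule canonical_element_inverse)
  note leg = lin_closed[OF leg13_lin[OF L Y K]]
  have uv: "?leg ?u \<otimes>\<^bsub>?M\<^esub> ?leg v = \<one>\<^bsub>?M\<^esub>" "?leg v \<otimes>\<^bsub>?M\<^esub> ?leg ?u = \<one>\<^bsub>?M\<^esub>"
    by (simp_all only: leg13_mult[OF L Y K, symmetric] u(1) v leg13_one[OF L Y K])
  have inv: "inv\<^bsub>?M\<^esub> (?leg v) = ?leg ?u"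
    by (rule M.inv_char[OF leg[OF v(1)] leg[OF u(1)] uv(2,1)])
  have "tensor_assoc k L Y K (tensor_map k L (T Y K) (\<lambda>x. x) \<alpha> (\<beta> y))
          = Ad ?M (?leg (inv\<^bsub>T L K\<^esub> ?u)) (tensor_map k (T L Y) K \<beta> (\<lambda>x. x) (\<alpha> y)) \<longleftrightarrow>
      (\<forall>x\<in>carrier K. \<forall>l\<in>carrier L.
      lift Y (\<lambda>l1 l2. lift Y (\<lambda>x1 x2. p x1 l1 \<odot>\<^bsub>Y\<^esub> slice_K Y l2 (\<alpha> (slice_L Y x2 (\<beta> y))))
        (comult K x)) (comult L l)
      = lift Y (\<lambda>l1 l2. lift Y (\<lambda>x1 x2. p x2 l2 \<odot>\<^bsub>Y\<^esub> slice_L Y x1 (\<beta> (slice_K Y l1 (\<alpha> y))))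
        (comult K x)) (comult L l))"
    (is "?z = Ad ?M _ ?w \<longleftrightarrow> (\<forall>x\<in>carrier K. \<forall>l\<in>carrier L. ?lhs x l = ?rhs x l)")
    if y: "y \<in> carrier Y" for y
  proof -
    note ay = lin_closed[OF \<alpha> y] and by' = lin_closed[OF \<beta> y]
    have m: "tensor_map k L (T Y K) (\<lambda>x. x) \<alpha> (\<beta> y) \<in> carrier (T L (T Y K))"
      by (rule map_closed[OF by' L_vs Y_vs' L_vs vYK lin_id \<alpha>])
    have z: "?z \<in> carrier ?M" by (rule lin_closed[OF assoc_lin[OF L_vs Y_vs' K_vs] m])
    have w: "?w \<in> carrier ?M" by (rule map_closed[OF ay Y_vs' K_vs LY_vs K_vs \<beta> lin_id])
    have sz: "slice_LK x l ?z = slice_K Y l (\<alpha> (slice_L Y x (\<beta> y)))"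
      if "x \<in> carrier K" "l \<in> carrier L" for x l
      by (simp only: slice_LK_assoc[OF m that] slice_L_map[OF Y \<alpha> vYK by' that(1)])
    have sw: "slice_LK x l ?w = slice_L Y x (\<beta> (slice_K Y l (\<alpha> y)))"
      if "x \<in> carrier K" "l \<in> carrier L" for x l
      by (simp only: slice_LK_def slice_K_map[OF Y \<beta> LY_vs ay that(2)])
    have lz: "slice_LK x l (?leg ?u \<otimes>\<^bsub>?M\<^esub> ?z) = ?lhs x l" if x: "x \<in> carrier K" and l: "l \<in> carrier L" for x l
      unfolding slice_LK_mult[OF leg[OF u(1)] z x l]
      by (intro lift_cong[OF L_vs L_vs comult_L_closed[OF l]] lift_cong[OF K_vs K_vs comult_K_closed[OF x]])
        (simp add: slice_LK_leg13 u sz[symmetric] Y.smult_mult_left p_closed slice_LK_closed[OF z])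
    have rw: "slice_LK x l (?w \<otimes>\<^bsub>?M\<^esub> ?leg ?u) = ?rhs x l" if x: "x \<in> carrier K" and l: "l \<in> carrier L" for x l
      unfolding slice_LK_mult[OF w leg[OF u(1)] x l]
      by (intro lift_cong[OF L_vs L_vs comult_L_closed[OF l]] lift_cong[OF K_vs K_vs comult_K_closed[OF x]])
        (simp add: slice_LK_leg13 u sw[symmetric] Y.smult_mult_right p_closed slice_LK_closed[OF w])
    note lv = leg[OF v(1)] and lu = leg[OF u(1)]
    have "?z = Ad ?M (?leg (inv\<^bsub>T L K\<^esub> ?u)) ?w \<longleftrightarrow> ?leg ?u \<otimes>\<^bsub>?M\<^esub> ?z = ?w \<otimes>\<^bsub>?M\<^esub> ?leg ?u"
      (is "?L \<longleftrightarrow> ?R")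
    proof
      assume ?L
      then have "?leg ?u \<otimes>\<^bsub>?M\<^esub> ?z = ?leg ?u \<otimes>\<^bsub>?M\<^esub> (?leg v \<otimes>\<^bsub>?M\<^esub> ?w \<otimes>\<^bsub>?M\<^esub> ?leg ?u)"
        by (simp only: Ad_def v(4) inv)
      also have "\<dots> = (?leg ?u \<otimes>\<^bsub>?M\<^esub> ?leg v) \<otimes>\<^bsub>?M\<^esub> ?w \<otimes>\<^bsub>?M\<^esub> ?leg ?u"
        using lv lu w by (simp only: M.m_assoc M.m_closed)
      finally show ?R using w by (simp only: uv M.l_one)
    next
      assume R: ?R
      have "?z = (?leg v \<otimes>\<^bsub>?M\<^esub> ?leg ?u) \<otimes>\<^bsub>?M\<^esub> ?z" using z by (simp only: uv M.l_one)
      also have "\<dots> = ?leg v \<otimes>\<^bsub>?M\<^esub> (?leg ?u \<otimes>\<^bsub>?M\<^esub> ?z)"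
        using lv lu z by (simp only: M.m_assoc)
      also have "\<dots> = ?leg v \<otimes>\<^bsub>?M\<^esub> ?w \<otimes>\<^bsub>?M\<^esub> ?leg ?u"
        unfolding R using lv lu w by (simp only: M.m_assoc)
      finally show ?L by (simp only: Ad_def v(4) inv)
    qed
    also have "\<dots> \<longleftrightarrow> (\<forall>x\<in>carrier K. \<forall>l\<in>carrier L. ?lhs x l = ?rhs x l)"
      using slice_LK_inj[OF M.m_closed[OF lu z] M.m_closed[OF w lu]] lz rw by metis
    finally show ?thesis .
  qed
  then show ?thesis
    unfolding yetter_drinfeld_algebra_def by (auto simp del: conv_simps)
qed

end

end

section \<open>Braided commutativity\<close>

context dual_pair
begin

abbreviation "Heis \<equiv> heisenberg k K L p"

lemma heisenberg_simps:
  "carrier Heis = carrier (T L K)" "zero Heis = zero (T L K)" "add Heis = add (T L K)" "smult Heis = smult (T L K)"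
  by (simp_all add: heisenberg_def)

lemma heisenberg_vs: "vs Heis"
  by (rule vs_transfer[OF tensor_vs[OF L_vs K_vs]]) (simp_all add: heisenberg_simps)

lemma lin_heisenberg: "lin X Heis f = lin X (T L K) f" "lin Heis X g = lin (T L K) X g"
  by (simp_all add: module_hom_def heisenberg_simps)

lemma heisenberg_mult:
  "s \<otimes>\<^bsub>Heis\<^esub> t = lift (T L K) (\<lambda>\<theta> h. lift (T L K) (\<lambda>\<theta>' h'. lift (T L K) (\<lambda>\<theta>1 \<theta>2. lift (T L K) (\<lambda>h1 h2.
      p h1 \<theta>2 \<odot>\<^bsub>T L K\<^esub> pt L K (\<theta> \<otimes>\<^bsub>L\<^esub> \<theta>1) (h2 \<otimes>\<^bsub>K\<^esub> h')) (comult K h)) (comult L \<theta>')) t) s"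
  by (simp add: heisenberg_def)

lemma heisenberg_product: "bilinear_product Heis"
proof -
  have "bil (T L K) (T L K) (T L K) (mult Heis)"
    unfolding heisenberg_mult[abs_def] by (assumption | rule multilin)+
  then show ?thesis
    by (simp add: bilinear_product_def heisenberg_vs bilinear_def lin_heisenberg heisenberg_simps)
qed

lemma heisenberg_mult_pt:
  assumes "\<theta> \<in> carrier L" "h \<in> carrier K" "\<theta>' \<in> carrier L" "h' \<in> carrier K"
  shows "pt L K \<theta> h \<otimes>\<^bsub>Heis\<^esub> pt L K \<theta>' h' = lift (T L K) (\<lambda>\<theta>1 \<theta>2. lift (T L K) (\<lambda>h1 h2.
      p h1 \<theta>2 \<odot>\<^bsub>T L K\<^esub> pt L K (\<theta> \<otimes>\<^bsub>L\<^esub> \<theta>1) (h2 \<otimes>\<^bsub>K\<^esub> h')) (comult K h)) (comult L \<theta>')"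
proof -
  note v = L_vs K_vs tensor_vs[OF L_vs K_vs]
  have t: "pt L K \<theta>' h' \<in> carrier (T L K)" by (rule pt_closed[OF L_vs K_vs assms(3,4)])
  have b1: "bil L K (T L K) (\<lambda>\<theta> h. lift (T L K) (\<lambda>\<theta>' h'. lift (T L K) (\<lambda>\<theta>1 \<theta>2. lift (T L K) (\<lambda>h1 h2.
      p h1 \<theta>2 \<odot>\<^bsub>T L K\<^esub> pt L K (\<theta> \<otimes>\<^bsub>L\<^esub> \<theta>1) (h2 \<otimes>\<^bsub>K\<^esub> h')) (comult K h)) (comult L \<theta>')) (pt L K \<theta>' h'))"
    by (assumption | rule multilin t)+
  have b2: "bil L K (T L K) (\<lambda>\<theta>' h'. lift (T L K) (\<lambda>\<theta>1 \<theta>2. lift (T L K) (\<lambda>h1 h2.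
      p h1 \<theta>2 \<odot>\<^bsub>T L K\<^esub> pt L K (\<theta> \<otimes>\<^bsub>L\<^esub> \<theta>1) (h2 \<otimes>\<^bsub>K\<^esub> h')) (comult K h)) (comult L \<theta>'))"
    by (assumption | rule multilin assms)+
  show ?thesis
    unfolding heisenberg_mult lift_pt[OF v b1 assms(1,2)] lift_pt[OF v b2 assms(3,4)] ..
qed

text \<open>The two mixed products \<open>(\<theta> # 1)(1 # h) = \<theta> # h\<close> and
  \<open>(1 # h)(\<theta> # 1) = \<theta>\<^sub>1 p(h\<^sub>1, \<theta>\<^sub>2) # h\<^sub>2\<close>, as bilinear forms. In the second the sum
  over \<open>\<theta>\<close> contracts, since \<open>p(x, \<theta>\<^sub>1) p(h\<^sub>1, \<theta>\<^sub>2) = p(xh\<^sub>1, \<theta>)\<close>.\<close>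

lemma eval_LK_heisenberg_left:
  assumes \<theta>: "\<theta> \<in> carrier L" and h: "h \<in> carrier K" and x: "x \<in> carrier K" and l: "l \<in> carrier L"
  shows "eval_LK x l (pt L K \<theta> \<one>\<^bsub>K\<^esub> \<otimes>\<^bsub>Heis\<^esub> pt L K \<one>\<^bsub>L\<^esub> h) = p x \<theta> \<otimes> p h l"
proof -
  interpret K: unital_algebra k K by (rule K)
  interpret L: unital_algebra k L by (rule L)
  interpret LK: vectorspace k "T L K" by (rule tensor_vs[OF L_vs K_vs])
  note v = tensor_vs[OF L_vs K_vs]
  have b1: "bil L L (T L K) (\<lambda>\<theta>1 \<theta>2. lift (T L K) (\<lambda>h1 h2.
      p h1 \<theta>2 \<odot>\<^bsub>T L K\<^esub> pt L K (\<theta> \<otimes>\<^bsub>L\<^esub> \<theta>1) (h2 \<otimes>\<^bsub>K\<^esub> h)) (pt K K \<one>\<^bsub>K\<^esub> \<one>\<^bsub>K\<^esub>))"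
    by (assumption | rule multilin \<theta> h)+
  have b2: "bil K K (T L K) (\<lambda>h1 h2. p h1 \<theta>2 \<odot>\<^bsub>T L K\<^esub> pt L K (\<theta> \<otimes>\<^bsub>L\<^esub> \<theta>1) (h2 \<otimes>\<^bsub>K\<^esub> h))"
    if "\<theta>1 \<in> carrier L" "\<theta>2 \<in> carrier L" for \<theta>1 \<theta>2
    by (assumption | rule multilin \<theta> h that)+
  show ?thesis
    unfolding heisenberg_mult_pt[OF \<theta> K.one_closed L.one_closed h] comult_K_one comult_L_one
      lift_pt[OF L_vs L_vs v b1 L.one_closed L.one_closed] lift_pt[OF K_vs K_vs v b2[OF L.one_closed L.one_closed] K.one_closed K.one_closed]
    using \<theta> h by (simp add: pt_closed[OF L_vs K_vs] eval_LK_pt x l pair_one)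
qed

lemma eval_LK_heisenberg_right:
  assumes \<theta>: "\<theta> \<in> carrier L" and h: "h \<in> carrier K" and x: "x \<in> carrier K" and l: "l \<in> carrier L"
  shows "eval_LK x l (pt L K \<one>\<^bsub>L\<^esub> h \<otimes>\<^bsub>Heis\<^esub> pt L K \<theta> \<one>\<^bsub>K\<^esub>)
    = lift (scalars k) (\<lambda>h1 h2. p (x \<otimes>\<^bsub>K\<^esub> h1) \<theta> \<otimes> p h2 l) (comult K h)"
proof -
  interpret K: unital_algebra k K by (rule K)
  interpret L: unital_algebra k L by (rule L)
  note v = tensor_vs[OF L_vs K_vs]
  note E = eval_LK_lin[OF lin_id x l]
  note cK = comult_K_closed[OF h] and cL = comult_L_closed[OF \<theta>]
  have b1: "bil L L (T L K) (\<lambda>\<theta>1 \<theta>2. lift (T L K) (\<lambda>h1 h2.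
      p h1 \<theta>2 \<odot>\<^bsub>T L K\<^esub> pt L K (\<one>\<^bsub>L\<^esub> \<otimes>\<^bsub>L\<^esub> \<theta>1) (h2 \<otimes>\<^bsub>K\<^esub> \<one>\<^bsub>K\<^esub>)) (comult K h))"
    by (assumption | rule multilin \<theta> h)+
  have b2: "bil K K (T L K) (\<lambda>h1 h2. p h1 \<theta>2 \<odot>\<^bsub>T L K\<^esub> pt L K (\<one>\<^bsub>L\<^esub> \<otimes>\<^bsub>L\<^esub> \<theta>1) (h2 \<otimes>\<^bsub>K\<^esub> \<one>\<^bsub>K\<^esub>))"
    if "\<theta>1 \<in> carrier L" "\<theta>2 \<in> carrier L" for \<theta>1 \<theta>2
    by (assumption | rule multilin that)+
  have "eval_LK x l (pt L K \<one>\<^bsub>L\<^esub> h \<otimes>\<^bsub>Heis\<^esub> pt L K \<theta> \<one>\<^bsub>K\<^esub>)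
      = lift (scalars k) (\<lambda>\<theta>1 \<theta>2. eval_LK x l (lift (T L K) (\<lambda>h1 h2.
        p h1 \<theta>2 \<odot>\<^bsub>T L K\<^esub> pt L K (\<one>\<^bsub>L\<^esub> \<otimes>\<^bsub>L\<^esub> \<theta>1) (h2 \<otimes>\<^bsub>K\<^esub> \<one>\<^bsub>K\<^esub>)) (comult K h))) (comult L \<theta>)"
    unfolding heisenberg_mult_pt[OF L.one_closed h \<theta> K.one_closed]
    by (rule lift_hom[OF E cL L_vs L_vs v scalars_vs b1])
  also have "\<dots> = lift (scalars k) (\<lambda>\<theta>1 \<theta>2. lift (scalars k) (\<lambda>h1 h2.
        p x \<theta>1 \<otimes> p h1 \<theta>2 \<otimes> p h2 l) (comult K h)) (comult L \<theta>)"
  proof (rule lift_cong[OF L_vs L_vs cL])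
    fix \<theta>1 \<theta>2 assume t: "\<theta>1 \<in> carrier L" "\<theta>2 \<in> carrier L"
    show "eval_LK x l (lift (T L K) (\<lambda>h1 h2.
        p h1 \<theta>2 \<odot>\<^bsub>T L K\<^esub> pt L K (\<one>\<^bsub>L\<^esub> \<otimes>\<^bsub>L\<^esub> \<theta>1) (h2 \<otimes>\<^bsub>K\<^esub> \<one>\<^bsub>K\<^esub>)) (comult K h))
      = lift (scalars k) (\<lambda>h1 h2. p x \<theta>1 \<otimes> p h1 \<theta>2 \<otimes> p h2 l) (comult K h)"
      unfolding lift_hom[OF E cK K_vs K_vs v scalars_vs b2[OF t]]
      by (rule lift_cong[OF K_vs K_vs cK])
        (simp add: lin_smult[OF E] p_closed t pt_closed[OF L_vs K_vs] eval_LK_pt x l m_ac)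
  qed
  also have "\<dots> = lift (scalars k) (\<lambda>h1 h2. lift (scalars k) (\<lambda>\<theta>1 \<theta>2.
        p x \<theta>1 \<otimes> p h1 \<theta>2 \<otimes> p h2 l) (comult L \<theta>)) (comult K h)"
    by (rule lift_swap[OF cL cK L_vs L_vs K_vs K_vs scalars_vs])
      (assumption | rule multilin x l)+
  also have "\<dots> = lift (scalars k) (\<lambda>h1 h2. p (x \<otimes>\<^bsub>K\<^esub> h1) \<theta> \<otimes> p h2 l) (comult K h)"
  proof (rule lift_cong[OF K_vs K_vs cK])
    fix h1 h2 assume h: "h1 \<in> carrier K" "h2 \<in> carrier K"
    have b: "bil L L (scalars k) (\<lambda>\<theta>1 \<theta>2. p x \<theta>1 \<otimes> p h1 \<theta>2)"
      by (assumption | rule multilin x h)+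
    show "lift (scalars k) (\<lambda>\<theta>1 \<theta>2. p x \<theta>1 \<otimes> p h1 \<theta>2 \<otimes> p h2 l) (comult L \<theta>) = p (x \<otimes>\<^bsub>K\<^esub> h1) \<theta> \<otimes> p h2 l"
      unfolding pair_mult_K[OF x h(1) \<theta>]
      using lift_smult_const[OF cL L_vs L_vs scalars_vs b, of "p h2 l"] p_closed[OF h(2) l] by simp
  qed
  finally show ?thesis .
qed

context
  fixes Y :: "('k, 'y, 'r) module_scheme"
  assumes Y [multilin]: "unital_algebra k Y"
begin

interpretation Y: unital_algebra k Y by (rule Y)
interpretation K: unital_algebra k K by (rule K)
interpretation L: unital_algebra k L by (rule L)

private lemmas Y_vs = unital_algebra_vs[OF Y]
private lemmas YK_vs = tensor_vs[OF Y_vs K_vs]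
private lemmas YH_vs = tensor_vs[OF Y_vs heisenberg_vs]
private lemmas YH_prods = unital_algebra_product[OF Y] heisenberg_product
private lemmas YH_product = tensor_product_bilinear[OF YH_prods]

text \<open>Evaluation of the second leg of \<open>Y \<otimes> Heis\<close>.\<close>

definition slice_H where "slice_H x l t = lift Y (\<lambda>y s. eval_LK x l s \<odot>\<^bsub>Y\<^esub> y) t"

lemma slice_H_bil:
  assumes "x \<in> carrier K" "l \<in> carrier L"
  shows "bil Y Heis Y (\<lambda>y s. eval_LK x l s \<odot>\<^bsub>Y\<^esub> y)"
proof -
  have "bil Y (T L K) Y (\<lambda>y s. eval_LK x l s \<odot>\<^bsub>Y\<^esub> y)"
    by (assumption | rule multilin assms)+
  then show ?thesis by (simp add: bilinear_def lin_heisenberg heisenberg_simps)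
qed

lemma slice_H_inj:
  assumes t: "t \<in> carrier (T Y Heis)" "t' \<in> carrier (T Y Heis)"
    and eq: "\<And>x l. \<lbrakk>x \<in> carrier K; l \<in> carrier L\<rbrakk> \<Longrightarrow> slice_H x l t = slice_H x l t'"
  shows "t = t'"
proof -
  obtain B d where B: "vectorspace.basis k K B" "d \<in> B \<rightarrow> carrier L"
    "dual_system K B (\<lambda>b. b) (\<lambda>b x. p x (d b))" "dual_system L B d p"
    using dual_bases by blast
  note sys = dual_system_tensor[OF L_vs K_vs B(4,3)]
  have finsum_Heis: "finsum Heis = finsum (T L K)"
    by (simp add: finsum_def finprod_def heisenberg_simps fun_eq_iff)
  have sysH: "dual_system Heis (B \<times> B) (\<lambda>ij. pt L K (d (fst ij)) (snd ij))
    (\<lambda>ij. lift (scalars k) (\<lambda>v w. p (fst ij) v \<otimes> p w (d (snd ij))))"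
    using sys by (simp add: dual_system_def lin_heisenberg heisenberg_simps finsum_Heis)
  show ?thesis
  proof (rule separate_right[OF heisenberg_vs Y_vs sysH t])
    fix ij assume "ij \<in> B \<times> B"
    then have x: "fst ij \<in> carrier K" and l: "d (snd ij) \<in> carrier L"
      using B(1,2) by (auto simp: K.basis_def)
    have b: "bil L K (scalars k) (\<lambda>v w. p (fst ij) v \<otimes> p w (d (snd ij)))"
      by (assumption | rule multilin x l)+
    have ev: "lift (scalars k) (\<lambda>v w. p (fst ij) v \<otimes> p w (d (snd ij))) s = eval_LK (fst ij) (d (snd ij)) s"
      if s: "s \<in> carrier Heis" for s
      by (rule tensor_ext[OF L_vs K_vs lift_lin[OF L_vs K_vs scalars_vs b] eval_LK_lin[OF lin_id x l] _ s[unfolded heisenberg_simps]])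
        (simp add: lift_pt[OF L_vs K_vs scalars_vs b] eval_LK_pt x l)
    have "lift Y (\<lambda>y s. lift (scalars k) (\<lambda>v w. p (fst ij) v \<otimes> p w (d (snd ij))) s \<odot>\<^bsub>Y\<^esub> y) u
        = slice_H (fst ij) (d (snd ij)) u" if u: "u \<in> carrier (T Y Heis)" for u
      unfolding slice_H_def by (rule lift_cong[OF Y_vs heisenberg_vs u]) (simp only: ev)
    then show "lift Y (\<lambda>y s. lift (scalars k) (\<lambda>v w. p (fst ij) v \<otimes> p w (d (snd ij))) s \<odot>\<^bsub>Y\<^esub> y) t
        = lift Y (\<lambda>y s. lift (scalars k) (\<lambda>v w. p (fst ij) v \<otimes> p w (d (snd ij))) s \<odot>\<^bsub>Y\<^esub> y) t'"
      using t eq[OF x l] by (simp only:)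
  qed
qed

text \<open>Coassociativity of a right coaction, tested against a form on the last leg.\<close>

lemma coaction_slice:
  assumes \<alpha>: "right_coaction k K Y \<alpha>" and a: "a \<in> carrier Y" and l: "l \<in> carrier L"
    and \<phi>: "bil Y K Y \<phi>"
  shows "lift Y \<phi> (\<alpha> (slice_K Y l (\<alpha> a)))
    = lift Y (\<lambda>a0 h. lift Y (\<lambda>h1 h2. p h2 l \<odot>\<^bsub>Y\<^esub> \<phi> a0 h1) (comult K h)) (\<alpha> a)"
proof -
  have \<alpha>_lin: "lin Y (T Y K) \<alpha>" using \<alpha> by (simp add: right_coaction_def algebra_hom_iff)
  note \<alpha>a = lin_closed[OF \<alpha>_lin a]
  note vKK = tensor_vs[OF K_vs K_vs]
  note f = lift_lin[OF Y_vs K_vs Y_vs \<phi>]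
  have \<psi>: "trilinear Y K K Y (\<lambda>y h1 h2. p h2 l \<odot>\<^bsub>Y\<^esub> \<phi> y h1)"
    by (assumption | rule multilin l bilinear_right[OF \<phi>] bilinear_left[OF \<phi>] bilinear_closed[OF \<phi>])+
  note b = trilinear_lift_bilinear(1)[OF \<psi> Y_vs K_vs K_vs Y_vs]
  have *: "lift Y \<phi> (slice_K (T Y K) l (tensor_assoc k Y K K u))
      = lift Y (\<lambda>y w. lift Y (\<lambda>h1 h2. p h2 l \<odot>\<^bsub>Y\<^esub> \<phi> y h1) w) u" if u: "u \<in> carrier (T Y (T K K))" for u
  proof (rule tensor_ext3_right[OF Y_vs K_vs K_vs _ _ _ u])
    show "lin (T Y (T K K)) Y (\<lambda>u. lift Y \<phi> (slice_K (T Y K) l (tensor_assoc k Y K K u)))"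
      by (rule lin_compose[OF f slice_K_lin[OF assoc_lin[OF Y_vs K_vs K_vs] YK_vs l]])
    show "lin (T Y (T K K)) Y (lift Y (\<lambda>y w. lift Y (\<lambda>h1 h2. p h2 l \<odot>\<^bsub>Y\<^esub> \<phi> y h1) w))"
      by (rule lift_lin[OF Y_vs vKK Y_vs b])
    fix y h1 h2 assume y: "y \<in> carrier Y" and h: "h1 \<in> carrier K" "h2 \<in> carrier K"
    have yh: "pt Y K y h1 \<in> carrier (T Y K)" by (rule pt_closed[OF Y_vs K_vs y h(1)])
    have hh: "pt K K h1 h2 \<in> carrier (T K K)" by (rule pt_closed[OF K_vs K_vs h])
    show "lift Y \<phi> (slice_K (T Y K) l (tensor_assoc k Y K K (pt Y (T K K) y (pt K K h1 h2))))
      = lift Y (\<lambda>y w. lift Y (\<lambda>h1 h2. p h2 l \<odot>\<^bsub>Y\<^esub> \<phi> y h1) w) (pt Y (T K K) y (pt K K h1 h2))"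
      unfolding assoc_pt[OF Y_vs K_vs K_vs y h] slice_K_pt[OF YK_vs yh h(2) l]
        lin_smult[OF f p_closed[OF h(2) l] yh] lift_pt[OF Y_vs K_vs Y_vs \<phi> y h(1)]
        lift_pt[OF Y_vs vKK Y_vs b y hh] lift_pt[OF K_vs K_vs Y_vs trilinearD(1)[OF \<psi> y] h] ..
  qed
  have m: "tensor_map k Y (T K K) (\<lambda>x. x) (comult K) (\<alpha> a) \<in> carrier (T Y (T K K))"
    by (rule map_closed[OF \<alpha>a Y_vs K_vs Y_vs vKK lin_id comult_K])
  have "lift Y \<phi> (\<alpha> (slice_K Y l (\<alpha> a)))
      = lift Y \<phi> (slice_K (T Y K) l (tensor_map k (T Y K) K \<alpha> (\<lambda>x. x) (\<alpha> a)))"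
    by (simp only: slice_K_map[OF Y \<alpha>_lin YK_vs \<alpha>a l])
  also have "tensor_map k (T Y K) K \<alpha> (\<lambda>x. x) (\<alpha> a)
      = tensor_assoc k Y K K (tensor_map k Y (T K K) (\<lambda>x. x) (comult K) (\<alpha> a))"
    using \<alpha> a by (simp add: right_coaction_def)
  finally show ?thesis
    unfolding *[OF m] lift_map[OF \<alpha>a Y_vs K_vs Y_vs vKK Y_vs lin_id comult_K b] .
qed

text \<open>Evaluating the Heisenberg leg of the two products at \<open>x\<close> and \<open>l\<close> gives, with
  \<open>a' = l \<rhd> a\<close> and \<open>b' = b \<lhd> x\<close>, the elements \<open>a'\<^sub>0 (b' \<lhd> a'\<^sub>1)\<close> and \<open>b' a'\<close>. So the
  identity for all \<open>a\<close>, \<open>b\<close> implies braided commutativity, and the converse is the case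
  \<open>x = 1\<close>, \<open>l = 1\<close>.\<close>

theorem braided_commutative_iff:
  "braided_commutative k K L p Y \<alpha> \<beta> \<longleftrightarrow> yetter_drinfeld_algebra k K L p Y \<alpha> \<beta> \<and>
    (\<forall>a\<in>carrier Y. \<forall>b\<in>carrier Y. lift Y (\<lambda>a0 h. a0 \<otimes>\<^bsub>Y\<^esub> slice_L Y h (\<beta> b)) (\<alpha> a) = b \<otimes>\<^bsub>Y\<^esub> a)"
proof -
  let ?i = "\<lambda>a. tensor_map k Y Heis (\<lambda>y. y) (\<lambda>h. pt L K \<one>\<^bsub>L\<^esub> h) (\<alpha> a)"
  let ?j = "\<lambda>b. lift (T Y Heis) (\<lambda>\<theta> y0. pt Y Heis y0 (pt L K \<theta> \<one>\<^bsub>K\<^esub>)) (\<beta> b)"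
  have "(\<forall>a\<in>carrier Y. \<forall>b\<in>carrier Y. ?i a \<otimes>\<^bsub>T Y Heis\<^esub> ?j b = ?j b \<otimes>\<^bsub>T Y Heis\<^esub> ?i a) \<longleftrightarrow>
    (\<forall>a\<in>carrier Y. \<forall>b\<in>carrier Y. lift Y (\<lambda>a0 h. a0 \<otimes>\<^bsub>Y\<^esub> slice_L Y h (\<beta> b)) (\<alpha> a) = b \<otimes>\<^bsub>Y\<^esub> a)"
    (is "?L \<longleftrightarrow> ?R")
    if yd: "yetter_drinfeld_algebra k K L p Y \<alpha> \<beta>"
  proof -
    have co: "right_coaction k K Y \<alpha>" "left_coaction k L Y \<beta>"
      using yd by (simp_all add: yetter_drinfeld_algebra_def)
    have \<alpha>: "lin Y (T Y K) \<alpha>" and \<beta>: "lin Y (T L Y) \<beta>"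
      using co by (simp_all add: right_coaction_def left_coaction_def algebra_hom_iff)
    note lm = right_coaction_iff[OF Y \<alpha>, THEN iffD1, OF co(1), unfolded left_module_algebra_def]
    note rm = left_coaction_iff[OF Y \<beta>, THEN iffD1, OF co(2), unfolded right_module_algebra_def]
    let ?la = "\<lambda>l a. slice_K Y l (\<alpha> a)" and ?ra = "\<lambda>b x. slice_L Y x (\<beta> b)"
    have la_closed: "?la l a \<in> carrier Y" if "a \<in> carrier Y" "l \<in> carrier L" for a l
      by (rule slice_K_closed[OF lin_closed[OF \<alpha> that(1)] Y_vs that(2)])
    have ra_closed: "?ra b x \<in> carrier Y" if "b \<in> carrier Y" "x \<in> carrier K" for b x
      by (rule slice_L_closed[OF lin_closed[OF \<beta> that(1)] Y_vs that(2)])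
    have iK: "lin K Heis (\<lambda>h. pt L K \<one>\<^bsub>L\<^esub> h)"
      unfolding lin_heisenberg by (assumption | rule multilin)+
    have iL: "lin L Heis (\<lambda>\<theta>. pt L K \<theta> \<one>\<^bsub>K\<^esub>)"
      unfolding lin_heisenberg by (assumption | rule multilin)+
    have iKc: "pt L K \<one>\<^bsub>L\<^esub> h \<in> carrier Heis" if "h \<in> carrier K" for h by (rule lin_closed[OF iK that])
    have iLc: "pt L K \<theta> \<one>\<^bsub>K\<^esub> \<in> carrier Heis" if "\<theta> \<in> carrier L" for \<theta> by (rule lin_closed[OF iL that])
    have jb: "bil L Y (T Y Heis) (\<lambda>\<theta> y0. pt Y Heis y0 (pt L K \<theta> \<one>\<^bsub>K\<^esub>))"
      by (intro bilinearI lin_pt_left[OF lin_id Y_vs heisenberg_vs iLc] lin_pt_right[OF iL Y_vs heisenberg_vs])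
    have key: "?i a \<otimes>\<^bsub>T Y Heis\<^esub> ?j b = ?j b \<otimes>\<^bsub>T Y Heis\<^esub> ?i a \<longleftrightarrow> (\<forall>x\<in>carrier K. \<forall>l\<in>carrier L.
        lift Y (\<lambda>a0 h. a0 \<otimes>\<^bsub>Y\<^esub> ?ra (?ra b x) h) (\<alpha> (?la l a)) = ?ra b x \<otimes>\<^bsub>Y\<^esub> ?la l a)"
      if a: "a \<in> carrier Y" and b: "b \<in> carrier Y" for a b
    proof -
      note \<alpha>a = lin_closed[OF \<alpha> a] and \<beta>b = lin_closed[OF \<beta> b]
      have i: "?i a \<in> carrier (T Y Heis)" by (rule map_closed[OF \<alpha>a Y_vs K_vs Y_vs heisenberg_vs lin_id iK])
      have j: "?j b \<in> carrier (T Y Heis)" by (rule lift_closed[OF \<beta>b L_vs Y_vs YH_vs jb])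
      have li: "lift Y \<phi> (?i a) = lift Y (\<lambda>a0 h. \<phi> a0 (pt L K \<one>\<^bsub>L\<^esub> h)) (\<alpha> a)" if "bil Y Heis Y \<phi>" for \<phi>
        by (rule lift_map[OF \<alpha>a Y_vs K_vs Y_vs heisenberg_vs Y_vs lin_id iK that])
      have lj: "lift Y \<phi> (?j b) = lift Y (\<lambda>\<theta> y0. \<phi> y0 (pt L K \<theta> \<one>\<^bsub>K\<^esub>)) (\<beta> b)" if \<phi>: "bil Y Heis Y \<phi>" for \<phi>
      proof -
        have "lift Y \<phi> (?j b) = lift Y (\<lambda>\<theta> y0. lift Y \<phi> (pt Y Heis y0 (pt L K \<theta> \<one>\<^bsub>K\<^esub>))) (\<beta> b)"
          by (rule lift_hom[OF lift_lin[OF Y_vs heisenberg_vs Y_vs \<phi>] \<beta>b L_vs Y_vs YH_vs Y_vs jb])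
        also have "\<dots> = lift Y (\<lambda>\<theta> y0. \<phi> y0 (pt L K \<theta> \<one>\<^bsub>K\<^esub>)) (\<beta> b)"
          by (rule lift_cong[OF L_vs Y_vs \<beta>b]) (rule lift_pt[OF Y_vs heisenberg_vs Y_vs \<phi> _ iLc])
        finally show ?thesis .
      qed
      have ij: "slice_H x l (?i a \<otimes>\<^bsub>T Y Heis\<^esub> ?j b)
          = lift Y (\<lambda>a0 h. a0 \<otimes>\<^bsub>Y\<^esub> ?ra (?ra b x) h) (\<alpha> (?la l a))" if x: "x \<in> carrier K" and l: "l \<in> carrier L" for x l
      proof -
        note E = slice_H_bil[OF x l]
        have mid: "bil Y Heis Y (\<lambda>y' s'. eval_LK x l (s \<otimes>\<^bsub>Heis\<^esub> s') \<odot>\<^bsub>Y\<^esub> (y \<otimes>\<^bsub>Y\<^esub> y'))"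
          if "y \<in> carrier Y" "s \<in> carrier Heis" for y s
          by (intro bilinearI lin_compose[OF bilinear_right[OF E]] lin_compose[OF bilinear_left[OF E]]
              lin_mult_right[OF lin_id] YH_prods that mult_closed[OF YH_prods(1)] mult_closed[OF YH_prods(2)])
        have out: "bil Y Heis Y (\<lambda>y s. lift Y (\<lambda>y' s'. eval_LK x l (s \<otimes>\<^bsub>Heis\<^esub> s') \<odot>\<^bsub>Y\<^esub> (y \<otimes>\<^bsub>Y\<^esub> y')) (?j b))"
          by (intro bilinearI lin_lift_param[OF j Y_vs heisenberg_vs Y_vs] heisenberg_vs Y_vs bilinearI
              lin_compose[OF bilinear_right[OF E]] lin_compose[OF bilinear_left[OF E]]
              lin_mult_right[OF lin_id] lin_mult_left[OF lin_id] YH_prods mult_closed[OF YH_prods(1)] mult_closed[OF YH_prods(2)])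
        have "slice_H x l (?i a \<otimes>\<^bsub>T Y Heis\<^esub> ?j b)
            = lift Y (\<lambda>y s. lift Y (\<lambda>y' s'. eval_LK x l (s \<otimes>\<^bsub>Heis\<^esub> s') \<odot>\<^bsub>Y\<^esub> (y \<otimes>\<^bsub>Y\<^esub> y')) (?j b)) (?i a)"
          unfolding slice_H_def by (rule lift_mult[OF YH_prods i j Y_vs E])
        also have "\<dots> = lift Y (\<lambda>a0 h. lift Y (\<lambda>y' s'. eval_LK x l (pt L K \<one>\<^bsub>L\<^esub> h \<otimes>\<^bsub>Heis\<^esub> s') \<odot>\<^bsub>Y\<^esub> (a0 \<otimes>\<^bsub>Y\<^esub> y')) (?j b)) (\<alpha> a)"
          by (rule li[OF out])
        also have "\<dots> = lift Y (\<lambda>a0 h. lift Y (\<lambda>h1 h2. p h2 l \<odot>\<^bsub>Y\<^esub> (a0 \<otimes>\<^bsub>Y\<^esub> ?ra (?ra b x) h1)) (comult K h)) (\<alpha> a)"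
        proof (rule lift_cong[OF Y_vs K_vs \<alpha>a])
          fix a0 h assume a0: "a0 \<in> carrier Y" and h: "h \<in> carrier K"
          note cK = comult_K_closed[OF h]
          have "lift Y (\<lambda>y' s'. eval_LK x l (pt L K \<one>\<^bsub>L\<^esub> h \<otimes>\<^bsub>Heis\<^esub> s') \<odot>\<^bsub>Y\<^esub> (a0 \<otimes>\<^bsub>Y\<^esub> y')) (?j b)
              = lift Y (\<lambda>\<theta> y0. eval_LK x l (pt L K \<one>\<^bsub>L\<^esub> h \<otimes>\<^bsub>Heis\<^esub> pt L K \<theta> \<one>\<^bsub>K\<^esub>) \<odot>\<^bsub>Y\<^esub> (a0 \<otimes>\<^bsub>Y\<^esub> y0)) (\<beta> b)"
            by (rule lj[OF mid[OF a0 iKc[OF h]]])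
          also have "\<dots> = lift Y (\<lambda>\<theta> y0. lift Y (\<lambda>h1 h2.
              (p (x \<otimes>\<^bsub>K\<^esub> h1) \<theta> \<otimes> p h2 l) \<odot>\<^bsub>Y\<^esub> (a0 \<otimes>\<^bsub>Y\<^esub> y0)) (comult K h)) (\<beta> b)"
          proof (rule lift_cong[OF L_vs Y_vs \<beta>b])
            fix \<theta> y0 assume \<theta>: "\<theta> \<in> carrier L" and y0: "y0 \<in> carrier Y"
            show "eval_LK x l (pt L K \<one>\<^bsub>L\<^esub> h \<otimes>\<^bsub>Heis\<^esub> pt L K \<theta> \<one>\<^bsub>K\<^esub>) \<odot>\<^bsub>Y\<^esub> (a0 \<otimes>\<^bsub>Y\<^esub> y0)
              = lift Y (\<lambda>h1 h2. (p (x \<otimes>\<^bsub>K\<^esub> h1) \<theta> \<otimes> p h2 l) \<odot>\<^bsub>Y\<^esub> (a0 \<otimes>\<^bsub>Y\<^esub> y0)) (comult K h)"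
              unfolding eval_LK_heisenberg_right[OF \<theta> h x l]
              by (rule lift_smult_const[OF cK K_vs K_vs Y_vs, symmetric])
                (assumption | rule multilin x l \<theta> a0 y0)+
          qed
          also have "\<dots> = lift Y (\<lambda>h1 h2. lift Y (\<lambda>\<theta> y0.
              (p (x \<otimes>\<^bsub>K\<^esub> h1) \<theta> \<otimes> p h2 l) \<odot>\<^bsub>Y\<^esub> (a0 \<otimes>\<^bsub>Y\<^esub> y0)) (\<beta> b)) (comult K h)"
            by (rule lift_swap[OF \<beta>b cK L_vs Y_vs K_vs K_vs Y_vs])
              (assumption | rule multilin x l a0)+
          also have "\<dots> = lift Y (\<lambda>h1 h2. p h2 l \<odot>\<^bsub>Y\<^esub> (a0 \<otimes>\<^bsub>Y\<^esub> ?ra (?ra b x) h1)) (comult K h)"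
          proof (rule lift_cong[OF K_vs K_vs cK])
            fix h1 h2 assume h1: "h1 \<in> carrier K" and h2: "h2 \<in> carrier K"
            have xh: "x \<otimes>\<^bsub>K\<^esub> h1 \<in> carrier K" using x h1 by simp
            have f: "lin Y Y (\<lambda>y. p h2 l \<odot>\<^bsub>Y\<^esub> (a0 \<otimes>\<^bsub>Y\<^esub> y))"
              by (assumption | rule multilin h2 l a0)+
            have "lift Y (\<lambda>\<theta> y0. (p (x \<otimes>\<^bsub>K\<^esub> h1) \<theta> \<otimes> p h2 l) \<odot>\<^bsub>Y\<^esub> (a0 \<otimes>\<^bsub>Y\<^esub> y0)) (\<beta> b)
                = lift Y (\<lambda>\<theta> y0. p h2 l \<odot>\<^bsub>Y\<^esub> (a0 \<otimes>\<^bsub>Y\<^esub> (p (x \<otimes>\<^bsub>K\<^esub> h1) \<theta> \<odot>\<^bsub>Y\<^esub> y0))) (\<beta> b)"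
              by (rule lift_cong[OF L_vs Y_vs \<beta>b])
                (simp add: Y.smult_mult_right Y.smult_assoc1[symmetric] p_closed xh h2 l a0 m_comm)
            also have "\<dots> = p h2 l \<odot>\<^bsub>Y\<^esub> (a0 \<otimes>\<^bsub>Y\<^esub> ?ra b (x \<otimes>\<^bsub>K\<^esub> h1))"
              unfolding slice_L_def
              by (rule lift_hom[OF f \<beta>b L_vs Y_vs Y_vs Y_vs slice_L_bil[OF Y_vs xh], symmetric])
            also have "?ra b (x \<otimes>\<^bsub>K\<^esub> h1) = ?ra (?ra b x) h1" using rm b x h1 by blast
            finally show "lift Y (\<lambda>\<theta> y0. (p (x \<otimes>\<^bsub>K\<^esub> h1) \<theta> \<otimes> p h2 l) \<odot>\<^bsub>Y\<^esub> (a0 \<otimes>\<^bsub>Y\<^esub> y0)) (\<beta> b)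
                = p h2 l \<odot>\<^bsub>Y\<^esub> (a0 \<otimes>\<^bsub>Y\<^esub> ?ra (?ra b x) h1)" .
          qed
          finally show "lift Y (\<lambda>y' s'. eval_LK x l (pt L K \<one>\<^bsub>L\<^esub> h \<otimes>\<^bsub>Heis\<^esub> s') \<odot>\<^bsub>Y\<^esub> (a0 \<otimes>\<^bsub>Y\<^esub> y')) (?j b)
            = lift Y (\<lambda>h1 h2. p h2 l \<odot>\<^bsub>Y\<^esub> (a0 \<otimes>\<^bsub>Y\<^esub> ?ra (?ra b x) h1)) (comult K h)" .
        qed
        also have "\<dots> = lift Y (\<lambda>a0 h. a0 \<otimes>\<^bsub>Y\<^esub> ?ra (?ra b x) h) (\<alpha> (?la l a))"
          by (rule coaction_slice[OF co(1) a l, symmetric])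
            (assumption | rule multilin lin_closed[OF \<beta>] ra_closed b x)+
        finally show ?thesis .
      qed
      have ji: "slice_H x l (?j b \<otimes>\<^bsub>T Y Heis\<^esub> ?i a) = ?ra b x \<otimes>\<^bsub>Y\<^esub> ?la l a"
        if x: "x \<in> carrier K" and l: "l \<in> carrier L" for x l
      proof -
        note E = slice_H_bil[OF x l]
        have mid: "bil Y Heis Y (\<lambda>y' s'. eval_LK x l (s \<otimes>\<^bsub>Heis\<^esub> s') \<odot>\<^bsub>Y\<^esub> (y \<otimes>\<^bsub>Y\<^esub> y'))"
          if "y \<in> carrier Y" "s \<in> carrier Heis" for y s
          by (intro bilinearI lin_compose[OF bilinear_right[OF E]] lin_compose[OF bilinear_left[OF E]]
              lin_mult_right[OF lin_id] YH_prods that mult_closed[OF YH_prods(1)] mult_closed[OF YH_prods(2)])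
        have out: "bil Y Heis Y (\<lambda>y s. lift Y (\<lambda>y' s'. eval_LK x l (s \<otimes>\<^bsub>Heis\<^esub> s') \<odot>\<^bsub>Y\<^esub> (y \<otimes>\<^bsub>Y\<^esub> y')) (?i a))"
          by (intro bilinearI lin_lift_param[OF i Y_vs heisenberg_vs Y_vs] heisenberg_vs Y_vs bilinearI
              lin_compose[OF bilinear_right[OF E]] lin_compose[OF bilinear_left[OF E]]
              lin_mult_right[OF lin_id] lin_mult_left[OF lin_id] YH_prods mult_closed[OF YH_prods(1)] mult_closed[OF YH_prods(2)])
        have "slice_H x l (?j b \<otimes>\<^bsub>T Y Heis\<^esub> ?i a)
            = lift Y (\<lambda>y s. lift Y (\<lambda>y' s'. eval_LK x l (s \<otimes>\<^bsub>Heis\<^esub> s') \<odot>\<^bsub>Y\<^esub> (y \<otimes>\<^bsub>Y\<^esub> y')) (?i a)) (?j b)"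
          unfolding slice_H_def by (rule lift_mult[OF YH_prods j i Y_vs E])
        also have "\<dots> = lift Y (\<lambda>\<theta> y0. lift Y (\<lambda>y' s'. eval_LK x l (pt L K \<theta> \<one>\<^bsub>K\<^esub> \<otimes>\<^bsub>Heis\<^esub> s') \<odot>\<^bsub>Y\<^esub> (y0 \<otimes>\<^bsub>Y\<^esub> y')) (?i a)) (\<beta> b)"
          by (rule lj[OF out])
        also have "\<dots> = lift Y (\<lambda>\<theta> y0. (p x \<theta> \<odot>\<^bsub>Y\<^esub> y0) \<otimes>\<^bsub>Y\<^esub> ?la l a) (\<beta> b)"
        proof (rule lift_cong[OF L_vs Y_vs \<beta>b])
          fix \<theta> y0 assume \<theta>: "\<theta> \<in> carrier L" and y0: "y0 \<in> carrier Y"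
          have f: "lin Y Y (\<lambda>y. (p x \<theta> \<odot>\<^bsub>Y\<^esub> y0) \<otimes>\<^bsub>Y\<^esub> y)"
            by (assumption | rule multilin x \<theta> y0)+
          have "lift Y (\<lambda>y' s'. eval_LK x l (pt L K \<theta> \<one>\<^bsub>K\<^esub> \<otimes>\<^bsub>Heis\<^esub> s') \<odot>\<^bsub>Y\<^esub> (y0 \<otimes>\<^bsub>Y\<^esub> y')) (?i a)
              = lift Y (\<lambda>a0 h. eval_LK x l (pt L K \<theta> \<one>\<^bsub>K\<^esub> \<otimes>\<^bsub>Heis\<^esub> pt L K \<one>\<^bsub>L\<^esub> h) \<odot>\<^bsub>Y\<^esub> (y0 \<otimes>\<^bsub>Y\<^esub> a0)) (\<alpha> a)"
            by (rule li[OF mid[OF y0 iLc[OF \<theta>]]])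
          also have "\<dots> = lift Y (\<lambda>a0 h. (p x \<theta> \<odot>\<^bsub>Y\<^esub> y0) \<otimes>\<^bsub>Y\<^esub> (p h l \<odot>\<^bsub>Y\<^esub> a0)) (\<alpha> a)"
            by (rule lift_cong[OF Y_vs K_vs \<alpha>a])
              (simp add: eval_LK_heisenberg_left \<theta> x l y0 scale_product[OF Y] p_closed)
          also have "\<dots> = (p x \<theta> \<odot>\<^bsub>Y\<^esub> y0) \<otimes>\<^bsub>Y\<^esub> ?la l a"
            unfolding slice_K_def
            by (rule lift_hom[OF f \<alpha>a Y_vs K_vs Y_vs Y_vs slice_K_bil[OF Y_vs l], symmetric])
          finally show "lift Y (\<lambda>y' s'. eval_LK x l (pt L K \<theta> \<one>\<^bsub>K\<^esub> \<otimes>\<^bsub>Heis\<^esub> s') \<odot>\<^bsub>Y\<^esub> (y0 \<otimes>\<^bsub>Y\<^esub> y')) (?i a)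
            = (p x \<theta> \<odot>\<^bsub>Y\<^esub> y0) \<otimes>\<^bsub>Y\<^esub> ?la l a" .
        qed
        also have "\<dots> = ?ra b x \<otimes>\<^bsub>Y\<^esub> ?la l a"
          unfolding slice_L_def
          by (rule lift_hom[OF lin_mult_left[OF lin_id YH_prods(1) la_closed[OF a l]] \<beta>b L_vs Y_vs Y_vs Y_vs slice_L_bil[OF Y_vs x], symmetric])
        finally show ?thesis .
      qed
      show ?thesis
        using slice_H_inj[OF mult_closed[OF YH_product i j] mult_closed[OF YH_product j i]] ij ji by metis
    qed
    show "?L \<longleftrightarrow> ?R"
    proof
      assume R: ?R
      show ?L
      proof (intro ballI)
        fix a b assume a: "a \<in> carrier Y" and b: "b \<in> carrier Y"
        show "?i a \<otimes>\<^bsub>T Y Heis\<^esub> ?j b = ?j b \<otimes>\<^bsub>T Y Heis\<^esub> ?i a"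
          unfolding key[OF a b] by (intro ballI R[rule_format] la_closed ra_closed a b)
      qed
    next
      assume L: ?L
      show ?R
      proof (intro ballI)
        fix a b assume a: "a \<in> carrier Y" and b: "b \<in> carrier Y"
        have "lift Y (\<lambda>a0 h. a0 \<otimes>\<^bsub>Y\<^esub> ?ra (?ra b \<one>\<^bsub>K\<^esub>) h) (\<alpha> (?la \<one>\<^bsub>L\<^esub> a)) = ?ra b \<one>\<^bsub>K\<^esub> \<otimes>\<^bsub>Y\<^esub> ?la \<one>\<^bsub>L\<^esub> a"
          using L[rule_format, OF a b, unfolded key[OF a b]] by simp
        moreover have "?ra b \<one>\<^bsub>K\<^esub> = b" "?la \<one>\<^bsub>L\<^esub> a = a" using lm rm a b by blast+
        ultimately show "lift Y (\<lambda>a0 h. a0 \<otimes>\<^bsub>Y\<^esub> ?ra b h) (\<alpha> a) = b \<otimes>\<^bsub>Y\<^esub> a"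
          by (simp only:)
      qed
    qed
  qed
  then show ?thesis
    unfolding braided_commutative_def Let_def by blast
qed

end

end

section \<open>Exchanging the two members of a dual pair\<close>

context ground
begin

text \<open>Biorthogonality makes the reconstructing family linearly independent.\<close>

lemma dual_system_basis:
  assumes V: "vs V" and I: "finite I" and sys: "dual_system V I e f"
    and delta: "\<And>i j. \<lbrakk>i \<in> I; j \<in> I\<rbrakk> \<Longrightarrow> f i (e j) = (if i = j then \<one> else \<zero>)"
  shows "inj_on e I" "vectorspace.basis k V (e ` I)"
proof -
  interpret V: vectorspace k V by (rule V)
  have e: "e i \<in> carrier V" and f: "lin V (scalars k) (f i)" if "i \<in> I" for i
    using sys that by (auto simp: dual_system_def)
  have ex: "(\<Oplus>\<^bsub>V\<^esub>i\<in>I. f i v \<odot>\<^bsub>V\<^esub> e i) = v" if "v \<in> carrier V" for v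
    using sys that by (simp add: dual_system_def)
  show inj: "inj_on e I"
  proof (rule inj_onI)
    fix i j assume ij: "i \<in> I" "j \<in> I" "e i = e j"
    then have "f i (e i) = f i (e j)" by simp
    then show "i = j" using delta[OF ij(1,1)] delta[OF ij(1,2)] one_not_zero by (simp split: if_splits)
  qed
  have eI: "e ` I \<subseteq> carrier V" using e by auto
  have reindex: "V.lincomb a (e ` I) = (\<Oplus>\<^bsub>V\<^esub>i\<in>I. a (e i) \<odot>\<^bsub>V\<^esub> e i)" if "a \<in> e ` I \<rightarrow> carrier k" for a
    unfolding V.lincomb_def using that eI by (intro V.finsum_reindex[OF _ inj]) auto
  have "V.lin_indpt (e ` I)"
  proof (rule V.finite_lin_indpt2[OF _ eI])
    show "finite (e ` I)" using I by simp
    fix a assume a: "a \<in> e ` I \<rightarrow> carrier k" and 0: "V.lincomb a (e ` I) = \<zero>\<^bsub>V\<^esub>"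
    have "a (e j) = \<zero>" if j: "j \<in> I" for j
    proof -
      have ak: "a (e i) \<in> carrier k" if "i \<in> I" for i using a that by auto
      have "\<zero> = f j (\<Oplus>\<^bsub>V\<^esub>i\<in>I. a (e i) \<odot>\<^bsub>V\<^esub> e i)"
        using 0 lin_zero[OF V scalars_vs f[OF j]] by (simp add: reindex[OF a])
      also have "\<dots> = (\<Oplus>\<^bsub>scalars k\<^esub>i\<in>I. f j (a (e i) \<odot>\<^bsub>V\<^esub> e i))"
        by (rule lin_finsum[OF V scalars_vs f[OF j] I]) (intro Pi_I V.smult_closed ak e)
      also have "\<dots> = (\<Oplus>\<^bsub>scalars k\<^esub>i\<in>I. if j = i then a (e i) else \<zero>)"
        by (rule finsum_cong_weak) (simp add: lin_smult[OF f[OF j]] ak e delta j)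
      also have "\<dots> = (\<Oplus>i\<in>I. if j = i then a (e i) else \<zero>)"
        by (simp add: finsum_def finprod_def)
      also have "\<dots> = a (e j)"
        using ak by (intro finsum_singleton[OF j I]) auto
      finally show ?thesis by simp
    qed
    then show "\<forall>v\<in>e ` I. a v = \<zero>" by auto
  qed
  moreover have "V.gen_set (e ` I)"
  proof
    show "V.span (e ` I) \<subseteq> carrier V" by (rule V.span_is_subset2[OF eI])
    show "carrier V \<subseteq> V.span (e ` I)"
    proof
      fix v assume v: "v \<in> carrier V"
      let ?a = "\<lambda>w. f (inv_into I e w) v"
      have fk: "f i v \<in> carrier k" if "i \<in> I" for i using lin_closed[OF f[OF that] v] by simp
      have a: "?a \<in> e ` I \<rightarrow> carrier k" using fk inj by auto
      have "V.lincomb ?a (e ` I) = (\<Oplus>\<^bsub>V\<^esub>i\<in>I. f i v \<odot>\<^bsub>V\<^esub> e i)"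
        unfolding reindex[OF a] by (rule finsum_cong_weak) (simp add: inj)
      then have "V.lincomb ?a (e ` I) = v" by (simp only: ex[OF v])
      then show "v \<in> V.span (e ` I)"
        unfolding V.finite_span[OF finite_imageI[OF I] eI] using a by (intro CollectI exI[of _ ?a]) simp
    qed
  qed
  ultimately show "vectorspace.basis k V (e ` I)" using eI by (simp add: V.basis_def)
qed

lemma basis_coordinates:
  assumes V: "vs V" and fin: "finite B" and basis: "vectorspace.basis k V B"
  obtains f where "\<And>b. b \<in> B \<Longrightarrow> lin V (scalars k) (f b)"
    "\<And>b b'. \<lbrakk>b \<in> B; b' \<in> B\<rbrakk> \<Longrightarrow> f b' b = (if b = b' then \<one> else \<zero>)"
proof -
  interpret V: vectorspace k V by (rule V)
  have BV: "B \<subseteq> carrier V" using basis by (simp add: V.basis_def)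
  have ex1: "\<exists>!a. a \<in> B \<rightarrow>\<^sub>E carrier k \<and> V.lincomb a B = v" if "v \<in> carrier V" for v
    using V.basis_criterion[OF fin BV] basis that by blast
  define c where "c v = (THE a. a \<in> B \<rightarrow>\<^sub>E carrier k \<and> V.lincomb a B = v)" for v
  have c: "c v \<in> B \<rightarrow>\<^sub>E carrier k" "V.lincomb (c v) B = v" if "v \<in> carrier V" for v
    using theI'[OF ex1[OF that]] unfolding c_def by blast+
  have ck: "c v b \<in> carrier k" if "v \<in> carrier V" "b \<in> B" for v b
    using c(1)[OF that(1)] that(2) by auto
  have unique: "c v b = a b" if v: "v \<in> carrier V" and a: "a \<in> B \<rightarrow> carrier k" and "V.lincomb a B = v" and b: "b \<in> B"
    for v a b
  proof -
    have "V.lincomb (restrict a B) B = V.lincomb a B"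
      unfolding V.lincomb_def by (rule finsum_cong_weak) simp
    then have "restrict a B \<in> B \<rightarrow>\<^sub>E carrier k \<and> V.lincomb (restrict a B) B = v"
      using a that(3) by auto
    then have "c v = restrict a B" using ex1[OF v] c[OF v] by blast
    then show ?thesis using b by simp
  qed
  show ?thesis
  proof (rule that[of "\<lambda>b v. c v b"])
    fix b assume b: "b \<in> B"
    show "lin V (scalars k) (\<lambda>v. c v b)"
    proof (rule linI)
      fix v assume v: "v \<in> carrier V"
      have cv: "c v \<in> B \<rightarrow> carrier k" using ck[OF v] by auto
      show "c v b \<in> carrier (scalars k)" using ck[OF v b] by simp
      show "c (r \<odot>\<^bsub>V\<^esub> v) b = r \<odot>\<^bsub>scalars k\<^esub> c v b" if r: "r \<in> carrier k" for r
      proof -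
        have "c (r \<odot>\<^bsub>V\<^esub> v) b = r \<otimes> c v b"
          by (rule unique[OF _ _ _ b])
            (use r v ck[OF v] V.lincomb_smult[OF BV cv r] c(2)[OF v] in auto)
        then show ?thesis by simp
      qed
      fix w assume w: "w \<in> carrier V"
      have cw: "c w \<in> B \<rightarrow> carrier k" using ck[OF w] by auto
      have "c (v \<oplus>\<^bsub>V\<^esub> w) b = c v b \<oplus> c w b"
        by (rule unique[OF _ _ _ b])
          (use v w ck[OF v] ck[OF w] V.lincomb_sum[OF fin BV cv cw] c(2)[OF v] c(2)[OF w] in auto)
      then show "c (v \<oplus>\<^bsub>V\<^esub> w) b = c v b \<oplus>\<^bsub>scalars k\<^esub> c w b" by simp
    qed
  next
    fix b b' assume b: "b \<in> B" and b': "b' \<in> B"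
    have bV: "b \<in> carrier V" using b BV by blast
    show "c b b' = (if b = b' then \<one> else \<zero>)"
    proof (rule unique[OF bV _ _ b'])
      have "V.lincomb (\<lambda>b'. if b = b' then \<one> else \<zero>) B = (\<Oplus>\<^bsub>V\<^esub>b'\<in>B. if b = b' then b' else \<zero>\<^bsub>V\<^esub>)"
        unfolding V.lincomb_def
      proof (rule finsum_cong_weak)
        fix b' assume "b' \<in> B"
        then have "b' \<in> carrier V" using BV by blast
        then show "(if b = b' then \<one> else \<zero>) \<odot>\<^bsub>V\<^esub> b' = (if b = b' then b' else \<zero>\<^bsub>V\<^esub>)" by simp
      qed
      also have "\<dots> = b" using BV by (intro V.finsum_singleton[OF b fin]) auto
      finally show "V.lincomb (\<lambda>b'. if b = b' then \<one> else \<zero>) B = b" .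
    qed auto
  qed
qed

end

context dual_pair
begin

text \<open>The dual basis of a basis of \<open>K\<close> is a basis of \<open>L\<close>, and the two orders of summation in the
  conditions on \<open>q\<close> agree. All other conditions come in symmetric pairs.\<close>

lemma swap: "dual_pair k L K (\<lambda>l x. p x l) (\<lambda>l x. q x l)"
proof (rule dual_pair.intro[OF ground_axioms], rule dual_pair_axioms.intro)
  show "unital_algebra k L" "unital_algebra k K" by (rule L, rule K)
  show "lin L (T L L) (comult L)" "lin K (T K K) (comult K)" by (rule comult_L, rule comult_K)
  show "bil L K (scalars k) (\<lambda>l x. p x l)" "bil L K (scalars k) (\<lambda>l x. q x l)"
    using p_bilinear q_bilinear by (simp_all add: bilinear_def)
  show "\<exists>B d. finite B \<and> vectorspace.basis k L B \<and> d \<in> B \<rightarrow> carrier K \<and>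
      (\<forall>b\<in>B. \<forall>b'\<in>B. p (d b') b = (if b = b' then \<one> else \<zero>)) \<and>
      dual_system L B (\<lambda>b. b) (\<lambda>b x. p (d b) x) \<and> dual_system K B d (\<lambda>l x. p x l)"
  proof -
    interpret Kv: vectorspace k K by (rule K_vs)
    obtain B d where B: "finite B" "vectorspace.basis k K B" "d \<in> B \<rightarrow> carrier L"
      "\<And>b b'. \<lbrakk>b \<in> B; b' \<in> B\<rbrakk> \<Longrightarrow> p b (d b') = (if b = b' then \<one> else \<zero>)"
      "dual_system K B (\<lambda>b. b) (\<lambda>b x. p x (d b))" "dual_system L B d p"
      using dual_bases by blast
    have BK: "b \<in> carrier K" if "b \<in> B" for b using that B(2) by (auto simp: Kv.basis_def)
    have inj: "inj_on d B" and basis: "vectorspace.basis k L (d ` B)"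
      using dual_system_basis[OF L_vs B(1,6) B(4)] by blast+
    let ?e = "inv_into B d"
    have sL: "dual_system L (d ` B) (\<lambda>b. b) (\<lambda>b x. p (?e b) x)"
    proof (rule basis_dual_system[OF L_vs _ basis])
      show "finite (d ` B)" using B(1) by simp
      show "lin L (scalars k) (p (?e b))" if "b \<in> d ` B" for b
        using that p_right[OF lin_id] BK inj by auto
      show "p (?e b') b = (if b = b' then \<one> else \<zero>)" if "b \<in> d ` B" "b' \<in> d ` B" for b b'
        using that inj B(4) by (auto simp: inj_on_eq_iff)
    qed
    have "dual_system K (d ` B) ?e (\<lambda>l x. p x l)"
    proof -
      have "(\<Oplus>\<^bsub>K\<^esub>l\<in>d ` B. p x l \<odot>\<^bsub>K\<^esub> ?e l) = x" if x: "x \<in> carrier K" for x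
      proof -
        have "(\<Oplus>\<^bsub>K\<^esub>l\<in>d ` B. p x l \<odot>\<^bsub>K\<^esub> ?e l) = (\<Oplus>\<^bsub>K\<^esub>b\<in>B. p x (d b) \<odot>\<^bsub>K\<^esub> ?e (d b))"
          using inj B(3) BK by (intro Kv.finsum_reindex) (auto intro!: smult_closed[OF K_vs] p_closed[OF x])
        also have "\<dots> = (\<Oplus>\<^bsub>K\<^esub>b\<in>B. p x (d b) \<odot>\<^bsub>K\<^esub> b)"
          by (rule finsum_cong_weak) (simp add: inj)
        also have "\<dots> = x" using B(5) x by (simp add: dual_system_def)
        finally show ?thesis .
      qed
      then show ?thesis
        using B(1,3) BK inj p_left[OF lin_id] by (auto simp: dual_system_def)
    qed
    moreover have "\<forall>b\<in>d ` B. \<forall>b'\<in>d ` B. p (?e b') b = (if b = b' then \<one> else \<zero>)"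
      using inj B(4) by (auto simp: inj_on_eq_iff)
    moreover have "?e \<in> d ` B \<rightarrow> carrier K" using BK inj by auto
    ultimately show ?thesis using B(1) basis sL by blast
  qed
  show "counit L l = p \<one>\<^bsub>K\<^esub> l" if "l \<in> carrier L" for l by (rule counit_L[OF that])
  show "counit K x = p x \<one>\<^bsub>L\<^esub>" if "x \<in> carrier K" for x by (rule counit_K[OF that])
  fix x l assume x: "x \<in> carrier K" and l: "l \<in> carrier L"
  show "p (x \<otimes>\<^bsub>K\<^esub> x') l = lift (scalars k) (\<lambda>l1 l2. p x l1 \<otimes> p x' l2) (comult L l)" if "x' \<in> carrier K" for x'
    by (rule pair_mult_K[OF x that l])
  show "p x (l \<otimes>\<^bsub>L\<^esub> l') = lift (scalars k) (\<lambda>x1 x2. p x1 l \<otimes> p x2 l') (comult K x)" if "l' \<in> carrier L" for l'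
    by (rule pair_mult_L[OF x l that])
  show "lift (scalars k) (\<lambda>l1 l2. lift (scalars k) (\<lambda>x1 x2. p x1 l1 \<otimes> q x2 l2) (comult K x)) (comult L l)
      = p \<one>\<^bsub>K\<^esub> l \<otimes> p x \<one>\<^bsub>L\<^esub>"
  proof -
    have "lift (scalars k) (\<lambda>l1 l2. lift (scalars k) (\<lambda>x1 x2. p x1 l1 \<otimes> q x2 l2) (comult K x)) (comult L l)
        = lift (scalars k) (\<lambda>x1 x2. lift (scalars k) (\<lambda>l1 l2. p x1 l1 \<otimes> q x2 l2) (comult L l)) (comult K x)"
      by (rule lift_swap[OF comult_L_closed[OF l] comult_K_closed[OF x] L_vs L_vs K_vs K_vs scalars_vs])
        (assumption | rule multilin)+
    then show ?thesis
      using p_closed[OF x one_closed_algebra[OF L]] p_closed[OF one_closed_algebra[OF K] l]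
      by (simp add: p_q[OF x l] m_comm)
  qed
  show "lift (scalars k) (\<lambda>l1 l2. lift (scalars k) (\<lambda>x1 x2. q x1 l1 \<otimes> p x2 l2) (comult K x)) (comult L l)
      = p \<one>\<^bsub>K\<^esub> l \<otimes> p x \<one>\<^bsub>L\<^esub>"
  proof -
    have "lift (scalars k) (\<lambda>l1 l2. lift (scalars k) (\<lambda>x1 x2. q x1 l1 \<otimes> p x2 l2) (comult K x)) (comult L l)
        = lift (scalars k) (\<lambda>x1 x2. lift (scalars k) (\<lambda>l1 l2. q x1 l1 \<otimes> p x2 l2) (comult L l)) (comult K x)"
      by (rule lift_swap[OF comult_L_closed[OF l] comult_K_closed[OF x] L_vs L_vs K_vs K_vs scalars_vs])
        (assumption | rule multilin)+
    then show ?thesis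
      using p_closed[OF x one_closed_algebra[OF L]] p_closed[OF one_closed_algebra[OF K] l]
      by (simp add: q_p[OF x l] m_comm)
  qed
qed (rule comult_K_one comult_L_one pair_one)+

end

section \<open>The dual of a finite-dimensional Hopf algebra\<close>

text \<open>The dual Hopf algebra extends the record of the dual algebra, so their tensor squares have to be
  identified. Tensor products depend only on the fields that enter the bilinearity relations, the
  product and the unit.\<close>

lemma tensor_rels_mono:
  assumes "carrier A = carrier A'" "add A = add A'" "smult A = smult A'"
    and "carrier B = carrier B'" "add B = add B'" "smult B = smult B'"
  shows "tensor_rels k A B \<subseteq> tensor_rels k A' B'"
proof
  fix r assume "r \<in> tensor_rels k A B"
  then show "r \<in> tensor_rels k A' B'"
  proof induction
    case (add_left a a' b)
    then show ?case using tensor_rels.add_left[of a A' a' b B' k] by (simp add: assms)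
  next
    case (add_right a b b')
    then show ?case using tensor_rels.add_right[of a A' b B' b' k] by (simp add: assms)
  next
    case (smult_left c a b)
    then show ?case using tensor_rels.smult_left[of c k a A' b B'] by (simp add: assms)
  next
    case (smult_right c a b)
    then show ?case using tensor_rels.smult_right[of c k a A' b B'] by (simp add: assms)
  qed
qed

lemma tensor_cong:
  assumes A: "carrier A = carrier A'" "add A = add A'" "smult A = smult A'" "mult A = mult A'" "one A = one A'"
    and B: "carrier B = carrier B'" "add B = add B'" "smult B = smult B'" "mult B = mult B'" "one B = one B'"
  shows "tensor k A B = tensor k A' B'" "pure_tensor k A B = pure_tensor k A' B'"
proof -
  have "tensor_rels k A B = tensor_rels k A' B'"
    using tensor_rels_mono[of A A' B B' k] tensor_rels_mono[of A' A B' B k] A B by auto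
  then have null: "tensor_null k A B = tensor_null k A' B'"
    by (simp add: tensor_null_def A B)
  then show pure: "pure_tensor k A B = pure_tensor k A' B'"
    by (simp add: pure_tensor_def A B fun_eq_iff)
  have "tensor_space k A B = tensor_space k A' B'"
    by (simp add: tensor_space_def null A B)
  then show "tensor k A B = tensor k A' B'"
    by (simp add: tensor_def pure A B)
qed

lemma dual_hopf_simps [simp]:
  "carrier (dual_hopf k H) = carrier (dual_algebra k H)" "mult (dual_hopf k H) = mult (dual_algebra k H)"
  "one (dual_hopf k H) = one (dual_algebra k H)" "zero (dual_hopf k H) = zero (dual_algebra k H)"
  "add (dual_hopf k H) = add (dual_algebra k H)" "smult (dual_hopf k H) = smult (dual_algebra k H)"
  "comult (dual_hopf k H) = dual_comult k H" "counit (dual_hopf k H) = (\<lambda>\<theta>. \<theta> \<one>\<^bsub>H\<^esub>)"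
  "antipode (dual_hopf k H) = (\<lambda>\<theta>. \<lambda>h\<in>carrier H. \<theta> (antipode H h))"
  by (simp_all add: dual_hopf_def module.defs hopf.defs)

lemma tensor_dual_hopf:
  "tensor k (dual_hopf k H) (dual_hopf k H) = tensor k (dual_algebra k H) (dual_algebra k H)"
  by (rule tensor_cong) simp_all

context ground
begin

lemma unital_algebra_transfer:
  assumes A: "unital_algebra k A"
    and eq: "carrier B = carrier A" "mult B = mult A" "one B = one A" "zero B = zero A" "add B = add A" "smult B = smult A"
  shows "unital_algebra k B"
proof -
  interpret A: unital_algebra k A by (rule A)
  have "vs B"
    using A.vectorspace_axioms vs_transfer[OF A.vectorspace_axioms, of B] eq by simp
  moreover have "bil B B B (mult B)"
    using mult_bilinear[OF unital_algebra_product[OF A]] by (simp add: bilinear_def module_hom_def eq)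
  ultimately have "bilinear_product B" by (simp add: bilinear_product_def)
  then show ?thesis by (rule unital_algebraI) (simp_all add: eq A.m_assoc)
qed

end

locale finite_hopf = ground k
  for k :: "('k, 'm) ring_scheme" (structure) +
  fixes H :: "('k, 'h, 'n) hopf_scheme"
  assumes H [multilin]: "hopf_algebra k H" and fin: "vectorspace.fin_dim k H"
begin

abbreviation "H' \<equiv> dual_hopf k H"

sublocale H: hopf_algebra k H by (rule H)

lemmas vH [multilin] = hopf_vs[OF H]

lemma dual_algebra_conv: "dual_algebra k H = conv_algebra k H (scalars k)"
  by (auto simp: dual_algebra_def conv_algebra_def restrict_def fun_eq_iff counit_closed[OF H])

lemma scalars_unital: "unital_algebra k (scalars k)"
proof (rule unital_algebraI)
  show "bilinear_product (scalars k)"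
    unfolding bilinear_product_def using scalars_vs smult_bilinear[OF scalars_vs] by simp
qed (simp_all add: m_assoc)

lemma dual_unital_algebra [multilin]: "unital_algebra k H'"
  by (rule unital_algebra_transfer[OF conv_unital_algebra[OF H scalars_unital]])
    (simp_all add: dual_algebra_conv)

lemmas vH' [multilin] = unital_algebra_vs[OF dual_unital_algebra]

lemma dual_carrier: "carrier H' = module_hom k H (scalars k) \<inter> extensional (carrier H)"
  by (simp add: dual_algebra_conv)

lemma dual_value: "\<lbrakk>\<theta> \<in> carrier H'; h \<in> carrier H\<rbrakk> \<Longrightarrow> \<theta> h \<in> carrier k"
  unfolding dual_carrier using lin_closed[of \<theta> k H "scalars k" h] by simp

lemma dual_ext: "\<lbrakk>\<theta> \<in> carrier H'; \<theta>' \<in> carrier H'; \<And>h. h \<in> carrier H \<Longrightarrow> \<theta> h = \<theta>' h\<rbrakk> \<Longrightarrow> \<theta> = \<theta>'"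
  unfolding dual_carrier by (auto intro: extensionalityI)

lemma eval_dual_lin: "h \<in> carrier H \<Longrightarrow> lin H' (scalars k) (\<lambda>\<theta>. \<theta> h)"
  using conv_eval_lin[OF vH scalars_vs, of h] by (simp add: dual_algebra_conv module_hom_def)

lemma eval_bilinear: "bil H H' (scalars k) (\<lambda>h \<theta>. \<theta> h)"
proof (rule bilinearI[OF eval_dual_lin])
  show "lin H (scalars k) (\<lambda>h. \<theta> h)" if "\<theta> \<in> carrier H'" for \<theta>
    using that unfolding dual_carrier by simp
qed

lemma dual_mult_apply:
  "h \<in> carrier H \<Longrightarrow> (\<theta> \<otimes>\<^bsub>H'\<^esub> \<theta>') h = lift (scalars k) (\<lambda>h1 h2. \<theta> h1 \<otimes> \<theta>' h2) (comult H h)"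
  by (simp add: dual_algebra_conv)

lemma dual_one_apply: "h \<in> carrier H \<Longrightarrow> \<one>\<^bsub>H'\<^esub> h = counit H h"
  by (simp add: dual_algebra_conv counit_closed[OF H])

lemma dual_bases_exist:
  "\<exists>B d. finite B \<and> H.basis B \<and> d \<in> B \<rightarrow> carrier H' \<and>
      (\<forall>b\<in>B. \<forall>b'\<in>B. d b' b = (if b = b' then \<one> else \<zero>)) \<and>
      dual_system H B (\<lambda>b. b) d \<and> dual_system H' B d (\<lambda>h \<theta>. \<theta> h)"
proof -
  obtain B where B: "finite B" "H.basis B" using H.finite_basis_exists[OF fin] by blast
  have BH: "b \<in> carrier H" if "b \<in> B" for b using that B(2) by (auto simp: H.basis_def)
  obtain f where f: "\<And>b. b \<in> B \<Longrightarrow> lin H (scalars k) (f b)"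
    "\<And>b b'. \<lbrakk>b \<in> B; b' \<in> B\<rbrakk> \<Longrightarrow> f b' b = (if b = b' then \<one> else \<zero>)"
    by (rule basis_coordinates[OF vH B]) blast
  define d where "d b = restrict (f b) (carrier H)" for b
  have dl: "lin H (scalars k) (d b)" if "b \<in> B" for b
    using f(1)[OF that] by (simp add: d_def lin_restrict[OF vH])
  have dH: "d b \<in> carrier H'" if "b \<in> B" for b
    using dl[OF that] unfolding dual_carrier by (simp add: d_def)
  have delta: "d b' b = (if b = b' then \<one> else \<zero>)" if "b \<in> B" "b' \<in> B" for b b'
    using that f(2) BH by (simp add: d_def)
  have sys: "dual_system H B (\<lambda>b. b) d"
    by (rule basis_dual_system[OF vH B dl delta])
  interpret H'v: vectorspace k H' by (rule vH')
  have "(\<Oplus>\<^bsub>H'\<^esub>b\<in>B. \<theta> b \<odot>\<^bsub>H'\<^esub> d b) = \<theta>" if \<theta>: "\<theta> \<in> carrier H'" for \<theta>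
  proof (rule dual_ext[OF _ \<theta>])
    have cl: "(\<lambda>b. \<theta> b \<odot>\<^bsub>H'\<^esub> d b) \<in> B \<rightarrow> carrier H'"
      by (intro Pi_I smult_closed[OF vH'] dual_value[OF \<theta>] BH dH)
    then show "(\<Oplus>\<^bsub>H'\<^esub>b\<in>B. \<theta> b \<odot>\<^bsub>H'\<^esub> d b) \<in> carrier H'" by (rule H'v.finsum_closed)
    fix h assume h: "h \<in> carrier H"
    have \<theta>l: "lin H (scalars k) \<theta>" using \<theta> unfolding dual_carrier by simp
    have dk: "d b h \<in> carrier k" if "b \<in> B" for b by (rule dual_value[OF dH[OF that] h])
    have "(\<Oplus>\<^bsub>H'\<^esub>b\<in>B. \<theta> b \<odot>\<^bsub>H'\<^esub> d b) h = (\<Oplus>\<^bsub>scalars k\<^esub>b\<in>B. (\<theta> b \<odot>\<^bsub>H'\<^esub> d b) h)"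
      by (rule lin_finsum[OF vH' scalars_vs eval_dual_lin[OF h] B(1) cl])
    also have "\<dots> = (\<Oplus>\<^bsub>scalars k\<^esub>b\<in>B. \<theta> (d b h \<odot>\<^bsub>H\<^esub> b))"
      by (rule finsum_cong_weak)
        (simp add: lin_smult[OF eval_dual_lin[OF h]] lin_smult[OF \<theta>l] dual_value[OF \<theta>] BH dH dk m_comm del: dual_hopf_simps)
    also have "\<dots> = \<theta> (\<Oplus>\<^bsub>H\<^esub>b\<in>B. d b h \<odot>\<^bsub>H\<^esub> b)"
      by (rule lin_finsum[OF vH scalars_vs \<theta>l B(1), symmetric]) (intro Pi_I smult_closed[OF vH] dk BH)
    also have "(\<Oplus>\<^bsub>H\<^esub>b\<in>B. d b h \<odot>\<^bsub>H\<^esub> b) = h" using sys h by (simp add: dual_system_def)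
    finally show "(\<Oplus>\<^bsub>H'\<^esub>b\<in>B. \<theta> b \<odot>\<^bsub>H'\<^esub> d b) h = \<theta> h" .
  qed
  then have "dual_system H' B d (\<lambda>h \<theta>. \<theta> h)"
    unfolding dual_system_def using B(1) dH eval_dual_lin BH by blast
  then show ?thesis using B dH delta sys by blast
qed

text \<open>The pairing of the tensor square of the dual with \<open>H \<times> H\<close>.\<close>

definition eval_dual2 where
  "eval_dual2 x y t = lift (scalars k) (\<lambda>\<theta>1 \<theta>2. \<theta>1 x \<otimes> \<theta>2 y) t"

lemma eval_dual2_bil: "\<lbrakk>x \<in> carrier H; y \<in> carrier H\<rbrakk> \<Longrightarrow> bil H' H' (scalars k) (\<lambda>\<theta>1 \<theta>2. \<theta>1 x \<otimes> \<theta>2 y)"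
  by (intro bilinearI lin_scalar_left lin_scalar_right eval_dual_lin dual_value)

lemma eval_dual2_lin: "\<lbrakk>x \<in> carrier H; y \<in> carrier H\<rbrakk> \<Longrightarrow> lin (T H' H') (scalars k) (eval_dual2 x y)"
  unfolding eval_dual2_def by (rule lift_lin[OF vH' vH' scalars_vs eval_dual2_bil])

lemma eval_dual2_pt:
  "\<lbrakk>x \<in> carrier H; y \<in> carrier H; \<theta> \<in> carrier H'; \<theta>' \<in> carrier H'\<rbrakk> \<Longrightarrow> eval_dual2 x y (pt H' H' \<theta> \<theta>') = \<theta> x \<otimes> \<theta>' y"
  unfolding eval_dual2_def by (rule lift_pt[OF vH' vH' scalars_vs eval_dual2_bil])

lemma eval_dual2_inj:
  assumes t: "t \<in> carrier (T H' H')" "t' \<in> carrier (T H' H')"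
    and eq: "\<And>x y. \<lbrakk>x \<in> carrier H; y \<in> carrier H\<rbrakk> \<Longrightarrow> eval_dual2 x y t = eval_dual2 x y t'"
  shows "t = t'"
proof -
  obtain B d where B: "H.basis B" "dual_system H' B d (\<lambda>h \<theta>. \<theta> h)"
    using dual_bases_exist by blast
  note sys = dual_system_tensor[OF vH' vH' B(2) B(2), unfolded dual_system_def]
  have *: "eval_dual2 (fst ij) (snd ij) t = eval_dual2 (fst ij) (snd ij) t'" if "ij \<in> B \<times> B" for ij
    using that B(1) by (intro eq) (auto simp: H.basis_def)
  let ?e = "\<lambda>ij. pt H' H' (d (fst ij)) (d (snd ij))"
  have "(\<Oplus>\<^bsub>T H' H'\<^esub>ij\<in>B \<times> B. eval_dual2 (fst ij) (snd ij) t \<odot>\<^bsub>T H' H'\<^esub> ?e ij)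
      = (\<Oplus>\<^bsub>T H' H'\<^esub>ij\<in>B \<times> B. eval_dual2 (fst ij) (snd ij) t' \<odot>\<^bsub>T H' H'\<^esub> ?e ij)"
    by (rule finsum_cong_weak) (simp only: *)
  moreover have "(\<Oplus>\<^bsub>T H' H'\<^esub>ij\<in>B \<times> B. eval_dual2 (fst ij) (snd ij) u \<odot>\<^bsub>T H' H'\<^esub> ?e ij) = u"
    if "u \<in> carrier (T H' H')" for u
    using sys[THEN conjunct2, THEN conjunct2, THEN conjunct2, rule_format, OF that]
    unfolding eval_dual2_def .
  ultimately show ?thesis using t by (simp only:)
qed

text \<open>Existence for the definite description of the coproduct: the tensor
  \<open>\<Sum> d(b) \<otimes> \<theta>(b -)\<close> over dual bases has the required values. Uniqueness: evaluations at pairs of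
  elements separate tensors.\<close>

lemma dual_comult_spec:
  assumes \<theta>: "\<theta> \<in> carrier H'"
  shows "dual_comult k H \<theta> \<in> carrier (T H' H')"
    and "\<lbrakk>x \<in> carrier H; y \<in> carrier H\<rbrakk> \<Longrightarrow> eval_dual2 x y (dual_comult k H \<theta>) = \<theta> (x \<otimes>\<^bsub>H\<^esub> y)"
proof -
  interpret TT: vectorspace k "T H' H'" by (rule tensor_vs[OF vH' vH'])
  define P where "P t \<longleftrightarrow> t \<in> carrier (T H' H') \<and> (\<forall>x\<in>carrier H. \<forall>y\<in>carrier H. eval_dual2 x y t = \<theta> (x \<otimes>\<^bsub>H\<^esub> y))" for t
  obtain B d where B: "finite B" "H.basis B" "d \<in> B \<rightarrow> carrier H'" "dual_system H B (\<lambda>b. b) d"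
    using dual_bases_exist by blast
  have BH: "b \<in> carrier H" if "b \<in> B" for b using that B(2) by (auto simp: H.basis_def)
  have dH: "d b \<in> carrier H'" if "b \<in> B" for b using B(3) that by blast
  have \<theta>l: "lin H (scalars k) \<theta>" using \<theta> unfolding dual_carrier by simp
  have ex: "(\<Oplus>\<^bsub>H\<^esub>b\<in>B. d b h \<odot>\<^bsub>H\<^esub> b) = h" if "h \<in> carrier H" for h
    using B(4) that by (simp add: dual_system_def)
  have dl: "lin H (scalars k) (d b)" if "b \<in> B" for b using dH[OF that] unfolding dual_carrier by simp
  define Q where "Q b = (\<lambda>y\<in>carrier H. \<theta> (b \<otimes>\<^bsub>H\<^esub> y))" for b
  have Q: "Q b \<in> carrier H'" if "b \<in> carrier H" for b
  proof -
    have "lin H (scalars k) (\<lambda>y. \<theta> (b \<otimes>\<^bsub>H\<^esub> y))"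
      by (rule lin_compose[OF \<theta>l lin_mult_right[OF lin_id unital_algebra_product[OF H.unital_algebra_axioms] that]])
    then show ?thesis unfolding dual_carrier by (simp add: Q_def lin_restrict[OF vH])
  qed
  define t where "t = (\<Oplus>\<^bsub>T H' H'\<^esub>b\<in>B. pt H' H' (d b) (Q b))"
  have cl: "(\<lambda>b. pt H' H' (d b) (Q b)) \<in> B \<rightarrow> carrier (T H' H')"
    by (intro Pi_I pt_closed[OF vH' vH'] dH Q BH)
  have "P t" unfolding P_def
  proof (intro conjI ballI)
    show "t \<in> carrier (T H' H')" unfolding t_def by (rule TT.finsum_closed[OF cl])
    fix x y assume x: "x \<in> carrier H" and y: "y \<in> carrier H"
    have m: "lin H (scalars k) (\<lambda>x. \<theta> (x \<otimes>\<^bsub>H\<^esub> y))"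
      by (rule lin_compose[OF \<theta>l lin_mult_left[OF lin_id unital_algebra_product[OF H.unital_algebra_axioms] y]])
    have dk: "d b x \<in> carrier k" if "b \<in> B" for b by (rule dual_value[OF dH[OF that] x])
    have "eval_dual2 x y t = (\<Oplus>\<^bsub>scalars k\<^esub>b\<in>B. eval_dual2 x y (pt H' H' (d b) (Q b)))"
      unfolding t_def
      by (rule lin_finsum[OF tensor_vs[OF vH' vH'] scalars_vs eval_dual2_lin[OF x y] B(1) cl])
    also have "\<dots> = (\<Oplus>\<^bsub>scalars k\<^esub>b\<in>B. \<theta> ((d b x \<odot>\<^bsub>H\<^esub> b) \<otimes>\<^bsub>H\<^esub> y))"
    proof (rule finsum_cong_weak)
      fix b assume b: "b \<in> B"
      show "eval_dual2 x y (pt H' H' (d b) (Q b)) = \<theta> ((d b x \<odot>\<^bsub>H\<^esub> b) \<otimes>\<^bsub>H\<^esub> y)"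
        unfolding eval_dual2_pt[OF x y dH[OF b] Q[OF BH[OF b]]] lin_smult[OF m dk[OF b] BH[OF b]]
        by (simp add: Q_def y)
    qed
    also have "\<dots> = \<theta> ((\<Oplus>\<^bsub>H\<^esub>b\<in>B. d b x \<odot>\<^bsub>H\<^esub> b) \<otimes>\<^bsub>H\<^esub> y)"
      by (rule lin_finsum[OF vH scalars_vs m B(1), symmetric]) (intro Pi_I smult_closed[OF vH] dk BH)
    finally show "eval_dual2 x y t = \<theta> (x \<otimes>\<^bsub>H\<^esub> y)" by (simp only: ex[OF x])
  qed
  moreover have "s = t" if "P s" for s
    using that \<open>P t\<close> eval_dual2_inj[of s t] unfolding P_def by simp
  ultimately have "P (The P)" by (rule theI)
  moreover have "dual_comult k H \<theta> = The P"
    unfolding dual_comult_def P_def[abs_def] eval_dual2_def tensor_dual_hopf ..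
  ultimately have "P (dual_comult k H \<theta>)" by (simp only:)
  then show "dual_comult k H \<theta> \<in> carrier (T H' H')"
    and "\<lbrakk>x \<in> carrier H; y \<in> carrier H\<rbrakk> \<Longrightarrow> eval_dual2 x y (dual_comult k H \<theta>) = \<theta> (x \<otimes>\<^bsub>H\<^esub> y)"
    unfolding P_def by blast+
qed

lemma dual_comult_lin: "lin H' (T H' H') (comult H')"
proof (rule linI)
  interpret TT: vectorspace k "T H' H'" by (rule tensor_vs[OF vH' vH'])
  interpret H'v: vectorspace k H' by (rule vH')
  note sp = dual_comult_spec
  fix \<theta> assume \<theta>: "\<theta> \<in> carrier H'"
  show "comult H' \<theta> \<in> carrier (T H' H')" using sp(1)[OF \<theta>] by simp
  show "comult H' (c \<odot>\<^bsub>H'\<^esub> \<theta>) = c \<odot>\<^bsub>T H' H'\<^esub> comult H' \<theta>" if c: "c \<in> carrier k" for c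
    unfolding dual_hopf_simps(7)
  proof (rule eval_dual2_inj)
    have c\<theta>: "c \<odot>\<^bsub>H'\<^esub> \<theta> \<in> carrier H'" by (rule H'v.smult_closed[OF c \<theta>])
    show "dual_comult k H (c \<odot>\<^bsub>H'\<^esub> \<theta>) \<in> carrier (T H' H')" by (rule sp(1)[OF c\<theta>])
    show "c \<odot>\<^bsub>T H' H'\<^esub> dual_comult k H \<theta> \<in> carrier (T H' H')" by (rule TT.smult_closed[OF c sp(1)[OF \<theta>]])
    show "eval_dual2 x y (dual_comult k H (c \<odot>\<^bsub>H'\<^esub> \<theta>)) = eval_dual2 x y (c \<odot>\<^bsub>T H' H'\<^esub> dual_comult k H \<theta>)"
      if x: "x \<in> carrier H" and y: "y \<in> carrier H" for x y
      unfolding sp(2)[OF c\<theta> x y] lin_smult[OF eval_dual2_lin[OF x y] c sp(1)[OF \<theta>]] sp(2)[OF \<theta> x y]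
        lin_smult[OF eval_dual_lin[OF H.m_closed[OF x y]] c \<theta>] ..
  qed
  fix \<theta>' assume \<theta>': "\<theta>' \<in> carrier H'"
  show "comult H' (\<theta> \<oplus>\<^bsub>H'\<^esub> \<theta>') = comult H' \<theta> \<oplus>\<^bsub>T H' H'\<^esub> comult H' \<theta>'"
    unfolding dual_hopf_simps(7)
  proof (rule eval_dual2_inj)
    have s: "\<theta> \<oplus>\<^bsub>H'\<^esub> \<theta>' \<in> carrier H'" by (rule H'v.a_closed[OF \<theta> \<theta>'])
    show "dual_comult k H (\<theta> \<oplus>\<^bsub>H'\<^esub> \<theta>') \<in> carrier (T H' H')" by (rule sp(1)[OF s])
    show "dual_comult k H \<theta> \<oplus>\<^bsub>T H' H'\<^esub> dual_comult k H \<theta>' \<in> carrier (T H' H')"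
      by (rule TT.a_closed[OF sp(1)[OF \<theta>] sp(1)[OF \<theta>']])
    show "eval_dual2 x y (dual_comult k H (\<theta> \<oplus>\<^bsub>H'\<^esub> \<theta>'))
      = eval_dual2 x y (dual_comult k H \<theta> \<oplus>\<^bsub>T H' H'\<^esub> dual_comult k H \<theta>')"
      if x: "x \<in> carrier H" and y: "y \<in> carrier H" for x y
      unfolding sp(2)[OF s x y] lin_add[OF eval_dual2_lin[OF x y] sp(1)[OF \<theta>] sp(1)[OF \<theta>']]
        sp(2)[OF \<theta> x y] sp(2)[OF \<theta>' x y] lin_add[OF eval_dual_lin[OF H.m_closed[OF x y]] \<theta> \<theta>'] ..
  qed
qed

lemma dual_pairing_mult:
  assumes "\<theta> \<in> carrier H'" "x \<in> carrier H" "y \<in> carrier H"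
  shows "\<theta> (x \<otimes>\<^bsub>H\<^esub> y) = lift (scalars k) (\<lambda>\<theta>1 \<theta>2. \<theta>1 x \<otimes> \<theta>2 y) (comult H' \<theta>)"
  using dual_comult_spec(2)[OF assms] by (simp add: eval_dual2_def)

lemma dual_one_closed: "\<one>\<^bsub>H'\<^esub> \<in> carrier H'"
  by (rule one_closed_algebra[OF dual_unital_algebra])

text \<open>The convolution inverse of the pairing is \<open>\<theta>(S(h))\<close>: summing over \<open>\<theta>\<close> first, the two
  conditions become \<open>\<theta>\<close> applied to the two antipode axioms.\<close>

theorem dual_pair: "dual_pair k H H' (\<lambda>h \<theta>. \<theta> h) (\<lambda>h \<theta>. \<theta> (antipode H h))"
proof (rule dual_pair.intro[OF ground_axioms], rule dual_pair_axioms.intro)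
  note S = antipode_closed[OF H]
  show "unital_algebra k H" "unital_algebra k H'" by (rule H.unital_algebra_axioms, rule dual_unital_algebra)
  show "lin H (T H H) (comult H)" "lin H' (T H' H') (comult H')" by (rule comult_lin[OF H], rule dual_comult_lin)
  show "bil H H' (scalars k) (\<lambda>h \<theta>. \<theta> h)" by (rule eval_bilinear)
  show Sbil: "bil H H' (scalars k) (\<lambda>h \<theta>. \<theta> (antipode H h))"
    by (intro bilinearI eval_dual_lin S lin_compose[OF bilinear_left[OF eval_bilinear] antipode_lin[OF H]])
  show "\<exists>B d. finite B \<and> H.basis B \<and> d \<in> B \<rightarrow> carrier H' \<and>
      (\<forall>b\<in>B. \<forall>b'\<in>B. d b' b = (if b = b' then \<one> else \<zero>)) \<and>
      dual_system H B (\<lambda>b. b) (\<lambda>b x. d b x) \<and> dual_system H' B d (\<lambda>h \<theta>. \<theta> h)"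
    using dual_bases_exist by simp
  show "comult H \<one>\<^bsub>H\<^esub> = pt H H \<one>\<^bsub>H\<^esub> \<one>\<^bsub>H\<^esub>" by (rule hopf_hom_simps(1)[OF H])
  show "comult H' \<one>\<^bsub>H'\<^esub> = pt H' H' \<one>\<^bsub>H'\<^esub> \<one>\<^bsub>H'\<^esub>"
    unfolding dual_hopf_simps(7)
  proof (rule eval_dual2_inj[OF dual_comult_spec(1)[OF dual_one_closed] pt_closed[OF vH' vH' dual_one_closed dual_one_closed]])
    fix x y assume x: "x \<in> carrier H" and y: "y \<in> carrier H"
    show "eval_dual2 x y (dual_comult k H \<one>\<^bsub>H'\<^esub>) = eval_dual2 x y (pt H' H' \<one>\<^bsub>H'\<^esub> \<one>\<^bsub>H'\<^esub>)"
      unfolding dual_comult_spec(2)[OF dual_one_closed x y] eval_dual2_pt[OF x y dual_one_closed dual_one_closed]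
        dual_one_apply[OF H.m_closed[OF x y]] dual_one_apply[OF x] dual_one_apply[OF y]
      by (rule hopf_hom_simps(4)[OF H x y])
  qed
  show "\<one>\<^bsub>H'\<^esub> \<one>\<^bsub>H\<^esub> = \<one>" by (simp only: dual_one_apply[OF H.one_closed] hopf_hom_simps(2)[OF H])
  show "counit H x = \<one>\<^bsub>H'\<^esub> x" if "x \<in> carrier H" for x by (rule dual_one_apply[OF that, symmetric])
  show "counit H' \<theta> = \<theta> \<one>\<^bsub>H\<^esub>" for \<theta> by simp
  fix x \<theta> assume x: "x \<in> carrier H" and \<theta>: "\<theta> \<in> carrier H'"
  have \<theta>l: "lin H (scalars k) \<theta>" using \<theta> unfolding dual_carrier by simp
  note cx = comult_closed[OF H x]
  show "(\<theta> \<otimes>\<^bsub>H'\<^esub> \<theta>') x = lift (scalars k) (\<lambda>x1 x2. \<theta> x1 \<otimes> \<theta>' x2) (comult H x)" for \<theta>'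
    by (rule dual_mult_apply[OF x])
  show "\<theta> (x \<otimes>\<^bsub>H\<^esub> y) = lift (scalars k) (\<lambda>\<theta>1 \<theta>2. \<theta>1 x \<otimes> \<theta>2 y) (comult H' \<theta>)" if "y \<in> carrier H" for y
    by (rule dual_pairing_mult[OF \<theta> x that])
  have conv: "lift (scalars k) (\<lambda>x1 x2. \<theta> (m x1 x2)) (comult H x) = \<one>\<^bsub>H'\<^esub> x \<otimes> \<theta> \<one>\<^bsub>H\<^esub>"
    if m: "bil H H H m" and eq: "lift H m (comult H x) = counit H x \<odot>\<^bsub>H\<^esub> \<one>\<^bsub>H\<^esub>" for m
  proof -
    have "lift (scalars k) (\<lambda>x1 x2. \<theta> (m x1 x2)) (comult H x) = \<theta> (lift H m (comult H x))"
      by (rule lift_hom[OF \<theta>l cx vH vH vH scalars_vs m, symmetric])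
    then show ?thesis
      using lin_smult[OF \<theta>l counit_closed[OF H x] H.one_closed] by (simp add: eq dual_one_apply x del: dual_hopf_simps)
  qed
  show "lift (scalars k) (\<lambda>x1 x2. lift (scalars k) (\<lambda>\<theta>1 \<theta>2. \<theta>1 x1 \<otimes> \<theta>2 (antipode H x2)) (comult H' \<theta>)) (comult H x)
      = \<one>\<^bsub>H'\<^esub> x \<otimes> \<theta> \<one>\<^bsub>H\<^esub>"
  proof -
    have "lift (scalars k) (\<lambda>x1 x2. lift (scalars k) (\<lambda>\<theta>1 \<theta>2. \<theta>1 x1 \<otimes> \<theta>2 (antipode H x2)) (comult H' \<theta>)) (comult H x)
        = lift (scalars k) (\<lambda>x1 x2. \<theta> (x1 \<otimes>\<^bsub>H\<^esub> antipode H x2)) (comult H x)"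
      by (rule lift_cong[OF vH vH cx]) (simp only: dual_pairing_mult[OF \<theta>] S)
    also have "\<dots> = \<one>\<^bsub>H'\<^esub> x \<otimes> \<theta> \<one>\<^bsub>H\<^esub>"
      by (rule conv[OF _ H.antipode_right[OF x]]) (assumption | rule multilin antipode_lin'[OF H] antipode_closed[OF H])+
    finally show ?thesis .
  qed
  show "lift (scalars k) (\<lambda>x1 x2. lift (scalars k) (\<lambda>\<theta>1 \<theta>2. \<theta>1 (antipode H x1) \<otimes> \<theta>2 x2) (comult H' \<theta>)) (comult H x)
      = \<one>\<^bsub>H'\<^esub> x \<otimes> \<theta> \<one>\<^bsub>H\<^esub>"
  proof -
    have "lift (scalars k) (\<lambda>x1 x2. lift (scalars k) (\<lambda>\<theta>1 \<theta>2. \<theta>1 (antipode H x1) \<otimes> \<theta>2 x2) (comult H' \<theta>)) (comult H x)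
        = lift (scalars k) (\<lambda>x1 x2. \<theta> (antipode H x1 \<otimes>\<^bsub>H\<^esub> x2)) (comult H x)"
      by (rule lift_cong[OF vH vH cx]) (simp only: dual_pairing_mult[OF \<theta>] S)
    also have "\<dots> = \<one>\<^bsub>H'\<^esub> x \<otimes> \<theta> \<one>\<^bsub>H\<^esub>"
      by (rule conv[OF _ H.antipode_left[OF x]]) (assumption | rule multilin antipode_lin'[OF H] antipode_closed[OF H])+
    finally show ?thesis .
  qed
qed

end

section \<open>The opposite algebra\<close>

lemma opposite_simps [simp]:
  "carrier (opposite A) = carrier A" "zero (opposite A) = zero A" "add (opposite A) = add A"
  "smult (opposite A) = smult A" "one (opposite A) = one A" "x \<otimes>\<^bsub>opposite A\<^esub> y = y \<otimes>\<^bsub>A\<^esub> x"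
  by (simp_all add: opposite_def)

lemma lift_opposite: "tensor_lift k (opposite A) = tensor_lift k A"
proof -
  have fs: "finsum (opposite A) f I = finsum A f I" for f :: "'z \<Rightarrow> 'c" and I
    by (simp add: finsum_def finprod_def)
  show ?thesis by (intro ext) (simp add: tensor_lift_def fs)
qed

lemma module_hom_opposite [simp]:
  "module_hom k (opposite A) B = module_hom k A B" "module_hom k B (opposite A) = module_hom k B A"
  by (simp_all add: module_hom_def)

context ground
begin

lemma opposite_unital_algebra:
  assumes A: "unital_algebra k A" shows "unital_algebra k (opposite A)"
proof (rule unital_algebraI)
  interpret A: unital_algebra k A by (rule A)
  have "vs (opposite A)"
    by (rule vs_transfer[OF A.vectorspace_axioms]) simp_all
  moreover have "bil (opposite A) (opposite A) (opposite A) (mult (opposite A))"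
    by (rule bilinearI)
      (simp_all add: lin_mult_left[OF lin_id unital_algebra_product[OF A]] lin_mult_right[OF lin_id unital_algebra_product[OF A]])
  ultimately show "bilinear_product (opposite A)" by (simp add: bilinear_product_def)
  fix x y z assume "x \<in> carrier (opposite A)" "y \<in> carrier (opposite A)" "z \<in> carrier (opposite A)"
  then show "x \<otimes>\<^bsub>opposite A\<^esub> y \<otimes>\<^bsub>opposite A\<^esub> z = x \<otimes>\<^bsub>opposite A\<^esub> (y \<otimes>\<^bsub>opposite A\<^esub> z)"
    by (simp add: A.m_assoc)
next
  interpret A: unital_algebra k A by (rule A)
  show "\<one>\<^bsub>opposite A\<^esub> \<in> carrier (opposite A)" by simp
  show "\<one>\<^bsub>opposite A\<^esub> \<otimes>\<^bsub>opposite A\<^esub> x = x" "x \<otimes>\<^bsub>opposite A\<^esub> \<one>\<^bsub>opposite A\<^esub> = x" if "x \<in> carrier (opposite A)" for x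
    using that by simp_all
qed

text \<open>A map that reverses products and coproducts turns a right action into a left one. It also exchanges
  the two factors in the action on a product, which is compensated by passing to the opposite
  algebra.\<close>

lemma left_module_algebra_opposite:
  assumes Y: "unital_algebra k Y" and K: "unital_algebra k K"
    and act: "right_module_algebra K Y act" and lin: "\<And>y. y \<in> carrier Y \<Longrightarrow> lin K Y (act y)"
    and S: "\<And>x. x \<in> carrier K \<Longrightarrow> S x \<in> carrier K"
      "\<And>x y. \<lbrakk>x \<in> carrier K; y \<in> carrier K\<rbrakk> \<Longrightarrow> S (x \<otimes>\<^bsub>K\<^esub> y) = S y \<otimes>\<^bsub>K\<^esub> S x" "S \<one>\<^bsub>K\<^esub> = \<one>\<^bsub>K\<^esub>"
      "\<And>x. x \<in> carrier K \<Longrightarrow> counit K (S x) = counit K x"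
      "\<And>x \<phi>. \<lbrakk>x \<in> carrier K; bil K K Y \<phi>\<rbrakk> \<Longrightarrow>
        lift Y \<phi> (comult K (S x)) = lift Y (\<lambda>x1 x2. \<phi> (S x2) (S x1)) (comult K x)"
  shows "left_module_algebra K (opposite Y) (\<lambda>x y. act y (S x))"
  unfolding left_module_algebra_def
proof (intro conjI ballI)
  note l = act[unfolded right_module_algebra_def]
  fix x x' y assume x: "x \<in> carrier K" and x': "x' \<in> carrier K" and y: "y \<in> carrier (opposite Y)"
  then show "act y (S (x \<otimes>\<^bsub>K\<^esub> x')) = act (act y (S x')) (S x)" using l S by simp
next
  note l = act[unfolded right_module_algebra_def]
  fix y assume "y \<in> carrier (opposite Y)"
  then show "act y (S \<one>\<^bsub>K\<^esub>) = y" using l S by simp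
next
  note l = act[unfolded right_module_algebra_def]
  fix x assume "x \<in> carrier K"
  then show "act \<one>\<^bsub>opposite Y\<^esub> (S x) = counit K x \<odot>\<^bsub>opposite Y\<^esub> \<one>\<^bsub>opposite Y\<^esub>" using l S by simp
next
  note l = act[unfolded right_module_algebra_def]
  fix x y z assume x: "x \<in> carrier K" and y: "y \<in> carrier (opposite Y)" and z: "z \<in> carrier (opposite Y)"
  have yz: "y \<in> carrier Y" "z \<in> carrier Y" using y z by simp_all
  have b: "bil K K Y (\<lambda>x1 x2. act z x1 \<otimes>\<^bsub>Y\<^esub> act y x2)"
    by (intro bilinearI lin_mult_left lin_mult_right unital_algebra_product[OF Y] lin yz lin_closed[OF lin[OF yz(1)]]
        lin_closed[OF lin[OF yz(2)]])
  have "act (z \<otimes>\<^bsub>Y\<^esub> y) (S x) = lift Y (\<lambda>x1 x2. act z x1 \<otimes>\<^bsub>Y\<^esub> act y x2) (comult K (S x))"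
    using l S(1)[OF x] yz by blast
  also have "\<dots> = lift Y (\<lambda>x1 x2. act z (S x2) \<otimes>\<^bsub>Y\<^esub> act y (S x1)) (comult K x)"
    by (rule S(5)[OF x b])
  finally show "act (y \<otimes>\<^bsub>opposite Y\<^esub> z) (S x)
      = lift (opposite Y) (\<lambda>x1 x2. act y (S x1) \<otimes>\<^bsub>opposite Y\<^esub> act z (S x2)) (comult K x)"
    by (simp add: lift_opposite)
qed

lemma right_module_algebra_opposite:
  assumes Y: "unital_algebra k Y" and L: "unital_algebra k L"
    and act: "left_module_algebra L Y act" and lin: "\<And>y. y \<in> carrier Y \<Longrightarrow> lin L Y (\<lambda>l. act l y)"
    and S: "\<And>x. x \<in> carrier L \<Longrightarrow> S x \<in> carrier L"
      "\<And>x y. \<lbrakk>x \<in> carrier L; y \<in> carrier L\<rbrakk> \<Longrightarrow> S (x \<otimes>\<^bsub>L\<^esub> y) = S y \<otimes>\<^bsub>L\<^esub> S x" "S \<one>\<^bsub>L\<^esub> = \<one>\<^bsub>L\<^esub>"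
      "\<And>x. x \<in> carrier L \<Longrightarrow> counit L (S x) = counit L x"
      "\<And>x \<phi>. \<lbrakk>x \<in> carrier L; bil L L Y \<phi>\<rbrakk> \<Longrightarrow>
        lift Y \<phi> (comult L (S x)) = lift Y (\<lambda>x1 x2. \<phi> (S x2) (S x1)) (comult L x)"
  shows "right_module_algebra L (opposite Y) (\<lambda>y l. act (S l) y)"
  unfolding right_module_algebra_def
proof (intro conjI ballI)
  note l = act[unfolded left_module_algebra_def]
  fix x x' y assume x: "x \<in> carrier L" and x': "x' \<in> carrier L" and y: "y \<in> carrier (opposite Y)"
  then show "act (S (x \<otimes>\<^bsub>L\<^esub> x')) y = act (S x') (act (S x) y)" using l S by simp
next
  note l = act[unfolded left_module_algebra_def]
  fix y assume "y \<in> carrier (opposite Y)"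
  then show "act (S \<one>\<^bsub>L\<^esub>) y = y" using l S by simp
next
  note l = act[unfolded left_module_algebra_def]
  fix x assume "x \<in> carrier L"
  then show "act (S x) \<one>\<^bsub>opposite Y\<^esub> = counit L x \<odot>\<^bsub>opposite Y\<^esub> \<one>\<^bsub>opposite Y\<^esub>" using l S by simp
next
  note l = act[unfolded left_module_algebra_def]
  fix x y z assume x: "x \<in> carrier L" and y: "y \<in> carrier (opposite Y)" and z: "z \<in> carrier (opposite Y)"
  have yz: "y \<in> carrier Y" "z \<in> carrier Y" using y z by simp_all
  have b: "bil L L Y (\<lambda>x1 x2. act x1 z \<otimes>\<^bsub>Y\<^esub> act x2 y)"
    by (intro bilinearI lin_mult_left lin_mult_right unital_algebra_product[OF Y] lin yz lin_closed[OF lin[OF yz(1)]]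
        lin_closed[OF lin[OF yz(2)]])
  have "act (S x) (z \<otimes>\<^bsub>Y\<^esub> y) = lift Y (\<lambda>x1 x2. act x1 z \<otimes>\<^bsub>Y\<^esub> act x2 y) (comult L (S x))"
    using l S(1)[OF x] yz by blast
  also have "\<dots> = lift Y (\<lambda>x1 x2. act (S x2) z \<otimes>\<^bsub>Y\<^esub> act (S x1) y) (comult L x)"
    by (rule S(5)[OF x b])
  finally show "act (S x) (y \<otimes>\<^bsub>opposite Y\<^esub> z)
      = lift (opposite Y) (\<lambda>x1 x2. act (S x1) y \<otimes>\<^bsub>opposite Y\<^esub> act (S x2) z) (comult L x)"
    by (simp add: lift_opposite)
qed

end

section \<open>The inverse antipode on the dual\<close>

locale finite_hopf_inverse = finite_hopf k H
  for k :: "('k, 'm) ring_scheme" (structure) and H :: "('k, 'h, 'n) hopf_scheme" +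
  assumes bij: "bij_betw (antipode H) (carrier H) (carrier H)"
begin

abbreviation "SH \<equiv> antipode H"
abbreviation "SHinv \<equiv> inv_into (carrier H) (antipode H)"

lemma S_closed: "h \<in> carrier H \<Longrightarrow> SH h \<in> carrier H"
  by (rule antipode_closed[OF H])

lemma Sinv_closed: "h \<in> carrier H \<Longrightarrow> SHinv h \<in> carrier H"
  using bij by (metis bij_betw_def inv_into_into)

lemma Sinv_S: "h \<in> carrier H \<Longrightarrow> SHinv (SH h) = h"
  by (rule bij_betw_inv_into_left[OF bij])

lemma S_Sinv: "h \<in> carrier H \<Longrightarrow> SH (SHinv h) = h"
  by (rule bij_betw_inv_into_right[OF bij])

lemma S_inj: "\<lbrakk>SH g = SH h; g \<in> carrier H; h \<in> carrier H\<rbrakk> \<Longrightarrow> g = h"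
  using Sinv_S by metis

lemma Sinv_lin: "lin H H SHinv"
proof (rule linI)
  note Sl = antipode_lin[OF H]
  fix g assume g: "g \<in> carrier H"
  show "SHinv g \<in> carrier H" by (rule Sinv_closed[OF g])
  show "SHinv (c \<odot>\<^bsub>H\<^esub> g) = c \<odot>\<^bsub>H\<^esub> SHinv g" if c: "c \<in> carrier k" for c
    by (rule S_inj) (simp_all add: S_Sinv lin_smult[OF Sl] Sinv_closed c g)
  show "SHinv (g \<oplus>\<^bsub>H\<^esub> h) = SHinv g \<oplus>\<^bsub>H\<^esub> SHinv h" if h: "h \<in> carrier H" for h
    by (rule S_inj) (simp_all add: S_Sinv lin_add[OF Sl] Sinv_closed g h)
qed

text \<open>The inverse of the antipode of the dual, that is, the transpose of the inverse antipode. Its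
  properties are obtained by evaluating at elements \<open>S(h)\<close>, where \<open>dual_Sinv \<theta>\<close> takes the
  value \<open>\<theta>(h)\<close>.\<close>

definition dual_Sinv where "dual_Sinv \<theta> = (\<lambda>h\<in>carrier H. \<theta> (SHinv h))"

lemma dual_Sinv_closed: "\<theta> \<in> carrier H' \<Longrightarrow> dual_Sinv \<theta> \<in> carrier H'"
  unfolding dual_carrier using lin_compose[OF _ Sinv_lin, of \<theta> "scalars k"]
  by (simp add: dual_Sinv_def lin_restrict[OF vH])

lemma dual_Sinv_apply: "h \<in> carrier H \<Longrightarrow> dual_Sinv \<theta> (SH h) = \<theta> h"
  by (simp add: dual_Sinv_def S_closed Sinv_S)

lemma dual_eq_S:
  assumes "\<theta> \<in> carrier H'" "\<theta>' \<in> carrier H'" "\<And>h. h \<in> carrier H \<Longrightarrow> \<theta> (SH h) = \<theta>' (SH h)"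
  shows "\<theta> = \<theta>'"
proof (rule dual_ext[OF assms(1,2)])
  fix h assume h: "h \<in> carrier H"
  show "\<theta> h = \<theta>' h" using assms(3)[OF Sinv_closed[OF h]] by (simp add: S_Sinv h)
qed

lemma dual_Sinv_lin: "lin H' H' dual_Sinv"
proof (rule linI)
  interpret H'v: vectorspace k H' by (rule vH')
  fix \<theta> assume \<theta>: "\<theta> \<in> carrier H'"
  show "dual_Sinv \<theta> \<in> carrier H'" by (rule dual_Sinv_closed[OF \<theta>])
  show "dual_Sinv (c \<odot>\<^bsub>H'\<^esub> \<theta>) = c \<odot>\<^bsub>H'\<^esub> dual_Sinv \<theta>" if c: "c \<in> carrier k" for c
    by (rule dual_eq_S[OF dual_Sinv_closed[OF H'v.smult_closed[OF c \<theta>]] H'v.smult_closed[OF c dual_Sinv_closed[OF \<theta>]]])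
      (simp add: dual_Sinv_apply lin_smult[OF eval_dual_lin] c \<theta> dual_Sinv_closed S_closed del: dual_hopf_simps)
  show "dual_Sinv (\<theta> \<oplus>\<^bsub>H'\<^esub> \<theta>') = dual_Sinv \<theta> \<oplus>\<^bsub>H'\<^esub> dual_Sinv \<theta>'" if \<theta>': "\<theta>' \<in> carrier H'" for \<theta>'
    by (rule dual_eq_S[OF dual_Sinv_closed[OF H'v.a_closed[OF \<theta> \<theta>']] H'v.a_closed[OF dual_Sinv_closed[OF \<theta>] dual_Sinv_closed[OF \<theta>']]])
      (simp add: dual_Sinv_apply lin_add[OF eval_dual_lin] \<theta> \<theta>' dual_Sinv_closed S_closed del: dual_hopf_simps)
qed

lemma dual_antipode_closed: "\<theta> \<in> carrier H' \<Longrightarrow> antipode H' \<theta> \<in> carrier H'"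
  unfolding dual_carrier using lin_compose[OF _ antipode_lin[OF H], of \<theta> "scalars k"]
  by (simp add: lin_restrict[OF vH])

lemma dual_antipode_apply: "h \<in> carrier H \<Longrightarrow> antipode H' \<theta> h = \<theta> (SH h)"
  by simp

lemma dual_Sinv_antipode: "\<theta> \<in> carrier H' \<Longrightarrow> dual_Sinv (antipode H' \<theta>) = \<theta>"
  by (rule dual_eq_S) (simp_all only: dual_Sinv_closed dual_antipode_closed dual_Sinv_apply dual_antipode_apply)

lemma dual_antipode_lin: "lin H' H' (antipode H')"
proof (rule linI)
  interpret H'v: vectorspace k H' by (rule vH')
  note cl = dual_antipode_closed
  fix \<theta> assume \<theta>: "\<theta> \<in> carrier H'"
  show "antipode H' \<theta> \<in> carrier H'" by (rule cl[OF \<theta>])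
  show "antipode H' (c \<odot>\<^bsub>H'\<^esub> \<theta>) = c \<odot>\<^bsub>H'\<^esub> antipode H' \<theta>" if c: "c \<in> carrier k" for c
    by (rule dual_ext[OF cl[OF H'v.smult_closed[OF c \<theta>]] H'v.smult_closed[OF c cl[OF \<theta>]]])
      (simp add: dual_antipode_apply lin_smult[OF eval_dual_lin] c \<theta> cl S_closed del: dual_hopf_simps)
  show "antipode H' (\<theta> \<oplus>\<^bsub>H'\<^esub> \<theta>') = antipode H' \<theta> \<oplus>\<^bsub>H'\<^esub> antipode H' \<theta>'" if \<theta>': "\<theta>' \<in> carrier H'" for \<theta>'
    by (rule dual_ext[OF cl[OF H'v.a_closed[OF \<theta> \<theta>']] H'v.a_closed[OF cl[OF \<theta>] cl[OF \<theta>']]])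
      (simp add: dual_antipode_apply lin_add[OF eval_dual_lin] \<theta> \<theta>' cl S_closed del: dual_hopf_simps)
qed

lemma dual_mult_closed: "\<lbrakk>\<theta> \<in> carrier H'; \<theta>' \<in> carrier H'\<rbrakk> \<Longrightarrow> \<theta> \<otimes>\<^bsub>H'\<^esub> \<theta>' \<in> carrier H'"
  by (rule mult_closed[OF unital_algebra_product[OF dual_unital_algebra]])

lemma dual_Sinv_mult:
  assumes \<theta>: "\<theta> \<in> carrier H'" and \<theta>': "\<theta>' \<in> carrier H'"
  shows "dual_Sinv (\<theta> \<otimes>\<^bsub>H'\<^esub> \<theta>') = dual_Sinv \<theta>' \<otimes>\<^bsub>H'\<^esub> dual_Sinv \<theta>"
proof (rule dual_eq_S[OF dual_Sinv_closed[OF dual_mult_closed[OF \<theta> \<theta>']] dual_mult_closed[OF dual_Sinv_closed[OF \<theta>'] dual_Sinv_closed[OF \<theta>]]])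
  fix h assume h: "h \<in> carrier H"
  have l: "lin H (scalars k) f" if "f \<in> carrier H'" for f using that unfolding dual_carrier by simp
  have b: "bil H H (scalars k) (\<lambda>a b. dual_Sinv \<theta>' a \<otimes> dual_Sinv \<theta> b)"
    by (intro bilinearI lin_scalar_left lin_scalar_right l dual_value dual_Sinv_closed \<theta> \<theta>')
  have "dual_Sinv (\<theta> \<otimes>\<^bsub>H'\<^esub> \<theta>') (SH h) = lift (scalars k) (\<lambda>h1 h2. \<theta> h1 \<otimes> \<theta>' h2) (comult H h)"
    unfolding dual_Sinv_apply[OF h] by (rule dual_mult_apply[OF h])
  also have "\<dots> = lift (scalars k) (\<lambda>h1 h2. dual_Sinv \<theta>' (SH h2) \<otimes> dual_Sinv \<theta> (SH h1)) (comult H h)"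
    by (rule lift_cong[OF vH vH comult_closed[OF H h]])
      (simp add: dual_Sinv_apply dual_value[OF \<theta>] dual_value[OF \<theta>'] m_comm)
  also have "\<dots> = lift (scalars k) (\<lambda>a b. dual_Sinv \<theta>' a \<otimes> dual_Sinv \<theta> b) (comult H (SH h))"
    by (rule lift_comult_antipode[OF H h scalars_vs b, symmetric])
  also have "\<dots> = (dual_Sinv \<theta>' \<otimes>\<^bsub>H'\<^esub> dual_Sinv \<theta>) (SH h)"
    by (rule dual_mult_apply[OF S_closed[OF h], symmetric])
  finally show "dual_Sinv (\<theta> \<otimes>\<^bsub>H'\<^esub> \<theta>') (SH h) = (dual_Sinv \<theta>' \<otimes>\<^bsub>H'\<^esub> dual_Sinv \<theta>) (SH h)" .
qed

lemma dual_Sinv_one: "dual_Sinv \<one>\<^bsub>H'\<^esub> = \<one>\<^bsub>H'\<^esub>"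
  by (rule dual_eq_S[OF dual_Sinv_closed[OF dual_one_closed] dual_one_closed])
    (simp only: dual_Sinv_apply dual_one_apply S_closed counit_antipode[OF H])

lemma dual_Sinv_counit: "counit H' (dual_Sinv \<theta>) = counit H' \<theta>"
  using dual_Sinv_apply[OF H.one_closed] by (simp add: antipode_one[OF H])

lemma dual_Sinv_comult:
  assumes \<theta>: "\<theta> \<in> carrier H'"
  shows "comult H' (dual_Sinv \<theta>) = lift (T H' H') (\<lambda>\<theta>1 \<theta>2. pt H' H' (dual_Sinv \<theta>2) (dual_Sinv \<theta>1)) (comult H' \<theta>)"
proof (rule eval_dual2_inj)
  note v = tensor_vs[OF vH' vH']
  have c: "comult H' \<theta> \<in> carrier (T H' H')" by (rule lin_closed[OF dual_comult_lin \<theta>])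
  have b: "bil H' H' (T H' H') (\<lambda>\<theta>1 \<theta>2. pt H' H' (dual_Sinv \<theta>2) (dual_Sinv \<theta>1))"
    by (intro bilinearI lin_pt_left lin_pt_right vH' dual_Sinv_lin dual_Sinv_closed)
  show "comult H' (dual_Sinv \<theta>) \<in> carrier (T H' H')" by (rule lin_closed[OF dual_comult_lin dual_Sinv_closed[OF \<theta>]])
  show "lift (T H' H') (\<lambda>\<theta>1 \<theta>2. pt H' H' (dual_Sinv \<theta>2) (dual_Sinv \<theta>1)) (comult H' \<theta>) \<in> carrier (T H' H')"
    by (rule lift_closed[OF c vH' vH' v b])
  have main: "eval_dual2 (SH x) (SH y) (comult H' (dual_Sinv \<theta>))
      = eval_dual2 (SH x) (SH y) (lift (T H' H') (\<lambda>\<theta>1 \<theta>2. pt H' H' (dual_Sinv \<theta>2) (dual_Sinv \<theta>1)) (comult H' \<theta>))"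
    if x: "x \<in> carrier H" and y: "y \<in> carrier H" for x y
  proof -
    note E = eval_dual2_lin[OF S_closed[OF x] S_closed[OF y]]
    have "eval_dual2 (SH x) (SH y) (comult H' (dual_Sinv \<theta>)) = dual_Sinv \<theta> (SH x \<otimes>\<^bsub>H\<^esub> SH y)"
      using dual_comult_spec(2)[OF dual_Sinv_closed[OF \<theta>] S_closed[OF x] S_closed[OF y]] by simp
    also have "\<dots> = \<theta> (y \<otimes>\<^bsub>H\<^esub> x)"
      unfolding antipode_mult[OF H y x, symmetric] by (rule dual_Sinv_apply[OF H.m_closed[OF y x]])
    also have "\<dots> = lift (scalars k) (\<lambda>\<theta>1 \<theta>2. \<theta>1 y \<otimes> \<theta>2 x) (comult H' \<theta>)"
      by (rule dual_pairing_mult[OF \<theta> y x])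
    also have "\<dots> = lift (scalars k) (\<lambda>\<theta>1 \<theta>2. eval_dual2 (SH x) (SH y) (pt H' H' (dual_Sinv \<theta>2) (dual_Sinv \<theta>1))) (comult H' \<theta>)"
      by (rule lift_cong[OF vH' vH' c])
        (simp only: eval_dual2_pt S_closed x y dual_Sinv_closed dual_Sinv_apply m_comm dual_value)
    also have "\<dots> = eval_dual2 (SH x) (SH y) (lift (T H' H') (\<lambda>\<theta>1 \<theta>2. pt H' H' (dual_Sinv \<theta>2) (dual_Sinv \<theta>1)) (comult H' \<theta>))"
      by (rule lift_hom[OF E c vH' vH' v scalars_vs b, symmetric])
    finally show ?thesis .
  qed
  fix x y assume x: "x \<in> carrier H" and y: "y \<in> carrier H"
  from main[OF Sinv_closed[OF x] Sinv_closed[OF y]]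
  show "eval_dual2 x y (comult H' (dual_Sinv \<theta>))
      = eval_dual2 x y (lift (T H' H') (\<lambda>\<theta>1 \<theta>2. pt H' H' (dual_Sinv \<theta>2) (dual_Sinv \<theta>1)) (comult H' \<theta>))"
    by (simp only: S_Sinv x y)
qed

lemma lift_comult_dual_Sinv:
  assumes \<theta>: "\<theta> \<in> carrier H'" and W: "vs W" and \<phi>: "bil H' H' W \<phi>"
  shows "lift W \<phi> (comult H' (dual_Sinv \<theta>)) = lift W (\<lambda>\<theta>1 \<theta>2. \<phi> (dual_Sinv \<theta>2) (dual_Sinv \<theta>1)) (comult H' \<theta>)"
proof -
  note v = tensor_vs[OF vH' vH']
  have c: "comult H' \<theta> \<in> carrier (T H' H')" by (rule lin_closed[OF dual_comult_lin \<theta>])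
  have b: "bil H' H' (T H' H') (\<lambda>\<theta>1 \<theta>2. pt H' H' (dual_Sinv \<theta>2) (dual_Sinv \<theta>1))"
    by (intro bilinearI lin_pt_left lin_pt_right vH' dual_Sinv_lin dual_Sinv_closed)
  have "lift W \<phi> (comult H' (dual_Sinv \<theta>)) = lift W (\<lambda>\<theta>1 \<theta>2. lift W \<phi> (pt H' H' (dual_Sinv \<theta>2) (dual_Sinv \<theta>1))) (comult H' \<theta>)"
    unfolding dual_Sinv_comult[OF \<theta>]
    by (rule lift_hom[OF lift_lin[OF vH' vH' W \<phi>] c vH' vH' v W b])
  also have "\<dots> = lift W (\<lambda>\<theta>1 \<theta>2. \<phi> (dual_Sinv \<theta>2) (dual_Sinv \<theta>1)) (comult H' \<theta>)"
    by (rule lift_cong[OF vH' vH' c]) (simp only: lift_pt[OF vH' vH' W \<phi>] dual_Sinv_closed)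
  finally show ?thesis .
qed

text \<open>The substitution of \<open>S(h)\<close> and \<open>S\<^sup>-\<^sup>1(\<theta>)\<close> in an expression with two coproducts: in each
  of them the components change places.\<close>

lemma twisted_double_lift:
  assumes h: "h \<in> carrier H" and \<theta>: "\<theta> \<in> carrier H'" and W: "vs W"
    and 1: "\<And>\<theta>1 \<theta>2. \<lbrakk>\<theta>1 \<in> carrier H'; \<theta>2 \<in> carrier H'\<rbrakk> \<Longrightarrow> bil H H W (\<lambda>h1 h2. F \<theta>1 \<theta>2 h1 h2)"
    and 2: "\<And>h1 h2. \<lbrakk>h1 \<in> carrier H; h2 \<in> carrier H\<rbrakk> \<Longrightarrow> bil H' H' W (\<lambda>\<theta>1 \<theta>2. F \<theta>1 \<theta>2 h1 h2)"
  shows "lift W (\<lambda>\<theta>1 \<theta>2. lift W (\<lambda>h1 h2. F \<theta>1 \<theta>2 h1 h2) (comult H (SH h))) (comult H' (dual_Sinv \<theta>))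
    = lift W (\<lambda>h1 h2. lift W (\<lambda>\<theta>1 \<theta>2. F (dual_Sinv \<theta>2) (dual_Sinv \<theta>1) (SH h2) (SH h1)) (comult H' \<theta>)) (comult H h)"
proof -
  note cS = comult_closed[OF H S_closed[OF h]] and ch = comult_closed[OF H h]
  have c: "comult H' \<theta> \<in> carrier (T H' H')" by (rule lin_closed[OF dual_comult_lin \<theta>])
  have b: "bil H' H' W (\<lambda>\<theta>1 \<theta>2. lift W (\<lambda>h1 h2. F \<theta>1 \<theta>2 h1 h2) (comult H (SH h)))"
    by (intro bilinearI lin_lift_param[OF cS vH vH W vH'] 1 bilinear_right[OF 2] bilinear_left[OF 2])
  have "lift W (\<lambda>\<theta>1 \<theta>2. lift W (\<lambda>h1 h2. F \<theta>1 \<theta>2 h1 h2) (comult H (SH h))) (comult H' (dual_Sinv \<theta>))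
      = lift W (\<lambda>\<theta>1 \<theta>2. lift W (\<lambda>h1 h2. F (dual_Sinv \<theta>2) (dual_Sinv \<theta>1) h1 h2) (comult H (SH h))) (comult H' \<theta>)"
    by (rule lift_comult_dual_Sinv[OF \<theta> W b])
  also have "\<dots> = lift W (\<lambda>\<theta>1 \<theta>2. lift W (\<lambda>h1 h2. F (dual_Sinv \<theta>2) (dual_Sinv \<theta>1) (SH h2) (SH h1)) (comult H h)) (comult H' \<theta>)"
    by (rule lift_cong[OF vH' vH' c]) (intro lift_comult_antipode[OF H h W] 1 dual_Sinv_closed)
  also have "\<dots> = lift W (\<lambda>h1 h2. lift W (\<lambda>\<theta>1 \<theta>2. F (dual_Sinv \<theta>2) (dual_Sinv \<theta>1) (SH h2) (SH h1)) (comult H' \<theta>)) (comult H h)"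
  proof (rule lift_swap[OF c ch vH' vH' vH vH W])
    show "bil H H W (\<lambda>h1 h2. F (dual_Sinv \<theta>2) (dual_Sinv \<theta>1) (SH h2) (SH h1))" if "\<theta>1 \<in> carrier H'" "\<theta>2 \<in> carrier H'" for \<theta>1 \<theta>2
      by (intro bilinearI lin_compose[OF bilinear_left[OF 1] antipode_lin[OF H]]
          lin_compose[OF bilinear_right[OF 1] antipode_lin[OF H]] dual_Sinv_closed S_closed that)
    show "bil H' H' W (\<lambda>\<theta>1 \<theta>2. F (dual_Sinv \<theta>2) (dual_Sinv \<theta>1) (SH h2) (SH h1))" if "h1 \<in> carrier H" "h2 \<in> carrier H" for h1 h2
      by (intro bilinearI lin_compose[OF bilinear_left[OF 2] dual_Sinv_lin]
          lin_compose[OF bilinear_right[OF 2] dual_Sinv_lin] dual_Sinv_closed S_closed that)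
  qed
  finally show ?thesis .
qed

section \<open>Yetter--Drinfeld structures on the opposite algebra\<close>

interpretation DP: dual_pair k H H' "\<lambda>h \<theta>. \<theta> h" "\<lambda>h \<theta>. \<theta> (antipode H h)"
  by (rule dual_pair)

interpretation DQ: dual_pair k H' H "\<lambda>\<theta> h. \<theta> h" "\<lambda>\<theta> h. \<theta> (antipode H h)"
  by (rule DP.swap)

text \<open>The names \<open>la\<close> and \<open>ra\<close> stand for the left action \<open>\<theta> \<rhd> x\<close> and the right action
  \<open>x \<lhd> h\<close> that correspond to \<open>\<alpha>\<close> and \<open>\<beta>\<close>, and \<open>\<alpha>'\<close>, \<open>\<beta>'\<close> for the coactions
  on the opposite algebra.\<close>

context
  fixes X :: "('k, 'x, 'p) module_scheme"
    and \<alpha> :: "'x \<Rightarrow> ('k, 'x, 'h) tens"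
    and \<beta> :: "'x \<Rightarrow> ('k, 'h \<Rightarrow> 'k, 'x) tens"
  assumes X: "unital_algebra k X"
    and right: "right_coaction k H X \<alpha>"
    and left: "left_coaction k H' X \<beta>"
begin

private abbreviation "Xop \<equiv> opposite X"
private abbreviation "\<alpha>' \<equiv> flip_co_left k H' X \<beta>"
private abbreviation "\<beta>' \<equiv> flip_co_right k H X \<alpha>"
private abbreviation "la \<equiv> \<lambda>\<theta> x. DP.slice_K X \<theta> (\<alpha> x)"
private abbreviation "ra \<equiv> \<lambda>x h. DP.slice_L X h (\<beta> x)"

interpretation X: unital_algebra k X by (rule X)

private lemmas Xop = opposite_unital_algebra[OF X]
private lemmas vX = unital_algebra_vs[OF X]
private lemmas vXop = unital_algebra_vs[OF Xop]

private lemma \<alpha>: "lin X (T X H) \<alpha>" using right by (simp add: right_coaction_def algebra_hom_iff)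
private lemma \<beta>: "lin X (T H' X) \<beta>" using left by (simp add: left_coaction_def algebra_hom_iff)

private lemma flip_left_bilinear:
  "bil H' X (T Xop H') (\<lambda>\<theta> x0. pt Xop H' x0 (antipode H' \<theta>))"
proof (rule bilinearI)
  show "lin X (T Xop H') (\<lambda>x0. pt Xop H' x0 (antipode H' \<theta>))" if "\<theta> \<in> carrier H'" for \<theta>
    using lin_pt_left[OF lin_id vXop vH' dual_antipode_closed[OF that]] by simp
  show "lin H' (T Xop H') (\<lambda>\<theta>. pt Xop H' x0 (antipode H' \<theta>))" if "x0 \<in> carrier X" for x0
    by (rule lin_pt_right[OF dual_antipode_lin vXop vH']) (simp add: that)
qed

private lemma flip_right_bilinear:
  "bil X H (T H Xop) (\<lambda>x0 h. pt H Xop (SHinv h) x0)"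
proof (rule bilinearI)
  show "lin X (T H Xop) (\<lambda>x0. pt H Xop (SHinv h) x0)" if "h \<in> carrier H" for h
    using lin_pt_right[OF lin_id vH vXop Sinv_closed[OF that]] by simp
  show "lin H (T H Xop) (\<lambda>h. pt H Xop (SHinv h) x0)" if "x0 \<in> carrier X" for x0
    by (rule lin_pt_left[OF Sinv_lin vH vXop]) (simp add: that)
qed

private lemma \<alpha>'_lin: "lin Xop (T Xop H') \<alpha>'"
  unfolding flip_co_left_def module_hom_opposite
  by (rule lin_lift_arg[OF \<beta> vH' vX tensor_vs[OF vXop vH'] flip_left_bilinear])

private lemma \<beta>'_lin: "lin Xop (T H Xop) \<beta>'"
  unfolding flip_co_right_def module_hom_opposite
  by (rule lin_lift_arg[OF \<alpha> vX vH tensor_vs[OF vH vXop] flip_right_bilinear])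

private lemma lift_\<alpha>':
  assumes x: "x \<in> carrier X" and W: "vs W" and \<phi>: "bil Xop H' W \<phi>"
  shows "lift W \<phi> (\<alpha>' x) = lift W (\<lambda>\<theta> x0. \<phi> x0 (antipode H' \<theta>)) (\<beta> x)"
proof -
  have "lift W \<phi> (\<alpha>' x) = lift W (\<lambda>\<theta> x0. lift W \<phi> (pt Xop H' x0 (antipode H' \<theta>))) (\<beta> x)"
    unfolding flip_co_left_def
    by (rule lift_hom[OF lift_lin[OF vXop vH' W \<phi>] lin_closed[OF \<beta> x] vH' vX tensor_vs[OF vXop vH'] W flip_left_bilinear])
  also have "\<dots> = lift W (\<lambda>\<theta> x0. \<phi> x0 (antipode H' \<theta>)) (\<beta> x)"
    by (rule lift_cong[OF vH' vX lin_closed[OF \<beta> x]])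
      (rule lift_pt[OF vXop vH' W \<phi>], simp_all only: opposite_simps dual_antipode_closed)
  finally show ?thesis .
qed

private lemma lift_\<beta>':
  assumes x: "x \<in> carrier X" and W: "vs W" and \<phi>: "bil H Xop W \<phi>"
  shows "lift W \<phi> (\<beta>' x) = lift W (\<lambda>x0 h. \<phi> (SHinv h) x0) (\<alpha> x)"
proof -
  have "lift W \<phi> (\<beta>' x) = lift W (\<lambda>x0 h. lift W \<phi> (pt H Xop (SHinv h) x0)) (\<alpha> x)"
    unfolding flip_co_right_def
    by (rule lift_hom[OF lift_lin[OF vH vXop W \<phi>] lin_closed[OF \<alpha> x] vX vH tensor_vs[OF vH vXop] W flip_right_bilinear])
  also have "\<dots> = lift W (\<lambda>x0 h. \<phi> (SHinv h) x0) (\<alpha> x)"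
    by (rule lift_cong[OF vX vH lin_closed[OF \<alpha> x]])
      (rule lift_pt[OF vH vXop W \<phi>], simp_all only: opposite_simps Sinv_closed)
  finally show ?thesis .
qed

text \<open>The actions of the opposite algebra are the original ones twisted by \<open>S\<close> and by the inverse
  antipode of the dual.\<close>

private lemma slice_\<alpha>':
  assumes x: "x \<in> carrier X" and h: "h \<in> carrier H"
  shows "DQ.slice_K Xop h (\<alpha>' x) = ra x (SH h)"
proof -
  have "DQ.slice_K Xop h (\<alpha>' x) = lift Xop (\<lambda>\<theta> x0. antipode H' \<theta> h \<odot>\<^bsub>Xop\<^esub> x0) (\<beta> x)"
    unfolding DQ.slice_K_def by (rule lift_\<alpha>'[OF x vXop DQ.slice_K_bil[OF vXop h]])
  also have "\<dots> = ra x (SH h)"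
    unfolding DP.slice_L_def lift_opposite opposite_simps dual_antipode_apply[OF h] ..
  finally show ?thesis .
qed

private lemma slice_\<beta>':
  assumes x: "x \<in> carrier X" and \<theta>: "\<theta> \<in> carrier H'"
  shows "DQ.slice_L Xop \<theta> (\<beta>' x) = la (dual_Sinv \<theta>) x"
proof -
  have "DQ.slice_L Xop \<theta> (\<beta>' x) = lift Xop (\<lambda>x0 h. \<theta> (SHinv h) \<odot>\<^bsub>Xop\<^esub> x0) (\<alpha> x)"
    unfolding DQ.slice_L_def by (rule lift_\<beta>'[OF x vXop DQ.slice_L_bil[OF vXop \<theta>]])
  also have "\<dots> = la (dual_Sinv \<theta>) x"
    unfolding DP.slice_K_def lift_opposite opposite_simps
    by (rule lift_cong[OF vX vH lin_closed[OF \<alpha> x]]) (simp add: dual_Sinv_def)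
  finally show ?thesis .
qed

private lemma la_lin: "x \<in> carrier X \<Longrightarrow> lin H' X (\<lambda>\<theta>. la \<theta> x)"
  by (rule DP.slice_K_param[OF lin_id lin_closed[OF \<alpha>] vX])
private lemma la_lin': "\<theta> \<in> carrier H' \<Longrightarrow> lin X X (\<lambda>x. la \<theta> x)"
  by (rule DP.slice_K_lin[OF \<alpha> vX])
private lemma ra_lin: "x \<in> carrier X \<Longrightarrow> lin H X (\<lambda>h. ra x h)"
  by (rule DP.slice_L_param[OF lin_id lin_closed[OF \<beta>] vX])
private lemma ra_lin': "h \<in> carrier H \<Longrightarrow> lin X X (\<lambda>x. ra x h)"
  by (rule DP.slice_L_lin[OF \<beta> vX])
private lemma la_closed: "\<lbrakk>\<theta> \<in> carrier H'; x \<in> carrier X\<rbrakk> \<Longrightarrow> la \<theta> x \<in> carrier X"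
  by (rule lin_closed[OF la_lin'])
private lemma ra_closed: "\<lbrakk>h \<in> carrier H; x \<in> carrier X\<rbrakk> \<Longrightarrow> ra x h \<in> carrier X"
  by (rule lin_closed[OF ra_lin'])

private lemma left_module_algebra_cong:
  assumes "\<And>l y. \<lbrakk>l \<in> carrier L; y \<in> carrier Y\<rbrakk> \<Longrightarrow> act l y = act' l y"
    and "\<And>l y. \<lbrakk>l \<in> carrier L; y \<in> carrier Y\<rbrakk> \<Longrightarrow> act' l y \<in> carrier Y"
    and L: "unital_algebra k L" and Y: "unital_algebra k Y" and D: "\<And>l. l \<in> carrier L \<Longrightarrow> comult L l \<in> carrier (T L L)"
  shows "left_module_algebra L Y act \<longleftrightarrow> left_module_algebra L Y act'"
proof -
  interpret L: unital_algebra k L by (rule L)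
  interpret Y: unital_algebra k Y by (rule Y)
  have "lift Y (\<lambda>l1 l2. act l1 y \<otimes>\<^bsub>Y\<^esub> act l2 z) (comult L l) = lift Y (\<lambda>l1 l2. act' l1 y \<otimes>\<^bsub>Y\<^esub> act' l2 z) (comult L l)"
    if "l \<in> carrier L" "y \<in> carrier Y" "z \<in> carrier Y" for l y z
    by (rule lift_cong[OF L.vectorspace_axioms L.vectorspace_axioms D[OF that(1)]]) (simp add: assms(1) that)
  then show ?thesis unfolding left_module_algebra_def using assms(1,2) by simp
qed

private lemma right_module_algebra_cong:
  assumes "\<And>l y. \<lbrakk>l \<in> carrier L; y \<in> carrier Y\<rbrakk> \<Longrightarrow> act y l = act' y l"
    and "\<And>l y. \<lbrakk>l \<in> carrier L; y \<in> carrier Y\<rbrakk> \<Longrightarrow> act' y l \<in> carrier Y"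
    and L: "unital_algebra k L" and Y: "unital_algebra k Y" and D: "\<And>l. l \<in> carrier L \<Longrightarrow> comult L l \<in> carrier (T L L)"
  shows "right_module_algebra L Y act \<longleftrightarrow> right_module_algebra L Y act'"
proof -
  interpret L: unital_algebra k L by (rule L)
  interpret Y: unital_algebra k Y by (rule Y)
  have "lift Y (\<lambda>l1 l2. act y l1 \<otimes>\<^bsub>Y\<^esub> act z l2) (comult L l) = lift Y (\<lambda>l1 l2. act' y l1 \<otimes>\<^bsub>Y\<^esub> act' z l2) (comult L l)"
    if "l \<in> carrier L" "y \<in> carrier Y" "z \<in> carrier Y" for l y z
    by (rule lift_cong[OF L.vectorspace_axioms L.vectorspace_axioms D[OF that(1)]]) (simp add: assms(1) that)
  then show ?thesis unfolding right_module_algebra_def using assms(1,2) by simp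
qed

lemma right_coaction_opposite: "right_coaction k H' Xop \<alpha>'"
proof -
  have "left_module_algebra H Xop (\<lambda>h x. ra x (SH h))"
    by (rule left_module_algebra_opposite[OF X H.unital_algebra_axioms _ ra_lin S_closed antipode_mult[OF H]
          antipode_one[OF H] counit_antipode[OF H] lift_comult_antipode[OF H _ vX]])
      (rule DP.left_coaction_iff[OF X \<beta>, THEN iffD1, OF left])
  then have "left_module_algebra H Xop (\<lambda>h x. DQ.slice_K Xop h (\<alpha>' x))"
    by (subst left_module_algebra_cong[where act' = "\<lambda>h x. ra x (SH h)"])
      (simp_all only: opposite_simps slice_\<alpha>' ra_closed S_closed H.unital_algebra_axioms Xop comult_closed[OF H])
  then show ?thesis by (rule DQ.right_coaction_iff[OF Xop \<alpha>'_lin, THEN iffD2])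
qed

lemma left_coaction_opposite: "left_coaction k H Xop \<beta>'"
proof -
  have "right_module_algebra H' Xop (\<lambda>x \<theta>. la (dual_Sinv \<theta>) x)"
    by (rule right_module_algebra_opposite[OF X dual_unital_algebra _ la_lin dual_Sinv_closed dual_Sinv_mult
          dual_Sinv_one dual_Sinv_counit lift_comult_dual_Sinv[OF _ vX]])
      (rule DP.right_coaction_iff[OF X \<alpha>, THEN iffD1, OF right])
  then have "right_module_algebra H' Xop (\<lambda>x \<theta>. DQ.slice_L Xop \<theta> (\<beta>' x))"
    by (subst right_module_algebra_cong[where act' = "\<lambda>x \<theta>. la (dual_Sinv \<theta>) x"])
      (simp_all only: opposite_simps slice_\<beta>' la_closed dual_Sinv_closed dual_unital_algebra Xop lin_closed[OF dual_comult_lin])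
  then show ?thesis by (rule DQ.left_coaction_iff[OF Xop \<beta>'_lin, THEN iffD2])
qed

private definition "yd_left y h \<theta> = lift X (\<lambda>\<theta>1 \<theta>2. lift X (\<lambda>h1 h2. \<theta>1 h1 \<odot>\<^bsub>X\<^esub> la \<theta>2 (ra y h2)) (comult H h)) (comult H' \<theta>)"
private definition "yd_right y h \<theta> = lift X (\<lambda>\<theta>1 \<theta>2. lift X (\<lambda>h1 h2. \<theta>2 h2 \<odot>\<^bsub>X\<^esub> ra (la \<theta>1 y) h1) (comult H h)) (comult H' \<theta>)"

private lemma yetter_drinfeld_original:
  "yetter_drinfeld_algebra k H H' (\<lambda>h \<theta>. \<theta> h) X \<alpha> \<beta> \<longleftrightarrow>
    (\<forall>y\<in>carrier X. \<forall>h\<in>carrier H. \<forall>\<theta>\<in>carrier H'. yd_left y h \<theta> = yd_right y h \<theta>)"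
  unfolding DP.yetter_drinfeld_iff[OF X \<alpha> \<beta>] yd_left_def yd_right_def using right left by simp

text \<open>In the identity of the opposite algebra the antipodes reverse both coproducts, and the pairing
  \<open>\<theta>(h)\<close> equals the value of \<open>S\<^sup>-\<^sup>1(\<theta>)\<close> at \<open>S(h)\<close>. So its left side is the right side of the
  original identity at \<open>S(h)\<close> and \<open>S\<^sup>-\<^sup>1(\<theta>)\<close>, and vice versa.\<close>

private lemma yetter_drinfeld_opposite:
  "yetter_drinfeld_algebra k H' H (\<lambda>\<theta> h. \<theta> h) Xop \<alpha>' \<beta>' \<longleftrightarrow>
    (\<forall>y\<in>carrier X. \<forall>\<theta>\<in>carrier H'. \<forall>h\<in>carrier H. yd_right y (SH h) (dual_Sinv \<theta>) = yd_left y (SH h) (dual_Sinv \<theta>))"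
proof -
  have co: "right_coaction k H' Xop \<alpha>'" "left_coaction k H Xop \<beta>'"
    by (rule right_coaction_opposite, rule left_coaction_opposite)
  have ev: "lin H (scalars k) \<theta>" if "\<theta> \<in> carrier H'" for \<theta> using that unfolding dual_carrier by simp
  have R: "lift Xop (\<lambda>h1 h2. lift Xop (\<lambda>\<theta>1 \<theta>2. \<theta>1 h1 \<odot>\<^bsub>Xop\<^esub>
        DQ.slice_K Xop h2 (\<alpha>' (DQ.slice_L Xop \<theta>2 (\<beta>' y)))) (comult H' \<theta>)) (comult H h) = yd_right y (SH h) (dual_Sinv \<theta>)"
    if y: "y \<in> carrier X" and \<theta>: "\<theta> \<in> carrier H'" and h: "h \<in> carrier H" for y \<theta> h
  proof -
    have c: "comult H' \<theta> \<in> carrier (T H' H')" by (rule lin_closed[OF dual_comult_lin \<theta>])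
    have "yd_right y (SH h) (dual_Sinv \<theta>) = lift X (\<lambda>h1 h2. lift X (\<lambda>\<theta>1 \<theta>2. dual_Sinv \<theta>1 (SH h1) \<odot>\<^bsub>X\<^esub> ra (la (dual_Sinv \<theta>2) y) (SH h2))
        (comult H' \<theta>)) (comult H h)"
      unfolding yd_right_def
    proof (rule twisted_double_lift[OF h \<theta> vX])
      show "bil H H X (\<lambda>h1 h2. \<theta>2 h2 \<odot>\<^bsub>X\<^esub> ra (la \<theta>1 y) h1)" if "\<theta>1 \<in> carrier H'" "\<theta>2 \<in> carrier H'" for \<theta>1 \<theta>2
        by (intro bilinearI lin_smult_left lin_smult_right ra_lin la_closed ra_closed ev dual_value vX y that)
      show "bil H' H' X (\<lambda>\<theta>1 \<theta>2. \<theta>2 h2 \<odot>\<^bsub>X\<^esub> ra (la \<theta>1 y) h1)" if "h1 \<in> carrier H" "h2 \<in> carrier H" for h1 h2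
        by (intro bilinearI lin_smult_left lin_smult_right lin_compose[OF ra_lin' la_lin] la_closed ra_closed
            eval_dual_lin dual_value vX y that)
    qed
    also have "\<dots> = lift X (\<lambda>h1 h2. lift X (\<lambda>\<theta>1 \<theta>2. \<theta>1 h1 \<odot>\<^bsub>X\<^esub>
        DQ.slice_K Xop h2 (\<alpha>' (DQ.slice_L Xop \<theta>2 (\<beta>' y)))) (comult H' \<theta>)) (comult H h)"
      by (rule lift_cong[OF vH vH comult_closed[OF H h]], rule lift_cong[OF vH' vH' c])
        (simp only: dual_Sinv_apply slice_\<beta>' y slice_\<alpha>' la_closed dual_Sinv_closed)
    finally show ?thesis by (simp only: lift_opposite opposite_simps)
  qed
  have L: "lift Xop (\<lambda>h1 h2. lift Xop (\<lambda>\<theta>1 \<theta>2. \<theta>2 h2 \<odot>\<^bsub>Xop\<^esub>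
        DQ.slice_L Xop \<theta>1 (\<beta>' (DQ.slice_K Xop h1 (\<alpha>' y)))) (comult H' \<theta>)) (comult H h) = yd_left y (SH h) (dual_Sinv \<theta>)"
    if y: "y \<in> carrier X" and \<theta>: "\<theta> \<in> carrier H'" and h: "h \<in> carrier H" for y \<theta> h
  proof -
    have c: "comult H' \<theta> \<in> carrier (T H' H')" by (rule lin_closed[OF dual_comult_lin \<theta>])
    have "yd_left y (SH h) (dual_Sinv \<theta>) = lift X (\<lambda>h1 h2. lift X (\<lambda>\<theta>1 \<theta>2. dual_Sinv \<theta>2 (SH h2) \<odot>\<^bsub>X\<^esub> la (dual_Sinv \<theta>1) (ra y (SH h1)))
        (comult H' \<theta>)) (comult H h)"
      unfolding yd_left_def
    proof (rule twisted_double_lift[OF h \<theta> vX])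
      show "bil H H X (\<lambda>h1 h2. \<theta>1 h1 \<odot>\<^bsub>X\<^esub> la \<theta>2 (ra y h2))" if "\<theta>1 \<in> carrier H'" "\<theta>2 \<in> carrier H'" for \<theta>1 \<theta>2
        by (intro bilinearI lin_smult_left lin_smult_right lin_compose[OF la_lin' ra_lin] la_closed ra_closed ev dual_value vX y that)
      show "bil H' H' X (\<lambda>\<theta>1 \<theta>2. \<theta>1 h1 \<odot>\<^bsub>X\<^esub> la \<theta>2 (ra y h2))" if "h1 \<in> carrier H" "h2 \<in> carrier H" for h1 h2
        by (intro bilinearI lin_smult_left lin_smult_right la_lin la_closed ra_closed
            eval_dual_lin dual_value vX y that)
    qed
    also have "\<dots> = lift X (\<lambda>h1 h2. lift X (\<lambda>\<theta>1 \<theta>2. \<theta>2 h2 \<odot>\<^bsub>X\<^esub>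
        DQ.slice_L Xop \<theta>1 (\<beta>' (DQ.slice_K Xop h1 (\<alpha>' y)))) (comult H' \<theta>)) (comult H h)"
      by (rule lift_cong[OF vH vH comult_closed[OF H h]], rule lift_cong[OF vH' vH' c])
        (simp only: dual_Sinv_apply slice_\<alpha>' y slice_\<beta>' ra_closed S_closed)
    finally show ?thesis by (simp only: lift_opposite opposite_simps)
  qed
  show ?thesis
    unfolding DQ.yetter_drinfeld_iff[OF Xop \<alpha>'_lin \<beta>'_lin] opposite_simps(1) using co
    by (simp only: R L simp_thms cong: ball_cong)
qed

theorem yetter_drinfeld_opposite_iff:
  "yetter_drinfeld_algebra k H H' (\<lambda>h \<theta>. \<theta> h) X \<alpha> \<beta> \<longleftrightarrow>
    yetter_drinfeld_algebra k H' H (\<lambda>\<theta> h. \<theta> h) Xop \<alpha>' \<beta>'"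
  unfolding yetter_drinfeld_original yetter_drinfeld_opposite
proof
  assume "\<forall>y\<in>carrier X. \<forall>h\<in>carrier H. \<forall>\<theta>\<in>carrier H'. yd_left y h \<theta> = yd_right y h \<theta>"
  then show "\<forall>y\<in>carrier X. \<forall>\<theta>\<in>carrier H'. \<forall>h\<in>carrier H. yd_right y (SH h) (dual_Sinv \<theta>) = yd_left y (SH h) (dual_Sinv \<theta>)"
    using S_closed dual_Sinv_closed by (metis (no_types))
next
  assume *: "\<forall>y\<in>carrier X. \<forall>\<theta>\<in>carrier H'. \<forall>h\<in>carrier H. yd_right y (SH h) (dual_Sinv \<theta>) = yd_left y (SH h) (dual_Sinv \<theta>)"
  show "\<forall>y\<in>carrier X. \<forall>h\<in>carrier H. \<forall>\<theta>\<in>carrier H'. yd_left y h \<theta> = yd_right y h \<theta>"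
  proof (intro ballI)
    fix y h \<theta> assume "y \<in> carrier X" "h \<in> carrier H" "\<theta> \<in> carrier H'"
    then show "yd_left y h \<theta> = yd_right y h \<theta>"
      using *[rule_format, OF _ dual_antipode_closed Sinv_closed, of y \<theta> h] by (simp only: S_Sinv dual_Sinv_antipode)
  qed
qed

text \<open>Both \<open>b\<^sub>0 (a \<lhd> b\<^sub>1)\<close> and the expression \<open>a\<^sub>0 (b \<lhd> a\<^sub>1)\<close> formed in the opposite
  algebra are equal to \<open>p(b\<^sub>1, a\<^sup>-\<^sup>1) b\<^sub>0 a\<^sup>0\<close>; the antipode in \<open>\<alpha>'\<close> cancels against its
  inverse in \<open>\<beta>'\<close>.\<close>

theorem braided_commutative_opposite_iff:
  "braided_commutative k H H' (\<lambda>h \<theta>. \<theta> h) X \<alpha> \<beta> \<longleftrightarrow>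
    braided_commutative k H' H (\<lambda>\<theta> h. \<theta> h) Xop \<alpha>' \<beta>'"
proof -
  have key: "lift Xop (\<lambda>a0 \<theta>. a0 \<otimes>\<^bsub>Xop\<^esub> DQ.slice_L Xop \<theta> (\<beta>' b)) (\<alpha>' a)
      = lift X (\<lambda>b0 h. b0 \<otimes>\<^bsub>X\<^esub> ra a h) (\<alpha> b)" if a: "a \<in> carrier X" and b: "b \<in> carrier X" for a b
  proof -
    note \<beta>a = lin_closed[OF \<beta> a] and \<alpha>b = lin_closed[OF \<alpha> b]
    have la': "lin H' X (\<lambda>\<theta>. DQ.slice_L Xop \<theta> (\<beta>' b))"
      using DQ.slice_L_param[OF lin_id lin_closed[OF \<beta>'_lin, unfolded opposite_simps, OF b] vXop] by simp
    have la'c: "DQ.slice_L Xop \<theta> (\<beta>' b) \<in> carrier X" if "\<theta> \<in> carrier H'" for \<theta>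
      by (rule lin_closed[OF la' that])
    have prod: "bilinear_product X" by (rule unital_algebra_product[OF X])
    have \<phi>: "bil Xop H' Xop (\<lambda>a0 \<theta>. a0 \<otimes>\<^bsub>Xop\<^esub> DQ.slice_L Xop \<theta> (\<beta>' b))"
      unfolding bilinear_def module_hom_opposite opposite_simps
      using lin_mult_left[OF la' prod] lin_mult_right[OF lin_id prod la'c] by simp
    have "lift Xop (\<lambda>a0 \<theta>. a0 \<otimes>\<^bsub>Xop\<^esub> DQ.slice_L Xop \<theta> (\<beta>' b)) (\<alpha>' a)
        = lift Xop (\<lambda>\<theta> a0. a0 \<otimes>\<^bsub>Xop\<^esub> DQ.slice_L Xop (antipode H' \<theta>) (\<beta>' b)) (\<beta> a)"
      by (rule lift_\<alpha>'[OF a vXop \<phi>])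
    also have "\<dots> = lift X (\<lambda>\<theta> a0. la \<theta> b \<otimes>\<^bsub>X\<^esub> a0) (\<beta> a)"
      unfolding lift_opposite opposite_simps
      by (rule lift_cong[OF vH' vX \<beta>a]) (simp only: slice_\<beta>' b dual_antipode_closed dual_Sinv_antipode)
    also have "\<dots> = lift X (\<lambda>\<theta> a0. lift X (\<lambda>b0 h. \<theta> h \<odot>\<^bsub>X\<^esub> (b0 \<otimes>\<^bsub>X\<^esub> a0)) (\<alpha> b)) (\<beta> a)"
    proof (rule lift_cong[OF vH' vX \<beta>a])
      fix \<theta> a0 assume \<theta>: "\<theta> \<in> carrier H'" and a0: "a0 \<in> carrier X"
      have "la \<theta> b \<otimes>\<^bsub>X\<^esub> a0 = lift X (\<lambda>b0 h. (\<theta> h \<odot>\<^bsub>X\<^esub> b0) \<otimes>\<^bsub>X\<^esub> a0) (\<alpha> b)"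
        unfolding DP.slice_K_def
        by (rule lift_hom[OF lin_mult_left[OF lin_id prod a0] \<alpha>b vX vH vX vX DP.slice_K_bil[OF vX \<theta>]])
      also have "\<dots> = lift X (\<lambda>b0 h. \<theta> h \<odot>\<^bsub>X\<^esub> (b0 \<otimes>\<^bsub>X\<^esub> a0)) (\<alpha> b)"
        by (rule lift_cong[OF vX vH \<alpha>b]) (simp add: X.smult_mult_left dual_value[OF \<theta>] a0)
      finally show "la \<theta> b \<otimes>\<^bsub>X\<^esub> a0 = lift X (\<lambda>b0 h. \<theta> h \<odot>\<^bsub>X\<^esub> (b0 \<otimes>\<^bsub>X\<^esub> a0)) (\<alpha> b)" .
    qed
    also have "\<dots> = lift X (\<lambda>b0 h. lift X (\<lambda>\<theta> a0. \<theta> h \<odot>\<^bsub>X\<^esub> (b0 \<otimes>\<^bsub>X\<^esub> a0)) (\<beta> a)) (\<alpha> b)"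
    proof (rule lift_swap[OF \<beta>a \<alpha>b vH' vX vX vH vX])
      show "bil X H X (\<lambda>b0 h. \<theta> h \<odot>\<^bsub>X\<^esub> (b0 \<otimes>\<^bsub>X\<^esub> a0))" if "\<theta> \<in> carrier H'" "a0 \<in> carrier X" for \<theta> a0
        using that unfolding dual_carrier
        by (intro bilinearI lin_smult_left lin_smult_right lin_mult_left lin_id prod vX mult_closed[OF prod])
          (auto intro: lin_closed[of \<theta> k H "scalars k", simplified])
      show "bil H' X X (\<lambda>\<theta> a0. \<theta> h \<odot>\<^bsub>X\<^esub> (b0 \<otimes>\<^bsub>X\<^esub> a0))" if "b0 \<in> carrier X" "h \<in> carrier H" for b0 h
        by (intro bilinearI lin_smult_left lin_smult_right lin_mult_right lin_id prod vX mult_closed[OF prod]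
            eval_dual_lin dual_value that)
    qed
    also have "\<dots> = lift X (\<lambda>b0 h. b0 \<otimes>\<^bsub>X\<^esub> ra a h) (\<alpha> b)"
    proof (rule lift_cong[OF vX vH \<alpha>b])
      fix b0 h assume b0: "b0 \<in> carrier X" and h: "h \<in> carrier H"
      have "lift X (\<lambda>\<theta> a0. \<theta> h \<odot>\<^bsub>X\<^esub> (b0 \<otimes>\<^bsub>X\<^esub> a0)) (\<beta> a) = lift X (\<lambda>\<theta> a0. b0 \<otimes>\<^bsub>X\<^esub> (\<theta> h \<odot>\<^bsub>X\<^esub> a0)) (\<beta> a)"
        by (rule lift_cong[OF vH' vX \<beta>a]) (simp add: X.smult_mult_right dual_value h b0 del: dual_hopf_simps)
      also have "\<dots> = b0 \<otimes>\<^bsub>X\<^esub> ra a h"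
        unfolding DP.slice_L_def
        by (rule lift_hom[OF lin_mult_right[OF lin_id prod b0] \<beta>a vH' vX vX vX DP.slice_L_bil[OF vX h], symmetric])
      finally show "lift X (\<lambda>\<theta> a0. \<theta> h \<odot>\<^bsub>X\<^esub> (b0 \<otimes>\<^bsub>X\<^esub> a0)) (\<beta> a) = b0 \<otimes>\<^bsub>X\<^esub> ra a h" .
    qed
    finally show ?thesis .
  qed
  show ?thesis
    unfolding DP.braided_commutative_iff[OF X] DQ.braided_commutative_iff[OF Xop] yetter_drinfeld_opposite_iff
      opposite_simps(1,6)
    using key by (simp only: opposite_simps cong: ball_cong) blast
qed

end

end

theorem proposition4p32:
  fixes k :: "('k, 'm) ring_scheme"
    and H :: "('k, 'h, 'n) hopf_scheme"
    and X :: "('k, 'x, 'p) module_scheme"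
    and \<alpha> :: "'x \<Rightarrow> ('k, 'x, 'h) tens"
    and \<beta> :: "'x \<Rightarrow> ('k, 'h \<Rightarrow> 'k, 'x) tens"
  assumes "field k"
    and "hopf_algebra k H"
    and "vectorspace.fin_dim k H"
    and "bij_betw (antipode H) (carrier H) (carrier H)"
    and "unital_algebra k X"
    and "right_coaction k H X \<alpha>"
    and "left_coaction k (dual_hopf k H) X \<beta>"
  shows "right_coaction k (dual_hopf k H) (opposite X) (flip_co_left k (dual_hopf k H) X \<beta>)
       \<and> left_coaction k H (opposite X) (flip_co_right k H X \<alpha>)
       \<and> (yetter_drinfeld_algebra k H (dual_hopf k H) (\<lambda>h \<theta>. \<theta> h) X \<alpha> \<beta> \<longleftrightarrow>
           yetter_drinfeld_algebra k (dual_hopf k H) H (\<lambda>\<theta> h. \<theta> h) (opposite X)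
             (flip_co_left k (dual_hopf k H) X \<beta>) (flip_co_right k H X \<alpha>))
       \<and> (braided_commutative k H (dual_hopf k H) (\<lambda>h \<theta>. \<theta> h) X \<alpha> \<beta> \<longleftrightarrow>
           braided_commutative k (dual_hopf k H) H (\<lambda>\<theta> h. \<theta> h) (opposite X)
             (flip_co_left k (dual_hopf k H) X \<beta>) (flip_co_right k H X \<alpha>))"
proof -
  interpret finite_hopf_inverse k H
    using assms(1-4)
    by (simp add: finite_hopf_inverse_def finite_hopf_inverse_axioms_def finite_hopf_def
        finite_hopf_axioms_def ground_def)
  show ?thesis
    using right_coaction_opposite[OF assms(5-7)] left_coaction_opposite[OF assms(5-7)]
      yetter_drinfeld_opposite_iff[OF assms(5-7)] braided_commutative_opposite_iff[OF assms(5-7)]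
    by (intro conjI)
qed

end
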